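(* Let $u$ be a weak solution of $\operatorname{div}\mathcal A(x,u,u_x)=\mathcal B(x,u,u_x)$ in $D$, with $\bar b^{n/(n-1)},c^n,\bar d\in L\log^{(n-1)/r}L(D)$ and with $\mathcal A,\mathcal B$ satisfying $$|\mathcal A|\le a|p|^{n-1}+\bar b|\bar u|^{n-1},\quad |\mathcal B|\le c|p|^{n-1}+\bar d|\bar u|^{n-1},\quad p\cdot\mathcal A\ge|p|^n-\bar d|\bar u|^n,\qquad \bar u=|u|+k.$$ If $0<R\le1$ and $\overline{B_{2R}(0)}\subset D$, then $$\|u\|_{L^\infty(B_R)}\le C R^{-1/(1-r)}\left(\|u\|_{E_{nr},B_{2R}}+k\right),\qquad \|u_x\|_{L^n(B_R)}\le C R^{-1}\left(\|u\|_{E_{nr},B_{2R}}+k\right),$$ where $B_\rho=B_\rho(0)$ and $C$ is a constant independent of $u$, $D$ and $R$ (it may depend on $n,r,a$ and monotonically on the norms $\|\cdot\|_{(N_r),D}$ of $\bar b^{n/(n-1)},c^n,\bar d$).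
   Context: Let $n\ge 2$, let $D\subset\mathbb R^n$ be bounded, connected and open, and let $\frac{n-1}{n}<r<1$. $u_x$ is the gradient of $u$. $\mathcal A(x,u,p)\in\mathbb R^n$, $\mathcal B(x,u,p)\in\mathbb R$ are defined for $x\in D,u\in\mathbb R,p\in\mathbb R^n$; $a>0$ is a constant and $b,c,d,e,f,g$ are nonnegative functions on $D$. Norms: for $s>0$ let $N_s(t)=\int_0^t\log^{(n-1)/s}(\tau+1)\,d\tau$; for measurable $\Omega$, $\|V\|_{(N_s),\Omega}=\inf\{\lambda>0:\int_\Omega N_s(|V|/\lambda)\,dx\le 1\}$ and $\|v\|_{E_s,\Omega}=\inf\{\lambda>0:\int_\Omega \left(\exp(|v/\lambda|^{s/(n-1)})-1\right)dx\le 1\}$. $L\log^{(n-1)/r}L(D)$ is the space of $V$ with $\int_D|V|\log^{(n-1)/r}(|V|+1)\,dx<\infty$ (equivalently $\|V\|_{(N_r),D}<\infty$). $k=\left(\|e^{n/(n-1)}\|_{(N_r),D}^{(n-1)/n}+\|f\|_{(N_r),D}\right)^{1/(n-1)}+\|g\|_{(N_r),D}^{1/n}$ (assumed finite), $\bar b=b+k^{1-n}e$, $\bar d=d+k^{1-n}f+k^{-n}g$; if $k=0$ then $e=f=g=0$ a.e. and $\bar b=b$, $\bar d=d$. (The displayed inequalities follow from $|\mathcal A|\le a|p|^{n-1}+b|u|^{n-1}+e$, $|\mathcal B|\le c|p|^{n-1}+d|u|^{n-1}+f$, $p\cdot\mathcal A\ge|p|^n-d|u|^n-g$.) Weak solution: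 $u\in W^{1,n}(D)$ and $\int_D \phi_x\cdot\mathcal A(x,u,u_x)+\phi\,\mathcal B(x,u,u_x)\,dx=0$ for all $\phi\in C_0^\infty(D)$ (it is part of the hypothesis that $\mathcal A(x,u,u_x),\mathcal B(x,u,u_x)$ are measurable and these integrals make sense). *)

theory Defs
  imports "HOL-Analysis.Analysis" "HOL-Probability.Essential_Supremum"
begin

text \<open>The dimension is \<open>n = CARD('n)\<close>. Functions given on a domain \<open>D\<close> are total functions
  whose values outside \<open>D\<close> are irrelevant.\<close>

definition partial_deriv :: "'n::finite \<Rightarrow> (real^'n \<Rightarrow> real) \<Rightarrow> real^'n \<Rightarrow> real" where
  "partial_deriv i f x = frechet_derivative f (at x) (axis i 1)"

definition grad :: "(real^'n::finite \<Rightarrow> real) \<Rightarrow> real^'n \<Rightarrow> real^'n" where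
  "grad f x = (\<chi> i. partial_deriv i f x)"

text \<open>Total differentiability of every iterated partial derivative makes all of them continuous,
  so this is \<open>C\<^sup>\<infinity>\<close>.\<close>

definition smooth :: "(real^'n::finite \<Rightarrow> real) \<Rightarrow> bool" where
  "smooth f \<longleftrightarrow> (\<forall>is x. foldr partial_deriv is f differentiable (at x))"

definition test_functions :: "(real^'n::finite) set \<Rightarrow> (real^'n \<Rightarrow> real) set" where
  "test_functions D =
     {\<phi>. smooth \<phi> \<and> compact (closure {x. \<phi> x \<noteq> 0}) \<and> closure {x. \<phi> x \<noteq> 0} \<subseteq> D}"

definition Lp :: "real \<Rightarrow> (real^'n::finite) set \<Rightarrow> (real^'n \<Rightarrow> 'b::euclidean_space) set" where
  "Lp p D = {v. v \<in> borel_measurable (lebesgue_on D) \<and>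
                integrable (lebesgue_on D) (\<lambda>x. norm (v x) powr p)}"

text \<open>Meaningful for \<open>v \<in> Lp p D\<close> only; the Bochner integral is 0 if it diverges.\<close>

definition Lp_norm :: "real \<Rightarrow> (real^'n::finite) set \<Rightarrow> (real^'n \<Rightarrow> 'b::euclidean_space) \<Rightarrow> real" where
  "Lp_norm p D v = (LINT x|lebesgue_on D. norm (v x) powr p) powr (1 / p)"

definition Linf_norm :: "(real^'n::finite) set \<Rightarrow> (real^'n \<Rightarrow> real) \<Rightarrow> ennreal" where
  "Linf_norm D v = esssup (lebesgue_on D) (\<lambda>x. ennreal \<bar>v x\<bar>)"

text \<open>\<open>u\<close> belongs to \<open>W\<^sup>1\<^sup>,\<^sup>p(D)\<close> and its weak gradient, which is unique up to null sets, is \<open>Du\<close>.\<close>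

definition W1_with_gradient ::
    "real \<Rightarrow> (real^'n::finite) set \<Rightarrow> (real^'n \<Rightarrow> real) \<Rightarrow> (real^'n \<Rightarrow> real^'n) \<Rightarrow> bool" where
  "W1_with_gradient p D u Du \<longleftrightarrow>
     u \<in> Lp p D \<and> Du \<in> Lp p D \<and>
     (\<forall>\<phi>\<in>test_functions D. \<forall>i.
        (LINT x|lebesgue_on D. u x * partial_deriv i \<phi> x) =
        - (LINT x|lebesgue_on D. Du x $ i * \<phi> x))"

definition weak_solution ::
    "(real^'n::finite \<Rightarrow> real \<Rightarrow> real^'n \<Rightarrow> real^'n) \<Rightarrow> (real^'n \<Rightarrow> real \<Rightarrow> real^'n \<Rightarrow> real) \<Rightarrow>
     (real^'n) set \<Rightarrow> (real^'n \<Rightarrow> real) \<Rightarrow> (real^'n \<Rightarrow> real^'n) \<Rightarrow> bool" where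
  "weak_solution A B D u Du \<longleftrightarrow>
     W1_with_gradient (real CARD('n)) D u Du \<and>
     (\<lambda>x. A x (u x) (Du x)) \<in> borel_measurable (lebesgue_on D) \<and>
     (\<lambda>x. B x (u x) (Du x)) \<in> borel_measurable (lebesgue_on D) \<and>
     (\<forall>\<phi>\<in>test_functions D.
        integrable (lebesgue_on D)
          (\<lambda>x. grad \<phi> x \<bullet> A x (u x) (Du x) + \<phi> x * B x (u x) (Du x)) \<and>
        (LINT x|lebesgue_on D.
          grad \<phi> x \<bullet> A x (u x) (Du x) + \<phi> x * B x (u x) (Du x)) = 0)"

text \<open>The norm is \<open>\<infinity>\<close> if no \<open>\<lambda>\<close> is admissible.\<close>

definition luxemburg_norm ::
    "(real \<Rightarrow> real) \<Rightarrow> (real^'n::finite) set \<Rightarrow> (real^'n \<Rightarrow> real) \<Rightarrow> ennreal" where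
  "luxemburg_norm \<Phi> \<Omega> v =
     Inf {ennreal l | l. 0 < l \<and> (\<integral>\<^sup>+x. ennreal (\<Phi> (\<bar>v x\<bar> / l)) \<partial>lebesgue_on \<Omega>) \<le> 1}"

definition N_fun :: "nat \<Rightarrow> real \<Rightarrow> real \<Rightarrow> real" where
  "N_fun n s t = integral {0..t} (\<lambda>\<tau>. ln (\<tau> + 1) powr ((real n - 1) / s))"

definition N_norm :: "real \<Rightarrow> (real^'n::finite) set \<Rightarrow> (real^'n \<Rightarrow> real) \<Rightarrow> ennreal" where
  "N_norm s \<Omega> V = luxemburg_norm (N_fun CARD('n) s) \<Omega> V"

definition E_norm :: "real \<Rightarrow> (real^'n::finite) set \<Rightarrow> (real^'n \<Rightarrow> real) \<Rightarrow> ennreal" where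
  "E_norm s \<Omega> v = luxemburg_norm (\<lambda>t. exp (t powr (s / (real CARD('n) - 1))) - 1) \<Omega> v"

definition LlogL :: "real \<Rightarrow> (real^'n::finite) set \<Rightarrow> (real^'n \<Rightarrow> real) set" where
  "LlogL r D =
     {V. V \<in> borel_measurable (lebesgue_on D) \<and>
         integrable (lebesgue_on D)
           (\<lambda>x. \<bar>V x\<bar> * ln (\<bar>V x\<bar> + 1) powr ((real CARD('n) - 1) / r))}"

definition k_const ::
    "real \<Rightarrow> (real^'n::finite) set \<Rightarrow>
     (real^'n \<Rightarrow> real) \<Rightarrow> (real^'n \<Rightarrow> real) \<Rightarrow> (real^'n \<Rightarrow> real) \<Rightarrow> real" where
  "k_const r D e f g =
     (let n = real CARD('n) in
      (enn2real (N_norm r D (\<lambda>x. e x powr (n / (n - 1)))) powr ((n - 1) / n)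
         + enn2real (N_norm r D f)) powr (1 / (n - 1))
      + enn2real (N_norm r D g) powr (1 / n))"

text \<open>Since \<open>x / 0 = 0\<close>, for \<open>k = 0\<close> the modified coefficients are \<open>b\<close> and \<open>d\<close> themselves.\<close>

definition b_bar :: "real \<Rightarrow> (real^'n::finite \<Rightarrow> real) \<Rightarrow> (real^'n \<Rightarrow> real) \<Rightarrow> real^'n \<Rightarrow> real" where
  "b_bar k b e x = b x + e x / k ^ (CARD('n) - 1)"

definition d_bar ::
    "real \<Rightarrow> (real^'n::finite \<Rightarrow> real) \<Rightarrow> (real^'n \<Rightarrow> real) \<Rightarrow> (real^'n \<Rightarrow> real) \<Rightarrow> real^'n \<Rightarrow> real" where
  "d_bar k d f g x = d x + f x / k ^ (CARD('n) - 1) + g x / k ^ CARD('n)"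

text \<open>The argument \<open>z\<close> stands for the value of the unknown, \<open>p\<close> for that of its gradient.\<close>

definition structure_conditions ::
    "real \<Rightarrow> real \<Rightarrow> (real^'n::finite \<Rightarrow> real) \<Rightarrow> (real^'n \<Rightarrow> real) \<Rightarrow> (real^'n \<Rightarrow> real) \<Rightarrow>
     (real^'n \<Rightarrow> real \<Rightarrow> real^'n \<Rightarrow> real^'n) \<Rightarrow> (real^'n \<Rightarrow> real \<Rightarrow> real^'n \<Rightarrow> real) \<Rightarrow>
     (real^'n) set \<Rightarrow> bool" where
  "structure_conditions a k bb c dd A B D \<longleftrightarrow>
     (\<forall>x\<in>D. \<forall>z p.
        norm (A x z p) \<le> a * norm p ^ (CARD('n) - 1) + bb x * (\<bar>z\<bar> + k) ^ (CARD('n) - 1) \<and>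
        \<bar>B x z p\<bar> \<le> c x * norm p ^ (CARD('n) - 1) + dd x * (\<bar>z\<bar> + k) ^ (CARD('n) - 1) \<and>
        p \<bullet> A x z p \<ge> norm p ^ CARD('n) - dd x * (\<bar>z\<bar> + k) ^ CARD('n))"

end

theory Submission
  imports Defs
begin

text \<open>
  Moser iteration in exponential Orlicz classes. Put \<open>v = sqrt (u\<^sup>2 + \<kappa>\<^sup>2)\<close> with \<open>\<kappa> > k\<close>, and suppose that
  \<open>v ^ q\<close> has \<open>E\<^bsub>nr\<^esub>\<close> size \<open>\<mu>\<close> on a ball. Testing the equation with a cut-off function times a power of \<open>v\<close>
  (Caccioppoli) and pairing the coefficients with \<open>v\<close> by the duality of \<open>L log\<^bsup>(n-1)/r\<^esup> L\<close> and \<open>E\<^bsub>nr\<^esub>\<close> bounds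
  the \<open>L\<^sup>n\<close> norm of the gradient of \<open>v ^ q\<close> on a smaller ball by \<open>\<mu>\<close> up to a factor. Trudinger's inequality turns this into
  an \<open>E\<^bsub>n\<^esub>\<close> bound, that is, an \<open>E\<^bsub>nr\<^esub>\<close> bound for \<open>v ^ (q/r)\<close>. Hence each step multiplies the exponent by
  \<open>1/r\<close>, and after all steps the factor \<open>S/R\<close> has been raised to \<open>\<Sum>j. r ^ j = 1/(1-r)\<close>. Letting \<open>\<kappa>\<close> tend to \<open>k\<close>
  gives the theorem. The first step alone gives the gradient estimate.
\<close>

section \<open>Trudinger's inequality\<close>

text \<open>Two obstacles shape the argument. First, the equation may be tested with smooth
  functions only, whereas powers of the solution are wanted. Every nonlinear expression in
  \<open>u\<close> is therefore formed from C1 approximants \<open>w j\<close>, for which product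
  and chain rule are classical, and carried over to \<open>u\<close> by dominated convergence or
  Fatou. No Sobolev chain rule occurs; the price is a stock of integrable majorants
  (\<open>Q\<close>, \<open>Z\<close>). Second, a power of \<open>v\<close> is not known in advance
  to be admissible. It is replaced by the antiderivative of a bounded monotone \<open>h\<close>,
  with constants that do not see \<open>h\<close>, and the truncation is removed afterwards by
  Fatou. The shift \<open>\<kappa>\<close> is strictly larger than \<open>k\<close> because
  \<open>k\<close> may be 0 while \<open>v\<close> has to stay away from 0; the square root makes
  \<open>v\<close> a smooth function of \<open>u\<close>. Trudinger's inequality is needed with a
  constant depending on the dimension only. It is derived from averages over annuli with Tonelli and
  scaling alone. Orlicz norms enter as admissible constants in a modular inequality; the infimum is
  taken at the very end.\<close>

definition C1_grad :: "('a::euclidean_space \<Rightarrow> real) \<Rightarrow> ('a \<Rightarrow> 'a) \<Rightarrow> bool" where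
  "C1_grad w W \<longleftrightarrow> continuous_on UNIV W \<and> (\<forall>x. (w has_derivative (\<lambda>h. W x \<bullet> h)) (at x))"

lemma C1_gradD:
  assumes "C1_grad w W"
  shows "(w has_derivative (\<lambda>h. W x \<bullet> h)) (at x)" "continuous_on UNIV W"
  using assms unfolding C1_grad_def by blast+

lemma C1_grad_continuous:
  assumes "C1_grad w W" shows "continuous_on UNIV w"
  using has_derivative_continuous[OF C1_gradD(1)[OF assms]] by (simp add: continuous_on_eq_continuous_at)

lemma C1_grad_measurable:
  assumes "C1_grad w W" shows "w \<in> borel_measurable borel" "W \<in> borel_measurable borel"
  by (rule borel_measurable_continuous_onI[OF C1_grad_continuous[OF assms]],
      rule borel_measurable_continuous_onI[OF C1_gradD(2)[OF assms]])

text \<open>The fundamental theorem of calculus on a segment. The bound is an \<open>ennreal\<close>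
  integral over \<open>lborel\<close>, so that Tonelli can be applied to it without integrability
  questions.\<close>

lemma C1_grad_line_bound:
  assumes w: "C1_grad w W" and ab: "a \<le> b"
  shows "ennreal \<bar>w (x + b *\<^sub>R \<theta>) - w (x + a *\<^sub>R \<theta>)\<bar>
    \<le> (\<integral>\<^sup>+s. indicator {a..b} s * ennreal (norm (W (x + s *\<^sub>R \<theta>)) * norm \<theta>) \<partial>lborel)"
proof -
  let ?f = "\<lambda>s. W (x + s *\<^sub>R \<theta>) \<bullet> \<theta>"
  have cont: "continuous_on {a..b} ?f"
    by (intro continuous_on_inner continuous_on_const continuous_on_compose2[OF C1_gradD(2)[OF w]]
        continuous_on_add continuous_on_scaleR continuous_on_id) auto
  have "((\<lambda>s. w (x + s *\<^sub>R \<theta>)) has_vector_derivative ?f s) (at s within {a..b})" for s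
  proof -
    have "(w has_derivative (\<lambda>h. W (x + s *\<^sub>R \<theta>) \<bullet> h)) (at (x + s *\<^sub>R \<theta>))"
      using w by (auto simp: C1_grad_def)
    then have "((\<lambda>s. w (x + s *\<^sub>R \<theta>)) has_derivative (\<lambda>h. W (x + s *\<^sub>R \<theta>) \<bullet> (h *\<^sub>R \<theta>))) (at s within {a..b})"
      by (rule has_derivative_compose[rotated]) (auto intro!: derivative_eq_intros)
    then show ?thesis by (simp add: has_vector_derivative_def mult.commute)
  qed
  then have "(\<integral>s. indicator {a..b} s *\<^sub>R ?f s \<partial>lborel) = w (x + b *\<^sub>R \<theta>) - w (x + a *\<^sub>R \<theta>)"
    by (intro integral_FTC_atLeastAtMost ab cont) auto
  moreover have "integrable lborel (\<lambda>s. indicator {a..b} s *\<^sub>R ?f s)"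
    using borel_integrable_atLeastAtMost'[OF cont] by (simp add: set_integrable_def)
  ultimately have "ennreal \<bar>w (x + b *\<^sub>R \<theta>) - w (x + a *\<^sub>R \<theta>)\<bar>
      \<le> (\<integral>\<^sup>+s. norm (indicator {a..b} s *\<^sub>R ?f s) \<partial>lborel)"
    using integral_norm_bound_ennreal[of lborel "\<lambda>s. indicator {a..b} s *\<^sub>R ?f s"] by simp
  also have "\<dots> \<le> (\<integral>\<^sup>+s. indicator {a..b} s * ennreal (norm (W (x + s *\<^sub>R \<theta>)) * norm \<theta>) \<partial>lborel)"
    by (intro nn_integral_mono) (auto simp: indicator_def intro!: ennreal_leI Cauchy_Schwarz_ineq2)
  finally show ?thesis .
qed

lemma nn_integral_lborel_affine:
  fixes f :: "'a::euclidean_space \<Rightarrow> ennreal"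
  assumes [measurable]: "f \<in> borel_measurable borel" and c: "c \<noteq> 0"
  shows "(\<integral>\<^sup>+x. f x \<partial>lborel) = ennreal (\<bar>c\<bar> ^ DIM('a)) * (\<integral>\<^sup>+x. f (t + c *\<^sub>R x) \<partial>lborel)"
  by (subst lborel_affine[OF c, of t])
     (simp add: nn_integral_density nn_integral_distr nn_integral_cmult)

lemma nn_integral_lborel_translate:
  fixes f :: "'a::euclidean_space \<Rightarrow> ennreal"
  assumes [measurable]: "f \<in> borel_measurable borel"
  shows "(\<integral>\<^sup>+x. f (x + t) \<partial>lborel) = (\<integral>\<^sup>+x. f x \<partial>lborel)"
  using nn_integral_lborel_affine[of f 1 t] by (simp add: add.commute)

text \<open>Splitting the gradient at the level \<open>m/s\<close> on the sphere of radius \<open>s\<close> replaces Hoelder's inequality.\<close>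
lemma le_plus_power_bound:
  fixes x m :: real
  assumes "x \<ge> 0" "m > 0" "n \<ge> 1"
  shows "x \<le> m + x ^ n / m ^ (n - 1)"
proof (cases "x \<le> m")
  case True
  with assms show ?thesis by (simp add: add_increasing2)
next
  case False
  then have "m ^ (n - 1) \<le> x ^ (n - 1)" using assms by (intro power_mono) auto
  then have "x * m ^ (n - 1) \<le> x * x ^ (n - 1)" using assms by (intro mult_left_mono) auto
  also have "\<dots> = x ^ n" using assms by (metis power_eq_if not_one_le_zero)
  finally have "x \<le> x ^ n / m ^ (n - 1)" using assms by (simp add: field_simps)
  then show ?thesis using assms by simp
qed

text \<open>Directions are taken from a shell of positive thickness instead of the unit sphere: for
  fixed \<open>s\<close> the map \<open>\<theta> \<mapsto> x + s *\<^sub>R \<theta>\<close> is then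
  an affine change of variables, and Lebesgue measure replaces polar coordinates.\<close>

definition annulus :: "'a::euclidean_space set" where
  "annulus = {\<theta>. 1 \<le> norm \<theta> \<and> norm \<theta> \<le> 2}"

lemma annulus_measurable [measurable]: "annulus \<in> sets borel"
  unfolding annulus_def by measurable

lemma emeasure_annulus_finite: "emeasure lborel (annulus :: 'a::euclidean_space set) < \<infinity>"
proof -
  have "emeasure lborel (annulus :: 'a set) \<le> emeasure lborel (cball 0 2 :: 'a set)"
    by (intro emeasure_mono) (auto simp: annulus_def)
  also have "\<dots> < \<infinity>" by (rule emeasure_lborel_cball_finite)
  finally show ?thesis .
qed

lemma measure_annulus_pos: "measure lborel (annulus :: 'a::euclidean_space set) > 0"
proof -
  obtain b :: 'a where b: "b \<in> Basis" using nonempty_Basis by blast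
  have "ball ((3/2) *\<^sub>R b) (1/2) \<subseteq> annulus"
  proof
    fix x assume "x \<in> ball ((3/2) *\<^sub>R b) (1/2)"
    then have "norm ((3/2) *\<^sub>R b - x) < 1/2" by (simp add: dist_norm)
    moreover have "norm ((3/2) *\<^sub>R b) = 3/2" using b by simp
    ultimately show "x \<in> annulus"
      using norm_triangle_ineq2[of "(3/2) *\<^sub>R b" x] norm_triangle_ineq2[of x "(3/2) *\<^sub>R b"]
      by (auto simp: annulus_def norm_minus_commute)
  qed
  then have "measure lborel (ball ((3/2) *\<^sub>R b) (1/2)) \<le> measure lborel (annulus :: 'a set)"
    using emeasure_annulus_finite by (intro measure_mono_fmeasurable) (auto simp: fmeasurable_def)
  moreover have "measure lborel (ball ((3/2) *\<^sub>R b) (1/2)) > 0"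
    using content_ball_pos[of "1/2" "(3/2) *\<^sub>R b"] by simp
  ultimately show ?thesis by linarith
qed

lemma nn_integral_inverse_Icc:
  assumes "0 < d" "d \<le> (e::real)"
  shows "(\<integral>\<^sup>+s. indicator {d..e} s * ennreal (1 / s) \<partial>lborel) = ennreal (ln (e / d))"
proof -
  have "(\<integral>\<^sup>+s. ennreal (1 / s) * indicator {d..e} s \<partial>lborel) = ennreal (ln e - ln d)"
    using assms by (intro nn_integral_FTC_Icc) (auto intro!: derivative_eq_intros)
  then show ?thesis using assms by (simp add: mult.commute ln_div)
qed

text \<open>Tonelli and the substitution \<open>y = x + s *\<^sub>R \<theta>\<close> turn the weight
  \<open>s ^ (n - 1)\<close> into \<open>1 / s\<close>, restricted to those \<open>s\<close> for
  which \<open>y - x\<close> lies in the annulus dilated by \<open>s\<close>. With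
  \<open>t = norm (y - x)\<close> these \<open>s\<close> lie between \<open>t / 2\<close> and
  \<open>t\<close>, where \<open>1 / s\<close> is at most \<open>2 / t\<close>; so every
  \<open>y\<close> is counted with weight at most 1.\<close>

lemma nn_integral_annulus_potential:
  fixes F :: "'a::euclidean_space \<Rightarrow> ennreal"
  assumes F[measurable]: "F \<in> borel_measurable borel" and d: "0 < d"
  shows "(\<integral>\<^sup>+\<theta>. indicator annulus \<theta> * (\<integral>\<^sup>+s. indicator {d..e} s * (ennreal (s ^ (DIM('a) - 1)) * F (x + s *\<^sub>R \<theta>)) \<partial>lborel) \<partial>lborel)
    \<le> (\<integral>\<^sup>+y. F y \<partial>lborel)"
proof -
  let ?n = "DIM('a)"
  have n: "?n \<ge> 1" by (simp add: DIM_positive Suc_leI)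
  have "(\<integral>\<^sup>+\<theta>. indicator annulus \<theta> * (\<integral>\<^sup>+s. indicator {d..e} s * (ennreal (s ^ (?n - 1)) * F (x + s *\<^sub>R \<theta>)) \<partial>lborel) \<partial>lborel)
    = (\<integral>\<^sup>+\<theta>. (\<integral>\<^sup>+s. indicator annulus \<theta> * (indicator {d..e} s * (ennreal (s ^ (?n - 1)) * F (x + s *\<^sub>R \<theta>))) \<partial>lborel) \<partial>lborel)"
    by (subst nn_integral_cmult) (auto simp: mult.assoc)
  also have "\<dots> = (\<integral>\<^sup>+s. (\<integral>\<^sup>+\<theta>. indicator annulus \<theta> * (indicator {d..e} s * (ennreal (s ^ (?n - 1)) * F (x + s *\<^sub>R \<theta>))) \<partial>lborel) \<partial>lborel)"
    by (rule lborel_pair.Fubini') measurable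
  also have "\<dots> = (\<integral>\<^sup>+s. (\<integral>\<^sup>+y. indicator {d..e} s * (ennreal (1 / s) * (indicator annulus ((1 / s) *\<^sub>R (y - x)) * F y)) \<partial>lborel) \<partial>lborel)"
  proof (rule nn_integral_cong)
    fix s :: real
    show "(\<integral>\<^sup>+\<theta>. indicator annulus \<theta> * (indicator {d..e} s * (ennreal (s ^ (?n - 1)) * F (x + s *\<^sub>R \<theta>))) \<partial>lborel)
      = (\<integral>\<^sup>+y. indicator {d..e} s * (ennreal (1 / s) * (indicator annulus ((1 / s) *\<^sub>R (y - x)) * F y)) \<partial>lborel)"
    proof (cases "s \<in> {d..e}")
      case False then show ?thesis by simp
    next
      case True
      then have s: "s > 0" using d by auto
      have sn: "s ^ ?n * (1 / s) = s ^ (?n - 1)"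
        using s n by (simp add: power_diff)
      have "(\<integral>\<^sup>+y. indicator {d..e} s * (ennreal (1 / s) * (indicator annulus ((1 / s) *\<^sub>R (y - x)) * F y)) \<partial>lborel)
        = ennreal (1 / s) * (\<integral>\<^sup>+y. indicator annulus ((1 / s) *\<^sub>R (y - x)) * F y \<partial>lborel)"
        using True by (simp add: nn_integral_cmult)
      also have "\<dots> = ennreal (1 / s) * (ennreal (s ^ ?n) * (\<integral>\<^sup>+\<theta>. indicator annulus \<theta> * F (x + s *\<^sub>R \<theta>) \<partial>lborel))"
        using s by (subst nn_integral_lborel_affine[where c=s and t=x]) auto
      also have "\<dots> = ennreal (s ^ ?n * (1 / s)) * (\<integral>\<^sup>+\<theta>. indicator annulus \<theta> * F (x + s *\<^sub>R \<theta>) \<partial>lborel)"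
        using s by (subst ennreal_mult) (auto simp: mult_ac)
      also have "\<dots> = (\<integral>\<^sup>+\<theta>. ennreal (s ^ (?n - 1)) * (indicator annulus \<theta> * F (x + s *\<^sub>R \<theta>)) \<partial>lborel)"
        unfolding sn by (subst nn_integral_cmult) auto
      finally show ?thesis using True by (simp add: mult_ac)
    qed
  qed
  also have "\<dots> = (\<integral>\<^sup>+y. (\<integral>\<^sup>+s. indicator {d..e} s * (ennreal (1 / s) * (indicator annulus ((1 / s) *\<^sub>R (y - x)) * F y)) \<partial>lborel) \<partial>lborel)"
    by (rule lborel_pair.Fubini') measurable
  also have "\<dots> \<le> (\<integral>\<^sup>+y. F y \<partial>lborel)"
  proof (rule nn_integral_mono)
    fix y
    let ?t = "norm (y - x)"
    have "(\<integral>\<^sup>+s. indicator {d..e} s * (ennreal (1 / s) * (indicator annulus ((1 / s) *\<^sub>R (y - x)) * F y)) \<partial>lborel)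
      \<le> (\<integral>\<^sup>+s. indicator {?t/2..?t} s * (ennreal (2 / ?t) * F y) \<partial>lborel)"
    proof (rule nn_integral_mono)
      fix s :: real
      show "indicator {d..e} s * (ennreal (1 / s) * (indicator annulus ((1 / s) *\<^sub>R (y - x)) * F y))
        \<le> indicator {?t/2..?t} s * (ennreal (2 / ?t) * F y)"
      proof (cases "s \<in> {d..e} \<and> (1 / s) *\<^sub>R (y - x) \<in> annulus")
        case True
        then have s: "s > 0" using d by auto
        have "norm ((1 / s) *\<^sub>R (y - x)) = ?t / s" using s by simp
        moreover have "1 \<le> norm ((1 / s) *\<^sub>R (y - x))" "norm ((1 / s) *\<^sub>R (y - x)) \<le> 2"
          using True unfolding annulus_def by blast+
        ultimately have "1 \<le> ?t / s" "?t / s \<le> 2" by (simp_all only:)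
        then have "s \<le> ?t" "?t \<le> 2 * s" using s by (simp_all add: field_simps)
        then have "1 / s \<le> 2 / ?t" using s
          frac_le[of 2 2 ?t "2 * s"] by (cases "y = x") simp_all
        then have "ennreal (1 / s) * F y \<le> ennreal (2 / ?t) * F y"
          by (intro mult_right_mono ennreal_leI) auto
        then show ?thesis using True \<open>s \<le> ?t\<close> \<open>?t \<le> 2 * s\<close> by simp
      qed (auto simp: indicator_def)
    qed
    also have "\<dots> = ennreal (?t / 2) * (ennreal (2 / ?t) * F y)"
      by (subst nn_integral_multc) auto
    also have "\<dots> = ennreal (?t / 2 * (2 / ?t)) * F y"
      by (simp only: ennreal_mult norm_ge_zero divide_nonneg_nonneg zero_le_numeral mult.assoc)
    also have "\<dots> \<le> F y" by (cases "?t = 0") auto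
    finally show "(\<integral>\<^sup>+s. indicator {d..e} s * (ennreal (1 / s) * (indicator annulus ((1 / s) *\<^sub>R (y - x)) * F y)) \<partial>lborel) \<le> F y" .
  qed
  finally show ?thesis .
qed

text \<open>Each ray is followed from parameter \<open>d\<close> to 4, where it has left the support
  because \<open>4 *\<^sub>R \<theta>\<close> has norm at least 4 and \<open>norm x < 2\<close>.
  Splitting the gradient at the level \<open>m / s\<close> leaves a logarithm for the small values
  and, for the large ones, its \<open>n\<close>-th power with exactly the weight of the preceding
  lemma. The factors 2 bound \<open>norm \<theta>\<close>.\<close>

lemma annulus_average_bound:
  fixes w :: "'a::euclidean_space \<Rightarrow> real"
  assumes w: "C1_grad w W" and out: "\<And>y. norm y \<ge> 2 \<Longrightarrow> w y = 0"
    and x: "norm x < 2" and d: "0 < d" "d \<le> 4" and m: "0 < m"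
  shows "(\<integral>\<^sup>+\<theta>. indicator annulus \<theta> * ennreal \<bar>w (x + d *\<^sub>R \<theta>)\<bar> \<partial>lborel)
    \<le> emeasure lborel (annulus :: 'a set) * ennreal (2 * m * ln (4 / d))
      + ennreal (2 / m ^ (DIM('a) - 1)) * (\<integral>\<^sup>+y. ennreal (norm (W y) ^ DIM('a)) \<partial>lborel)"
proof -
  let ?n = "DIM('a)"
  have n: "?n \<ge> 1" by (simp add: DIM_positive Suc_leI)
  have [measurable]: "w \<in> borel_measurable borel" "W \<in> borel_measurable borel"
    using C1_grad_measurable[OF w] by auto
  let ?F = "\<lambda>y. ennreal (2 / m ^ (?n - 1)) * ennreal (norm (W y) ^ ?n)"
  have pt: "indicator annulus \<theta> * ennreal \<bar>w (x + d *\<^sub>R \<theta>)\<bar>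
      \<le> indicator annulus \<theta> * ennreal (2 * m * ln (4 / d)) +
        indicator annulus \<theta> * (\<integral>\<^sup>+s. indicator {d..4} s * (ennreal (s ^ (?n - 1)) * ?F (x + s *\<^sub>R \<theta>)) \<partial>lborel)"
    for \<theta>
  proof (cases "\<theta> \<in> annulus")
    case True
    then have th: "1 \<le> norm \<theta>" "norm \<theta> \<le> 2" by (auto simp: annulus_def)
    have "norm (x + 4 *\<^sub>R \<theta>) \<ge> 2"
      using norm_triangle_ineq2[of "4 *\<^sub>R \<theta>" "- x"] th x by (simp add: add.commute)
    then have "ennreal \<bar>w (x + d *\<^sub>R \<theta>)\<bar> = ennreal \<bar>w (x + 4 *\<^sub>R \<theta>) - w (x + d *\<^sub>R \<theta>)\<bar>"
      using out by simp
    also have "\<dots> \<le> (\<integral>\<^sup>+s. indicator {d..4} s * ennreal (norm (W (x + s *\<^sub>R \<theta>)) * norm \<theta>) \<partial>lborel)"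
      by (rule C1_grad_line_bound[OF w d(2)])
    also have "\<dots> \<le> (\<integral>\<^sup>+s. ennreal (2 * m) * (indicator {d..4} s * ennreal (1 / s)) +
        indicator {d..4} s * (ennreal (s ^ (?n - 1)) * ?F (x + s *\<^sub>R \<theta>)) \<partial>lborel)"
    proof (rule nn_integral_mono)
      fix s :: real
      show "indicator {d..4} s * ennreal (norm (W (x + s *\<^sub>R \<theta>)) * norm \<theta>)
        \<le> ennreal (2 * m) * (indicator {d..4} s * ennreal (1 / s)) +
        indicator {d..4} s * (ennreal (s ^ (?n - 1)) * ?F (x + s *\<^sub>R \<theta>))"
      proof (cases "s \<in> {d..4}")
        case True
        then have s: "s > 0" using d by auto
        let ?g = "norm (W (x + s *\<^sub>R \<theta>))"
        have "?g * norm \<theta> \<le> ?g * 2" using th by (intro mult_left_mono) auto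
        also have "\<dots> \<le> (m / s + ?g ^ ?n / (m / s) ^ (?n - 1)) * 2"
          using s m n by (intro mult_right_mono le_plus_power_bound) auto
        also have "\<dots> = 2 * m * (1 / s) + s ^ (?n - 1) * (2 / m ^ (?n - 1) * ?g ^ ?n)"
          using s m by (simp add: field_simps power_divide)
        finally have "ennreal (?g * norm \<theta>) \<le> ennreal (2 * m * (1 / s) + s ^ (?n - 1) * (2 / m ^ (?n - 1) * ?g ^ ?n))"
          by (rule ennreal_leI)
        moreover have "ennreal (2 * m * (1 / s) + s ^ (?n - 1) * (2 / m ^ (?n - 1) * ?g ^ ?n)) =
            ennreal (2 * m) * ennreal (1 / s) + ennreal (s ^ (?n - 1)) * (ennreal (2 / m ^ (?n - 1)) * ennreal (?g ^ ?n))"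
          using s m by (simp only: ennreal_mult[symmetric] ennreal_plus[symmetric] zero_le_mult_iff
              zero_le_divide_iff zero_le_power norm_ge_zero less_imp_le simp_thms zero_le_numeral zero_le_one)
        ultimately show ?thesis using True by simp
      qed auto
    qed
    also have "\<dots> = ennreal (2 * m) * ennreal (ln (4 / d)) +
        (\<integral>\<^sup>+s. indicator {d..4} s * (ennreal (s ^ (?n - 1)) * ?F (x + s *\<^sub>R \<theta>)) \<partial>lborel)"
      by (subst nn_integral_add, measurable, subst nn_integral_cmult, measurable,
          subst nn_integral_inverse_Icc[OF d]) simp
    finally show ?thesis using True m d by (simp add: ennreal_mult)
  qed (simp add: indicator_def)
  have "(\<integral>\<^sup>+\<theta>. indicator annulus \<theta> * ennreal \<bar>w (x + d *\<^sub>R \<theta>)\<bar> \<partial>lborel)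
    \<le> (\<integral>\<^sup>+\<theta>. indicator annulus \<theta> * ennreal (2 * m * ln (4 / d)) +
        indicator annulus \<theta> * (\<integral>\<^sup>+s. indicator {d..4} s * (ennreal (s ^ (?n - 1)) * ?F (x + s *\<^sub>R \<theta>)) \<partial>lborel) \<partial>lborel)"
    by (intro nn_integral_mono pt)
  also have "\<dots> = emeasure lborel (annulus :: 'a set) * ennreal (2 * m * ln (4 / d)) +
      (\<integral>\<^sup>+\<theta>. indicator annulus \<theta> * (\<integral>\<^sup>+s. indicator {d..4} s * (ennreal (s ^ (?n - 1)) * ?F (x + s *\<^sub>R \<theta>)) \<partial>lborel) \<partial>lborel)"
    by (subst nn_integral_add) (auto simp: nn_integral_multc)
  also have "\<dots> \<le> emeasure lborel (annulus :: 'a set) * ennreal (2 * m * ln (4 / d)) + (\<integral>\<^sup>+y. ?F y \<partial>lborel)"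
    by (intro add_left_mono nn_integral_annulus_potential d(1)) simp
  finally show ?thesis by (simp add: nn_integral_cmult)
qed

text \<open>The L1 modulus of continuity: the segment bound is integrated over \<open>x\<close>, and
  translation invariance removes the shift.\<close>

lemma translate_difference_bound:
  fixes w :: "'a::euclidean_space \<Rightarrow> real"
  assumes w: "C1_grad w W" and d: "0 \<le> d"
  shows "(\<integral>\<^sup>+x. ennreal \<bar>w (x + d *\<^sub>R \<theta>) - w x\<bar> \<partial>lborel)
    \<le> ennreal (d * norm \<theta>) * (\<integral>\<^sup>+x. ennreal (norm (W x)) \<partial>lborel)"
proof -
  have [measurable]: "w \<in> borel_measurable borel" "W \<in> borel_measurable borel"
    using C1_grad_measurable[OF w] by auto
  have "(\<integral>\<^sup>+x. ennreal \<bar>w (x + d *\<^sub>R \<theta>) - w x\<bar> \<partial>lborel)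
    \<le> (\<integral>\<^sup>+x. \<integral>\<^sup>+s. indicator {0..d} s * ennreal (norm (W (x + s *\<^sub>R \<theta>)) * norm \<theta>) \<partial>lborel \<partial>lborel)"
    using C1_grad_line_bound[OF w d, of _ \<theta>] by (intro nn_integral_mono) simp
  also have "\<dots> = (\<integral>\<^sup>+s. \<integral>\<^sup>+x. indicator {0..d} s * ennreal (norm (W (x + s *\<^sub>R \<theta>)) * norm \<theta>) \<partial>lborel \<partial>lborel)"
    by (rule lborel_pair.Fubini') measurable
  also have "\<dots> = (\<integral>\<^sup>+s. indicator {0..d} s * (ennreal (norm \<theta>) * (\<integral>\<^sup>+x. ennreal (norm (W x)) \<partial>lborel)) \<partial>lborel)"
  proof (rule nn_integral_cong)
    fix s :: real
    have "(\<integral>\<^sup>+x. ennreal (norm (W (x + s *\<^sub>R \<theta>)) * norm \<theta>) \<partial>lborel) = (\<integral>\<^sup>+x. ennreal (norm \<theta>) * ennreal (norm (W (x + s *\<^sub>R \<theta>))) \<partial>lborel)"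
      by (simp add: ennreal_mult mult.commute)
    also have "\<dots> = ennreal (norm \<theta>) * (\<integral>\<^sup>+x. ennreal (norm (W x)) \<partial>lborel)"
      by (subst nn_integral_cmult) (auto simp: nn_integral_lborel_translate[where f="\<lambda>x. ennreal (norm (W x))"])
    finally show "(\<integral>\<^sup>+x. indicator {0..d} s * ennreal (norm (W (x + s *\<^sub>R \<theta>)) * norm \<theta>) \<partial>lborel) =
      indicator {0..d} s * (ennreal (norm \<theta>) * (\<integral>\<^sup>+x. ennreal (norm (W x)) \<partial>lborel))"
      by (subst nn_integral_cmult) auto
  qed
  also have "\<dots> = ennreal (d * norm \<theta>) * (\<integral>\<^sup>+x. ennreal (norm (W x)) \<partial>lborel)"
    using d by (subst nn_integral_multc) (auto simp: ennreal_mult mult.assoc)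
  finally show ?thesis .
qed

text \<open>Uniqueness of the derivative; it confines the gradient of a compactly supported function
  to the support.\<close>

lemma C1_grad_zero_outside:
  fixes w :: "'a::euclidean_space \<Rightarrow> real"
  assumes w: "C1_grad w W" and S: "open S" "x \<in> S" and z: "\<And>y. y \<in> S \<Longrightarrow> w y = 0"
  shows "W x = 0"
proof -
  have "((\<lambda>_. 0) has_derivative (\<lambda>h. W x \<bullet> h)) (at x)"
    by (rule has_derivative_transform_within_open[OF C1_gradD(1)[OF w] S]) (simp add: z)
  then have "(\<lambda>h. W x \<bullet> h) = (\<lambda>h. 0)"
    by (rule has_derivative_unique) (rule has_derivative_const)
  then show ?thesis by (metis inner_eq_zero_iff)
qed

text \<open>Convexity of exp on the segment from 0 to \<open>x\<close>. This is how an exponential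
  modular is brought below 1 by enlarging the admissible constant.\<close>

lemma exp_minus_one_scale:
  fixes t x :: real
  assumes "0 \<le> t" "t \<le> 1"
  shows "exp (t * x) - 1 \<le> t * (exp x - 1)"
  using convex_onD[OF exp_convex assms, of 0 x] by (simp add: algebra_simps)

text \<open>With \<open>4 exp (-l)\<close> as translation length, the annulus average of \<open>w\<close> is of size
  \<open>l powr ((n-1)/n)\<close> everywhere, and \<open>w\<close> is \<open>L\<^sup>1\<close>-close to it.\<close>
lemma Trudinger_tail:
  fixes w :: "'a::euclidean_space \<Rightarrow> real"
  defines "n \<equiv> DIM('a)" and "\<alpha> \<equiv> measure lborel (annulus :: 'a set)"
    and "\<beta> \<equiv> measure lborel (cball 0 2 :: 'a set)"
  assumes w: "C1_grad w W" and out: "\<And>y. norm y \<ge> 2 \<Longrightarrow> w y = 0"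
    and W1: "(\<integral>\<^sup>+y. ennreal (norm (W y) ^ n) \<partial>lborel) \<le> 1" and l: "0 \<le> l"
  shows "emeasure lborel {x. \<bar>w x\<bar> > (3 + 2 / \<alpha>) * l powr ((real n - 1) / real n)}
    \<le> ennreal (8 * (\<beta> + 1) * exp (- l))"
proof -
  have n: "n \<ge> 1" by (simp add: n_def DIM_positive Suc_leI)
  have \<alpha>: "\<alpha> > 0" "emeasure lborel (annulus :: 'a set) = ennreal \<alpha>"
    using measure_annulus_pos emeasure_annulus_finite
    by (auto simp: \<alpha>_def less_top[symmetric] intro!: emeasure_eq_ennreal_measure)
  have \<beta>: "\<beta> \<ge> 0" "emeasure lborel (cball 0 2 :: 'a set) = ennreal \<beta>"
    using emeasure_lborel_cball_finite[of "0::'a" 2] by (auto simp: \<beta>_def intro!: emeasure_eq_ennreal_measure)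
  have [measurable]: "w \<in> borel_measurable borel" "W \<in> borel_measurable borel"
    using C1_grad_measurable[OF w] by auto
  define p where "p = (real n - 1) / real n"
  define E where "E = {x. \<bar>w x\<bar> > (3 + 2 / \<alpha>) * l powr p}"
  have [measurable]: "E \<in> sets borel" unfolding E_def by measurable
  have Esub: "norm x < 2" if "x \<in> E" for x
  proof (rule ccontr)
    assume "\<not> norm x < 2"
    then have "w x = 0" using out by auto
    then have "(3 + 2 / \<alpha>) * l powr p < 0" using that by (simp add: E_def)
    then show False using \<alpha>(1) by (smt (verit) divide_nonneg_pos mult_nonneg_nonneg powr_ge_zero)
  qed
  have "emeasure lborel E \<le> ennreal (8 * (\<beta> + 1) * exp (- l))"
  proof (cases "l < 2")
    \<comment> \<open>Here \<open>8 * exp (- l) \<ge> 1\<close>, as the square of e is below 8, so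
      the claim follows from the support of \<open>w\<close> alone.\<close>
    case True
    have "emeasure lborel E \<le> emeasure lborel (cball 0 2 :: 'a set)"
      using Esub by (intro emeasure_mono) (auto simp: less_imp_le)
    also have "\<dots> \<le> ennreal (8 * (\<beta> + 1) * exp (- l))"
    proof -
      have "exp l \<le> exp 2" using True by simp
      also have "exp 2 = exp (1::real) * exp 1" by (simp add: exp_add[symmetric])
      also have "\<dots> \<le> 2.8 * 2.8" using e_less_272 by (intro mult_mono) auto
      finally have "exp l \<le> 8" by simp
      then have "1 \<le> 8 * exp (- l)" by (simp add: exp_minus field_simps)
      then have "\<beta> * 1 \<le> (\<beta> + 1) * (8 * exp (- l))" using \<beta>(1) by (intro mult_mono) auto
      then show ?thesis by (auto simp: \<beta>(2) algebra_simps intro!: ennreal_leI)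
    qed
    finally show ?thesis .
  next
    case False
    then have l2: "l \<ge> 2" by simp
    \<comment> \<open>These choices give \<open>ln (4 / d) = l\<close> and balance the two terms of
      the annulus bound: \<open>m * l\<close> and \<open>1 / m ^ (n - 1)\<close> both equal
      \<open>l powr p\<close>.\<close>
    define d where "d = 4 * exp (- l)"
    define m where "m = l powr (- 1 / real n)"
    have "exp l \<ge> 1 + l + l\<^sup>2 / 2" using exp_lower_Taylor_quadratic[of l] l2 by simp
    moreover have "l * l \<ge> 2 * 2" using l2 by (intro mult_mono) auto
    ultimately have "exp l \<ge> 4" using l2 by (simp add: power2_eq_square)
    then have d: "0 < d" "d \<le> 4" using l2 by (auto simp: d_def exp_minus field_simps)
    have lnd: "ln (4 / d) = l" by (simp add: d_def exp_minus inverse_eq_divide)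
    have m: "m > 0" using l2 by (simp add: m_def)
    have lp: "l powr p \<ge> 1" using l2 n by (simp add: p_def ge_one_powr_ge_zero)
    have m1: "m * l = l powr p"
      using l2 n by (simp add: m_def p_def powr_mult_base[symmetric] powr_add[symmetric] diff_divide_distrib)
        (metis add.commute add_uminus_conv_diff divide_minus_left less_eq_real_def mult.commute not_numeral_le_zero order.trans powr_mult_base zero_le_numeral)
    have m2: "1 / m ^ (n - 1) = l powr p"
    proof -
      have "m ^ (n - 1) = l powr (- p)"
        using l2 n unfolding m_def by (simp add: powr_power p_def of_nat_diff)
      then show ?thesis by (simp add: powr_minus inverse_eq_divide)
    qed
    let ?I = "\<lambda>x. (\<integral>\<^sup>+\<theta>. indicator annulus \<theta> * ennreal \<bar>w (x + d *\<^sub>R \<theta>) - w x\<bar> \<partial>lborel)"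
    \<comment> \<open>On \<open>E\<close> the value \<open>\<bar>w x\<bar>\<close> exceeds the mean
      of its translates over the annulus by at least \<open>l powr p\<close>, hence by at least 1.
      The translates therefore differ from \<open>w x\<close> by at least 1 on average, which is
      \<open>\<alpha>\<close> in unnormalised form. Chebyshev and the translation estimate then
      bound the measure of \<open>E\<close>.\<close>
    have pt: "ennreal \<alpha> \<le> ?I x" if x: "x \<in> E" for x
    proof -
      have "(\<integral>\<^sup>+\<theta>. indicator annulus \<theta> * ennreal \<bar>w (x + d *\<^sub>R \<theta>)\<bar> \<partial>lborel)
        \<le> ennreal \<alpha> * ennreal (2 * m * l) + ennreal (2 / m ^ (n - 1)) * 1"
        using annulus_average_bound[OF w out Esub[OF x] d m] W1 unfolding lnd \<alpha>(2) n_def[symmetric]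
        by (meson add_left_mono mult_left_mono order_trans zero_le)
      also have "\<dots> = ennreal (\<alpha> * ((2 + 2 / \<alpha>) * l powr p))"
      proof -
        have e1: "2 * m * l = 2 * l powr p" using m1 by simp
        have "2 / m ^ (n - 1) = 2 * (1 / m ^ (n - 1))" by simp
        then have e2: "2 / m ^ (n - 1) = 2 * l powr p" unfolding m2 .
        have "ennreal \<alpha> * ennreal (2 * l powr p) + ennreal (2 * l powr p) * 1
            = ennreal (\<alpha> * (2 * l powr p) + 2 * l powr p)"
          using \<alpha>(1) by (subst ennreal_plus) (auto simp: ennreal_mult)
        moreover have "\<alpha> * (2 * l powr p) + 2 * l powr p = \<alpha> * ((2 + 2 / \<alpha>) * l powr p)"
          using \<alpha>(1) by (simp add: field_simps)
        ultimately show ?thesis unfolding e1 e2 by (rule trans[OF _ arg_cong[where f=ennreal]])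
      qed
      finally have avg: "(\<integral>\<^sup>+\<theta>. indicator annulus \<theta> * ennreal \<bar>w (x + d *\<^sub>R \<theta>)\<bar> \<partial>lborel)
        \<le> ennreal (\<alpha> * ((2 + 2 / \<alpha>) * l powr p))" .
      have "(3 + 2 / \<alpha>) * l powr p = l powr p + (2 + 2 / \<alpha>) * l powr p" by (simp add: algebra_simps)
      then have "\<bar>w x\<bar> \<ge> 1 + (2 + 2 / \<alpha>) * l powr p"
        using x lp by (simp add: E_def)
      then have "ennreal \<alpha> + ennreal (\<alpha> * ((2 + 2 / \<alpha>) * l powr p)) \<le> ennreal (\<alpha> * \<bar>w x\<bar>)"
        using \<alpha>(1) mult_left_mono[of "1 + (2 + 2 / \<alpha>) * l powr p" "\<bar>w x\<bar>" \<alpha>]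
        by (subst ennreal_plus[symmetric]) (simp_all add: ennreal_leI distrib_left del: ennreal_plus)
      also have "\<dots> = (\<integral>\<^sup>+(\<theta> :: 'a). indicator annulus \<theta> * ennreal \<bar>w x\<bar> \<partial>lborel)"
        using \<alpha> by (simp add: nn_integral_multc ennreal_mult)
      also have "\<dots> \<le> (\<integral>\<^sup>+\<theta>. indicator annulus \<theta> * ennreal \<bar>w (x + d *\<^sub>R \<theta>) - w x\<bar> +
          indicator annulus \<theta> * ennreal \<bar>w (x + d *\<^sub>R \<theta>)\<bar> \<partial>lborel)"
        by (intro nn_integral_mono)
          (auto simp: indicator_def ennreal_plus[symmetric] simp del: ennreal_plus intro!: ennreal_leI)
      also have "\<dots> = ?I x + (\<integral>\<^sup>+\<theta>. indicator annulus \<theta> * ennreal \<bar>w (x + d *\<^sub>R \<theta>)\<bar> \<partial>lborel)"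
        by (rule nn_integral_add) auto
      also have "\<dots> \<le> ?I x + ennreal (\<alpha> * ((2 + 2 / \<alpha>) * l powr p))"
        by (intro add_left_mono avg)
      finally have "ennreal (\<alpha> * ((2 + 2 / \<alpha>) * l powr p)) + ennreal \<alpha> \<le> ennreal (\<alpha> * ((2 + 2 / \<alpha>) * l powr p)) + ?I x"
        by (simp only: add.commute)
      then show ?thesis unfolding ennreal_add_left_cancel_le by simp
    qed
    \<comment> \<open>The L1 norm of \<open>W\<close> is controlled through
      \<open>t \<le> 1 + t ^ n\<close>, the 1 being paid only on the ball outside of which
      \<open>W\<close> vanishes.\<close>
    have WW: "(\<integral>\<^sup>+y. ennreal (norm (W y)) \<partial>lborel) \<le> ennreal (\<beta> + 1)"
    proof -
      have "W y = 0" if "norm y > 2" for y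
        by (rule C1_grad_zero_outside[OF w, where S="- cball 0 2"]) (use that out in auto)
      then have WI: "norm (W y) \<le> indicator (cball 0 2) y + norm (W y) ^ n" for y
        using le_plus_power_bound[of "norm (W y)" 1 n] n by (cases "norm y > 2") (auto simp: indicator_def)
      have "ennreal (norm (W y)) \<le> indicator (cball 0 2) y + ennreal (norm (W y) ^ n)" for y
        using ennreal_leI[OF WI[of y]] by (subst (asm) ennreal_plus) (auto simp: ennreal_indicator)
      then have "(\<integral>\<^sup>+y. ennreal (norm (W y)) \<partial>lborel) \<le> (\<integral>\<^sup>+y. indicator (cball 0 2) y + ennreal (norm (W y) ^ n) \<partial>lborel)"
        by (intro nn_integral_mono)
      also have "\<dots> = ennreal \<beta> + (\<integral>\<^sup>+y. ennreal (norm (W y) ^ n) \<partial>lborel)"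
        by (subst nn_integral_add) (auto simp: \<beta>(2) intro!: borel_measurable_indicator)
      also have "\<dots> \<le> ennreal \<beta> + 1" by (intro add_left_mono W1)
      finally show ?thesis using \<beta>(1) by simp
    qed
    have "ennreal \<alpha> * emeasure lborel E = (\<integral>\<^sup>+x. ennreal \<alpha> * indicator E x \<partial>lborel)"
      by (simp add: nn_integral_cmult)
    also have "\<dots> \<le> (\<integral>\<^sup>+x. ?I x \<partial>lborel)"
      using pt by (intro nn_integral_mono) (auto simp: indicator_def)
    also have "\<dots> = (\<integral>\<^sup>+\<theta>. \<integral>\<^sup>+x. indicator annulus \<theta> * ennreal \<bar>w (x + d *\<^sub>R \<theta>) - w x\<bar> \<partial>lborel \<partial>lborel)"
      by (rule lborel_pair.Fubini') measurable
    also have "\<dots> \<le> (\<integral>\<^sup>+(\<theta> :: 'a). indicator annulus \<theta> * ennreal (d * 2 * (\<beta> + 1)) \<partial>lborel)"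
    proof (rule nn_integral_mono)
      fix \<theta> :: 'a
      have "(\<integral>\<^sup>+x. ennreal \<bar>w (x + d *\<^sub>R \<theta>) - w x\<bar> \<partial>lborel) \<le> ennreal (d * 2 * (\<beta> + 1))" if "\<theta> \<in> annulus"
      proof -
        have "(\<integral>\<^sup>+x. ennreal \<bar>w (x + d *\<^sub>R \<theta>) - w x\<bar> \<partial>lborel) \<le> ennreal (d * norm \<theta>) * (\<integral>\<^sup>+x. ennreal (norm (W x)) \<partial>lborel)"
          using d by (intro translate_difference_bound[OF w]) simp
        also have "\<dots> \<le> ennreal (d * 2) * ennreal (\<beta> + 1)"
          using that d by (intro mult_mono WW ennreal_leI mult_left_mono) (auto simp: annulus_def)
        also have "\<dots> = ennreal (d * 2 * (\<beta> + 1))"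
          using d \<beta>(1) by (subst ennreal_mult) auto
        finally show ?thesis .
      qed
      then show "(\<integral>\<^sup>+x. indicator annulus \<theta> * ennreal \<bar>w (x + d *\<^sub>R \<theta>) - w x\<bar> \<partial>lborel)
        \<le> indicator annulus \<theta> * ennreal (d * 2 * (\<beta> + 1))"
        by (auto simp: indicator_def)
    qed
    also have "\<dots> = ennreal \<alpha> * ennreal (8 * (\<beta> + 1) * exp (- l))"
      using \<alpha>(2) by (simp add: nn_integral_multc d_def algebra_simps)
    finally show ?thesis
      using \<alpha>(1) by (simp add: ennreal_mult_le_mult_iff)
  qed
  then show ?thesis by (simp add: E_def p_def)
qed

text \<open>The points with \<open>Y\<close> between \<open>j\<close> and \<open>j + 1\<close>
  contribute at most \<open>exp ((j + 1) / 2)\<close> times the tail \<open>B * exp (- j)\<close>.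
  Halving \<open>Y\<close> is what makes this a convergent geometric series, of ratio
  \<open>exp (- 1/2)\<close>.\<close>

lemma nn_integral_exp_layer_cake:
  fixes Y :: "'a \<Rightarrow> real"
  assumes [measurable]: "Y \<in> borel_measurable M" and Y: "\<And>x. Y x \<ge> 0"
    and tail: "\<And>j::nat. emeasure M {x\<in>space M. Y x > real j} \<le> ennreal (B * exp (- real j))" and B: "B \<ge> 0"
  shows "(\<integral>\<^sup>+x. ennreal (exp (Y x / 2) - 1) \<partial>M) \<le> ennreal (B * (exp (1/2) / (1 - exp (- 1/2))))"
proof -
  let ?T = "\<lambda>j. {x\<in>space M. Y x > real j}"
  let ?f = "\<lambda>j x. ennreal (exp ((real j + 1) / 2)) * indicator (?T j) x"
  have "(\<integral>\<^sup>+x. ennreal (exp (Y x / 2) - 1) \<partial>M) \<le> (\<integral>\<^sup>+x. (\<Sum>j. ?f j x) \<partial>M)"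
  proof (rule nn_integral_mono)
    fix x assume x: "x \<in> space M"
    show "ennreal (exp (Y x / 2) - 1) \<le> (\<Sum>j. ?f j x)"
    proof (cases "Y x = 0")
      case False
      with Y[of x] have Y0: "Y x > 0" by simp
      define j where "j = nat (\<lceil>Y x\<rceil> - 1)"
      have j: "real j < Y x" "Y x \<le> real j + 1" using Y0 unfolding j_def by linarith+
      have "ennreal (exp (Y x / 2) - 1) \<le> ennreal (exp ((real j + 1) / 2))"
        by (rule ennreal_leI, rule order_trans[of _ "exp (Y x / 2)"]) (use j in auto)
      also have "\<dots> = ?f j x" using j x by simp
      also have "\<dots> = (\<Sum>i\<in>{j}. ?f i x)" by (subst sum.insert) auto
      also have "\<dots> \<le> (\<Sum>j. ?f j x)" by (rule sum_le_suminf) (auto simp: summableI)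
      finally show ?thesis .
    qed simp
  qed
  also have "\<dots> = (\<Sum>j. \<integral>\<^sup>+x. ?f j x \<partial>M)"
    by (rule nn_integral_suminf) measurable
  also have "\<dots> \<le> (\<Sum>j. ennreal (B * exp (1/2) * exp (- 1/2) ^ j))"
  proof (intro suminf_le)
    fix j
    have "(\<integral>\<^sup>+x. ?f j x \<partial>M) = ennreal (exp ((real j + 1) / 2)) * emeasure M (?T j)"
      by (subst nn_integral_cmult) auto
    also have "\<dots> \<le> ennreal (exp ((real j + 1) / 2)) * ennreal (B * exp (- real j))"
      by (intro mult_left_mono tail) simp
    also have "\<dots> = ennreal (B * exp (1/2) * exp (- 1/2) ^ j)"
    proof -
      have "exp ((real j + 1) / 2) * exp (- real j) = exp (1/2) * exp (real j * (- 1/2))"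
        by (simp only: exp_add[symmetric]) (simp add: field_simps)
      also have "exp (real j * (- 1/2)) = exp (- 1/2) ^ j" by (rule exp_of_nat_mult)
      finally have "exp ((real j + 1) / 2) * (B * exp (- real j)) = B * exp (1/2) * exp (- 1/2) ^ j"
        by (simp only: mult.assoc mult.left_commute[of _ B])
      then show ?thesis using B by (subst ennreal_mult[symmetric]) (simp_all only: exp_ge_zero mult_nonneg_nonneg)
    qed
    finally show "(\<integral>\<^sup>+x. ?f j x \<partial>M) \<le> ennreal (B * exp (1/2) * exp (- 1/2) ^ j)" .
  qed (auto simp: summableI)
  also have "\<dots> = ennreal (B * (exp (1/2) / (1 - exp (- 1/2))))"
  proof -
    have "(\<lambda>j. B * exp (1/2) * exp (- 1/2) ^ j) sums (B * exp (1/2) * (1 / (1 - exp (- 1/2))))"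
      by (intro sums_mult geometric_sums) simp
    then have "(\<Sum>j. ennreal (B * exp (1/2) * exp (- 1/2) ^ j)) = ennreal (B * exp (1/2) * (1 / (1 - exp (- 1/2))))"
      using B by (intro suminf_ennreal_eq) auto
    then show ?thesis by simp
  qed
  finally show ?thesis .
qed

text \<open>With \<open>l = j\<close> the tail estimate says that \<open>Y\<close>, the power
  \<open>n / (n - 1)\<close> of \<open>\<bar>w\<bar> / c\<close>, has exponential tails, so the
  modular of \<open>Y / 2\<close> is at most some \<open>K0\<close>; convexity of exp trades
  \<open>K0\<close> for 1. Other gradient norms are reduced to norm 1 by dividing \<open>w\<close>
  by \<open>L\<close>.\<close>

theorem Trudinger_inequality:
  assumes n2: "DIM('a::euclidean_space) \<ge> 2"
  obtains K :: real where "K > 0"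
    "\<And>(w :: 'a \<Rightarrow> real) W L. C1_grad w W \<Longrightarrow> (\<And>y. norm y \<ge> 2 \<Longrightarrow> w y = 0) \<Longrightarrow> 0 < L \<Longrightarrow>
      (\<integral>\<^sup>+y. ennreal (norm (W y) ^ DIM('a)) \<partial>lborel) \<le> ennreal (L ^ DIM('a)) \<Longrightarrow>
      (\<integral>\<^sup>+x. ennreal (exp ((\<bar>w x\<bar> / (K * L)) powr (real DIM('a) / (real DIM('a) - 1))) - 1) \<partial>lborel) \<le> 1"
proof -
  define n where "n = DIM('a)"
  define p where "p = (real n - 1) / real n"
  have n: "n \<ge> 2" using n2 by (simp add: n_def)
  have p: "p > 0" "1 / p = real n / (real n - 1)" using n by (auto simp: p_def)
  define c where "c = 3 + 2 / measure lborel (annulus :: 'a set)"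
  define B where "B = 8 * (measure lborel (cball 0 2 :: 'a set) + 1)"
  \<comment> \<open>The summand 1 makes \<open>1 / K0\<close> a legitimate convexity factor.
    \<open>K\<close> is then chosen such that the power \<open>1 / p\<close> of
    \<open>\<bar>w x\<bar> / K\<close> is \<open>Y x / (2 * K0)\<close>.\<close>
  define K0 where "K0 = B * (exp (1/2) / (1 - exp (- 1/2))) + 1"
  define K where "K = c * (2 * K0) powr p"
  have c: "c > 0" using measure_annulus_pos[where 'a='a] by (simp add: c_def add_pos_pos)
  have B: "B \<ge> 0" by (simp add: B_def)
  have K0: "K0 \<ge> 1" using B by (simp add: K0_def)
  have K: "K > 0" using c K0 by (simp add: K_def)
  have main: "(\<integral>\<^sup>+x. ennreal (exp ((\<bar>w x\<bar> / K) powr (1 / p)) - 1) \<partial>lborel) \<le> 1"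
    if w: "C1_grad w W" and out: "\<And>y. norm y \<ge> 2 \<Longrightarrow> w y = 0"
      and W1: "(\<integral>\<^sup>+y. ennreal (norm (W y) ^ n) \<partial>lborel) \<le> 1" for w :: "'a \<Rightarrow> real" and W
  proof -
    have [measurable]: "w \<in> borel_measurable borel" using C1_grad_measurable[OF w] by auto
    define Y where "Y x = (\<bar>w x\<bar> / c) powr (1 / p)" for x
    have [measurable]: "Y \<in> borel_measurable lborel" unfolding Y_def by measurable
    have Y_eq: "Y x / 2 / K0 = (\<bar>w x\<bar> / K) powr (1 / p)" for x
    proof -
      have "\<bar>w x\<bar> / K = (\<bar>w x\<bar> / c) / (2 * K0) powr p" by (simp add: K_def)
      then have "(\<bar>w x\<bar> / K) powr (1 / p) = (\<bar>w x\<bar> / c) powr (1 / p) / ((2 * K0) powr p) powr (1 / p)"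
        using c K0 by (simp only: powr_divide divide_nonneg_pos abs_ge_zero powr_ge_zero)
      then show ?thesis using p(1) K0 by (simp add: Y_def powr_powr)
    qed
    have "{x\<in>space lborel. Y x > real j} = {x. \<bar>w x\<bar> > c * real j powr p}" for j
    proof -
      have "real j < Y x \<longleftrightarrow> c * real j powr p < \<bar>w x\<bar>" for x
      proof -
        have "real j < Y x \<longleftrightarrow> (real j powr p) powr (1/p) < (\<bar>w x\<bar> / c) powr (1 / p)"
          using p(1) by (simp add: Y_def powr_powr)
        also have "\<dots> \<longleftrightarrow> real j powr p < \<bar>w x\<bar> / c"
          using p(1) c powr_less_mono2[of "1/p"] powr_mono2[of "1/p"] by (meson abs_ge_zero divide_nonneg_pos linorder_not_less powr_ge_zero zero_less_divide_1_iff order_less_imp_le)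
        finally show ?thesis using c by (simp add: field_simps)
      qed
      then show ?thesis by simp
    qed
    then have tail: "emeasure lborel {x\<in>space lborel. Y x > real j} \<le> ennreal (B * exp (- real j))" for j
      using Trudinger_tail[OF w out, of "real j"] W1 by (simp add: c_def B_def p_def n_def)
    have Y_int: "(\<integral>\<^sup>+x. ennreal (exp (Y x / 2) - 1) \<partial>lborel) \<le> ennreal K0"
      by (rule order_trans[OF nn_integral_exp_layer_cake[of Y lborel B]]) (use B tail in \<open>simp_all add: Y_def K0_def ennreal_leI\<close>)
    have "(\<integral>\<^sup>+x. ennreal (exp ((\<bar>w x\<bar> / K) powr (1 / p)) - 1) \<partial>lborel)
      \<le> (\<integral>\<^sup>+x. ennreal (1 / K0) * ennreal (exp (Y x / 2) - 1) \<partial>lborel)"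
    proof (rule nn_integral_mono)
      fix x
      have "exp (1 / K0 * (Y x / 2)) - 1 \<le> 1 / K0 * (exp (Y x / 2) - 1)"
        using K0 by (intro exp_minus_one_scale) auto
      moreover have "1 / K0 * (Y x / 2) = (\<bar>w x\<bar> / K) powr (1 / p)" using Y_eq[of x] by simp
      ultimately have "ennreal (exp ((\<bar>w x\<bar> / K) powr (1 / p)) - 1) \<le> ennreal (1 / K0 * (exp (Y x / 2) - 1))"
        by (simp add: ennreal_leI)
      also have "\<dots> = ennreal (1 / K0) * ennreal (exp (Y x / 2) - 1)"
        using K0 by (intro ennreal_mult) (auto simp: Y_def)
      finally show "ennreal (exp ((\<bar>w x\<bar> / K) powr (1 / p)) - 1) \<le> ennreal (1 / K0) * ennreal (exp (Y x / 2) - 1)" .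
    qed
    also have "\<dots> = ennreal (1 / K0) * (\<integral>\<^sup>+x. ennreal (exp (Y x / 2) - 1) \<partial>lborel)"
      by (rule nn_integral_cmult) measurable
    also have "\<dots> \<le> ennreal (1 / K0) * ennreal K0"
      by (intro mult_left_mono Y_int) simp
    also have "\<dots> = 1" using K0 by (simp add: ennreal_mult[symmetric])
    finally show ?thesis .
  qed
  show thesis
  proof (rule that[OF K])
    fix w :: "'a \<Rightarrow> real" and W L
    assume w: "C1_grad w W" and out: "\<And>y. norm y \<ge> 2 \<Longrightarrow> w y = 0" and L: "0 < L"
      and WL: "(\<integral>\<^sup>+y. ennreal (norm (W y) ^ DIM('a)) \<partial>lborel) \<le> ennreal (L ^ DIM('a))"
    have [measurable]: "W \<in> borel_measurable borel" using C1_grad_measurable[OF w] by auto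
    have "C1_grad (\<lambda>x. w x / L) (\<lambda>x. (1 / L) *\<^sub>R W x)"
      unfolding C1_grad_def
    proof (intro conjI allI)
      show "continuous_on UNIV (\<lambda>x. (1 / L) *\<^sub>R W x)"
        using C1_gradD(2)[OF w] by (intro continuous_intros)
      show "((\<lambda>x. w x / L) has_derivative (\<lambda>h. (1 / L) *\<^sub>R W x \<bullet> h)) (at x)" for x
        using has_derivative_mult_right[OF C1_gradD(1)[OF w, of x], of "1 / L"] by simp
    qed
    moreover have "(\<integral>\<^sup>+y. ennreal (norm ((1 / L) *\<^sub>R W y) ^ n) \<partial>lborel) \<le> 1"
    proof -
      have "(\<integral>\<^sup>+y. ennreal (norm ((1 / L) *\<^sub>R W y) ^ n) \<partial>lborel) = (\<integral>\<^sup>+y. ennreal ((1 / L) ^ n) * ennreal (norm (W y) ^ n) \<partial>lborel)"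
        using L by (simp add: ennreal_mult[symmetric] power_mult_distrib[symmetric])
      also have "\<dots> = ennreal ((1 / L) ^ n) * (\<integral>\<^sup>+y. ennreal (norm (W y) ^ n) \<partial>lborel)"
        by (rule nn_integral_cmult) measurable
      also have "\<dots> \<le> ennreal ((1 / L) ^ n) * ennreal (L ^ n)"
        using WL by (intro mult_left_mono) (auto simp: n_def)
      also have "\<dots> = 1" using L by (simp add: ennreal_mult[symmetric] power_mult_distrib[symmetric])
      finally show ?thesis .
    qed
    ultimately have "(\<integral>\<^sup>+x. ennreal (exp ((\<bar>w x / L\<bar> / K) powr (1 / p)) - 1) \<partial>lborel) \<le> 1"
      using out by (intro main) auto
    moreover have "\<bar>w x / L\<bar> / K = \<bar>w x\<bar> / (K * L)" for x using L K by (simp add: field_simps)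
    ultimately show "(\<integral>\<^sup>+x. ennreal (exp ((\<bar>w x\<bar> / (K * L)) powr (real DIM('a) / (real DIM('a) - 1))) - 1) \<partial>lborel) \<le> 1"
      by (simp only: p(2) n_def)
  qed
qed

section \<open>Mollifiers and smooth approximation\<close>

text \<open>Carrying the power of \<open>t\<close> in the denominator makes the family closed under
  differentiation up to linear combinations, see \<open>flat_exp_deriv\<close>.\<close>

definition flat_exp :: "nat \<Rightarrow> real \<Rightarrow> real" where
  "flat_exp k t = (if t > 0 then exp (- 1 / t) / t ^ k else 0)"

text \<open>The single term of order \<open>k + 2\<close> in the exponential series at
  \<open>1 / t\<close> suffices. The quadratic bound is what yields the derivative 0 at the
  origin.\<close>

lemma flat_exp_bound: "\<bar>flat_exp k t\<bar> \<le> fact (k + 2) * t\<^sup>2"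
proof (cases "t > 0")
  case True
  define F :: real where "F = fact (k + 2)"
  have F: "F > 0" by (simp add: F_def)
  have "(1 / t) ^ (k + 2) /\<^sub>R F \<le> (\<Sum>i. (1 / t) ^ i /\<^sub>R fact i)"
    using sum_le_suminf[OF summable_exp_generic[of "1 / t"], of "{k + 2}"] True by (simp add: F_def)
  then have "(1 / t) ^ (k + 2) / F \<le> exp (1 / t)"
    by (simp add: exp_def divide_inverse_commute)
  then have "exp (- 1 / t) \<le> F * t ^ (k + 2)"
    using True F by (simp add: exp_minus inverse_eq_divide field_simps power_divide del: power_Suc power_add)
  then show ?thesis using True unfolding F_def[symmetric]
    by (simp add: flat_exp_def divide_le_eq power_add power2_eq_square mult_ac)
qed (simp add: flat_exp_def)

lemma flat_exp_deriv:
  "(flat_exp k has_real_derivative (flat_exp (k + 2) t - real k * flat_exp (k + 1) t)) (at t)"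
proof (cases "t = 0")
  case True
  have "((\<lambda>h. (flat_exp k (0 + h) - flat_exp k 0) / h) \<longlongrightarrow> 0) (at 0)"
  proof (rule Lim_null_comparison)
    show "\<forall>\<^sub>F h in at 0. norm ((flat_exp k (0 + h) - flat_exp k 0) / h) \<le> fact (k + 2) * \<bar>h\<bar>"
    proof (rule always_eventually, rule allI)
      fix h :: real
      have "\<bar>flat_exp k h\<bar> / \<bar>h\<bar> \<le> fact (k + 2) * h\<^sup>2 / \<bar>h\<bar>"
        by (intro divide_right_mono flat_exp_bound) simp
      also have "\<dots> = fact (k + 2) * \<bar>h\<bar>" by (simp add: power2_eq_square abs_if)
      finally show "norm ((flat_exp k (0 + h) - flat_exp k 0) / h) \<le> fact (k + 2) * \<bar>h\<bar>"
        by (simp add: flat_exp_def[of k 0] abs_divide)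
    qed
    show "((\<lambda>h. fact (k + 2) * \<bar>h\<bar>) \<longlongrightarrow> (0::real)) (at 0)"
      by (auto intro!: tendsto_eq_intros)
  qed
  then show ?thesis using True by (simp add: DERIV_def flat_exp_def)
next
  case False
  show ?thesis
  proof (cases "t > 0")
    case True
    have "((\<lambda>s. exp (- 1 / s) / s ^ k) has_real_derivative
        (flat_exp (k + 2) t - real k * flat_exp (k + 1) t)) (at t)"
    proof (cases k)
      case 0
      then show ?thesis using True
        by (auto intro!: derivative_eq_intros simp: flat_exp_def field_simps power2_eq_square)
    next
      case (Suc m)
      have d1: "((\<lambda>s. exp (- 1 / s)) has_real_derivative exp (- 1 / t) * (1 / t\<^sup>2)) (at t)"
        using True by (auto intro!: derivative_eq_intros simp: power2_eq_square)
      have d2: "((\<lambda>s. s ^ k) has_real_derivative real k * t ^ m) (at t)"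
        using DERIV_pow[of k t] Suc by simp
      have "((\<lambda>s. exp (- 1 / s) / s ^ k) has_real_derivative
        (exp (- 1 / t) * (1 / t\<^sup>2) * t ^ k - exp (- 1 / t) * (real k * t ^ m)) / (t ^ k * t ^ k)) (at t)"
        by (rule DERIV_divide[OF d1 d2]) (use True in simp)
      moreover have "(exp (- 1 / t) * (1 / t\<^sup>2) * t ^ k - exp (- 1 / t) * (real k * t ^ m)) / (t ^ k * t ^ k)
        = flat_exp (k + 2) t - real k * flat_exp (k + 1) t"
        using True Suc by (simp add: flat_exp_def field_simps power2_eq_square)
      ultimately show ?thesis by simp
    qed
    then show ?thesis
      by (rule has_field_derivative_transform_within_open[where S="{0<..}"]) (use True in \<open>auto simp: flat_exp_def\<close>)
  next
    case F2: False
    with False have "t < 0" by simp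
    have "((\<lambda>s. 0) has_real_derivative (flat_exp (k + 2) t - real k * flat_exp (k + 1) t)) (at t)"
      using F2 by (simp add: flat_exp_def)
    then show ?thesis
      by (rule has_field_derivative_transform_within_open[where S="{..<0}"]) (use \<open>t < 0\<close> in \<open>auto simp: flat_exp_def\<close>)
  qed
qed

text \<open>A class of functions closed under partial differentiation that contains the bump function
  \<open>exp (-1 / (1 - c |x - x0|\<^sup>2))\<close>.\<close>
inductive_set bump_algebra :: "(real^'n::finite \<Rightarrow> real) set" where
  const: "(\<lambda>_. c) \<in> bump_algebra"
| coord: "(\<lambda>x. x $ i) \<in> bump_algebra"
| bump: "(\<lambda>x. flat_exp k (1 - c * ((x - x0) \<bullet> (x - x0)))) \<in> bump_algebra"
| add: "f \<in> bump_algebra \<Longrightarrow> g \<in> bump_algebra \<Longrightarrow> (\<lambda>x. f x + g x) \<in> bump_algebra"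
| mult: "f \<in> bump_algebra \<Longrightarrow> g \<in> bump_algebra \<Longrightarrow> (\<lambda>x. f x * g x) \<in> bump_algebra"

text \<open>Induction over the generators. The derivative of a bump is a combination of bumps times
  an affine function of the coordinates, which is the reason for having \<open>coord\<close> and
  \<open>const\<close> among the generators.\<close>

lemma bump_algebra_has_derivative:
  assumes "f \<in> bump_algebra"
  shows "\<exists>F. (\<forall>x. (f has_derivative F x) (at x)) \<and> (\<forall>i. (\<lambda>x. F x (axis i 1)) \<in> bump_algebra)"
  using assms
proof induction
  case (const c)
  show ?case
    by (rule exI[of _ "\<lambda>x h. 0"]) (auto intro!: bump_algebra.const derivative_eq_intros)
next
  case (coord i)
  show ?case
    by (rule exI[of _ "\<lambda>x h. h $ i"])
      (auto intro!: bump_algebra.const bounded_linear_imp_has_derivative bounded_linear_vec_nth)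
next
  case (bump k c x0)
  let ?s = "\<lambda>x. 1 - c * ((x - x0) \<bullet> (x - x0))"
  let ?F = "\<lambda>x h. (flat_exp (k + 2) (?s x) - real k * flat_exp (k + 1) (?s x)) * (- (c * (2 * ((x - x0) \<bullet> h))))"
  have "((\<lambda>x. flat_exp k (?s x)) has_derivative ?F x) (at x)" for x
  proof -
    have "(?s has_derivative (\<lambda>h. - (c * (2 * ((x - x0) \<bullet> h))))) (at x)"
      by (auto intro!: derivative_eq_intros simp: inner_commute)
    then show ?thesis
      by (rule has_derivative_compose)
         (use flat_exp_deriv[of k "?s x"] in \<open>simp add: has_field_derivative_def\<close>)
  qed
  moreover have "(\<lambda>x. ?F x (axis i 1)) \<in> bump_algebra" for i
  proof -
    have "(\<lambda>x. (flat_exp (k + 2) (?s x) + (- real k) * flat_exp (k + 1) (?s x)) *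
        ((-2 * c) * (x $ i + (- x0 $ i)))) \<in> bump_algebra"
      by (intro bump_algebra.intros)
    then show ?thesis
      by (simp add: inner_axis algebra_simps)
  qed
  ultimately show ?case by (intro exI[of _ ?F]) blast
next
  case (add f g)
  then obtain F G where "\<And>x. (f has_derivative F x) (at x)" "\<And>i. (\<lambda>x. F x (axis i 1)) \<in> bump_algebra"
    "\<And>x. (g has_derivative G x) (at x)" "\<And>i. (\<lambda>x. G x (axis i 1)) \<in> bump_algebra" by blast
  then show ?case
    by (intro exI[of _ "\<lambda>x h. F x h + G x h"]) (auto intro!: has_derivative_add bump_algebra.add)
next
  case (mult f g)
  then obtain F G where "\<And>x. (f has_derivative F x) (at x)" "\<And>i. (\<lambda>x. F x (axis i 1)) \<in> bump_algebra"
    "\<And>x. (g has_derivative G x) (at x)" "\<And>i. (\<lambda>x. G x (axis i 1)) \<in> bump_algebra" by blast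
  then show ?case using mult.hyps
    by (intro exI[of _ "\<lambda>x h. f x * G x h + F x h * g x"])
      (auto intro!: has_derivative_mult bump_algebra.add bump_algebra.mult)
qed

lemma bump_algebra_partial_deriv:
  assumes "f \<in> bump_algebra"
  shows "f differentiable (at x)" "partial_deriv i f \<in> bump_algebra"
proof -
  obtain F where F: "\<And>x. (f has_derivative F x) (at x)" "\<And>i. (\<lambda>x. F x (axis i 1)) \<in> bump_algebra"
    using bump_algebra_has_derivative[OF assms] by blast
  show "f differentiable (at x)" using F(1) by (auto simp: differentiable_def)
  have "partial_deriv i f = (\<lambda>x. F x (axis i 1))"
    using frechet_derivative_at[OF F(1)] by (auto simp: partial_deriv_def)
  with F(2) show "partial_deriv i f \<in> bump_algebra" by simp
qed

lemma bump_algebra_smooth: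
  assumes "f \<in> bump_algebra" shows "smooth f"
proof -
  have "foldr partial_deriv is f \<in> bump_algebra" for "is"
    by (induction "is") (auto intro: assms bump_algebra_partial_deriv)
  then show ?thesis unfolding smooth_def using bump_algebra_partial_deriv(1) by blast
qed

section \<open>Smooth functions, their gradients, and the standard mollifier\<close>

lemma smooth_partial_deriv: "smooth f \<Longrightarrow> smooth (partial_deriv i f)"
  unfolding smooth_def
proof (intro allI)
  fix "is" x
  assume "\<forall>is x. foldr partial_deriv is f differentiable at x"
  \<comment> \<open>\<open>foldr\<close> lets the last entry of the list act first, so
    differentiating \<open>f\<close> beforehand amounts to appending \<open>i\<close>.\<close>
  then have "foldr partial_deriv (is @ [i]) f differentiable at x" by blast
  then show "foldr partial_deriv is (partial_deriv i f) differentiable at x" by simp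
qed

lemma smooth_differentiable: "smooth f \<Longrightarrow> f differentiable (at x)"
  unfolding smooth_def using foldr.simps(1) by (metis id_apply)

lemma has_derivative_grad:
  fixes f :: "real^'n::finite \<Rightarrow> real"
  assumes "(f has_derivative F) (at x)"
  shows "F = (\<lambda>h. grad f x \<bullet> h)" "\<And>i. partial_deriv i f x = F (axis i 1)"
proof -
  have F: "frechet_derivative f (at x) = F" using frechet_derivative_at[OF assms] by simp
  then show "partial_deriv i f x = F (axis i 1)" for i by (simp add: partial_deriv_def)
  have lin: "linear F" using assms has_derivative_linear by blast
  show "F = (\<lambda>h. grad f x \<bullet> h)"
  proof
    fix h :: "real^'n"
    have "F h = F (\<Sum>i\<in>UNIV. h $ i *\<^sub>R axis i 1)"
      using basis_expansion[of h] by (simp add: scalar_mult_eq_scaleR)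
    also have "\<dots> = (\<Sum>i\<in>UNIV. h $ i * F (axis i 1))"
      by (simp add: linear_sum[OF lin] linear_cmul[OF lin])
    also have "\<dots> = grad f x \<bullet> h"
      by (simp add: inner_vec_def grad_def partial_deriv_def F mult.commute)
    finally show "F h = grad f x \<bullet> h" .
  qed
qed

lemma C1_grad_grad:
  fixes f :: "real^'n::finite \<Rightarrow> real"
  assumes "C1_grad f F"
  shows "grad f = F" "partial_deriv i f x = F x $ i"
proof -
  show "partial_deriv i f x = F x $ i"
    using has_derivative_grad(2)[OF C1_gradD(1)[OF assms], of i x] by (simp add: inner_axis)
  show "grad f = F"
    using has_derivative_grad(2)[OF C1_gradD(1)[OF assms]] by (auto simp: grad_def vec_eq_iff inner_axis)
qed

lemma smooth_C1_grad:
  fixes f :: "real^'n::finite \<Rightarrow> real"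
  assumes "smooth f" shows "C1_grad f (grad f)"
  unfolding C1_grad_def
proof (intro conjI allI)
  have "continuous_on UNIV (partial_deriv i f)" for i
    using smooth_differentiable[OF smooth_partial_deriv[OF assms]] differentiable_imp_continuous_within
    by (metis continuous_at_imp_continuous_on)
  then show "continuous_on UNIV (grad f)"
    unfolding grad_def[abs_def] by (intro continuous_on_vec_lambda)
  show "(f has_derivative (\<lambda>h. grad f x \<bullet> h)) (at x)" for x
    using smooth_differentiable[OF assms, of x] has_derivative_grad(1) unfolding differentiable_def by metis
qed

definition bump0 :: "real \<Rightarrow> real^'n::finite \<Rightarrow> real" where
  "bump0 e x = flat_exp 0 (1 - (1 / e\<^sup>2) * (x \<bullet> x))"

definition mollifier :: "real \<Rightarrow> real^'n::finite \<Rightarrow> real" where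
  "mollifier e x = inverse (\<integral>y. bump0 e (y :: real^'n) \<partial>lborel) * bump0 e x"

lemma bump0_algebra: "(\<lambda>y. bump0 e (y - x)) \<in> bump_algebra"
  unfolding bump0_def by (rule bump_algebra.bump)

lemma bump0_nonneg: "bump0 e x \<ge> 0" and bump0_le: "bump0 e x \<le> 1"
  by (auto simp: bump0_def flat_exp_def)

lemma bump0_pos_iff:
  assumes "e > 0" shows "bump0 e x > 0 \<longleftrightarrow> norm x < e"
proof -
  have "bump0 e x > 0 \<longleftrightarrow> x \<bullet> x < e\<^sup>2"
    using assms by (auto simp: bump0_def flat_exp_def field_simps)
  also have "\<dots> \<longleftrightarrow> (norm x)\<^sup>2 < e\<^sup>2" by (simp add: power2_norm_eq_inner)
  also have "\<dots> \<longleftrightarrow> norm x < e"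
    using assms power2_less_imp_less[of "norm x" e] power_strict_mono[of "norm x" e 2] by auto
  finally show ?thesis .
qed

lemma bump0_measurable [measurable]: "bump0 e \<in> borel_measurable borel"
proof -
  have "smooth (bump0 e :: real^'n \<Rightarrow> real)"
    using bump_algebra_smooth[OF bump0_algebra[of e 0]] by simp
  from C1_grad_measurable(1)[OF smooth_C1_grad[OF this]] show ?thesis .
qed

lemma bump0_integrable:
  assumes "e > 0" shows "integrable lborel (bump0 e :: real^'n::finite \<Rightarrow> real)"
proof (rule Bochner_Integration.integrable_bound)
  show "integrable lborel (indicator (cball 0 e) :: real^'n \<Rightarrow> real)"
    using emeasure_lborel_cball_finite[of "0 :: real^'n" e] by simp
  have "norm (bump0 e x) \<le> norm (indicator (cball 0 e) x :: real)" for x :: "real^'n"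
    using bump0_pos_iff[OF assms, of x] bump0_nonneg[of e x] bump0_le[of e x]
    by (cases "norm x < e") (auto simp: indicator_def)
  then show "AE x :: real^'n in lborel. norm (bump0 e x) \<le> norm (indicator (cball 0 e) x :: real)" by simp
qed simp

lemma bump0_integral_pos:
  assumes "e > 0" shows "(\<integral>y. bump0 e (y :: real^'n::finite) \<partial>lborel) > 0"
proof (rule ccontr)
  assume "\<not> ?thesis"
  moreover have "(\<integral>y. bump0 e (y :: real^'n) \<partial>lborel) \<ge> 0"
    by (intro integral_nonneg_AE) (simp add: bump0_nonneg)
  ultimately have "(\<integral>y. bump0 e (y :: real^'n) \<partial>lborel) = 0" by simp
  then have "AE x :: real^'n in lborel. bump0 e x = 0"
    by (subst (asm) integral_nonneg_eq_0_iff_AE[OF bump0_integrable[OF assms]]) (auto simp: bump0_nonneg)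
  then have "AE x :: real^'n in lborel. x \<notin> ball 0 e"
    by eventually_elim (metis bump0_pos_iff[OF assms] less_irrefl mem_ball_0)
  then have "emeasure lborel (ball 0 e :: (real^'n) set) = 0"
    by (subst (asm) AE_iff_null_sets[symmetric]) auto
  then show False using content_ball_pos[OF assms, of "0 :: real^'n"] by (simp add: measure_def)
qed

lemma mollifier_nonneg: "e > 0 \<Longrightarrow> mollifier e (x :: real^'n::finite) \<ge> 0"
  using bump0_integral_pos[where 'n='n, of e] by (simp add: mollifier_def bump0_nonneg less_imp_le)

lemma mollifier_zero: "e > 0 \<Longrightarrow> e \<le> norm x \<Longrightarrow> mollifier e x = 0"
  using bump0_pos_iff[of e x] bump0_nonneg[of e x] by (simp add: mollifier_def)

lemma mollifier_integrable: "e > 0 \<Longrightarrow> integrable lborel (mollifier e)"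
  unfolding mollifier_def by (intro integrable_mult_right bump0_integrable)

lemma mollifier_integral: "e > 0 \<Longrightarrow> (\<integral>y. mollifier e (y :: real^'n::finite) \<partial>lborel) = 1"
  unfolding mollifier_def using bump0_integral_pos[where 'n='n, of e] by simp

lemma mollifier_algebra: "(\<lambda>y. mollifier e (y - x)) \<in> bump_algebra"
  unfolding mollifier_def by (intro bump_algebra.mult bump_algebra.const bump0_algebra)

lemma mollifier_smooth: "smooth (mollifier e)"
  using bump_algebra_smooth[OF mollifier_algebra[of e 0]] by simp

lemma mollifier_minus: "mollifier e (- x) = mollifier e x"
  by (simp add: mollifier_def bump0_def)

lemma mollifier_smooth_translate: "smooth (\<lambda>y. mollifier e (x - y))"
proof -
  have "(\<lambda>y. mollifier e (x - y)) = (\<lambda>y. mollifier e (y - x))"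
    by (metis minus_diff_eq mollifier_minus)
  then show ?thesis using bump_algebra_smooth[OF mollifier_algebra] by metis
qed

lemma mollifier_measurable [measurable]: "mollifier e \<in> borel_measurable borel"
  unfolding mollifier_def by measurable

lemma lborel_integral_reflect:
  fixes f :: "'a::euclidean_space \<Rightarrow> 'b::{banach, second_countable_topology}"
  shows "integrable lborel (\<lambda>y. f (x - y)) \<longleftrightarrow> integrable lborel f"
    and "f \<in> borel_measurable borel \<Longrightarrow> (\<integral>y. f (x - y) \<partial>lborel) = (\<integral>y. f y \<partial>lborel)"
proof -
  have l: "lborel = distr lborel borel (\<lambda>y::'a. x - y)"
    using lborel_affine[of "- 1 :: real" x] by (simp add: density_1)
  show 2: "(\<integral>y. f (x - y) \<partial>lborel) = (\<integral>y. f y \<partial>lborel)" if "f \<in> borel_measurable borel" for f :: "'a \<Rightarrow> 'b"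
    by (subst (2) l, subst integral_distr) (use that in auto)
  have 3: "integrable lborel (\<lambda>y. f (x - y))" if "integrable lborel f" for f :: "'a \<Rightarrow> 'b"
  proof -
    have "f \<in> borel_measurable borel" using borel_measurable_integrable[OF that] by simp
    then show ?thesis using that by (subst (asm) l, subst (asm) integrable_distr_eq) auto
  qed
  show "integrable lborel (\<lambda>y. f (x - y)) \<longleftrightarrow> integrable lborel f"
    using 3[of f] 3[of "\<lambda>y. f (x - y)"] by auto
qed

lemma compact_support_bounded:
  fixes f :: "'a::euclidean_space \<Rightarrow> 'b::real_normed_vector"
  assumes "continuous_on UNIV f" "\<And>x. norm x > \<rho> \<Longrightarrow> f x = 0"
  obtains B where "B > 0" "\<And>x. norm (f x) \<le> B"
proof -
  have "compact (f ` cball 0 \<rho>)"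
    using assms(1) by (intro compact_continuous_image) (auto intro: continuous_on_subset)
  then obtain B where B: "B > 0" "\<And>x. x \<in> cball 0 \<rho> \<Longrightarrow> norm (f x) \<le> B"
    using bounded_pos[of "f ` cball 0 \<rho>"] compact_imp_bounded by auto
  have "norm (f x) \<le> B" for x
    using B(1) B(2)[of x] assms(2)[of x] by (cases "norm x > \<rho>") auto
  with B(1) show thesis by (rule that)
qed

text \<open>Heine-Cantor on the ball enlarged by 1: two points at distance less than 1 either both
  have norm above \<open>\<rho>\<close>, where \<open>f\<close> is 0, or both lie in that
  ball.\<close>

lemma compact_support_uniformly_continuous:
  fixes f :: "'a::euclidean_space \<Rightarrow> 'b::real_normed_vector"
  assumes f: "continuous_on UNIV f" "\<And>x. norm x > \<rho> \<Longrightarrow> f x = 0" and e: "e > 0"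
  obtains d where "d > 0" "\<And>x y. dist x y < d \<Longrightarrow> dist (f x) (f y) < e"
proof -
  have "uniformly_continuous_on (cball 0 (\<rho> + 1)) f"
    using f(1) by (intro compact_uniformly_continuous) (auto intro: continuous_on_subset)
  then obtain d where d: "d > 0"
    "\<And>x y. x \<in> cball 0 (\<rho> + 1) \<Longrightarrow> y \<in> cball 0 (\<rho> + 1) \<Longrightarrow> dist x y < d \<Longrightarrow> dist (f x) (f y) < e"
    using e unfolding uniformly_continuous_on_def by (metis dist_commute)
  have "dist (f x) (f y) < e" if xy: "dist x y < min d 1" for x y
  proof (cases "norm x > \<rho> \<and> norm y > \<rho>")
    case True
    then show ?thesis using f(2) e by simp
  next
    case False
    moreover have "norm x \<le> norm y + dist x y" "norm y \<le> norm x + dist x y"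
      using norm_triangle_ineq2[of x y] norm_triangle_ineq2[of y x] by (auto simp: dist_norm norm_minus_commute)
    ultimately have "x \<in> cball 0 (\<rho> + 1)" "y \<in> cball 0 (\<rho> + 1)" using xy by auto
    then show ?thesis using d(2) xy by simp
  qed
  then show thesis using d(1) that[of "min d 1"] by auto
qed

section \<open>Convolution with C1 and smooth kernels\<close>

lemma C1_grad_mvt:
  fixes w :: "'a::euclidean_space \<Rightarrow> real"
  assumes w: "C1_grad w W"
  obtains t where "0 \<le> t" "t \<le> 1" "w (a + h) - w a = W (a + t *\<^sub>R h) \<bullet> h"
proof -
  have "((\<lambda>s. w (a + s *\<^sub>R h)) has_real_derivative (W (a + s *\<^sub>R h) \<bullet> h)) (at s)" for s
  proof -
    have "((\<lambda>s. w (a + s *\<^sub>R h)) has_derivative (\<lambda>k. W (a + s *\<^sub>R h) \<bullet> (k *\<^sub>R h))) (at s)"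
      by (rule has_derivative_compose[OF _ C1_gradD(1)[OF w]]) (auto intro!: derivative_eq_intros)
    then show ?thesis by (simp add: has_field_derivative_def mult_commute_abs)
  qed
  then obtain t where "0 < t" "t < 1" "w (a + 1 *\<^sub>R h) - w (a + 0 *\<^sub>R h) = (1 - 0) * (W (a + t *\<^sub>R h) \<bullet> h)"
    using MVT2[of 0 1 "\<lambda>s. w (a + s *\<^sub>R h)" "\<lambda>s. W (a + s *\<^sub>R h) \<bullet> h"] by auto
  then show thesis using that[of t] by simp
qed

definition convol :: "('a::euclidean_space \<Rightarrow> real) \<Rightarrow> ('a \<Rightarrow> real) \<Rightarrow> 'a \<Rightarrow> real" where
  "convol \<kappa> v x = (\<integral>y. \<kappa> (x - y) * v y \<partial>lborel)"

text \<open>By commutativity the derivative may be put on either factor: on the mollifier for a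
  Sobolev function, on the test function itself in \<open>weak_equation_C1\<close>.\<close>

lemma convol_commute:
  assumes [measurable]: "\<kappa> \<in> borel_measurable borel" "v \<in> borel_measurable borel"
  shows "convol \<kappa> v x = convol v \<kappa> x"
  unfolding convol_def
  by (subst lborel_integral_reflect(2)[where x=x, symmetric]) (auto simp: mult.commute)

lemma compact_support_integrable_scaleR:
  fixes K :: "'a::euclidean_space \<Rightarrow> 'b::euclidean_space"
  assumes K: "continuous_on UNIV K" "\<And>x. norm x > \<rho> \<Longrightarrow> K x = 0" and v: "integrable lborel v"
  shows "integrable lborel (\<lambda>y. v y *\<^sub>R K (x - y))"
proof -
  obtain B where B: "B > 0" "\<And>x. norm (K x) \<le> B" by (rule compact_support_bounded[OF K]) auto
  have [measurable]: "K \<in> borel_measurable borel" "v \<in> borel_measurable borel"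
    using K(1) borel_measurable_integrable[OF v] by (auto intro: borel_measurable_continuous_onI)
  show ?thesis
  proof (rule Bochner_Integration.integrable_bound)
    show "integrable lborel (\<lambda>y. B * v y)" using v by simp
    show "AE y in lborel. norm (v y *\<^sub>R K (x - y)) \<le> norm (B * v y)"
    proof (rule AE_I2)
      show "norm (v y *\<^sub>R K (x - y)) \<le> norm (B * v y)" for y
        using mult_left_mono[OF B(2)[of "x - y"] abs_ge_zero[of "v y"]] B(1) by (simp add: abs_mult mult.commute)
    qed
  qed measurable
qed

text \<open>Differentiation under the integral sign by hand: \<open>v\<close> is merely integrable,
  but \<open>K\<close> is uniformly continuous, so by the mean value theorem the Taylor error of
  \<open>\<kappa> (x - y)\<close> is small uniformly in \<open>y\<close>.\<close>

lemma convol_C1_grad: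
  fixes \<kappa> :: "'a::euclidean_space \<Rightarrow> real"
  assumes \<kappa>: "C1_grad \<kappa> K" and supp: "\<And>x. norm x > \<rho> \<Longrightarrow> \<kappa> x = 0" and v: "integrable lborel v"
  shows "C1_grad (convol \<kappa> v) (\<lambda>x. \<integral>y. v y *\<^sub>R K (x - y) \<partial>lborel)"
proof -
  have Ksupp: "K x = 0" if "norm x > \<rho>" for x
    by (rule C1_grad_zero_outside[OF \<kappa>, where S="- cball 0 \<rho>"]) (use that supp in auto)
  note Kc = C1_gradD(2)[OF \<kappa>]
  have int_K: "integrable lborel (\<lambda>y. v y *\<^sub>R K (x - y))" for x
    by (rule compact_support_integrable_scaleR[OF Kc Ksupp v])
  have int_\<kappa>: "integrable lborel (\<lambda>y. \<kappa> (x - y) * v y)" for x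
    using compact_support_integrable_scaleR[OF C1_grad_continuous[OF \<kappa>] supp v, where x=x] by (simp add: mult.commute)
  \<comment> \<open>The modulus of continuity is taken at the level \<open>e / (V + 1)\<close>; the
    1 guards against \<open>V = 0\<close>.\<close>
  define V where "V = (\<integral>y. \<bar>v y\<bar> \<partial>lborel)"
  have V: "V \<ge> 0" by (simp add: V_def)
  have modulus: "\<exists>d>0. \<forall>x y. dist x y < d \<longrightarrow> dist (K x) (K y) < e / (V + 1)" if "e > 0" for e
  proof -
    have "e / (V + 1) > 0" using V that by auto
    from compact_support_uniformly_continuous[OF Kc Ksupp this] show ?thesis by metis
  qed
  show ?thesis
    unfolding C1_grad_def
  proof (intro conjI allI)
    show "continuous_on UNIV (\<lambda>x. \<integral>y. v y *\<^sub>R K (x - y) \<partial>lborel)"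
      unfolding continuous_on_iff
    proof (intro ballI allI impI)
      fix x :: 'a and e :: real assume "e > 0"
      from modulus[OF this] obtain d where d: "d > 0" "\<And>x y. dist x y < d \<Longrightarrow> dist (K x) (K y) < e / (V + 1)" by blast
      show "\<exists>d>0. \<forall>x'\<in>UNIV. dist x' x < d \<longrightarrow>
          dist (\<integral>y. v y *\<^sub>R K (x' - y) \<partial>lborel) (\<integral>y. v y *\<^sub>R K (x - y) \<partial>lborel) < e"
      proof (intro exI[of _ d] conjI ballI impI d(1))
        fix x' assume x': "dist x' x < d"
        have "norm (\<integral>y. v y *\<^sub>R K (x' - y) - v y *\<^sub>R K (x - y) \<partial>lborel) \<le> (\<integral>y. e / (V + 1) * \<bar>v y\<bar> \<partial>lborel)"
        proof (rule Bochner_Integration.integral_norm_bound_integral)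
          fix y
          have "norm (v y *\<^sub>R K (x' - y) - v y *\<^sub>R K (x - y)) = \<bar>v y\<bar> * dist (K (x' - y)) (K (x - y))"
            by (simp add: scaleR_diff_right[symmetric] dist_norm)
          also have "\<dots> \<le> \<bar>v y\<bar> * (e / (V + 1))"
          proof (rule mult_left_mono)
            have "dist (x' - y) (x - y) < d" using x' by (simp add: dist_norm)
            then show "dist (K (x' - y)) (K (x - y)) \<le> e / (V + 1)" by (rule less_imp_le[OF d(2)])
          qed simp
          finally show "norm (v y *\<^sub>R K (x' - y) - v y *\<^sub>R K (x - y)) \<le> e / (V + 1) * \<bar>v y\<bar>" by (simp add: mult.commute)
        qed (use int_K v in auto)
        also have "\<dots> = e * (V / (V + 1))" by (simp add: V_def)
        also have "\<dots> < e" using \<open>e > 0\<close> V by (simp add: field_simps)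
        finally show "dist (\<integral>y. v y *\<^sub>R K (x' - y) \<partial>lborel) (\<integral>y. v y *\<^sub>R K (x - y) \<partial>lborel) < e"
          using int_K by (simp add: dist_norm)
      qed
    qed
    fix x
    show "(convol \<kappa> v has_derivative (\<lambda>h. (\<integral>y. v y *\<^sub>R K (x - y) \<partial>lborel) \<bullet> h)) (at x)"
      unfolding has_derivative_at_alt
    proof (intro conjI allI impI)
      show "bounded_linear (\<lambda>h. (\<integral>y. v y *\<^sub>R K (x - y) \<partial>lborel) \<bullet> h)" by (rule bounded_linear_inner_right)
      fix e :: real assume "e > 0"
      from modulus[OF this] obtain d where d: "d > 0" "\<And>x y. dist x y < d \<Longrightarrow> dist (K x) (K y) < e / (V + 1)" by blast
      show "\<exists>d>0. \<forall>z. norm (z - x) < d \<longrightarrow>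
          norm (convol \<kappa> v z - convol \<kappa> v x - (\<integral>y. v y *\<^sub>R K (x - y) \<partial>lborel) \<bullet> (z - x)) \<le> e * norm (z - x)"
      proof (intro exI[of _ d] conjI allI impI d(1))
        fix z assume z: "norm (z - x) < d"
        let ?h = "z - x"
        have "convol \<kappa> v z - convol \<kappa> v x - (\<integral>y. v y *\<^sub>R K (x - y) \<partial>lborel) \<bullet> ?h
          = (\<integral>y. \<kappa> (z - y) * v y - \<kappa> (x - y) * v y - (v y *\<^sub>R K (x - y)) \<bullet> ?h \<partial>lborel)"
        proof -
          have 1: "integrable lborel (\<lambda>y. (v y *\<^sub>R K (x - y)) \<bullet> ?h)" by (rule integrable_inner_left[OF int_K])
          have 2: "(\<integral>y. (v y *\<^sub>R K (x - y)) \<bullet> ?h \<partial>lborel) = (\<integral>y. v y *\<^sub>R K (x - y) \<partial>lborel) \<bullet> ?h"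
            by (rule integral_inner_left[OF int_K])
          show ?thesis
            by (simp only: convol_def 2 Bochner_Integration.integral_diff[OF Bochner_Integration.integrable_diff[OF int_\<kappa> int_\<kappa>] 1]
                Bochner_Integration.integral_diff[OF int_\<kappa> int_\<kappa>])
        qed
        also have "norm \<dots> \<le> (\<integral>y. e / (V + 1) * norm ?h * \<bar>v y\<bar> \<partial>lborel)"
        proof (rule Bochner_Integration.integral_norm_bound_integral)
          fix y
          obtain t where t: "0 \<le> t" "t \<le> 1" "\<kappa> ((x - y) + ?h) - \<kappa> (x - y) = K ((x - y) + t *\<^sub>R ?h) \<bullet> ?h"
            by (rule C1_grad_mvt[OF \<kappa>])
          have "(x - y) + ?h = z - y" by simp
          with t(3) have "\<kappa> (z - y) - \<kappa> (x - y) = K ((x - y) + t *\<^sub>R ?h) \<bullet> ?h" by simp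
          then have tay: "\<kappa> (z - y) - \<kappa> (x - y) - K (x - y) \<bullet> ?h = (K ((x - y) + t *\<^sub>R ?h) - K (x - y)) \<bullet> ?h"
            by (simp only: inner_diff_left)
          have "\<kappa> (z - y) * v y - \<kappa> (x - y) * v y - (v y *\<^sub>R K (x - y)) \<bullet> ?h
            = v y * (\<kappa> (z - y) - \<kappa> (x - y) - K (x - y) \<bullet> ?h)"
            by (simp add: right_diff_distrib mult.commute)
          also have "\<dots> = v y * ((K ((x - y) + t *\<^sub>R ?h) - K (x - y)) \<bullet> ?h)" unfolding tay ..
          also have "norm \<dots> \<le> \<bar>v y\<bar> * (e / (V + 1) * norm ?h)"
          proof -
            have "t * norm ?h \<le> 1 * norm ?h" using t by (intro mult_right_mono) auto
            then have "dist ((x - y) + t *\<^sub>R ?h) (x - y) < d" using t z by (simp add: dist_norm)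
            then have "norm (K ((x - y) + t *\<^sub>R ?h) - K (x - y)) \<le> e / (V + 1)"
              using d(2) by (metis dist_norm less_imp_le)
            then have "\<bar>(K ((x - y) + t *\<^sub>R ?h) - K (x - y)) \<bullet> ?h\<bar> \<le> e / (V + 1) * norm ?h"
              by (meson Cauchy_Schwarz_ineq2 mult_right_mono norm_ge_zero order_trans)
            from mult_left_mono[OF this abs_ge_zero[of "v y"]] show ?thesis by (simp add: abs_mult)
          qed
          finally show "norm (\<kappa> (z - y) * v y - \<kappa> (x - y) * v y - (v y *\<^sub>R K (x - y)) \<bullet> ?h) \<le> e / (V + 1) * norm ?h * \<bar>v y\<bar>"
            by (simp add: mult_ac)
        qed (intro Bochner_Integration.integrable_diff int_\<kappa> integrable_inner_left int_K, use v in simp)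
        also have "\<dots> = e * norm ?h * (V / (V + 1))" by (simp add: V_def)
        also have "\<dots> \<le> e * norm ?h * 1" using \<open>e > 0\<close> V by (intro mult_left_mono) auto
        finally show "norm (convol \<kappa> v z - convol \<kappa> v x - (\<integral>y. v y *\<^sub>R K (x - y) \<partial>lborel) \<bullet> ?h) \<le> e * norm ?h" by simp
      qed
    qed
  qed
qed

text \<open>Partial derivatives fall on the kernel, and a partial derivative of the kernel is again
  smooth and vanishes outside the same ball; this is iterated along the list of indices.\<close>

lemma convol_smooth:
  fixes \<kappa> :: "real^'n::finite \<Rightarrow> real"
  assumes \<kappa>: "smooth \<kappa>" and supp: "\<And>x. norm x > \<rho> \<Longrightarrow> \<kappa> x = 0" and v: "integrable lborel v"
  shows "smooth (convol \<kappa> v)"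
proof -
  have partial: "partial_deriv i (convol \<eta> v) = convol (partial_deriv i \<eta>) v \<and> smooth (partial_deriv i \<eta>) \<and>
      (\<forall>x. norm x > \<rho> \<longrightarrow> partial_deriv i \<eta> x = 0) \<and> (\<forall>x. convol \<eta> v differentiable at x)"
    if \<eta>: "smooth \<eta>" and s: "\<And>x. norm x > \<rho> \<Longrightarrow> \<eta> x = 0" for \<eta> :: "real^'n \<Rightarrow> real" and i
  proof (intro conjI allI impI)
    note C = smooth_C1_grad[OF \<eta>]
    have g0: "grad \<eta> x = 0" if "norm x > \<rho>" for x
      by (rule C1_grad_zero_outside[OF C, where S="- cball 0 \<rho>"]) (use that s in auto)
    note D = convol_C1_grad[OF C s v]
    show "partial_deriv i (convol \<eta> v) = convol (partial_deriv i \<eta>) v"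
    proof
      fix x
      have "partial_deriv i (convol \<eta> v) x = (\<integral>y. v y *\<^sub>R grad \<eta> (x - y) \<partial>lborel) $ i"
        by (rule C1_grad_grad(2)[OF D])
      also have "\<dots> = (\<integral>y. (v y *\<^sub>R grad \<eta> (x - y)) $ i \<partial>lborel)"
        by (rule integral_bounded_linear[OF bounded_linear_vec_nth, symmetric])
           (rule compact_support_integrable_scaleR[OF C1_gradD(2)[OF C] g0 v])
      also have "\<dots> = convol (partial_deriv i \<eta>) v x"
        by (simp add: convol_def grad_def mult.commute)
      finally show "partial_deriv i (convol \<eta> v) x = convol (partial_deriv i \<eta>) v x" .
    qed
    show "smooth (partial_deriv i \<eta>)" by (rule smooth_partial_deriv[OF \<eta>])
    show "partial_deriv i \<eta> x = 0" if "norm x > \<rho>" for x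
      using g0[OF that] by (simp add: grad_def vec_eq_iff)
    show "convol \<eta> v differentiable at x" for x
      using C1_gradD(1)[OF D] by (auto simp: differentiable_def)
  qed
  have iter: "foldr partial_deriv is (convol \<kappa> v) = convol (foldr partial_deriv is \<kappa>) v \<and> smooth (foldr partial_deriv is \<kappa>) \<and>
      (\<forall>x. norm x > \<rho> \<longrightarrow> foldr partial_deriv is \<kappa> x = 0)" for "is"
    by (induction "is") (use \<kappa> supp partial in auto)
  show ?thesis
    unfolding smooth_def
  proof (intro allI)
    fix "is" x
    show "foldr partial_deriv is (convol \<kappa> v) differentiable at x"
      using partial[of "foldr partial_deriv is \<kappa>"] iter[of "is"] by metis
  qed
qed

text \<open>The graph of a power lies above its tangent at \<open>M\<close>: the pointwise fact
  behind Jensen's inequality for integer exponents.\<close>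

lemma power_tangent_bound:
  fixes x M :: real
  assumes "x \<ge> 0" "M \<ge> 0"
  shows "M ^ Suc m + real (Suc m) * M ^ m * (x - M) \<le> x ^ Suc m"
proof (induction m)
  case (Suc m)
  have "x * (x - M) \<ge> M * (x - M)"
    using zero_le_square[of "x - M"] by (simp add: algebra_simps)
  then have "real (Suc m) * M ^ m * (M * (x - M)) \<le> real (Suc m) * M ^ m * (x * (x - M))"
    using assms by (intro mult_left_mono) auto
  moreover have "x * (M ^ Suc m + real (Suc m) * M ^ m * (x - M)) \<le> x * x ^ Suc m"
    using Suc assms by (intro mult_left_mono) auto
  ultimately show ?case by (simp add: algebra_simps)
qed simp

lemma mollifier_continuous: "continuous_on UNIV (mollifier e)"
  by (rule C1_grad_continuous[OF smooth_C1_grad[OF mollifier_smooth]])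

lemma mollify_integrable:
  assumes e: "e > 0" and f: "integrable lborel f"
  shows "integrable lborel (\<lambda>y. mollifier e (x - y) * f y)"
  using compact_support_integrable_scaleR[OF mollifier_continuous _ f, of e e x] e
  by (simp add: mollifier_zero mult.commute)

lemma mollifier_translate:
  assumes e: "e > 0"
  shows "integrable lborel (\<lambda>y. mollifier e (x - y))" "(\<integral>y. mollifier e (x - y) \<partial>lborel) = 1"
  using mollifier_integrable[OF e] mollifier_integral[OF e]
  by (auto simp: lborel_integral_reflect)

text \<open>Jensen's inequality for the probability density \<open>mollifier e (x - y)\<close> in
  \<open>y\<close>, obtained by integrating the tangent line of the power at the mean
  \<open>M\<close> of \<open>\<bar>f\<bar>\<close>.\<close>

lemma mollify_power_le:
  fixes f :: "real^'n::finite \<Rightarrow> real"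
  assumes e: "e > 0" and f: "integrable lborel f" "integrable lborel (\<lambda>x. \<bar>f x\<bar> ^ p)" and p: "p \<ge> 1"
  shows "\<bar>convol (mollifier e) f x\<bar> ^ p \<le> convol (mollifier e) (\<lambda>y. \<bar>f y\<bar> ^ p) x"
proof -
  define M where "M = convol (mollifier e) (\<lambda>y. \<bar>f y\<bar>) x"
  note int1 = mollify_integrable[OF e f(1), of x]
  have int2: "integrable lborel (\<lambda>y. mollifier e (x - y) * \<bar>f y\<bar>)"
    using mollify_integrable[OF e, of "\<lambda>y. \<bar>f y\<bar>" x] f(1) by simp
  note intp = mollify_integrable[OF e f(2), of x]
  note tr = mollifier_translate[OF e, of x]
  have M: "M \<ge> 0" unfolding M_def convol_def by (intro integral_nonneg_AE) (simp add: mollifier_nonneg[OF e])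
  have "\<bar>convol (mollifier e) f x\<bar> \<le> M"
    unfolding M_def convol_def
    by (rule order_trans[OF integral_abs_bound]) (simp add: abs_mult mollifier_nonneg[OF e])
  then have "\<bar>convol (mollifier e) f x\<bar> ^ p \<le> M ^ p" by (intro power_mono) auto
  also have "\<dots> \<le> convol (mollifier e) (\<lambda>y. \<bar>f y\<bar> ^ p) x"
  proof -
    obtain m where m: "p = Suc m" using p by (cases p) auto
    let ?c = "real (Suc m) * M ^ m"
    have i: "integrable lborel (\<lambda>y. (M ^ p - ?c * M) * mollifier e (x - y) + ?c * (mollifier e (x - y) * \<bar>f y\<bar>))"
      by (intro Bochner_Integration.integrable_add integrable_mult_right tr int2)
    have "M ^ p = (M ^ p - ?c * M) * 1 + ?c * M" by simp
    also have "\<dots> = (\<integral>y. (M ^ p - ?c * M) * mollifier e (x - y) + ?c * (mollifier e (x - y) * \<bar>f y\<bar>) \<partial>lborel)"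
      using tr int2 by (simp add: M_def convol_def)
    also have "\<dots> \<le> (\<integral>y. mollifier e (x - y) * \<bar>f y\<bar> ^ p \<partial>lborel)"
    proof (rule integral_mono[OF i intp])
      fix y
      have "mollifier e (x - y) * (M ^ Suc m + real (Suc m) * M ^ m * (\<bar>f y\<bar> - M)) \<le> mollifier e (x - y) * \<bar>f y\<bar> ^ Suc m"
        by (intro mult_left_mono power_tangent_bound M) (auto simp: mollifier_nonneg[OF e])
      then show "(M ^ p - ?c * M) * mollifier e (x - y) + ?c * (mollifier e (x - y) * \<bar>f y\<bar>) \<le> mollifier e (x - y) * \<bar>f y\<bar> ^ p"
        unfolding m by (simp add: algebra_simps)
    qed
    finally show ?thesis by (simp add: convol_def)
  qed
  finally show ?thesis .
qed

lemma convol_measurable [measurable]: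
  fixes \<kappa> :: "'a::euclidean_space \<Rightarrow> real"
  assumes [measurable]: "\<kappa> \<in> borel_measurable borel" "v \<in> borel_measurable borel"
  shows "convol \<kappa> v \<in> borel_measurable borel"
proof -
  have "(\<lambda>x. \<integral>y. \<kappa> (x - y) * v y \<partial>lborel) \<in> borel_measurable (borel :: 'a measure)"
    by (rule lborel.borel_measurable_lebesgue_integral) measurable
  then show ?thesis unfolding convol_def[abs_def] .
qed

text \<open>The pointwise Jensen bound is integrated with Tonelli; the mollifier has mass 1 in the
  other variable as well.\<close>

lemma mollify_Lp_le:
  fixes f :: "real^'n::finite \<Rightarrow> real"
  assumes e: "e > 0" and f: "integrable lborel f" "integrable lborel (\<lambda>x. \<bar>f x\<bar> ^ p)" and p: "p \<ge> 1"
  shows "(\<integral>\<^sup>+x. ennreal (\<bar>convol (mollifier e) f x\<bar> ^ p) \<partial>lborel) \<le> (\<integral>\<^sup>+x. ennreal (\<bar>f x\<bar> ^ p) \<partial>lborel)"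
proof -
  have [measurable]: "f \<in> borel_measurable borel" using borel_measurable_integrable[OF f(1)] by simp
  have "(\<integral>\<^sup>+x. ennreal (\<bar>convol (mollifier e) f x\<bar> ^ p) \<partial>lborel)
    \<le> (\<integral>\<^sup>+x. \<integral>\<^sup>+y. ennreal (mollifier e (x - y) * \<bar>f y\<bar> ^ p) \<partial>lborel \<partial>lborel)"
  proof (rule nn_integral_mono)
    fix x
    have "ennreal (\<bar>convol (mollifier e) f x\<bar> ^ p) \<le> ennreal (\<integral>y. mollifier e (x - y) * \<bar>f y\<bar> ^ p \<partial>lborel)"
      using mollify_power_le[OF e f p, of x] by (intro ennreal_leI) (simp add: convol_def)
    also have "\<dots> = (\<integral>\<^sup>+y. ennreal (mollifier e (x - y) * \<bar>f y\<bar> ^ p) \<partial>lborel)"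
      by (rule nn_integral_eq_integral[symmetric, OF mollify_integrable[OF e f(2)]]) (simp add: mollifier_nonneg[OF e])
    finally show "ennreal (\<bar>convol (mollifier e) f x\<bar> ^ p) \<le> (\<integral>\<^sup>+y. ennreal (mollifier e (x - y) * \<bar>f y\<bar> ^ p) \<partial>lborel)" .
  qed
  also have "\<dots> = (\<integral>\<^sup>+y. \<integral>\<^sup>+x. ennreal (mollifier e (x - y) * \<bar>f y\<bar> ^ p) \<partial>lborel \<partial>lborel)"
    by (rule lborel_pair.Fubini') measurable
  also have "\<dots> = (\<integral>\<^sup>+y. ennreal (\<bar>f y\<bar> ^ p) \<partial>lborel)"
  proof (rule nn_integral_cong)
    fix y :: "real^'n"
    have "(\<integral>\<^sup>+x. ennreal (mollifier e (x - y)) \<partial>lborel) = (\<integral>\<^sup>+(x :: real^'n). ennreal (mollifier e x) \<partial>lborel)"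
      using nn_integral_lborel_translate[of "\<lambda>x. ennreal (mollifier e x)" "- y"] by simp
    also have "\<dots> = ennreal 1"
      unfolding mollifier_integral[OF e, symmetric, where 'n='n]
      by (rule nn_integral_eq_integral[OF mollifier_integrable[OF e]]) (simp add: mollifier_nonneg[OF e])
    finally show "(\<integral>\<^sup>+x. ennreal (mollifier e (x - y) * \<bar>f y\<bar> ^ p) \<partial>lborel) = ennreal (\<bar>f y\<bar> ^ p)"
      by (simp add: ennreal_mult mollifier_nonneg[OF e] nn_integral_multc)
  qed
  finally show ?thesis .
qed

section \<open>Approximation in the p-th mean by continuous functions and by mollification\<close>

lemma power_abs_add_le:
  fixes a b :: real
  shows "\<bar>a + b\<bar> ^ p \<le> 2 ^ p * (\<bar>a\<bar> ^ p + \<bar>b\<bar> ^ p)"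
proof -
  have "\<bar>a + b\<bar> \<le> 2 * max \<bar>a\<bar> \<bar>b\<bar>" by linarith
  then have "\<bar>a + b\<bar> ^ p \<le> (2 * max \<bar>a\<bar> \<bar>b\<bar>) ^ p" by (intro power_mono) auto
  also have "\<dots> = 2 ^ p * (max \<bar>a\<bar> \<bar>b\<bar>) ^ p" by (simp add: power_mult_distrib)
  also have "\<dots> \<le> 2 ^ p * (\<bar>a\<bar> ^ p + \<bar>b\<bar> ^ p)"
    by (intro mult_left_mono) (auto simp: max_def)
  finally show ?thesis .
qed

text \<open>Measurability supplies continuous functions converging almost everywhere. Clipping them
  at the levels \<open>- B\<close> and \<open>B\<close> and multiplying by a cut-off that is 1 on
  the support ball does not change the limit and provides the majorant for dominated
  convergence.\<close>

lemma Lp_approx_continuous_bounded: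
  fixes f :: "'a::euclidean_space \<Rightarrow> real"
  assumes f[measurable]: "f \<in> borel_measurable borel" and B: "\<And>x. \<bar>f x\<bar> \<le> B"
    and supp: "\<And>x. norm x > \<rho> \<Longrightarrow> f x = 0" and p: "p \<ge> 1" and e: "e > 0"
  obtains g where "continuous_on UNIV g" "\<And>x. norm x > \<rho> + 1 \<Longrightarrow> g x = 0"
    "(\<integral>\<^sup>+x. ennreal (\<bar>f x - g x\<bar> ^ p) \<partial>lborel) < ennreal e"
proof -
  have B0: "B \<ge> 0" using B[of 0] by linarith
  have "f \<in> borel_measurable lebesgue" using f by (simp add: measurable_completion)
  then have "f measurable_on UNIV"
    by (rule lebesgue_measurable_imp_measurable_on_real) simp
  then obtain N g where N: "negligible N" and g: "\<And>k. continuous_on UNIV (g k)"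
      "\<And>x. x \<notin> N \<Longrightarrow> (\<lambda>k. g k x) \<longlonglongrightarrow> f x"
    unfolding measurable_on_def by auto
  define h where "h k x = max 0 (min 1 (\<rho> + 1 - norm x)) * max (- B) (min B (g k x))" for k :: nat and x
  have hc: "continuous_on UNIV (h k)" for k
    unfolding h_def[abs_def] by (intro continuous_intros g)
  then have [measurable]: "h k \<in> borel_measurable borel" for k by (rule borel_measurable_continuous_onI)
  have hs: "h k x = 0" if "norm x > \<rho> + 1" for k x using that by (simp add: h_def)
  have lim: "(\<lambda>k. h k x) \<longlonglongrightarrow> f x" if "x \<notin> N" for x
  proof -
    have "(\<lambda>k. h k x) \<longlonglongrightarrow> max 0 (min 1 (\<rho> + 1 - norm x)) * max (- B) (min B (f x))"
      unfolding h_def by (intro tendsto_intros g(2)[OF that])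
    also have "max 0 (min 1 (\<rho> + 1 - norm x)) * max (- B) (min B (f x)) = f x"
      using supp[of x] B[of x] by (cases "norm x > \<rho>") auto
    finally show ?thesis .
  qed
  have "AE x in lborel. x \<notin> N"
  proof -
    have "AE x in lebesgue. x \<notin> N" using N negligible_iff_null_sets AE_not_in by blast
    then show ?thesis by (simp add: AE_completion_iff)
  qed
  then have ae: "AE x in lborel. (\<lambda>k. \<bar>f x - h k x\<bar> ^ p) \<longlonglongrightarrow> 0"
  proof eventually_elim
    case (elim x)
    have "(\<lambda>k. \<bar>f x - h k x\<bar> ^ p) \<longlonglongrightarrow> \<bar>f x - f x\<bar> ^ p" by (intro tendsto_intros lim elim)
    then show ?case using p by (simp add: zero_power)
  qed
  have hB: "\<bar>h k x\<bar> \<le> B" for k x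
  proof -
    have "\<bar>h k x\<bar> \<le> 1 * B" unfolding h_def abs_mult using B0 by (intro mult_mono) auto
    then show ?thesis by simp
  qed
  have bd: "\<bar>f x - h k x\<bar> ^ p \<le> (2 * B) ^ p * indicator (cball 0 (\<rho> + 1)) x" for k x
  proof (cases "norm x > \<rho> + 1")
    case True then show ?thesis using supp[of x] hs[of x k] p by (simp add: zero_power)
  next
    case False
    have "\<bar>f x - h k x\<bar> \<le> 2 * B" using B[of x] hB[of k x] by linarith
    from power_mono[OF this abs_ge_zero, of p] show ?thesis using False by simp
  qed
  have "(\<lambda>k. \<integral>\<^sup>+x. ennreal (\<bar>f x - h k x\<bar> ^ p) \<partial>lborel) \<longlonglongrightarrow> (\<integral>\<^sup>+(x::'a). 0 \<partial>lborel)"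
  proof (rule nn_integral_dominated_convergence[where w="\<lambda>x. ennreal ((2 * B) ^ p * indicator (cball 0 (\<rho> + 1)) x)"])
    show "(\<integral>\<^sup>+(x::'a). ennreal ((2 * B) ^ p * indicator (cball 0 (\<rho> + 1)) x) \<partial>lborel) < \<infinity>"
    proof -
      have "integrable lborel (\<lambda>x::'a. (2 * B) ^ p * indicator (cball 0 (\<rho> + 1)) x)"
        using emeasure_lborel_cball_finite[of "0::'a" "\<rho> + 1"] by simp
      from nn_integral_eq_integral[OF this] B0 show ?thesis by simp
    qed
    show "AE x in lborel. (\<lambda>k. ennreal (\<bar>f x - h k x\<bar> ^ p)) \<longlonglongrightarrow> 0"
      using ae by eventually_elim (metis ennreal_0 tendsto_ennrealI)
    show "(\<lambda>x::'a. ennreal ((2 * B) ^ p * indicator (cball 0 (\<rho> + 1)) x)) \<in> borel_measurable lborel"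
      by (intro measurable_compose[OF _ measurable_ennreal] borel_measurable_times borel_measurable_const
          borel_measurable_indicator) simp
    show "AE x in lborel. ennreal (\<bar>f x - h k x\<bar> ^ p) \<le> ennreal ((2 * B) ^ p * indicator (cball 0 (\<rho> + 1)) x)" for k
      by (intro AE_I2 ennreal_leI bd)
  qed measurable
  then have "eventually (\<lambda>k. (\<integral>\<^sup>+x. ennreal (\<bar>f x - h k x\<bar> ^ p) \<partial>lborel) < ennreal e) sequentially"
    using e by (intro order_tendstoD(2)) auto
  then obtain k where "(\<integral>\<^sup>+x. ennreal (\<bar>f x - h k x\<bar> ^ p) \<partial>lborel) < ennreal e"
    using eventually_happens'[of sequentially] by auto
  with hc hs show thesis by (rule that)
qed

lemma nn_integral_power_add_le:
  fixes f g :: "'a \<Rightarrow> real"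
  assumes [measurable]: "f \<in> borel_measurable M" "g \<in> borel_measurable M"
  shows "(\<integral>\<^sup>+x. ennreal (\<bar>f x + g x\<bar> ^ p) \<partial>M)
    \<le> ennreal (2 ^ p) * ((\<integral>\<^sup>+x. ennreal (\<bar>f x\<bar> ^ p) \<partial>M) + (\<integral>\<^sup>+x. ennreal (\<bar>g x\<bar> ^ p) \<partial>M))"
proof -
  have "(\<integral>\<^sup>+x. ennreal (\<bar>f x + g x\<bar> ^ p) \<partial>M) \<le> (\<integral>\<^sup>+x. ennreal (2 ^ p) * (ennreal (\<bar>f x\<bar> ^ p) + ennreal (\<bar>g x\<bar> ^ p)) \<partial>M)"
  proof (rule nn_integral_mono)
    fix x
    have "ennreal (\<bar>f x + g x\<bar> ^ p) \<le> ennreal (2 ^ p * (\<bar>f x\<bar> ^ p + \<bar>g x\<bar> ^ p))"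
      by (intro ennreal_leI power_abs_add_le)
    then show "ennreal (\<bar>f x + g x\<bar> ^ p) \<le> ennreal (2 ^ p) * (ennreal (\<bar>f x\<bar> ^ p) + ennreal (\<bar>g x\<bar> ^ p))"
      by (subst (asm) ennreal_mult) auto
  qed
  also have "\<dots> = ennreal (2 ^ p) * ((\<integral>\<^sup>+x. ennreal (\<bar>f x\<bar> ^ p) \<partial>M) + (\<integral>\<^sup>+x. ennreal (\<bar>g x\<bar> ^ p) \<partial>M))"
    by (subst nn_integral_cmult, measurable, subst nn_integral_add) auto
  finally show ?thesis .
qed

text \<open>Truncation of \<open>f\<close> at a large level reduces to the bounded case.\<close>

lemma Lp_approx_continuous:
  fixes f :: "'a::euclidean_space \<Rightarrow> real"
  assumes f[measurable]: "f \<in> borel_measurable borel" and fp: "integrable lborel (\<lambda>x. \<bar>f x\<bar> ^ p)"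
    and supp: "\<And>x. norm x > \<rho> \<Longrightarrow> f x = 0" and p: "p \<ge> 1" and e: "e > 0"
  obtains g where "continuous_on UNIV g" "\<And>x. norm x > \<rho> + 1 \<Longrightarrow> g x = 0"
    "(\<integral>\<^sup>+x. ennreal (\<bar>f x - g x\<bar> ^ p) \<partial>lborel) \<le> ennreal e"
proof -
  \<comment> \<open>Half of \<open>e\<close> for each of the two errors, divided by the constant
    \<open>2 ^ p\<close> of \<open>nn_integral_power_add_le\<close>.\<close>
  define c where "c = e / 2 / 2 ^ p"
  have c: "c > 0" using e by (simp add: c_def)
  define T where "T k x = max (- real k) (min (real k) (f x))" for k x
  have [measurable]: "T k \<in> borel_measurable borel" for k unfolding T_def by measurable
  have "(\<lambda>k. \<integral>\<^sup>+x. ennreal (\<bar>f x - T k x\<bar> ^ p) \<partial>lborel) \<longlonglongrightarrow> (\<integral>\<^sup>+(x::'a). 0 \<partial>lborel)"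
  proof (rule nn_integral_dominated_convergence[where w="\<lambda>x. ennreal (\<bar>f x\<bar> ^ p)"])
    show "(\<integral>\<^sup>+x. ennreal (\<bar>f x\<bar> ^ p) \<partial>lborel) < \<infinity>"
      using nn_integral_eq_integral[OF fp] by simp
    show "AE x in lborel. (\<lambda>k. ennreal (\<bar>f x - T k x\<bar> ^ p)) \<longlonglongrightarrow> 0"
    proof (rule AE_I2)
      fix x
      have "eventually (\<lambda>k. ennreal (\<bar>f x - T k x\<bar> ^ p) = 0) sequentially"
        using eventually_ge_at_top[of "nat \<lceil>\<bar>f x\<bar>\<rceil>"]
      proof eventually_elim
        case (elim k)
        then have "\<bar>f x\<bar> \<le> real k" by linarith
        then have "T k x = f x" by (auto simp: T_def)
        then show ?case using p by (simp add: zero_power)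
      qed
      then show "(\<lambda>k. ennreal (\<bar>f x - T k x\<bar> ^ p)) \<longlonglongrightarrow> 0" by (rule tendsto_eventually)
    qed
    show "AE x in lborel. ennreal (\<bar>f x - T k x\<bar> ^ p) \<le> ennreal (\<bar>f x\<bar> ^ p)" for k
      by (intro AE_I2 ennreal_leI power_mono) (auto simp: T_def)
  qed measurable
  then have "eventually (\<lambda>k. (\<integral>\<^sup>+x. ennreal (\<bar>f x - T k x\<bar> ^ p) \<partial>lborel) < ennreal c) sequentially"
    using c by (intro order_tendstoD(2)) auto
  then obtain k where k: "(\<integral>\<^sup>+x. ennreal (\<bar>f x - T k x\<bar> ^ p) \<partial>lborel) < ennreal c"
    using eventually_happens'[of sequentially] by auto
  obtain g where g: "continuous_on UNIV g" "\<And>x. norm x > \<rho> + 1 \<Longrightarrow> g x = 0"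
    "(\<integral>\<^sup>+x. ennreal (\<bar>T k x - g x\<bar> ^ p) \<partial>lborel) < ennreal c"
  proof (rule Lp_approx_continuous_bounded)
    show "T k \<in> borel_measurable borel" by measurable
    show "\<bar>T k x\<bar> \<le> real k" for x by (auto simp: T_def)
    show "T k x = 0" if "norm x > \<rho>" for x using supp[OF that] by (simp add: T_def)
  qed (use p c in auto)
  have [measurable]: "g \<in> borel_measurable borel" using g(1) by (rule borel_measurable_continuous_onI)
  have "(\<integral>\<^sup>+x. ennreal (\<bar>f x - g x\<bar> ^ p) \<partial>lborel) = (\<integral>\<^sup>+x. ennreal (\<bar>(f x - T k x) + (T k x - g x)\<bar> ^ p) \<partial>lborel)"
    by simp
  also have "\<dots> \<le> ennreal (2 ^ p) * ((\<integral>\<^sup>+x. ennreal (\<bar>f x - T k x\<bar> ^ p) \<partial>lborel) + (\<integral>\<^sup>+x. ennreal (\<bar>T k x - g x\<bar> ^ p) \<partial>lborel))"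
    by (rule nn_integral_power_add_le) measurable
  also have "\<dots> \<le> ennreal (2 ^ p) * (ennreal c + ennreal c)"
    using k g(3) by (intro mult_left_mono add_mono) auto
  also have "\<dots> = ennreal (2 ^ p * (c + c))"
    using c by (subst ennreal_mult, simp, simp, subst ennreal_plus) simp_all
  also have "2 ^ p * (c + c) = e" by (simp add: c_def)
  finally show thesis using g(1,2) by (intro that)
qed

text \<open>The mollification averages translates by less than \<open>e\<close>, so it moves the
  value at \<open>x\<close> by at most the oscillation of \<open>G\<close> over such
  translates.\<close>

lemma mollify_uniform:
  fixes G :: "real^'n::finite \<Rightarrow> 'b::euclidean_space"
  assumes e: "e > 0" and G: "continuous_on UNIV G" "\<And>x. norm x > \<rho> \<Longrightarrow> G x = 0"
    and w: "\<And>y. norm y < e \<Longrightarrow> norm (G (x - y) - G x) \<le> \<omega>"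
  shows "norm ((\<integral>y. mollifier e y *\<^sub>R G (x - y) \<partial>lborel) - G x) \<le> \<omega>"
proof -
  have i: "integrable lborel (\<lambda>y. mollifier e y *\<^sub>R G (x - y))"
    by (rule compact_support_integrable_scaleR[OF G mollifier_integrable[OF e]])
  have i2: "integrable lborel (\<lambda>y::real^'n. mollifier e y *\<^sub>R G x)"
    by (intro integrable_scaleR_left mollifier_integrable[OF e])
  have "G x = (\<integral>(y::real^'n). mollifier e y *\<^sub>R G x \<partial>lborel)"
    using mollifier_integral[OF e, where 'n='n] by (subst integral_scaleR_left) (auto simp: mollifier_integrable[OF e])
  then have "(\<integral>y. mollifier e y *\<^sub>R G (x - y) \<partial>lborel) - G x = (\<integral>y. mollifier e y *\<^sub>R G (x - y) - mollifier e y *\<^sub>R G x \<partial>lborel)"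
    using Bochner_Integration.integral_diff[OF i i2] by simp
  also have "norm \<dots> \<le> (\<integral>y. \<omega> * mollifier e y \<partial>(lborel :: (real^'n) measure))"
  proof (rule Bochner_Integration.integral_norm_bound_integral)
    fix y
    have "norm (mollifier e y *\<^sub>R G (x - y) - mollifier e y *\<^sub>R G x) = mollifier e y * norm (G (x - y) - G x)"
      by (simp add: scaleR_diff_right[symmetric] mollifier_nonneg[OF e])
    also have "\<dots> \<le> mollifier e y * \<omega>"
      using w[of y] mollifier_nonneg[OF e, of y] mollifier_zero[OF e, of y]
      by (cases "norm y < e") (auto intro!: mult_left_mono)
    finally show "norm (mollifier e y *\<^sub>R G (x - y) - mollifier e y *\<^sub>R G x) \<le> \<omega> * mollifier e y"
      by (simp add: mult.commute)
  qed (use i i2 mollifier_integrable[OF e] in auto)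
  also have "\<dots> = \<omega>" using mollifier_integral[OF e, where 'n='n] by simp
  finally show ?thesis .
qed

lemma mollify_Lp_close:
  fixes f :: "real^'n::finite \<Rightarrow> real"
  assumes f: "integrable lborel f" "integrable lborel (\<lambda>x. \<bar>f x\<bar> ^ p)"
    and supp: "\<And>x. norm x > \<rho> \<Longrightarrow> f x = 0" and p: "p \<ge> 1" and \<eta>: "\<eta> > 0"
  shows "\<exists>e0>0. \<forall>e. 0 < e \<longrightarrow> e < e0 \<longrightarrow> (\<integral>\<^sup>+x. ennreal (\<bar>convol (mollifier e) f x - f x\<bar> ^ p) \<partial>lborel) \<le> ennreal \<eta>"
proof -
  have fm[measurable]: "f \<in> borel_measurable borel" using borel_measurable_integrable[OF f(1)] by simp
  define V where "V = measure lborel (cball 0 (\<rho> + 2) :: (real^'n) set)"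
  \<comment> \<open>The error is split into the mollified \<open>f - g\<close>, the mollification
    error of \<open>g\<close>, and \<open>g - f\<close>. Two nested uses of the power inequality
    give the factors \<open>2 ^ p\<close>, \<open>4 ^ p\<close> and \<open>4 ^ p\<close>, hence
    \<open>3 * 4 ^ p\<close> in total. Having \<open>\<omega> \<le> 1\<close> permits bounding the
    \<open>p\<close>-th power of the error of \<open>g\<close> by the error itself.\<close>
  define \<tau> where "\<tau> = \<eta> / (3 * 4 ^ p)"
  define \<omega> where "\<omega> = min 1 (\<eta> / (3 * 4 ^ p * (V + 1)))"
  have V: "V \<ge> 0" "emeasure lborel (cball 0 (\<rho> + 2) :: (real^'n) set) = ennreal V"
    using emeasure_lborel_cball_finite[of "0 :: real^'n" "\<rho> + 2"]
    by (auto simp: V_def intro!: emeasure_eq_ennreal_measure)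
  have \<tau>: "\<tau> > 0" and \<omega>: "\<omega> > 0" using \<eta> V by (auto simp: \<tau>_def \<omega>_def)
  obtain g where g: "continuous_on UNIV g" "\<And>x. norm x > \<rho> + 1 \<Longrightarrow> g x = 0"
    "(\<integral>\<^sup>+x. ennreal (\<bar>f x - g x\<bar> ^ p) \<partial>lborel) \<le> ennreal \<tau>"
    by (rule Lp_approx_continuous[OF fm f(2) supp p \<tau>]) auto
  obtain d where d: "d > 0" "\<And>x y. dist x y < d \<Longrightarrow> dist (g x) (g y) < \<omega>"
    by (rule compact_support_uniformly_continuous[OF g(1,2) \<omega>]) auto
  have [measurable]: "g \<in> borel_measurable borel" using g(1) by (rule borel_measurable_continuous_onI)
  have g_int: "integrable lborel g"
  proof -
    obtain B where B: "B > 0" "\<And>x. norm (g x) \<le> B" by (rule compact_support_bounded[OF g(1,2)]) auto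
    have "integrable lborel (\<lambda>x :: real^'n. B * indicator (cball 0 (\<rho> + 1)) x)"
      using emeasure_lborel_cball_finite[of "0 :: real^'n" "\<rho> + 1"] by simp
    then show ?thesis
    proof (rule Bochner_Integration.integrable_bound)
      have "norm (g x) \<le> norm (B * indicator (cball 0 (\<rho> + 1)) x)" for x
        using B(1) B(2)[of x] g(2)[of x] by (cases "norm x > \<rho> + 1") auto
      then show "AE x in lborel. norm (g x) \<le> norm (B * indicator (cball 0 (\<rho> + 1)) x)" by simp
    qed simp
  qed
  have fg_p: "integrable lborel (\<lambda>x. \<bar>f x - g x\<bar> ^ p)"
    using g(3) by (intro integrableI_bounded) (auto intro: le_less_trans)
  show ?thesis
  proof (intro exI[of _ "min 1 d"] conjI allI impI)
    show "0 < min 1 d" using d(1) by simp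
    fix e :: real assume e: "0 < e" and ed: "e < min 1 d"
    let ?C = "\<lambda>h. convol (mollifier e) h"
    have gx: "\<bar>?C g x - g x\<bar> \<le> \<omega> * indicator (cball 0 (\<rho> + 2)) x" for x
    proof (cases "norm x > \<rho> + 2")
      case False
      have "?C g x = (\<integral>y. mollifier e y *\<^sub>R g (x - y) \<partial>lborel)"
        by (subst convol_commute) (auto simp: convol_def mult.commute)
      moreover have "norm ((\<integral>y. mollifier e y *\<^sub>R g (x - y) \<partial>lborel) - g x) \<le> \<omega>"
        by (rule mollify_uniform[OF e g(1,2)]) (use d(2)[of "x - _" x] ed in \<open>auto simp: dist_norm intro: less_imp_le\<close>)
      ultimately show ?thesis using False by simp
    next
      case True
      have "mollifier e (x - y) * g y = 0" for y
      proof (cases "norm (x - y) < e")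
        case F: True
        have "norm y > \<rho> + 1" using norm_triangle_ineq2[of x "x - y"] True F ed by simp
        then show ?thesis using g(2) by simp
      qed (simp add: mollifier_zero[OF e])
      then have "?C g x = (\<integral>(y :: real^'n). 0 \<partial>lborel)"
        unfolding convol_def by (intro Bochner_Integration.integral_cong) auto
      moreover have "g x = 0" using g(2)[of x] True by simp
      ultimately show ?thesis using \<omega> by simp
    qed
    have Cg: "(\<integral>\<^sup>+x. ennreal (\<bar>?C g x - g x\<bar> ^ p) \<partial>lborel) \<le> ennreal \<tau>"
    proof -
      have "(\<integral>\<^sup>+x. ennreal (\<bar>?C g x - g x\<bar> ^ p) \<partial>lborel) \<le> (\<integral>\<^sup>+(x :: real^'n). ennreal \<omega> * indicator (cball 0 (\<rho> + 2)) x \<partial>lborel)"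
      proof (rule nn_integral_mono)
        fix x :: "real^'n"
        have "\<omega> * indicator (cball 0 (\<rho> + 2)) x \<le> 1 * 1"
          using \<omega> by (intro mult_mono) (auto simp: \<omega>_def indicator_def)
        then have "\<bar>?C g x - g x\<bar> \<le> 1" using gx[of x] by simp
        then have "\<bar>?C g x - g x\<bar> ^ p \<le> \<bar>?C g x - g x\<bar> ^ 1"
          using p by (intro power_decreasing) auto
        also have "\<dots> \<le> \<omega> * indicator (cball 0 (\<rho> + 2)) x" using gx[of x] by simp
        finally have "ennreal (\<bar>?C g x - g x\<bar> ^ p) \<le> ennreal (\<omega> * indicator (cball 0 (\<rho> + 2)) x)" by (rule ennreal_leI)
        then show "ennreal (\<bar>?C g x - g x\<bar> ^ p) \<le> ennreal \<omega> * indicator (cball 0 (\<rho> + 2)) x"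
          by (auto simp: indicator_def split: if_splits)
      qed
      also have "\<dots> = ennreal (\<omega> * V)"
        using \<omega> by (subst nn_integral_cmult_indicator) (auto simp: V(2) ennreal_mult V(1))
      also have "\<omega> * V \<le> \<tau>"
      proof -
        have "\<omega> * V \<le> \<eta> / (3 * 4 ^ p * (V + 1)) * (V + 1)"
          using \<eta> V(1) by (intro mult_mono) (auto simp: \<omega>_def)
        then show ?thesis using V(1) by (simp add: \<tau>_def)
      qed
      finally show ?thesis by (simp add: ennreal_leI)
    qed
    have Cfg: "(\<integral>\<^sup>+x. ennreal (\<bar>?C (\<lambda>y. f y - g y) x\<bar> ^ p) \<partial>lborel) \<le> ennreal \<tau>"
      by (rule order_trans[OF mollify_Lp_le[OF e _ fg_p p] g(3)]) (use f(1) g_int in auto)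
    have lin: "?C f x = ?C (\<lambda>y. f y - g y) x + ?C g x" for x
      using mollify_integrable[OF e f(1), of x] mollify_integrable[OF e g_int, of x]
      by (simp add: convol_def right_diff_distrib)
    have "(\<integral>\<^sup>+x. ennreal (\<bar>?C f x - f x\<bar> ^ p) \<partial>lborel)
      = (\<integral>\<^sup>+x. ennreal (\<bar>?C (\<lambda>y. f y - g y) x + ((?C g x - g x) + (g x - f x))\<bar> ^ p) \<partial>lborel)"
      by (simp add: lin algebra_simps)
    also have "\<dots> \<le> ennreal (2 ^ p) * ((\<integral>\<^sup>+x. ennreal (\<bar>?C (\<lambda>y. f y - g y) x\<bar> ^ p) \<partial>lborel)
        + (\<integral>\<^sup>+x. ennreal (\<bar>(?C g x - g x) + (g x - f x)\<bar> ^ p) \<partial>lborel))"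
      by (rule nn_integral_power_add_le) measurable
    also have "\<dots> \<le> ennreal (2 ^ p) * (ennreal \<tau> + ennreal (2 ^ p) * (ennreal \<tau> + ennreal \<tau>))"
    proof (intro mult_left_mono add_mono Cfg)
      have "(\<integral>\<^sup>+x. ennreal (\<bar>(?C g x - g x) + (g x - f x)\<bar> ^ p) \<partial>lborel)
        \<le> ennreal (2 ^ p) * ((\<integral>\<^sup>+x. ennreal (\<bar>?C g x - g x\<bar> ^ p) \<partial>lborel) + (\<integral>\<^sup>+x. ennreal (\<bar>g x - f x\<bar> ^ p) \<partial>lborel))"
        by (rule nn_integral_power_add_le) measurable
      also have "\<dots> \<le> ennreal (2 ^ p) * (ennreal \<tau> + ennreal \<tau>)"
        using g(3) Cg by (intro mult_left_mono add_mono) (auto simp: abs_minus_commute)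
      finally show "(\<integral>\<^sup>+x. ennreal (\<bar>(?C g x - g x) + (g x - f x)\<bar> ^ p) \<partial>lborel) \<le> ennreal (2 ^ p) * (ennreal \<tau> + ennreal \<tau>)" .
    qed simp
    also have "\<dots> = ennreal (2 ^ p * (\<tau> + 2 ^ p * (\<tau> + \<tau>)))"
    proof -
      have "ennreal (2 ^ p) * (ennreal \<tau> + ennreal (2 ^ p) * (ennreal \<tau> + ennreal \<tau>)) =
          ennreal (2 ^ p) * (ennreal \<tau> + ennreal (2 ^ p) * ennreal (\<tau> + \<tau>))"
        using \<tau> by (subst ennreal_plus) simp_all
      also have "\<dots> = ennreal (2 ^ p * (\<tau> + 2 ^ p * (\<tau> + \<tau>)))"
        using \<tau> by (subst ennreal_mult[symmetric], simp, simp, subst ennreal_plus[symmetric], simp, simp,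
            subst ennreal_mult[symmetric]) simp_all
      finally show ?thesis .
    qed
    also have "2 ^ p * (\<tau> + 2 ^ p * (\<tau> + \<tau>)) \<le> \<eta>"
    proof -
      have "2 ^ p * \<tau> \<le> 4 ^ p * \<tau>" using \<tau> by (intro mult_right_mono power_mono) auto
      moreover have "2 ^ p * (2 ^ p * (\<tau> + \<tau>)) = 4 ^ p * \<tau> + 4 ^ p * \<tau>"
        by (simp add: mult.assoc[symmetric] power_mult_distrib[symmetric] distrib_left)
      moreover have "3 * (4 ^ p * \<tau>) = \<eta>" by (simp add: \<tau>_def)
      ultimately show ?thesis by (simp only: distrib_left)
    qed
    finally show "(\<integral>\<^sup>+x. ennreal (\<bar>?C f x - f x\<bar> ^ p) \<partial>lborel) \<le> ennreal \<eta>" by (simp add: ennreal_leI)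
  qed
qed

text \<open>Errors that are summable in \<open>p\<close>-th power give almost everywhere convergence
  of the whole sequence together with one majorant, both read off from the integrable sum
  \<open>S\<close>. In this form the approximants feed dominated convergence.\<close>

lemma fast_Lp_convergence:
  fixes f :: "'a \<Rightarrow> real" and g :: "nat \<Rightarrow> 'a \<Rightarrow> real"
  assumes [measurable]: "f \<in> borel_measurable M" "\<And>j. g j \<in> borel_measurable M"
    and p: "p \<ge> 1" and fp: "integrable M (\<lambda>x. \<bar>f x\<bar> ^ p)"
    and fast: "\<And>j. (\<integral>\<^sup>+x. ennreal (\<bar>g j x - f x\<bar> ^ p) \<partial>M) \<le> ennreal ((1/2) ^ j)"
  obtains Z where "integrable M Z" "\<And>x. Z x \<ge> 0"
    "AE x in M. (\<forall>j. \<bar>g j x\<bar> ^ p \<le> Z x) \<and> (\<lambda>j. g j x) \<longlonglongrightarrow> f x"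
proof -
  define S where "S x = (\<Sum>j. ennreal (\<bar>g j x - f x\<bar> ^ p))" for x
  have [measurable]: "S \<in> borel_measurable M" unfolding S_def[abs_def] by measurable
  have "(\<integral>\<^sup>+x. S x \<partial>M) = (\<Sum>j. \<integral>\<^sup>+x. ennreal (\<bar>g j x - f x\<bar> ^ p) \<partial>M)"
    unfolding S_def by (rule nn_integral_suminf) measurable
  also have "\<dots> \<le> (\<Sum>j. ennreal ((1/2) ^ j))"
    by (intro suminf_le fast) (auto simp: summableI)
  also have "\<dots> = ennreal (1 / (1 - 1/2))"
    by (intro suminf_ennreal_eq geometric_sums) auto
  finally have S_int: "(\<integral>\<^sup>+x. S x \<partial>M) < \<infinity>" by (rule le_less_trans) simp
  then have S_fin: "AE x in M. S x \<noteq> \<infinity>" by (intro nn_integral_noteq_infinite) auto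
  define Z where "Z x = 2 ^ p * (\<bar>f x\<bar> ^ p + enn2real (S x))" for x
  have "integrable M (\<lambda>x. enn2real (S x))"
  proof (rule integrableI_bounded)
    have "(\<integral>\<^sup>+x. ennreal (norm (enn2real (S x))) \<partial>M) \<le> (\<integral>\<^sup>+x. S x \<partial>M)"
      by (intro nn_integral_mono) (auto simp: ennreal_enn2real_if)
    then show "(\<integral>\<^sup>+x. ennreal (norm (enn2real (S x))) \<partial>M) < \<infinity>" using S_int by (rule le_less_trans)
  qed measurable
  then have "integrable M Z" unfolding Z_def[abs_def]
    using fp by (intro integrable_mult_right Bochner_Integration.integrable_add)
  moreover have "Z x \<ge> 0" for x by (simp add: Z_def)
  moreover from S_fin have "AE x in M. (\<forall>j. \<bar>g j x\<bar> ^ p \<le> Z x) \<and> (\<lambda>j. g j x) \<longlonglongrightarrow> f x"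
  proof eventually_elim
    case (elim x)
    then have sm: "summable (\<lambda>j. \<bar>g j x - f x\<bar> ^ p)"
      by (intro summable_suminf_not_top) (auto simp: S_def)
    have term_le: "\<bar>g j x - f x\<bar> ^ p \<le> enn2real (S x)" for j
    proof -
      have "ennreal (\<bar>g j x - f x\<bar> ^ p) = (\<Sum>i\<in>{j}. ennreal (\<bar>g i x - f x\<bar> ^ p))" by simp
      also have "\<dots> \<le> S x" unfolding S_def by (rule sum_le_suminf) (auto simp: summableI)
      finally have "enn2real (ennreal (\<bar>g j x - f x\<bar> ^ p)) \<le> enn2real (S x)"
        using elim by (intro enn2real_mono) (auto simp: less_top)
      then show ?thesis by simp
    qed
    have "\<bar>g j x\<bar> ^ p \<le> Z x" for j
    proof -
      have "\<bar>g j x\<bar> ^ p \<le> 2 ^ p * (\<bar>f x\<bar> ^ p + \<bar>g j x - f x\<bar> ^ p)"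
        using power_abs_add_le[of "f x" "g j x - f x" p] by simp
      also have "\<dots> \<le> Z x" unfolding Z_def using term_le[of j] by (intro mult_left_mono add_left_mono) auto
      finally show ?thesis .
    qed
    moreover have "(\<lambda>j. g j x) \<longlonglongrightarrow> f x"
    proof -
      have "(\<lambda>j. root p (\<bar>g j x - f x\<bar> ^ p)) \<longlonglongrightarrow> root p 0"
        by (intro tendsto_real_root summable_LIMSEQ_zero sm)
      then have "(\<lambda>j. \<bar>g j x - f x\<bar>) \<longlonglongrightarrow> 0"
        using p by (simp add: real_root_power_cancel)
      then have "(\<lambda>j. g j x - f x) \<longlonglongrightarrow> 0" by (rule tendsto_rabs_zero_cancel)
      then show ?thesis by (rule LIM_zero_cancel)
    qed
    ultimately show ?case by blast
  qed
  ultimately show thesis by (rule that)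
qed

lemma norm_vec_power_le:
  fixes v :: "real^'n::finite"
  shows "norm v ^ p \<le> real CARD('n) ^ p * (\<Sum>i\<in>UNIV. \<bar>v $ i\<bar> ^ p)"
proof -
  define M where "M = Max (range (\<lambda>i. \<bar>v $ i\<bar>))"
  have "M \<in> range (\<lambda>i. \<bar>v $ i\<bar>)" unfolding M_def by (intro Max_in) auto
  then obtain k where k: "M = \<bar>v $ k\<bar>" by auto
  have le: "\<bar>v $ i\<bar> \<le> M" for i unfolding M_def by (intro Max_ge) auto
  have "norm v \<le> (\<Sum>i\<in>UNIV. \<bar>v $ i\<bar>)" by (rule norm_le_l1_cart)
  also have "\<dots> \<le> (\<Sum>i\<in>(UNIV::'n set). M)" by (intro sum_mono le)
  finally have "norm v ^ p \<le> (real CARD('n) * M) ^ p" by (intro power_mono) auto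
  also have "\<dots> = real CARD('n) ^ p * \<bar>v $ k\<bar> ^ p" by (simp add: power_mult_distrib k)
  also have "\<dots> \<le> real CARD('n) ^ p * (\<Sum>i\<in>UNIV. \<bar>v $ i\<bar> ^ p)"
    by (intro mult_left_mono member_le_sum) auto
  finally show ?thesis .
qed

lemma mollifier_test_function:
  assumes e: "e > 0" and sub: "cball x e \<subseteq> D"
  shows "(\<lambda>y. mollifier e (x - y)) \<in> test_functions D"
proof -
  have sub2: "closure {y. mollifier e (x - y) \<noteq> 0} \<subseteq> cball x e"
  proof (rule closure_minimal)
    show "{y. mollifier e (x - y) \<noteq> 0} \<subseteq> cball x e"
    proof
      fix y assume "y \<in> {y. mollifier e (x - y) \<noteq> 0}"
      then have "norm (x - y) < e" using mollifier_zero[OF e, of "x - y"] by (meson mem_Collect_eq not_le)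
      then show "y \<in> cball x e" by (simp add: dist_norm)
    qed
  qed simp
  moreover have "bounded (closure {y. mollifier e (x - y) \<noteq> 0})"
    using sub2 bounded_cball bounded_subset by blast
  ultimately show ?thesis
    using sub mollifier_smooth_translate[of e x] by (auto simp: test_functions_def compact_eq_bounded_closed)
qed

text \<open>Where the closed \<open>e\<close>-ball around \<open>x\<close> lies in \<open>D\<close>,
  the reflected mollifier is a test function, and the sign from the reflection cancels the sign in
  the definition of the weak gradient.\<close>

lemma convol_mollifier_grad:
  fixes u :: "real^'n::finite \<Rightarrow> real" and Du :: "real^'n \<Rightarrow> real^'n"
  assumes u: "integrable lborel u"
    and wg: "\<And>\<phi> i. \<phi> \<in> test_functions D \<Longrightarrow> (\<integral>x. u x * partial_deriv i \<phi> x \<partial>lborel) = - (\<integral>x. Du x $ i * \<phi> x \<partial>lborel)"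
    and e: "e > 0" and sub: "cball x e \<subseteq> D"
  shows "(\<integral>y. u y *\<^sub>R grad (mollifier e) (x - y) \<partial>lborel) $ i = convol (mollifier e) (\<lambda>y. Du y $ i) x"
proof -
  note C = smooth_C1_grad[OF mollifier_smooth[of e]]
  have "C1_grad (\<lambda>y. mollifier e (x - y)) (\<lambda>y. - grad (mollifier e) (x - y))"
    unfolding C1_grad_def
  proof (intro conjI allI)
    show "continuous_on UNIV (\<lambda>y. - grad (mollifier e) (x - y))"
      by (intro continuous_on_minus continuous_on_compose2[OF C1_gradD(2)[OF C]] continuous_on_diff
          continuous_on_const continuous_on_id) auto
    fix y
    have "((\<lambda>y. mollifier e (x - y)) has_derivative (\<lambda>h. grad (mollifier e) (x - y) \<bullet> (- h))) (at y)"
      by (rule has_derivative_compose[OF _ C1_gradD(1)[OF C]]) (auto intro!: derivative_eq_intros)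
    then show "((\<lambda>y. mollifier e (x - y)) has_derivative (\<lambda>h. - grad (mollifier e) (x - y) \<bullet> h)) (at y)" by simp
  qed
  note pd = C1_grad_grad(2)[OF this, of i]
  have g0: "grad (mollifier e) z = 0" if "norm z > e" for z
    by (rule C1_grad_zero_outside[OF C, where S="- cball 0 e"]) (use that e in \<open>auto simp: mollifier_zero\<close>)
  have "(\<integral>y. u y *\<^sub>R grad (mollifier e) (x - y) \<partial>lborel) $ i = (\<integral>y. (u y *\<^sub>R grad (mollifier e) (x - y)) $ i \<partial>lborel)"
    by (rule integral_bounded_linear[OF bounded_linear_vec_nth, symmetric])
       (rule compact_support_integrable_scaleR[OF C1_gradD(2)[OF C] g0 u])
  also have "\<dots> = (\<integral>y. - (u y * partial_deriv i (\<lambda>y. mollifier e (x - y)) y) \<partial>lborel)"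
    by (simp add: pd)
  also have "\<dots> = (\<integral>y. Du y $ i * mollifier e (x - y) \<partial>lborel)"
    using wg[OF mollifier_test_function[OF e sub], of i] by simp
  finally show ?thesis by (simp add: convol_def mult.commute)
qed

text \<open>In filter form, so that the finitely many components of the gradient can be treated at
  once by \<open>eventually_all_finite\<close>.\<close>

lemma mollify_eventually:
  fixes f :: "real^'n::finite \<Rightarrow> real"
  assumes f: "integrable lborel f" "integrable lborel (\<lambda>x. \<bar>f x\<bar> ^ p)"
    and supp: "\<And>x. norm x > \<rho> \<Longrightarrow> f x = 0" and p: "p \<ge> 1" and \<eta>: "\<eta> > 0"
  shows "\<forall>\<^sub>F e in at_right 0. (\<integral>\<^sup>+x. ennreal (\<bar>convol (mollifier e) f x - f x\<bar> ^ p) \<partial>lborel) \<le> ennreal \<eta>"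
  unfolding eventually_at_right_field using mollify_Lp_close[OF f supp p \<eta>] by metis

lemma integrable_of_power:
  fixes f :: "'a::euclidean_space \<Rightarrow> real"
  assumes [measurable]: "f \<in> borel_measurable borel" and fp: "integrable lborel (\<lambda>x. \<bar>f x\<bar> ^ p)"
    and supp: "\<And>x. norm x > \<rho> \<Longrightarrow> f x = 0" and p: "p \<ge> 1"
  shows "integrable lborel f"
proof (rule Bochner_Integration.integrable_bound)
  show "integrable lborel (\<lambda>x::'a. indicator (cball 0 \<rho>) x + \<bar>f x\<bar> ^ p)"
    using fp emeasure_lborel_cball_finite[of "0::'a" \<rho>] by (intro Bochner_Integration.integrable_add) auto
  have "\<bar>f x\<bar> \<le> indicator (cball 0 \<rho>) x + \<bar>f x\<bar> ^ p" for x
    using le_plus_power_bound[of "\<bar>f x\<bar>" 1 p] p supp[of x] by (cases "norm x > \<rho>") (auto simp: indicator_def)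
  then show "AE x in lborel. norm (f x) \<le> norm (indicator (cball 0 \<rho>) x + \<bar>f x\<bar> ^ p)"
    by (intro AE_I2) (auto intro: order_trans)
qed measurable

text \<open>The extension of \<open>u\<close> by 0 may fail to have a weak gradient across the
  sphere of radius \<open>P\<close>, so the gradient of the mollification is identified only at
  points farther from that sphere than the mollification radius. Hence convergence and majorant are
  claimed for \<open>norm x < \<rho>\<close> only, and the radii \<open>e j\<close> stay below
  \<open>P - \<rho>\<close>.\<close>

lemma Sobolev_smooth_approximation:
  fixes u :: "real^'n::finite \<Rightarrow> real" and Du :: "real^'n \<Rightarrow> real^'n"
  assumes um[measurable]: "u \<in> borel_measurable borel" "Du \<in> borel_measurable borel"
    and up: "integrable lborel (\<lambda>x. \<bar>u x\<bar> ^ p)" "integrable lborel (\<lambda>x. norm (Du x) ^ p)"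
    and supp: "\<And>x. norm x > P \<Longrightarrow> u x = 0" "\<And>x. norm x > P \<Longrightarrow> Du x = 0" and p: "p \<ge> 1"
    and wg: "\<And>\<phi> i. \<phi> \<in> test_functions (ball 0 P) \<Longrightarrow>
      (\<integral>x. u x * partial_deriv i \<phi> x \<partial>lborel) = - (\<integral>x. Du x $ i * \<phi> x \<partial>lborel)"
    and \<rho>: "\<rho> < P"
  obtains v V Z where "\<And>j::nat. C1_grad (v j) (V j)" "integrable lborel Z" "\<And>x. Z x \<ge> 0"
    "AE x in lborel. norm x < \<rho> \<longrightarrow> (\<forall>j. \<bar>v j x\<bar> ^ p \<le> Z x \<and> norm (V j x) ^ p \<le> Z x) \<and>
       (\<lambda>j. v j x) \<longlonglongrightarrow> u x \<and> (\<lambda>j. V j x) \<longlonglongrightarrow> Du x"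
proof -
  have Dum[measurable]: "(\<lambda>x. Du x $ i) \<in> borel_measurable borel" for i
    by (rule measurable_compose[OF um(2) borel_measurable_continuous_onI[OF linear_continuous_on[OF bounded_linear_vec_nth]]])
  have Dup: "integrable lborel (\<lambda>x. \<bar>Du x $ i\<bar> ^ p)" for i
    by (rule Bochner_Integration.integrable_bound[OF up(2)])
      (auto intro!: power_mono component_le_norm_cart AE_I2)
  have ui: "integrable lborel u" by (rule integrable_of_power[OF um(1) up(1) supp(1) p])
  have Dui: "integrable lborel (\<lambda>x. Du x $ i)" for i
    by (rule integrable_of_power[OF _ Dup _ p, where \<rho>=P]) (auto simp: supp(2))
  have "\<exists>e. 0 < e \<and> e < P - \<rho> \<and>
      (\<integral>\<^sup>+x. ennreal (\<bar>convol (mollifier e) u x - u x\<bar> ^ p) \<partial>lborel) \<le> ennreal ((1/2) ^ j) \<and>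
      (\<forall>i. (\<integral>\<^sup>+x. ennreal (\<bar>convol (mollifier e) (\<lambda>y. Du y $ i) x - Du x $ i\<bar> ^ p) \<partial>lborel) \<le> ennreal ((1/2) ^ j))" for j :: nat
  proof -
    have "\<forall>\<^sub>F e in at_right (0::real). 0 < e \<and> e < P - \<rho>"
      unfolding eventually_at_right_field using \<rho> by (intro exI[of _ "P - \<rho>"]) auto
    moreover have "\<forall>\<^sub>F e in at_right 0. (\<integral>\<^sup>+x. ennreal (\<bar>convol (mollifier e) u x - u x\<bar> ^ p) \<partial>lborel) \<le> ennreal ((1/2) ^ j)"
      by (rule mollify_eventually[OF ui up(1) supp(1) p]) auto
    moreover have "\<forall>\<^sub>F e in at_right 0. \<forall>i. (\<integral>\<^sup>+x. ennreal (\<bar>convol (mollifier e) (\<lambda>y. Du y $ i) x - Du x $ i\<bar> ^ p) \<partial>lborel) \<le> ennreal ((1/2) ^ j)"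
      by (rule eventually_all_finite) (rule mollify_eventually[OF Dui Dup _ p, where \<rho>=P], auto simp: supp(2))
    ultimately have "\<forall>\<^sub>F e in at_right (0::real). (0 < e \<and> e < P - \<rho>) \<and>
      (\<integral>\<^sup>+x. ennreal (\<bar>convol (mollifier e) u x - u x\<bar> ^ p) \<partial>lborel) \<le> ennreal ((1/2) ^ j) \<and>
      (\<forall>i. (\<integral>\<^sup>+x. ennreal (\<bar>convol (mollifier e) (\<lambda>y. Du y $ i) x - Du x $ i\<bar> ^ p) \<partial>lborel) \<le> ennreal ((1/2) ^ j))"
      by eventually_elim blast
    then show ?thesis using eventually_happens'[OF trivial_limit_at_right_real] by (simp add: conj_assoc)
  qed
  then have "\<forall>j. \<exists>e. 0 < e \<and> e < P - \<rho> \<and>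
      (\<integral>\<^sup>+x. ennreal (\<bar>convol (mollifier e) u x - u x\<bar> ^ p) \<partial>lborel) \<le> ennreal ((1/2) ^ j) \<and>
      (\<forall>i. (\<integral>\<^sup>+x. ennreal (\<bar>convol (mollifier e) (\<lambda>y. Du y $ i) x - Du x $ i\<bar> ^ p) \<partial>lborel) \<le> ennreal ((1/2) ^ j))" by blast
  from choice[OF this] obtain e where e0: "\<forall>j. 0 < e j \<and> e j < P - \<rho> \<and>
      (\<integral>\<^sup>+x. ennreal (\<bar>convol (mollifier (e j)) u x - u x\<bar> ^ p) \<partial>lborel) \<le> ennreal ((1/2) ^ j) \<and>
      (\<forall>i. (\<integral>\<^sup>+x. ennreal (\<bar>convol (mollifier (e j)) (\<lambda>y. Du y $ i) x - Du x $ i\<bar> ^ p) \<partial>lborel) \<le> ennreal ((1/2) ^ j))" ..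
  have e: "\<And>j. 0 < e j" "\<And>j. e j < P - \<rho>"
      "\<And>j. (\<integral>\<^sup>+x. ennreal (\<bar>convol (mollifier (e j)) u x - u x\<bar> ^ p) \<partial>lborel) \<le> ennreal ((1/2) ^ j)"
      "\<And>j i. (\<integral>\<^sup>+x. ennreal (\<bar>convol (mollifier (e j)) (\<lambda>y. Du y $ i) x - Du x $ i\<bar> ^ p) \<partial>lborel) \<le> ennreal ((1/2) ^ j)"
    using e0 by blast+
  define v where "v j = convol (mollifier (e j)) u" for j
  define V where "V j x = (\<integral>y. u y *\<^sub>R grad (mollifier (e j)) (x - y) \<partial>lborel)" for j x
  have C1: "C1_grad (v j) (V j)" for j
    unfolding v_def V_def[abs_def]
    by (rule convol_C1_grad[OF smooth_C1_grad[OF mollifier_smooth] _ ui, where \<rho>="e j"])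
      (simp add: mollifier_zero e(1))
  have VD: "V j x $ i = convol (mollifier (e j)) (\<lambda>y. Du y $ i) x" if x: "norm x < \<rho>" for j x i
    unfolding V_def
  proof (rule convol_mollifier_grad[OF ui wg e(1)])
    show "cball x (e j) \<subseteq> ball 0 P"
    proof
      fix y assume "y \<in> cball x (e j)"
      then show "y \<in> ball 0 P"
        using norm_triangle_ineq2[of y x] x e(2)[of j] by (simp add: dist_norm norm_minus_commute)
    qed
  qed
  have [measurable]: "v j \<in> borel_measurable borel" for j using C1_grad_measurable[OF C1] by blast
  obtain Z0 where Z0: "integrable lborel Z0" "\<And>x. Z0 x \<ge> 0"
    "AE x in lborel. (\<forall>j. \<bar>v j x\<bar> ^ p \<le> Z0 x) \<and> (\<lambda>j. v j x) \<longlonglongrightarrow> u x"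
  proof (rule fast_Lp_convergence[OF _ _ p up(1)])
    show "(\<integral>\<^sup>+x. ennreal (\<bar>v j x - u x\<bar> ^ p) \<partial>lborel) \<le> ennreal ((1/2) ^ j)" for j
      using e(3) by (simp only: v_def)
  qed auto
  have "\<exists>Z. integrable lborel Z \<and> (\<forall>x. Z x \<ge> 0) \<and>
    (AE x in lborel. (\<forall>j. \<bar>convol (mollifier (e j)) (\<lambda>y. Du y $ i) x\<bar> ^ p \<le> Z x) \<and>
      (\<lambda>j. convol (mollifier (e j)) (\<lambda>y. Du y $ i) x) \<longlonglongrightarrow> Du x $ i)" for i
  proof -
    have m: "(\<lambda>x. Du x $ i) \<in> borel_measurable lborel"
      "\<And>j. convol (mollifier (e j)) (\<lambda>y. Du y $ i) \<in> borel_measurable lborel"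
      by measurable
    obtain Z where "integrable lborel Z" "\<And>x. Z x \<ge> 0"
      "AE x in lborel. (\<forall>j. \<bar>convol (mollifier (e j)) (\<lambda>y. Du y $ i) x\<bar> ^ p \<le> Z x) \<and>
        (\<lambda>j. convol (mollifier (e j)) (\<lambda>y. Du y $ i) x) \<longlonglongrightarrow> Du x $ i"
      by (rule fast_Lp_convergence[OF m p Dup e(4)]) blast
    then show ?thesis by blast
  qed
  then have "\<forall>i. \<exists>Z. integrable lborel (Z) \<and> (\<forall>x. Z x \<ge> 0) \<and>
    (AE x in lborel. (\<forall>j. \<bar>convol (mollifier (e j)) (\<lambda>y. Du y $ i) x\<bar> ^ p \<le> Z x) \<and>
      (\<lambda>j. convol (mollifier (e j)) (\<lambda>y. Du y $ i) x) \<longlonglongrightarrow> Du x $ i)" by blast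
  from choice[OF this] obtain Z1 where Z10: "\<forall>i. integrable lborel (Z1 i) \<and> (\<forall>x. Z1 i x \<ge> 0) \<and>
    (AE x in lborel. (\<forall>j. \<bar>convol (mollifier (e j)) (\<lambda>y. Du y $ i) x\<bar> ^ p \<le> Z1 i x) \<and>
      (\<lambda>j. convol (mollifier (e j)) (\<lambda>y. Du y $ i) x) \<longlonglongrightarrow> Du x $ i)" ..
  have Z1: "\<And>i. integrable lborel (Z1 i)" "\<And>i x. Z1 i x \<ge> 0"
    "\<And>i. AE x in lborel. (\<forall>j. \<bar>convol (mollifier (e j)) (\<lambda>y. Du y $ i) x\<bar> ^ p \<le> Z1 i x) \<and>
      (\<lambda>j. convol (mollifier (e j)) (\<lambda>y. Du y $ i) x) \<longlonglongrightarrow> Du x $ i"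
    using Z10 by blast+
  \<comment> \<open>The factor stems from \<open>norm_vec_power_le\<close>, which passes from the
    components of the gradient to its norm.\<close>
  define Z where "Z x = Z0 x + real CARD('n) ^ p * (\<Sum>i\<in>UNIV. Z1 i x)" for x
  show thesis
  proof (rule that[OF C1])
    show "integrable lborel Z" unfolding Z_def[abs_def]
      using Z0(1) Z1(1) by (intro Bochner_Integration.integrable_add integrable_mult_right Bochner_Integration.integrable_sum)
    show "Z x \<ge> 0" for x unfolding Z_def by (intro add_nonneg_nonneg mult_nonneg_nonneg sum_nonneg Z0 Z1) auto
    have "AE x in lborel. \<forall>i. (\<forall>j. \<bar>convol (mollifier (e j)) (\<lambda>y. Du y $ i) x\<bar> ^ p \<le> Z1 i x) \<and>
      (\<lambda>j. convol (mollifier (e j)) (\<lambda>y. Du y $ i) x) \<longlonglongrightarrow> Du x $ i"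
      by (rule eventually_all_finite[OF Z1(3)])
    with Z0(3) show "AE x in lborel. norm x < \<rho> \<longrightarrow> (\<forall>j. \<bar>v j x\<bar> ^ p \<le> Z x \<and> norm (V j x) ^ p \<le> Z x) \<and>
       (\<lambda>j. v j x) \<longlonglongrightarrow> u x \<and> (\<lambda>j. V j x) \<longlonglongrightarrow> Du x"
    proof eventually_elim
      case (elim x)
      show ?case
      proof (intro impI conjI allI)
        assume x: "norm x < \<rho>"
        fix j
        have s0: "(\<Sum>i\<in>UNIV. Z1 i x) \<ge> 0" by (intro sum_nonneg Z1)
        show "\<bar>v j x\<bar> ^ p \<le> Z x" using elim s0 by (auto simp: Z_def intro: add_increasing2)
        have "norm (V j x) ^ p \<le> real CARD('n) ^ p * (\<Sum>i\<in>UNIV. \<bar>V j x $ i\<bar> ^ p)" by (rule norm_vec_power_le)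
        also have "\<dots> \<le> real CARD('n) ^ p * (\<Sum>i\<in>UNIV. Z1 i x)"
          using elim by (intro mult_left_mono sum_mono) (auto simp: VD[OF x])
        also have "\<dots> \<le> Z x" using Z0(2) by (simp add: Z_def)
        finally show "norm (V j x) ^ p \<le> Z x" .
      next
        show "(\<lambda>j. v j x) \<longlonglongrightarrow> u x" using elim by blast
      next
        assume x: "norm x < \<rho>"
        show "(\<lambda>j. V j x) \<longlonglongrightarrow> Du x"
          by (rule vec_tendstoI) (use elim in \<open>auto simp: VD[OF x]\<close>)
      qed
    qed
  qed
qed

section \<open>The Caccioppoli inequality\<close>

text \<open>Young's inequality with crude constants: the smaller factor is replaced by the larger
  one.\<close>

lemma mult_power_le:
  fixes x y :: real
  assumes "x \<ge> 0" "y \<ge> 0"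
  shows "x * y ^ m \<le> x ^ Suc m + y ^ Suc m"
proof (cases "x \<le> y")
  case True
  then have "x * y ^ m \<le> y * y ^ m" using assms by (intro mult_right_mono) auto
  then show ?thesis using assms by (simp add: add_increasing)
next
  case False
  then have "x * y ^ m \<le> x * x ^ m" using assms by (intro mult_left_mono power_mono) auto
  then show ?thesis using assms by (simp add: add_increasing2)
qed

lemma compact_support_integrable:
  fixes f :: "'a::euclidean_space \<Rightarrow> 'b::euclidean_space"
  assumes f: "continuous_on UNIV f" "\<And>x. norm x > \<rho> \<Longrightarrow> f x = 0"
  shows "integrable lborel f"
proof -
  obtain B where B: "B > 0" "\<And>x. norm (f x) \<le> B" by (rule compact_support_bounded[OF f]) auto
  have "integrable lborel (\<lambda>x :: 'a. B * indicator (cball 0 \<rho>) x)"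
    using emeasure_lborel_cball_finite[of "0 :: 'a" \<rho>] by simp
  then show ?thesis
  proof (rule Bochner_Integration.integrable_bound)
    show "f \<in> borel_measurable lborel"
      using f(1) by (simp add: borel_measurable_continuous_onI)
    have "norm (f x) \<le> norm (B * indicator (cball 0 \<rho>) x)" for x
      using B(1) B(2)[of x] f(2)[of x] by (cases "norm x > \<rho>") auto
    then show "AE x in lborel. norm (f x) \<le> norm (B * indicator (cball 0 \<rho>) x)" by simp
  qed
qed

text \<open>The data of the equation on \<open>ball 0 P\<close>, extended by 0: \<open>A\<close> and \<open>B\<close> stand for the composites
  \<open>\<A>(x, u, u\<^sub>x)\<close> and \<open>\<B>(x, u, u\<^sub>x)\<close>, and \<open>\<beta> ^ (n - 1)\<close> for the coefficient \<open>b\<close>. The function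
  \<open>v\<close> is a smooth substitute for \<open>\<bar>u\<bar> + \<kappa>\<close>; the factors \<open>2 ^ n\<close> make up for the difference.\<close>
locale elliptic_ball =
  fixes u B \<beta> c d v :: "real^'n::finite \<Rightarrow> real" and Du A :: "real^'n \<Rightarrow> real^'n"
    and P a \<kappa> :: real and n m :: nat
  assumes n: "n = CARD('n)" "n = Suc m" "m \<ge> 1"
    and P: "0 < P" "P \<le> 2" and a: "0 \<le> a" and \<kappa>: "0 < \<kappa>"
    and meas [measurable]: "u \<in> borel_measurable borel" "B \<in> borel_measurable borel"
      "\<beta> \<in> borel_measurable borel" "c \<in> borel_measurable borel" "d \<in> borel_measurable borel"
      "Du \<in> borel_measurable borel" "A \<in> borel_measurable borel"
    and outside: "\<And>x. P \<le> norm x \<Longrightarrow> u x = 0 \<and> Du x = 0 \<and> A x = 0 \<and> B x = 0 \<and> \<beta> x = 0 \<and> c x = 0 \<and> d x = 0"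
    and nonneg: "\<And>x. 0 \<le> \<beta> x" "\<And>x. 0 \<le> c x" "\<And>x. 0 \<le> d x"
    and v: "\<And>x. v x = sqrt ((u x)\<^sup>2 + \<kappa>\<^sup>2)"
    and A_le: "\<And>x. norm (A x) \<le> a * norm (Du x) ^ m + 2 ^ n * (\<beta> x * v x) ^ m"
    and B_le: "\<And>x. \<bar>B x\<bar> \<le> c x * norm (Du x) ^ m + 2 ^ n * (d x * v x ^ m)"
    and coercive: "\<And>x. Du x \<bullet> A x \<ge> norm (Du x) ^ n - 2 ^ n * (d x * v x ^ n)"
    and u_int: "integrable lborel (\<lambda>x. \<bar>u x\<bar> ^ n)" and Du_int: "integrable lborel (\<lambda>x. norm (Du x) ^ n)"
    and V_int: "integrable lborel (\<lambda>x. (\<beta> x ^ n + c x ^ n + d x) * v x ^ n)"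
    and weak_gradient: "\<And>\<phi> i. \<phi> \<in> test_functions (ball 0 P) \<Longrightarrow>
      (\<integral>x. u x * partial_deriv i \<phi> x \<partial>lborel) = - (\<integral>x. Du x $ i * \<phi> x \<partial>lborel)"
    and weak_equation: "\<And>\<phi>. \<phi> \<in> test_functions (ball 0 P) \<Longrightarrow>
      (\<integral>x. grad \<phi> x \<bullet> A x + \<phi> x * B x \<partial>lborel) = 0"
begin

definition V where "V x = \<beta> x ^ n + c x ^ n + d x"

text \<open>The common majorant for integrands built from \<open>A\<close> and \<open>B\<close>. The
  indicator gives \<open>Q \<ge> 1\<close> on the ball, so that \<open>A_mult_le\<close> with
  \<open>t = 1\<close> makes \<open>A\<close> itself integrable.\<close>

definition Q where "Q x = norm (Du x) ^ n + V x * v x ^ n + indicator (ball 0 P) x"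

definition CA where "CA = a + 2 ^ n"

lemma v_measurable [measurable]: "v \<in> borel_measurable borel"
  unfolding v[abs_def] by measurable

lemma V_measurable [measurable]: "V \<in> borel_measurable borel"
  unfolding V_def[abs_def] by measurable

lemma v_ge: "\<kappa> \<le> v x" "\<bar>u x\<bar> \<le> v x" "0 < v x"
proof -
  show "\<kappa> \<le> v x" unfolding v using \<kappa> by (intro real_le_rsqrt) auto
  show "\<bar>u x\<bar> \<le> v x" unfolding v by (intro real_le_rsqrt) auto
  show "0 < v x" using \<open>\<kappa> \<le> v x\<close> \<kappa> by linarith
qed

lemma V_nonneg: "0 \<le> V x"
  unfolding V_def using nonneg by simp

lemma CA: "CA \<ge> 0" using a by (simp add: CA_def)

lemma Q_nonneg: "0 \<le> Q x"
  unfolding Q_def using V_nonneg v_ge(3)[of x] by (simp add: less_imp_le)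

lemma indicator_ball_integrable: "integrable lborel (indicator (ball 0 P) :: real^'n \<Rightarrow> real)"
proof -
  have "emeasure lborel (ball 0 P :: (real^'n) set) \<le> emeasure lborel (cball 0 P :: (real^'n) set)"
    by (intro emeasure_mono) auto
  also have "\<dots> < \<infinity>" by (rule emeasure_lborel_cball_finite)
  finally show ?thesis by simp
qed

lemma Q_integrable: "integrable lborel Q"
  unfolding Q_def[abs_def]
  using Du_int V_int indicator_ball_integrable by (intro Bochner_Integration.integrable_add) (auto simp: V_def)

lemma V_parts: "\<beta> x ^ n * v x ^ n \<le> V x * v x ^ n" "c x ^ n * v x ^ n \<le> V x * v x ^ n" "d x * v x ^ n \<le> V x * v x ^ n"
  using nonneg[of x] v_ge(3)[of x] by (auto simp: V_def intro!: mult_right_mono)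

text \<open>\<open>A\<close> grows with degree \<open>n - 1\<close>; one extra factor
  \<open>t\<close> restores degree \<open>n\<close>, and Young's inequality separates it from
  \<open>norm (Du x)\<close> and from \<open>\<beta> x * v x\<close>.\<close>

lemma A_mult_le:
  assumes t: "t \<ge> 0" shows "norm (A x) * t \<le> CA * (t ^ n + Q x)"
proof -
  have bv: "\<beta> x * v x \<ge> 0" using nonneg(1)[of x] v_ge(3)[of x] by simp
  have "norm (A x) * t \<le> (a * norm (Du x) ^ m + 2 ^ n * (\<beta> x * v x) ^ m) * t"
    using A_le t by (intro mult_right_mono) auto
  also have "\<dots> = a * (t * norm (Du x) ^ m) + 2 ^ n * (t * (\<beta> x * v x) ^ m)"
    by (simp add: algebra_simps)
  also have "\<dots> \<le> a * (t ^ n + norm (Du x) ^ n) + 2 ^ n * (t ^ n + (\<beta> x * v x) ^ n)"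
    unfolding n(2) using t a bv by (intro add_mono mult_left_mono mult_power_le) auto
  also have "\<dots> \<le> a * (t ^ n + Q x) + 2 ^ n * (t ^ n + Q x)"
  proof -
    have "norm (Du x) ^ n \<le> Q x" "(\<beta> x * v x) ^ n \<le> Q x"
    proof -
      have "0 \<le> norm (Du x) ^ n" "0 \<le> (indicator (ball 0 P) x :: real)" by simp_all
      moreover have "0 \<le> V x * v x ^ n" using V_nonneg[of x] v_ge(3)[of x] by simp
      ultimately show "norm (Du x) ^ n \<le> Q x" "(\<beta> x * v x) ^ n \<le> Q x"
        using V_parts(1)[of x] unfolding Q_def power_mult_distrib by linarith+
    qed
    then show ?thesis using a by (intro add_mono mult_left_mono add_left_mono) auto
  qed
  finally show ?thesis by (simp add: CA_def algebra_simps)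
qed

text \<open>After multiplication by \<open>v\<close> every term has degree \<open>n\<close>. The
  coefficient \<open>c\<close> appears to the power \<open>n\<close> by Young's inequality,
  \<open>d\<close> linearly, which is how they occur in \<open>V\<close>.\<close>

lemma B_mult_le: "\<bar>B x\<bar> * v x \<le> 2 ^ n * Q x"
proof -
  have cv: "c x * v x \<ge> 0" using nonneg(2)[of x] v_ge(3)[of x] by simp
  have "\<bar>B x\<bar> * v x \<le> (c x * norm (Du x) ^ m + 2 ^ n * (d x * v x ^ m)) * v x"
    using B_le v_ge(3)[of x] by (intro mult_right_mono) auto
  also have "\<dots> = (c x * v x) * norm (Du x) ^ m + 2 ^ n * (d x * v x ^ n)"
    by (simp add: n(2) algebra_simps)
  also have "\<dots> \<le> ((c x * v x) ^ n + norm (Du x) ^ n) + 2 ^ n * (d x * v x ^ n)"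
    unfolding n(2) using cv by (intro add_right_mono mult_power_le) auto
  also have "\<dots> \<le> 2 ^ n * (c x ^ n * v x ^ n + norm (Du x) ^ n + d x * v x ^ n)"
  proof -
    have "1 * ((c x * v x) ^ n + norm (Du x) ^ n) \<le> 2 ^ n * ((c x * v x) ^ n + norm (Du x) ^ n)"
      using cv by (intro mult_right_mono) auto
    then show ?thesis by (simp add: power_mult_distrib distrib_left)
  qed
  also have "\<dots> \<le> 2 ^ n * Q x"
    using nonneg[of x] v_ge(3)[of x] unfolding Q_def V_def
    by (intro mult_left_mono) (auto simp: distrib_right intro!: mult_nonneg_nonneg)
  finally show ?thesis .
qed

lemma A_le_Q: "norm (A x) \<le> 2 * CA * Q x"
proof (cases "P \<le> norm x")
  case True then show ?thesis using outside Q_nonneg[of x] CA by simp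
next
  case False
  then have "1 \<le> Q x" using V_nonneg[of x] v_ge(3)[of x] by (simp add: Q_def)
  then have "CA * (1 + Q x) \<le> CA * (2 * Q x)" using CA by (intro mult_left_mono) auto
  then show ?thesis using A_mult_le[of 1 x] by simp
qed

text \<open>Dividing by the lower bound of \<open>v\<close> brings in \<open>1 / \<kappa>\<close>.
  The bound serves integrability and domination and does not reach the final constants.\<close>

lemma B_le_Q: "\<bar>B x\<bar> \<le> 2 ^ n / \<kappa> * Q x"
proof -
  have "\<bar>B x\<bar> * \<kappa> \<le> \<bar>B x\<bar> * v x" using v_ge by (intro mult_left_mono) auto
  also have "\<dots> \<le> 2 ^ n * Q x" by (rule B_mult_le)
  finally show ?thesis using \<kappa> by (simp add: field_simps)
qed

lemma integrable_le_Q: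
  fixes f :: "real^'n \<Rightarrow> 'b::{banach, second_countable_topology}"
  assumes "f \<in> borel_measurable borel" "\<And>x. norm (f x) \<le> C * Q x"
  shows "integrable lborel f"
proof (rule Bochner_Integration.integrable_bound)
  show "integrable lborel (\<lambda>x. C * Q x)" using Q_integrable by simp
  show "AE x in lborel. norm (f x) \<le> norm (C * Q x)"
    using assms(2) by (intro AE_I2) (metis abs_ge_self order_trans real_norm_def)
qed (use assms(1) in simp)

lemma A_integrable: "integrable lborel A"
  by (rule integrable_le_Q[OF meas(7) A_le_Q])

lemma B_integrable: "integrable lborel B"
  by (rule integrable_le_Q[OF meas(2), where C="2 ^ n / \<kappa>"]) (simp only: real_norm_def B_le_Q)

lemma v_power_integrable: "integrable lborel (\<lambda>x. indicator (ball 0 P) x * v x ^ n)"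
proof (rule Bochner_Integration.integrable_bound)
  show "integrable lborel (\<lambda>x. 2 ^ n * (\<bar>u x\<bar> ^ n + \<kappa> ^ n * indicator (ball 0 P) x))"
    using u_int indicator_ball_integrable
    by (intro integrable_mult_right Bochner_Integration.integrable_add) auto
  have "v x ^ n \<le> 2 ^ n * (\<bar>u x\<bar> ^ n + \<kappa> ^ n)" for x
  proof -
    have "v x \<le> \<bar>u x\<bar> + \<kappa>" unfolding v
      using \<kappa> by (intro real_le_lsqrt) (auto simp: power2_sum)
    then have "v x ^ n \<le> \<bar>\<bar>u x\<bar> + \<kappa>\<bar> ^ n" using v_ge(3)[of x] by (intro power_mono) auto
    also have "\<dots> \<le> 2 ^ n * (\<bar>u x\<bar> ^ n + \<kappa> ^ n)" using power_abs_add_le[of "\<bar>u x\<bar>" \<kappa> n] \<kappa> by simp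
    finally show ?thesis .
  qed
  then show "AE x in lborel. norm (indicator (ball 0 P) x * v x ^ n) \<le> norm (2 ^ n * (\<bar>u x\<bar> ^ n + \<kappa> ^ n * indicator (ball 0 P) x))"
    using v_ge(3) \<kappa> by (intro AE_I2) (auto simp: indicator_def abs_mult less_imp_le)
  show "(\<lambda>x. indicator (ball 0 P) x * v x ^ n) \<in> borel_measurable lborel"
    by (intro borel_measurable_times borel_measurable_indicator borel_measurable_power) (use v_measurable in simp_all)
qed

text \<open>Mollifying a C1 function supported inside the ball gives genuine test functions whose
  values and gradients converge uniformly; as \<open>A\<close> and \<open>B\<close> are integrable,
  the equation survives the limit.\<close>

lemma weak_equation_C1:
  assumes \<phi>: "C1_grad \<phi> \<Phi>" and supp: "\<And>x. norm x \<ge> \<rho> \<Longrightarrow> \<phi> x = 0" and \<rho>: "\<rho> < P"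
  shows "(\<integral>x. \<Phi> x \<bullet> A x + \<phi> x * B x \<partial>lborel) = 0"
proof -
  have \<Phi>0: "\<Phi> x = 0" if "norm x > \<rho>" for x
    by (rule C1_grad_zero_outside[OF \<phi>, where S="- cball 0 \<rho>"]) (use that supp in auto)
  have \<phi>0: "\<phi> x = 0" if "norm x > \<rho>" for x using supp that by simp
  note \<phi>c = C1_grad_continuous[OF \<phi>] and \<Phi>c = C1_gradD(2)[OF \<phi>]
  have [measurable]: "\<phi> \<in> borel_measurable borel" "\<Phi> \<in> borel_measurable borel"
    using C1_grad_measurable[OF \<phi>] by auto
  obtain K1 where K1: "\<And>x. norm (\<phi> x) \<le> K1" by (rule compact_support_bounded[OF \<phi>c \<phi>0]) auto
  obtain K2 where K2: "\<And>x. norm (\<Phi> x) \<le> K2" by (rule compact_support_bounded[OF \<Phi>c \<Phi>0]) auto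
  have intA: "integrable lborel (\<lambda>x. F x \<bullet> A x)"
    if [measurable]: "F \<in> borel_measurable borel" and "\<And>x. norm (F x) \<le> K" for F :: "real^'n \<Rightarrow> real^'n" and K
  proof (rule Bochner_Integration.integrable_bound)
    show "integrable lborel (\<lambda>x. K * norm (A x))" using A_integrable by simp
    have "norm (F x \<bullet> A x) \<le> norm (K * norm (A x))" for x
      using Cauchy_Schwarz_ineq2[of "F x" "A x"] mult_right_mono[OF that(2)[of x] norm_ge_zero[of "A x"]] by auto
    then show "AE x in lborel. norm (F x \<bullet> A x) \<le> norm (K * norm (A x))" by simp
  qed measurable
  have intB: "integrable lborel (\<lambda>x. f x * B x)"
    if [measurable]: "f \<in> borel_measurable borel" and "\<And>x. norm (f x) \<le> K" for f :: "real^'n \<Rightarrow> real" and K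
  proof (rule Bochner_Integration.integrable_bound)
    show "integrable lborel (\<lambda>x. K * \<bar>B x\<bar>)" using B_integrable by simp
    have "norm (f x * B x) \<le> norm (K * \<bar>B x\<bar>)" for x
    proof -
      have "norm (f x * B x) \<le> K * \<bar>B x\<bar>"
        using mult_right_mono[OF that(2)[of x] abs_ge_zero[of "B x"]] by (simp add: abs_mult)
      also have "\<dots> \<le> norm (K * \<bar>B x\<bar>)" by (simp only: real_norm_def abs_ge_self)
      finally show ?thesis .
    qed
    then show "AE x in lborel. norm (f x * B x) \<le> norm (K * \<bar>B x\<bar>)" by simp
  qed measurable
  have int1: "integrable lborel (\<lambda>x. \<Phi> x \<bullet> A x + \<phi> x * B x)"
    by (intro Bochner_Integration.integrable_add intA[OF _ K2] intB[OF _ K1]) auto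
  define M where "M = (\<integral>x. norm (A x) + \<bar>B x\<bar> \<partial>lborel)"
  have M: "M \<ge> 0" unfolding M_def by (intro integral_nonneg_AE) auto
  have close: "\<bar>\<integral>x. \<Phi> x \<bullet> A x + \<phi> x * B x \<partial>lborel\<bar> \<le> \<omega> * M" if \<omega>: "\<omega> > 0" for \<omega>
  proof -
    obtain d1 where d1: "d1 > 0" "\<And>x y. dist x y < d1 \<Longrightarrow> dist (\<phi> x) (\<phi> y) < \<omega>"
      by (rule compact_support_uniformly_continuous[OF \<phi>c \<phi>0 \<omega>]) auto
    obtain d2 where d2: "d2 > 0" "\<And>x y. dist x y < d2 \<Longrightarrow> dist (\<Phi> x) (\<Phi> y) < \<omega>"
      by (rule compact_support_uniformly_continuous[OF \<Phi>c \<Phi>0 \<omega>]) auto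
    \<comment> \<open>Below both moduli of continuity, and below \<open>P - \<rho>\<close> so that
      the mollified function is still supported in the ball.\<close>
    define e where "e = min (min d1 d2) (P - \<rho>) / 2"
    have e: "0 < e" "e < d1" "e < d2" "e < P - \<rho>" using d1(1) d2(1) \<rho> by (auto simp: e_def min_def)
    define \<psi> where "\<psi> = convol (mollifier e) \<phi>"
    define \<Psi> where "\<Psi> x = (\<integral>y. mollifier e y *\<^sub>R \<Phi> (x - y) \<partial>lborel)" for x
    have \<phi>_int: "integrable lborel \<phi>"
      by (rule compact_support_integrable[OF \<phi>c \<phi>0])
    have \<psi>_alt: "\<psi> = convol \<phi> (mollifier e)"
      unfolding \<psi>_def by (intro ext convol_commute) auto
    have \<psi>C: "C1_grad \<psi> \<Psi>"
      unfolding \<psi>_alt \<Psi>_def[abs_def] by (rule convol_C1_grad[OF \<phi> \<phi>0 mollifier_integrable[OF e(1)]])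
    have "closure {x. \<psi> x \<noteq> 0} \<subseteq> cball 0 (\<rho> + e)"
    proof (rule closure_minimal)
      show "{x. \<psi> x \<noteq> 0} \<subseteq> cball 0 (\<rho> + e)"
      proof (rule subsetI, rule ccontr)
        fix x assume x: "x \<in> {x. \<psi> x \<noteq> 0}" "x \<notin> cball 0 (\<rho> + e)"
        have "mollifier e (x - y) * \<phi> y = 0" for y
          using norm_triangle_ineq2[of x "x - y"] x(2) mollifier_zero[OF e(1), of "x - y"] \<phi>0[of y]
          by (cases "norm (x - y) < e") auto
        then have "\<psi> x = (\<integral>(y::real^'n). 0 \<partial>lborel)"
          unfolding \<psi>_def convol_def by (intro Bochner_Integration.integral_cong) auto
        then show False using x(1) by simp
      qed
    qed simp
    moreover have "cball 0 (\<rho> + e) \<subseteq> (ball 0 P :: (real^'n) set)" using e(4) by auto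
    moreover have "smooth \<psi>"
      unfolding \<psi>_def by (rule convol_smooth[OF mollifier_smooth _ \<phi>_int, of e]) (simp add: mollifier_zero e(1))
    ultimately have "\<psi> \<in> test_functions (ball 0 P)"
      unfolding test_functions_def using compact_eq_bounded_closed bounded_subset[OF bounded_cball] by blast
    from weak_equation[OF this] have z: "(\<integral>x. \<Psi> x \<bullet> A x + \<psi> x * B x \<partial>lborel) = 0"
      by (simp only: C1_grad_grad(1)[OF \<psi>C])
    have c1: "norm (\<Psi> x - \<Phi> x) \<le> \<omega>" for x
      unfolding \<Psi>_def
    proof (rule mollify_uniform[OF e(1) \<Phi>c \<Phi>0])
      fix y :: "real^'n" assume "norm y < e"
      then have "dist (x - y) x < d2" using e(3) by (simp add: dist_norm)
      from d2(2)[OF this] show "norm (\<Phi> (x - y) - \<Phi> x) \<le> \<omega>" by (simp add: dist_norm)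
    qed
    have c2: "norm (\<psi> x - \<phi> x) \<le> \<omega>" for x
    proof -
      have "norm ((\<integral>y. mollifier e y *\<^sub>R \<phi> (x - y) \<partial>lborel) - \<phi> x) \<le> \<omega>"
      proof (rule mollify_uniform[OF e(1) \<phi>c \<phi>0])
        fix y :: "real^'n" assume "norm y < e"
        then have "dist (x - y) x < d1" using e(2) by (simp add: dist_norm)
        from d1(2)[OF this] show "norm (\<phi> (x - y) - \<phi> x) \<le> \<omega>" by (simp add: dist_norm)
      qed
      then show ?thesis by (simp add: \<psi>_alt convol_def mult.commute)
    qed
    have [measurable]: "\<psi> \<in> borel_measurable borel" "\<Psi> \<in> borel_measurable borel"
      using C1_grad_measurable[OF \<psi>C] by auto
    have int2: "integrable lborel (\<lambda>x. (\<Psi> x - \<Phi> x) \<bullet> A x + (\<psi> x - \<phi> x) * B x)"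
      by (intro Bochner_Integration.integrable_add intA[OF _ c1] intB[OF _ c2]) measurable
    have "(\<integral>x. \<Psi> x \<bullet> A x + \<psi> x * B x \<partial>lborel) =
      (\<integral>x. (\<Phi> x \<bullet> A x + \<phi> x * B x) + ((\<Psi> x - \<Phi> x) \<bullet> A x + (\<psi> x - \<phi> x) * B x) \<partial>lborel)"
      by (intro Bochner_Integration.integral_cong) (auto simp: inner_diff_left algebra_simps)
    also have "\<dots> = (\<integral>x. \<Phi> x \<bullet> A x + \<phi> x * B x \<partial>lborel) + (\<integral>x. (\<Psi> x - \<Phi> x) \<bullet> A x + (\<psi> x - \<phi> x) * B x \<partial>lborel)"
      by (rule Bochner_Integration.integral_add[OF int1 int2])
    finally have "\<bar>\<integral>x. \<Phi> x \<bullet> A x + \<phi> x * B x \<partial>lborel\<bar> = norm (\<integral>x. (\<Psi> x - \<Phi> x) \<bullet> A x + (\<psi> x - \<phi> x) * B x \<partial>lborel)"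
      unfolding z by simp
    also have "\<dots> \<le> (\<integral>x. \<omega> * (norm (A x) + \<bar>B x\<bar>) \<partial>lborel)"
    proof (rule Bochner_Integration.integral_norm_bound_integral[OF int2])
      show "integrable lborel (\<lambda>x. \<omega> * (norm (A x) + \<bar>B x\<bar>))"
        using A_integrable B_integrable by (intro integrable_mult_right Bochner_Integration.integrable_add) auto
      fix x
      have "norm ((\<Psi> x - \<Phi> x) \<bullet> A x + (\<psi> x - \<phi> x) * B x) \<le> norm (\<Psi> x - \<Phi> x) * norm (A x) + \<bar>\<psi> x - \<phi> x\<bar> * \<bar>B x\<bar>"
        using Cauchy_Schwarz_ineq2[of "\<Psi> x - \<Phi> x" "A x"] by (intro norm_triangle_le) (simp add: abs_mult)
      also have "\<dots> \<le> \<omega> * norm (A x) + \<omega> * \<bar>B x\<bar>"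
        using c1[of x] c2[of x] by (intro add_mono mult_right_mono) auto
      finally show "norm ((\<Psi> x - \<Phi> x) \<bullet> A x + (\<psi> x - \<phi> x) * B x) \<le> \<omega> * (norm (A x) + \<bar>B x\<bar>)"
        by (simp add: distrib_left)
    qed
    also have "\<dots> = \<omega> * M" by (simp add: M_def)
    finally show ?thesis .
  qed
  show ?thesis
  proof (rule ccontr)
    let ?I = "\<integral>x. \<Phi> x \<bullet> A x + \<phi> x * B x \<partial>lborel"
    assume "?I \<noteq> 0"
    then have pos: "\<bar>?I\<bar> > 0" by simp
    \<comment> \<open>The estimate \<open>close\<close> with half of
      \<open>\<bar>?I\<bar> / (M + 1)\<close> would bound the integral by half of itself.\<close>
    have "\<bar>?I\<bar> \<le> \<bar>?I\<bar> / 2 / (M + 1) * M" using pos M by (intro close) auto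
    also have "\<dots> = \<bar>?I\<bar> / 2 * (M / (M + 1))" by simp
    also have "\<dots> \<le> \<bar>?I\<bar> / 2 * 1" using M by (intro mult_left_mono) auto
    finally show False using pos by simp
  qed
qed

end

text \<open>Product and chain rule for the standard test function, a cut-off to the power
  \<open>n = Suc m\<close> times a nonlinear function of \<open>w\<close>. The case
  \<open>m = 0\<close> serves the function that is put into Trudinger's inequality.\<close>

lemma C1_grad_cutoff:
  fixes w \<eta> :: "'a::euclidean_space \<Rightarrow> real"
  assumes w: "C1_grad w W" and \<eta>: "C1_grad \<eta> E"
    and \<Psi>: "\<And>t. (\<Psi> has_real_derivative \<psi> t) (at t)" "continuous_on UNIV \<psi>"
  shows "C1_grad (\<lambda>x. \<eta> x ^ Suc m * \<Psi> (w x))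
    (\<lambda>x. (\<eta> x ^ Suc m * \<psi> (w x)) *\<^sub>R W x + (real (Suc m) * \<eta> x ^ m * \<Psi> (w x)) *\<^sub>R E x)"
  unfolding C1_grad_def
proof (intro conjI allI)
  have \<Psi>c: "continuous_on UNIV \<Psi>"
    using DERIV_isCont[OF \<Psi>(1)] by (simp add: continuous_on_eq_continuous_at)
  have c: "continuous_on UNIV (\<lambda>x. \<psi> (w x))" "continuous_on UNIV (\<lambda>x. \<Psi> (w x))"
    by (rule continuous_on_compose2[OF \<Psi>(2) C1_grad_continuous[OF w]], simp,
        rule continuous_on_compose2[OF \<Psi>c C1_grad_continuous[OF w]], simp)
  show "continuous_on UNIV (\<lambda>x. (\<eta> x ^ Suc m * \<psi> (w x)) *\<^sub>R W x + (real (Suc m) * \<eta> x ^ m * \<Psi> (w x)) *\<^sub>R E x)"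
    using c C1_grad_continuous[OF \<eta>] C1_gradD(2)[OF \<eta>] C1_gradD(2)[OF w]
    by (intro continuous_on_add continuous_on_scaleR continuous_on_mult continuous_on_power continuous_on_const)
  fix x
  have 1: "((\<lambda>x. \<Psi> (w x)) has_derivative (\<lambda>h. \<psi> (w x) * (W x \<bullet> h))) (at x)"
    by (rule has_derivative_compose[OF C1_gradD(1)[OF w]]) (use \<Psi>(1)[of "w x"] in \<open>simp add: has_field_derivative_def\<close>)
  have 2: "((\<lambda>x. \<eta> x ^ Suc m) has_derivative (\<lambda>h. real (Suc m) * (E x \<bullet> h) * \<eta> x ^ m)) (at x)"
    using has_derivative_power[OF C1_gradD(1)[OF \<eta>, of x], of "Suc m"] by (simp add: mult_ac)
  show "((\<lambda>x. \<eta> x ^ Suc m * \<Psi> (w x)) has_derivative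
      (\<lambda>h. ((\<eta> x ^ Suc m * \<psi> (w x)) *\<^sub>R W x + (real (Suc m) * \<eta> x ^ m * \<Psi> (w x)) *\<^sub>R E x) \<bullet> h)) (at x)"
    using has_derivative_mult[OF 2 1]
    by (rule has_derivative_eq_rhs) (auto simp: inner_add_left algebra_simps)
qed

section \<open>Testing the equation with nonlinear functions of the solution\<close>

context elliptic_ball
begin

lemma smooth_approximation:
  assumes "\<rho> < P"
  obtains w W Z where "\<And>j::nat. C1_grad (w j) (W j)" "integrable lborel Z" "\<And>x. Z x \<ge> 0"
    "AE x in lborel. norm x < \<rho> \<longrightarrow> (\<forall>j. \<bar>w j x\<bar> ^ n \<le> Z x \<and> norm (W j x) ^ n \<le> Z x) \<and>
       (\<lambda>j. w j x) \<longlonglongrightarrow> u x \<and> (\<lambda>j. W j x) \<longlonglongrightarrow> Du x"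
proof (rule Sobolev_smooth_approximation[OF meas(1) meas(6) u_int Du_int, of P \<rho>])
  show "norm x > P \<Longrightarrow> u x = 0" "norm x > P \<Longrightarrow> Du x = 0" for x using outside[of x] by simp_all
  show "1 \<le> n" using n(2) by simp
qed (use weak_gradient assms that in auto)

text \<open>With the approximant \<open>w j\<close> in place of \<open>u\<close> the test function
  is C1 and admissible; dominated convergence then replaces \<open>w j\<close> by \<open>u\<close>.
  Bounded \<open>\<Psi>\<close> and \<open>\<psi>\<close> keep the integrands below multiples of
  \<open>Z\<close> and \<open>Q\<close>.\<close>

lemma weak_equation_bounded:
  assumes \<eta>: "C1_grad \<eta> E" "\<And>x. 0 \<le> \<eta> x" "\<And>x. \<eta> x \<le> 1" "\<And>x. norm x \<ge> \<rho> \<Longrightarrow> \<eta> x = 0" and \<rho>: "\<rho> < P"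
    and \<Psi>: "\<And>t. (\<Psi> has_real_derivative \<psi> t) (at t)" "continuous_on UNIV \<psi>"
    and bound: "\<And>t. \<bar>\<Psi> t\<bar> \<le> K" "\<And>t. \<bar>\<psi> t\<bar> \<le> K"
  shows "(\<integral>x. ((\<eta> x ^ n * \<psi> (u x)) *\<^sub>R Du x + (real n * \<eta> x ^ m * \<Psi> (u x)) *\<^sub>R E x) \<bullet> A x
      + (\<eta> x ^ n * \<Psi> (u x)) * B x \<partial>lborel) = 0"
proof -
  \<comment> \<open>Strictly between the support radius of the cut-off and \<open>P\<close>: inside,
    the approximants converge; outside, \<open>\<eta>\<close> and \<open>E\<close> vanish.\<close>
  define \<rho>' where "\<rho>' = (\<rho> + P) / 2"
  have \<rho>': "\<rho> < \<rho>'" "\<rho>' < P" using \<rho> by (auto simp: \<rho>'_def)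
  obtain w W Z where C: "\<And>j::nat. C1_grad (w j) (W j)" and Z: "integrable lborel Z" "\<And>x. Z x \<ge> 0"
    and conv: "AE x in lborel. norm x < \<rho>' \<longrightarrow> (\<forall>j. \<bar>w j x\<bar> ^ n \<le> Z x \<and> norm (W j x) ^ n \<le> Z x) \<and>
       (\<lambda>j. w j x) \<longlonglongrightarrow> u x \<and> (\<lambda>j. W j x) \<longlonglongrightarrow> Du x"
    by (rule smooth_approximation[OF \<rho>'(2)]) blast
  have E0: "E x = 0" if "norm x > \<rho>" for x
    by (rule C1_grad_zero_outside[OF \<eta>(1), where S="- cball 0 \<rho>"]) (use that \<eta>(4) in auto)
  obtain KE where KE: "KE > 0" "\<And>x. norm (E x) \<le> KE"
    by (rule compact_support_bounded[OF C1_gradD(2)[OF \<eta>(1)] E0]) auto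
  have K: "K \<ge> 0" using bound(1)[of 0] by linarith
  have \<Psi>c: "continuous_on UNIV \<Psi>"
    using DERIV_isCont[OF \<Psi>(1)] by (simp add: continuous_on_eq_continuous_at)
  have [measurable]: "\<eta> \<in> borel_measurable borel" "E \<in> borel_measurable borel"
    using C1_grad_measurable[OF \<eta>(1)] by auto
  have [measurable]: "w j \<in> borel_measurable borel" "W j \<in> borel_measurable borel" for j
    using C1_grad_measurable[OF C] by auto
  have [measurable]: "\<psi> \<in> borel_measurable borel" "\<Psi> \<in> borel_measurable borel"
    using \<Psi>(2) \<Psi>c by (auto intro: borel_measurable_continuous_onI)
  define F where "F w W x = ((\<eta> x ^ n * \<psi> (w x)) *\<^sub>R W x + (real n * \<eta> x ^ m * \<Psi> (w x)) *\<^sub>R E x) \<bullet> A x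
      + (\<eta> x ^ n * \<Psi> (w x)) * B x" for w :: "real^'n \<Rightarrow> real" and W x
  have zero: "(\<integral>x. F (w j) (W j) x \<partial>lborel) = 0" for j
    unfolding F_def n(2) by (rule weak_equation_C1[OF C1_grad_cutoff[OF C \<eta>(1) \<Psi>], where \<rho>=\<rho>]) (use \<eta>(4) \<rho> in auto)
  define D where "D x = K * (CA * (Z x + Q x)) + real n * K * KE * (2 * CA * Q x) + K * (2 ^ n / \<kappa> * Q x)" for x
  have \<eta>n: "0 \<le> \<eta> x ^ k" "\<eta> x ^ k \<le> 1" for x k using \<eta>(2,3) by (auto intro: power_le_one)
  have "(\<lambda>j. \<integral>x. F (w j) (W j) x \<partial>lborel) \<longlonglongrightarrow> (\<integral>x. F u Du x \<partial>lborel)"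
  proof (rule integral_dominated_convergence)
    show "integrable lborel D" unfolding D_def[abs_def]
      using Z(1) Q_integrable by (intro Bochner_Integration.integrable_add integrable_mult_right)
    show "F u Du \<in> borel_measurable lborel" "F (w j) (W j) \<in> borel_measurable lborel" for j
      unfolding F_def[abs_def] by measurable
    show "AE x in lborel. (\<lambda>j. F (w j) (W j) x) \<longlonglongrightarrow> F u Du x"
      using conv
    proof eventually_elim
      case (elim x)
      show ?case
      proof (cases "norm x < \<rho>'")
        case True
        with elim have l: "(\<lambda>j. w j x) \<longlonglongrightarrow> u x" "(\<lambda>j. W j x) \<longlonglongrightarrow> Du x" by auto
        have "(\<lambda>j. \<psi> (w j x)) \<longlonglongrightarrow> \<psi> (u x)" "(\<lambda>j. \<Psi> (w j x)) \<longlonglongrightarrow> \<Psi> (u x)"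
          using continuous_on_tendsto_compose[OF \<Psi>(2) l(1)] continuous_on_tendsto_compose[OF \<Psi>c l(1)] by auto
        then show ?thesis unfolding F_def using l(2) by (intro tendsto_intros)
      next
        case False
        then have "\<eta> x = 0" "E x = 0" using \<rho>' E0[of x] \<eta>(4)[of x] by auto
        then show ?thesis using n(2) by (simp add: F_def)
      qed
    qed
    show "AE x in lborel. norm (F (w j) (W j) x) \<le> D x" for j
      using conv
    proof eventually_elim
      case (elim x)
      show ?case
      proof (cases "norm x < \<rho>'")
        case True
        have t1: "\<bar>(\<eta> x ^ n * \<psi> (w j x)) * (W j x \<bullet> A x)\<bar> \<le> K * (CA * (Z x + Q x))"
        proof -
          have "\<bar>W j x \<bullet> A x\<bar> \<le> norm (A x) * norm (W j x)" using Cauchy_Schwarz_ineq2 by (metis mult.commute)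
          also have "\<dots> \<le> CA * (norm (W j x) ^ n + Q x)" by (rule A_mult_le) simp
          also have "\<dots> \<le> CA * (Z x + Q x)" using elim True CA by (intro mult_left_mono add_right_mono) auto
          finally have b: "\<bar>W j x \<bullet> A x\<bar> \<le> CA * (Z x + Q x)" .
          have "\<bar>\<eta> x ^ n * \<psi> (w j x)\<bar> \<le> 1 * K" unfolding abs_mult using \<eta>n[of x n] bound(2) by (intro mult_mono) auto
          then have "\<bar>\<eta> x ^ n * \<psi> (w j x)\<bar> * \<bar>W j x \<bullet> A x\<bar> \<le> K * (CA * (Z x + Q x))" using b K by (intro mult_mono) auto
          then show ?thesis by (simp add: abs_mult)
        qed
        have t2: "\<bar>(real n * \<eta> x ^ m * \<Psi> (w j x)) * (E x \<bullet> A x)\<bar> \<le> real n * K * KE * (2 * CA * Q x)"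
        proof -
          have "\<bar>E x \<bullet> A x\<bar> \<le> norm (E x) * norm (A x)" by (rule Cauchy_Schwarz_ineq2)
          also have "\<dots> \<le> KE * (2 * CA * Q x)" using KE A_le_Q[of x] by (intro mult_mono) auto
          finally have b: "\<bar>E x \<bullet> A x\<bar> \<le> KE * (2 * CA * Q x)" .
          have "\<bar>real n * \<eta> x ^ m * \<Psi> (w j x)\<bar> \<le> real n * 1 * K"
            unfolding abs_mult using \<eta>n[of x m] bound(1) by (intro mult_mono) auto
          then have "\<bar>real n * \<eta> x ^ m * \<Psi> (w j x)\<bar> * \<bar>E x \<bullet> A x\<bar> \<le> (real n * 1 * K) * (KE * (2 * CA * Q x))"
            using b K by (intro mult_mono) auto
          then show ?thesis by (simp add: abs_mult mult.assoc)
        qed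
        have t3: "\<bar>(\<eta> x ^ n * \<Psi> (w j x)) * B x\<bar> \<le> K * (2 ^ n / \<kappa> * Q x)"
        proof -
          have "\<bar>\<eta> x ^ n * \<Psi> (w j x)\<bar> \<le> 1 * K" unfolding abs_mult using \<eta>n[of x n] bound(1) by (intro mult_mono) auto
          then have "\<bar>\<eta> x ^ n * \<Psi> (w j x)\<bar> * \<bar>B x\<bar> \<le> K * (2 ^ n / \<kappa> * Q x)" using B_le_Q[of x] K by (intro mult_mono) auto
          then show ?thesis by (simp add: abs_mult)
        qed
        have "F (w j) (W j) x = (\<eta> x ^ n * \<psi> (w j x)) * (W j x \<bullet> A x) + (real n * \<eta> x ^ m * \<Psi> (w j x)) * (E x \<bullet> A x)
            + (\<eta> x ^ n * \<Psi> (w j x)) * B x" by (simp add: F_def inner_add_left)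
        then show ?thesis unfolding D_def real_norm_def using t1 t2 t3 by linarith
      next
        case False
        then have "\<eta> x = 0" "E x = 0" using \<rho>' E0[of x] \<eta>(4)[of x] by auto
        then have "F (w j) (W j) x = 0" using n(2) by (simp add: F_def)
        moreover have "D x \<ge> 0" unfolding D_def using K CA Q_nonneg[of x] Z(2)[of x] KE(1) \<kappa>
          by (intro add_nonneg_nonneg mult_nonneg_nonneg) auto
        ultimately show ?thesis by simp
      qed
    qed
  qed
  then have "(\<lambda>j::nat. 0) \<longlonglongrightarrow> (\<integral>x. F u Du x \<partial>lborel)" unfolding zero .
  then show ?thesis unfolding F_def by (simp add: LIMSEQ_const_iff)
qed

end

text \<open>These maps are the smooth truncations of \<open>weak_equation_Lipschitz\<close>: each is
  bounded, has derivative between 0 and 1, and does not increase absolute values.\<close>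

lemma arctan_truncation_tendsto:
  fixes t :: real
  shows "(\<lambda>k. real (Suc k) * arctan (t / real (Suc k))) \<longlonglongrightarrow> t"
proof (cases "t = 0")
  case False
  have 1: "(\<lambda>k. t / real (Suc k)) \<longlonglongrightarrow> 0" using LIMSEQ_Suc[OF lim_const_over_n[of t]] by simp
  have "((\<lambda>h. (arctan (0 + h) - arctan 0) / h) \<longlongrightarrow> inverse (1 + 0\<^sup>2)) (at 0)"
    by (rule DERIV_arctan[unfolded DERIV_def])
  then have lim: "((\<lambda>h. arctan h / h) \<longlongrightarrow> 1) (at (0::real))" by simp
  have at: "filterlim (\<lambda>k. t / real (Suc k)) (at 0) sequentially"
    by (rule filterlim_atI[OF 1]) (use False in simp)
  from filterlim_compose[OF lim at] have "(\<lambda>k. arctan (t / real (Suc k)) / (t / real (Suc k))) \<longlonglongrightarrow> 1" .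
  from tendsto_mult_left[OF this, of t] have "(\<lambda>k. t * (arctan (t / real (Suc k)) / (t / real (Suc k)))) \<longlonglongrightarrow> t * 1" .
  moreover have "t * (arctan (t / real (Suc k)) / (t / real (Suc k))) = real (Suc k) * arctan (t / real (Suc k))" for k
    using False by (simp del: of_nat_Suc)
  ultimately show ?thesis by simp
qed simp

text \<open>Young's inequality with weight one quarter on the top power. In the Caccioppoli
  inequality two such quarters are absorbed into the coercive term, which leaves a half.\<close>

lemma mult_power_le_eps:
  fixes x y C :: real
  assumes "x \<ge> 0" "y \<ge> 0" "C \<ge> 0"
  shows "C * (x * y ^ m) \<le> y ^ Suc m / 4 + 4 ^ m * C ^ Suc m * x ^ Suc m"
proof (cases "C * x \<le> y / 4")
  case True
  then have "(C * x) * y ^ m \<le> (y / 4) * y ^ m" using assms by (intro mult_right_mono) auto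
  moreover have "0 \<le> 4 ^ m * C ^ Suc m * x ^ Suc m" using assms by simp
  ultimately show ?thesis by (simp add: mult_ac)
next
  case False
  then have "y \<le> 4 * (C * x)" by simp
  then have "(C * x) * y ^ m \<le> (C * x) * (4 * (C * x)) ^ m" using assms by (intro mult_left_mono power_mono) auto
  also have "\<dots> = 4 ^ m * C ^ Suc m * x ^ Suc m" by (simp add: power_mult_distrib mult_ac)
  finally show ?thesis using assms by (simp add: mult.assoc add_increasing)
qed

lemma antiderivative_exists:
  fixes f :: "real \<Rightarrow> real"
  assumes "continuous_on UNIV f"
  obtains F where "\<And>t. (F has_real_derivative f t) (at t)" "F 0 = 0"
proof -
  have "\<exists>F. \<forall>x. -\<infinity> < ereal x \<longrightarrow> ereal x < \<infinity> \<longrightarrow> (F has_vector_derivative f x) (at x)"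
    using assms by (intro einterval_antiderivative) (auto simp: continuous_on_eq_continuous_at)
  then obtain F where F: "\<And>t. (F has_real_derivative f t) (at t)"
    by (auto simp: has_real_derivative_iff_has_vector_derivative)
  have "((\<lambda>t. F t - F 0) has_real_derivative f t) (at t)" for t
    using DERIV_diff[OF F DERIV_const] by simp
  then show thesis using that[of "\<lambda>t. F t - F 0"] by simp
qed

context elliptic_ball
begin

text \<open>Boundedness of \<open>\<Psi>\<close> is traded for linear growth by inserting the arctan
  truncation. The bound of \<open>\<bar>\<Psi> (u x)\<bar>\<close> by \<open>K * v x\<close>
  supplies the factor \<open>v\<close> under which \<open>A\<close> and \<open>B\<close> are
  dominated by \<open>A_mult_le\<close> and \<open>B_mult_le\<close>, so the majorant
  \<open>D\<close> does not depend on the truncation level.\<close>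

lemma weak_equation_Lipschitz:
  assumes \<eta>: "C1_grad \<eta> E" "\<And>x. 0 \<le> \<eta> x" "\<And>x. \<eta> x \<le> 1" "\<And>x. norm x \<ge> \<rho> \<Longrightarrow> \<eta> x = 0" and \<rho>: "\<rho> < P"
    and \<Psi>: "\<And>t. (\<Psi> has_real_derivative \<psi> t) (at t)" "continuous_on UNIV \<psi>"
    and bound: "\<And>t. \<bar>\<Psi> t\<bar> \<le> K * \<bar>t\<bar>" "\<And>t. \<bar>\<psi> t\<bar> \<le> K"
  defines "F \<equiv> \<lambda>x. ((\<eta> x ^ n * \<psi> (u x)) *\<^sub>R Du x + (real n * \<eta> x ^ m * \<Psi> (u x)) *\<^sub>R E x) \<bullet> A x
      + (\<eta> x ^ n * \<Psi> (u x)) * B x"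
  shows "integrable lborel F" "(\<integral>x. F x \<partial>lborel) = 0"
proof -
  have E0: "E x = 0" if "norm x > \<rho>" for x
    by (rule C1_grad_zero_outside[OF \<eta>(1), where S="- cball 0 \<rho>"]) (use that \<eta>(4) in auto)
  obtain KE where KE: "KE > 0" "\<And>x. norm (E x) \<le> KE"
    by (rule compact_support_bounded[OF C1_gradD(2)[OF \<eta>(1)] E0]) auto
  have K: "K \<ge> 0" using bound(2)[of 0] by linarith
  have \<Psi>c: "continuous_on UNIV \<Psi>"
    using DERIV_isCont[OF \<Psi>(1)] by (simp add: continuous_on_eq_continuous_at)
  have [measurable]: "\<eta> \<in> borel_measurable borel" "E \<in> borel_measurable borel"
    using C1_grad_measurable[OF \<eta>(1)] by auto
  have [measurable]: "\<psi> \<in> borel_measurable borel" "\<Psi> \<in> borel_measurable borel"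
    using \<Psi>(2) \<Psi>c by (auto intro: borel_measurable_continuous_onI)
  have \<eta>n: "0 \<le> \<eta> x ^ k" "\<eta> x ^ k \<le> 1" for x k using \<eta>(2,3) by (auto intro: power_le_one)
  define T where "T k t = real (Suc k) * arctan (t / real (Suc k))" for k t
  define T' where "T' k t = inverse (1 + (t / real (Suc k))\<^sup>2)" for k t
  have Td: "(T k has_real_derivative T' k t) (at t)" for k t
    unfolding T_def[abs_def] T'_def by (auto intro!: derivative_eq_intros)
  have T'_cont: "continuous_on UNIV (T' k)" for k
    unfolding T'_def[abs_def] by (intro continuous_intros) (auto simp: add_nonneg_eq_0_iff)
  have T_cont: "continuous_on UNIV (T k)" for k
    using DERIV_isCont[OF Td] by (simp add: continuous_on_eq_continuous_at)
  have [measurable]: "T k \<in> borel_measurable borel" "T' k \<in> borel_measurable borel" for k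
    using T_cont T'_cont by (auto intro: borel_measurable_continuous_onI)
  have T'01: "\<bar>T' k t\<bar> \<le> 1" for k t
  proof -
    have "1 \<le> 1 + (t / real (Suc k))\<^sup>2" by simp
    then have "inverse (1 + (t / real (Suc k))\<^sup>2) \<le> 1" by (rule inverse_le_1_iff[THEN iffD2, OF disjI2])
    moreover have "0 \<le> inverse (1 + (t / real (Suc k))\<^sup>2)" by simp
    ultimately show ?thesis by (simp add: T'_def)
  qed
  have T_le: "\<bar>T k t\<bar> \<le> \<bar>t\<bar>" for k t
  proof -
    have "\<bar>T k t\<bar> = real (Suc k) * \<bar>arctan (t / real (Suc k))\<bar>" by (simp add: T_def abs_mult)
    also have "\<dots> \<le> real (Suc k) * \<bar>t / real (Suc k)\<bar>" by (intro mult_left_mono abs_arctan_le) auto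
    finally show ?thesis by (simp add: abs_divide)
  qed
  have T_bdd: "\<bar>T k t\<bar> \<le> real (Suc k) * (pi / 2)" for k t
    using arctan_bounded[of "t / real (Suc k)"] unfolding T_def abs_mult by (intro mult_mono) auto
  define F0 where "F0 \<psi> \<Psi> x = ((\<eta> x ^ n * \<psi> (u x)) *\<^sub>R Du x + (real n * \<eta> x ^ m * \<Psi> (u x)) *\<^sub>R E x) \<bullet> A x
      + (\<eta> x ^ n * \<Psi> (u x)) * B x" for \<psi> \<Psi> :: "real \<Rightarrow> real" and x
  have zero: "(\<integral>x. F0 (\<lambda>t. \<psi> (T k t) * T' k t) (\<lambda>t. \<Psi> (T k t)) x \<partial>lborel) = 0" for k
    unfolding F0_def
  proof (rule weak_equation_bounded[OF \<eta> \<rho>])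
    show "((\<lambda>t. \<Psi> (T k t)) has_real_derivative \<psi> (T k t) * T' k t) (at t)" for t
      using DERIV_chain2[OF \<Psi>(1) Td] by simp
    show "continuous_on UNIV (\<lambda>t. \<psi> (T k t) * T' k t)"
      by (intro continuous_on_mult T'_cont continuous_on_compose2[OF \<Psi>(2) T_cont]) auto
    have c: "0 \<le> K * (real (Suc k) * (pi / 2))" using K by simp
    have "\<bar>\<Psi> (T k t)\<bar> \<le> K * (real (Suc k) * (pi / 2))" for t
      by (rule order_trans[OF bound(1)]) (intro mult_left_mono T_bdd K)
    then show "\<bar>\<Psi> (T k t)\<bar> \<le> K * (real (Suc k) * (pi / 2)) + K" for t using K by (rule add_increasing2[rotated])
    have "\<bar>\<psi> (T k t) * T' k t\<bar> \<le> K * 1" for t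
      unfolding abs_mult by (intro mult_mono bound(2) T'01 K) auto
    then show "\<bar>\<psi> (T k t) * T' k t\<bar> \<le> K * (real (Suc k) * (pi / 2)) + K" for t using c by (intro add_increasing) auto
  qed
  define D where "D x = K * (CA * (norm (Du x) ^ n + Q x)) + real n * K * KE * (CA * (indicator (ball 0 P) x * v x ^ n + Q x)) + K * (2 ^ n * Q x)" for x
  have D_int: "integrable lborel D" unfolding D_def[abs_def]
    using Du_int v_power_integrable Q_integrable by (intro Bochner_Integration.integrable_add integrable_mult_right)
  have dom: "norm (F0 g G x) \<le> D x" if g: "\<And>t. \<bar>g t\<bar> \<le> K" "\<And>t. \<bar>G t\<bar> \<le> K * \<bar>t\<bar>" for g G x
  proof -
    have t1: "\<bar>(\<eta> x ^ n * g (u x)) * (Du x \<bullet> A x)\<bar> \<le> K * (CA * (norm (Du x) ^ n + Q x))"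
    proof -
      have "\<bar>Du x \<bullet> A x\<bar> \<le> norm (A x) * norm (Du x)" using Cauchy_Schwarz_ineq2 by (metis mult.commute)
      also have "\<dots> \<le> CA * (norm (Du x) ^ n + Q x)" by (rule A_mult_le) simp
      finally have b: "\<bar>Du x \<bullet> A x\<bar> \<le> CA * (norm (Du x) ^ n + Q x)" .
      have "\<bar>\<eta> x ^ n * g (u x)\<bar> \<le> 1 * K" unfolding abs_mult using \<eta>n[of x n] g(1) by (intro mult_mono) auto
      then have "\<bar>\<eta> x ^ n * g (u x)\<bar> * \<bar>Du x \<bullet> A x\<bar> \<le> (1 * K) * (CA * (norm (Du x) ^ n + Q x))" using b K by (intro mult_mono) auto
      then show ?thesis by (simp add: abs_mult)
    qed
    have Gv: "\<bar>G (u x)\<bar> \<le> K * v x" by (rule order_trans[OF g(2)]) (intro mult_left_mono v_ge K)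
    have t2: "\<bar>(real n * \<eta> x ^ m * G (u x)) * (E x \<bullet> A x)\<bar> \<le> real n * K * KE * (CA * (indicator (ball 0 P) x * v x ^ n + Q x))"
    proof -
      have b: "norm (A x) * v x \<le> CA * (indicator (ball 0 P) x * v x ^ n + Q x)"
      proof (cases "norm x < P")
        case True then show ?thesis using A_mult_le[of "v x" x] v_ge(3)[of x] by simp
      next
        case False then show ?thesis using outside[of x] CA Q_nonneg[of x] by simp
      qed
      have "\<bar>(real n * \<eta> x ^ m * G (u x)) * (E x \<bullet> A x)\<bar> = (real n * \<eta> x ^ m) * \<bar>G (u x)\<bar> * \<bar>E x \<bullet> A x\<bar>"
        using \<eta>n[of x m] by (simp add: abs_mult)
      also have "\<dots> \<le> (real n * 1) * (K * v x) * (KE * norm (A x))"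
      proof (intro mult_mono)
        show "\<bar>E x \<bullet> A x\<bar> \<le> KE * norm (A x)"
          by (rule order_trans[OF Cauchy_Schwarz_ineq2]) (intro mult_right_mono KE, simp)
      qed (use \<eta>n[of x m] Gv K v_ge(3)[of x] KE in auto)
      also have "\<dots> = real n * K * KE * (norm (A x) * v x)" by (simp add: mult_ac)
      also have "\<dots> \<le> real n * K * KE * (CA * (indicator (ball 0 P) x * v x ^ n + Q x))"
        using b K KE by (intro mult_left_mono) auto
      finally show ?thesis .
    qed
    have t3: "\<bar>(\<eta> x ^ n * G (u x)) * B x\<bar> \<le> K * (2 ^ n * Q x)"
    proof -
      have "\<bar>(\<eta> x ^ n * G (u x)) * B x\<bar> = \<eta> x ^ n * (\<bar>G (u x)\<bar> * \<bar>B x\<bar>)" using \<eta>n[of x n] by (simp add: abs_mult)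
      also have "\<dots> \<le> 1 * ((K * v x) * \<bar>B x\<bar>)"
        using \<eta>n[of x n] Gv by (intro mult_mono) auto
      also have "\<dots> = K * (\<bar>B x\<bar> * v x)" by simp
      also have "\<dots> \<le> K * (2 ^ n * Q x)" by (intro mult_left_mono B_mult_le K)
      finally show ?thesis .
    qed
    have "F0 g G x = (\<eta> x ^ n * g (u x)) * (Du x \<bullet> A x) + (real n * \<eta> x ^ m * G (u x)) * (E x \<bullet> A x)
        + (\<eta> x ^ n * G (u x)) * B x" by (simp add: F0_def inner_add_left)
    then show ?thesis unfolding D_def real_norm_def using t1 t2 t3 by linarith
  qed
  have F_eq: "F = F0 \<psi> \<Psi>" by (simp add: F_def F0_def fun_eq_iff)
  have [measurable]: "F0 \<psi> \<Psi> \<in> borel_measurable lborel" unfolding F0_def[abs_def] by measurable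
  show "integrable lborel F" unfolding F_eq
  proof (rule Bochner_Integration.integrable_bound[OF D_int])
    show "AE x in lborel. norm (F0 \<psi> \<Psi> x) \<le> norm (D x)"
    proof (rule AE_I2)
      fix x
      have "norm (F0 \<psi> \<Psi> x) \<le> D x" by (rule dom[OF bound(2) bound(1)])
      then show "norm (F0 \<psi> \<Psi> x) \<le> norm (D x)" unfolding real_norm_def[of "D x"] by linarith
    qed
  qed measurable
  have "(\<lambda>k. \<integral>x. F0 (\<lambda>t. \<psi> (T k t) * T' k t) (\<lambda>t. \<Psi> (T k t)) x \<partial>lborel) \<longlonglongrightarrow> (\<integral>x. F0 \<psi> \<Psi> x \<partial>lborel)"
  proof (rule integral_dominated_convergence[OF _ _ D_int])
    show "F0 \<psi> \<Psi> \<in> borel_measurable lborel" by measurable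
    show "F0 (\<lambda>t. \<psi> (T k t) * T' k t) (\<lambda>t. \<Psi> (T k t)) \<in> borel_measurable lborel" for k
      unfolding F0_def[abs_def] by measurable
    show "AE x in lborel. (\<lambda>k. F0 (\<lambda>t. \<psi> (T k t) * T' k t) (\<lambda>t. \<Psi> (T k t)) x) \<longlonglongrightarrow> F0 \<psi> \<Psi> x"
    proof (rule AE_I2)
      fix x
      have 1: "(\<lambda>k. T k (u x)) \<longlonglongrightarrow> u x" unfolding T_def by (rule arctan_truncation_tendsto)
      have 2: "(\<lambda>k. T' k (u x)) \<longlonglongrightarrow> 1"
      proof -
        have "(\<lambda>k. u x / real (Suc k)) \<longlonglongrightarrow> 0" using LIMSEQ_Suc[OF lim_const_over_n[of "u x"]] by simp
        then have "(\<lambda>k. inverse (1 + (u x / real (Suc k))\<^sup>2)) \<longlonglongrightarrow> inverse (1 + 0\<^sup>2)"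
          by (intro tendsto_intros) auto
        then show ?thesis by (simp add: T'_def)
      qed
      have 3: "(\<lambda>k. \<psi> (T k (u x))) \<longlonglongrightarrow> \<psi> (u x)" "(\<lambda>k. \<Psi> (T k (u x))) \<longlonglongrightarrow> \<Psi> (u x)"
        using continuous_on_tendsto_compose[OF \<Psi>(2) 1] continuous_on_tendsto_compose[OF \<Psi>c 1] by auto
      have 4: "(\<lambda>k. \<psi> (T k (u x)) * T' k (u x)) \<longlonglongrightarrow> \<psi> (u x)" using tendsto_mult[OF 3(1) 2] by simp
      show "(\<lambda>k. F0 (\<lambda>t. \<psi> (T k t) * T' k t) (\<lambda>t. \<Psi> (T k t)) x) \<longlonglongrightarrow> F0 \<psi> \<Psi> x"
        unfolding F0_def using 3(2) 4 by (intro tendsto_intros)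
    qed
    show "AE x in lborel. norm (F0 (\<lambda>t. \<psi> (T k t) * T' k t) (\<lambda>t. \<Psi> (T k t)) x) \<le> D x" for k
    proof (intro AE_I2 dom)
      show "\<bar>\<psi> (T k t) * T' k t\<bar> \<le> K" for t
        using mult_mono[OF bound(2)[of "T k t"] T'01[of k t] K] by (simp add: abs_mult)
      show "\<bar>\<Psi> (T k t)\<bar> \<le> K * \<bar>t\<bar>" for t
        by (rule order_trans[OF bound(1)]) (intro mult_left_mono T_le K)
    qed
  qed
  then have "(\<lambda>k::nat. 0) \<longlonglongrightarrow> (\<integral>x. F0 \<psi> \<Psi> x \<partial>lborel)" unfolding zero .
  then show "(\<integral>x. F x \<partial>lborel) = 0" unfolding F_eq by (simp add: LIMSEQ_const_iff)
qed

text \<open>Collects the losses in the tested equation. The first summand comes from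
  \<open>a\<close> in the cut-off term, with Young constant \<open>n * a\<close>; the second from
  \<open>c\<close>; in the third, \<open>n\<close> stems from \<open>\<beta>\<close> in the cut-off
  term and 2 from \<open>d\<close>, which occurs both in the coercivity and in
  \<open>B\<close>.\<close>

definition CC where "CC = 4 ^ m * (real n * a) ^ n + 4 ^ m + 2 ^ n * (real n + 2)"

lemma CC_nonneg: "CC \<ge> 0" using a by (simp add: CC_def)

text \<open>With \<open>\<psi> = h(v) ^ n\<close> and \<open>\<Psi> t = \<integral>\<^sub>0\<^sup>t \<psi>\<close> monotonicity of \<open>h\<close> gives \<open>\<bar>\<Psi>\<bar> \<le> v h(v) ^ n\<close>; this makes the
  constant independent of \<open>h\<close>.\<close>
theorem Caccioppoli:
  assumes \<eta>: "C1_grad \<eta> E" "\<And>x. 0 \<le> \<eta> x" "\<And>x. \<eta> x \<le> 1" "\<And>x. norm x \<ge> \<rho> \<Longrightarrow> \<eta> x = 0" and \<rho>: "\<rho> < P"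
    and h: "continuous_on UNIV h" "\<And>s. 0 \<le> h s" "mono h" "\<And>s. h s \<le> K"
  shows "integrable lborel (\<lambda>x. \<eta> x ^ n * h (v x) ^ n * norm (Du x) ^ n)"
    and "integrable lborel (\<lambda>x. (norm (E x) ^ n + \<eta> x ^ n * V x) * (v x * h (v x)) ^ n)"
    and "(\<integral>x. \<eta> x ^ n * h (v x) ^ n * norm (Du x) ^ n \<partial>lborel)
      \<le> 2 * CC * (\<integral>x. (norm (E x) ^ n + \<eta> x ^ n * V x) * (v x * h (v x)) ^ n \<partial>lborel)"
proof -
  have E0: "E x = 0" if "norm x > \<rho>" for x
    by (rule C1_grad_zero_outside[OF \<eta>(1), where S="- cball 0 \<rho>"]) (use that \<eta>(4) in auto)
  obtain KE where KE: "KE > 0" "\<And>x. norm (E x) \<le> KE"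
    by (rule compact_support_bounded[OF C1_gradD(2)[OF \<eta>(1)] E0]) auto
  have K: "K \<ge> 0" using h(2)[of 0] h(4)[of 0] by linarith
  have [measurable]: "h \<in> borel_measurable borel" using h(1) by (rule borel_measurable_continuous_onI)
  have [measurable]: "\<eta> \<in> borel_measurable borel" "E \<in> borel_measurable borel"
    using C1_grad_measurable[OF \<eta>(1)] by auto
  have \<eta>n: "0 \<le> \<eta> x ^ k" "\<eta> x ^ k \<le> 1" for x k using \<eta>(2,3) by (auto intro: power_le_one)
  have hK: "h s ^ n \<le> K ^ n" for s using h(2,4) by (intro power_mono)
  let ?X = "\<lambda>x. \<eta> x ^ n * h (v x) ^ n * norm (Du x) ^ n"
  let ?Y = "\<lambda>x. (norm (E x) ^ n + \<eta> x ^ n * V x) * (v x * h (v x)) ^ n"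
  \<comment> \<open>The upper bound \<open>K\<close> of \<open>h\<close> secures integrability and
    the admissibility of the test function; it does not appear in the inequality.\<close>
  show X_int: "integrable lborel ?X"
  proof (rule Bochner_Integration.integrable_bound)
    show "integrable lborel (\<lambda>x. K ^ n * norm (Du x) ^ n)" using Du_int by simp
    show "AE x in lborel. norm (?X x) \<le> norm (K ^ n * norm (Du x) ^ n)"
    proof (rule AE_I2)
      fix x
      have "?X x \<le> 1 * K ^ n * norm (Du x) ^ n"
        using \<eta>n[of x n] hK[of "v x"] h(2)[of "v x"] K by (intro mult_mono) auto
      then show "norm (?X x) \<le> norm (K ^ n * norm (Du x) ^ n)" using \<eta>n[of x n] h(2) K by simp
    qed
  qed measurable
  show Y_int: "integrable lborel ?Y"
  proof (rule Bochner_Integration.integrable_bound)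
    show "integrable lborel (\<lambda>x. K ^ n * (KE ^ n * (indicator (ball 0 P) x * v x ^ n) + V x * v x ^ n))"
      using v_power_integrable V_int by (intro integrable_mult_right Bochner_Integration.integrable_add) (auto simp: V_def)
    show "AE x in lborel. norm (?Y x) \<le> norm (K ^ n * (KE ^ n * (indicator (ball 0 P) x * v x ^ n) + V x * v x ^ n))"
    proof (rule AE_I2)
      fix x
      have "norm (E x) ^ n \<le> KE ^ n * indicator (ball 0 P) x"
      proof (cases "norm x < P")
        case True then show ?thesis using KE(2)[of x] by (auto intro!: power_mono)
      next
        case False then show ?thesis using E0[of x] \<rho> n(2) by simp
      qed
      moreover have "\<eta> x ^ n * V x \<le> 1 * V x" using \<eta>n[of x n] V_nonneg[of x] by (intro mult_right_mono) auto
      moreover have vn: "(v x * h (v x)) ^ n \<le> v x ^ n * K ^ n"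
        unfolding power_mult_distrib using hK v_ge(3)[of x] by (intro mult_left_mono) auto
      ultimately have "?Y x \<le> (KE ^ n * indicator (ball 0 P) x + 1 * V x) * (v x ^ n * K ^ n)"
        using h(2) v_ge(3)[of x] \<eta>n[of x n] \<eta>(2)[of x] V_nonneg[of x] KE(1) by (intro mult_mono add_mono) (auto simp: less_imp_le)
      also have "\<dots> = K ^ n * (KE ^ n * (indicator (ball 0 P) x * v x ^ n) + V x * v x ^ n)"
        by (simp add: algebra_simps)
      finally have le: "?Y x \<le> K ^ n * (KE ^ n * (indicator (ball 0 P) x * v x ^ n) + V x * v x ^ n)" .
      have "0 \<le> ?Y x" using \<eta>(2)[of x] h(2)[of "v x"] v_ge(3)[of x] \<eta>n[of x n] V_nonneg[of x]
        by (intro mult_nonneg_nonneg add_nonneg_nonneg zero_le_power) (auto simp: less_imp_le)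
      with le show "norm (?Y x) \<le> norm (K ^ n * (KE ^ n * (indicator (ball 0 P) x * v x ^ n) + V x * v x ^ n))"
        unfolding real_norm_def by linarith
    qed
  qed measurable
  define s where "s t = sqrt (t\<^sup>2 + \<kappa>\<^sup>2)" for t
  have s_u: "s (u x) = v x" for x by (simp add: s_def v)
  define \<psi> where "\<psi> t = h (s t) ^ n" for t
  have \<psi>c: "continuous_on UNIV \<psi>"
    unfolding \<psi>_def[abs_def] s_def by (intro continuous_on_power continuous_on_compose2[OF h(1)] continuous_intros) auto
  obtain \<Psi> where \<Psi>: "\<And>t. (\<Psi> has_real_derivative \<psi> t) (at t)" "\<Psi> 0 = 0"
    by (rule antiderivative_exists[OF \<psi>c]) auto
  have \<psi>_mono: "\<psi> y \<le> \<psi> t" if "\<bar>y\<bar> \<le> \<bar>t\<bar>" for y t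
  proof -
    have "s y \<le> s t" unfolding s_def using that by (intro real_sqrt_le_mono add_right_mono) (simp add: abs_le_square_iff)
    then show ?thesis unfolding \<psi>_def using h(2,3) by (intro power_mono) (auto dest: monoD)
  qed
  have \<psi>_nonneg: "0 \<le> \<psi> t" for t using h(2) by (simp add: \<psi>_def)
  have \<Psi>_le: "\<bar>\<Psi> t\<bar> \<le> \<bar>t\<bar> * \<psi> t" for t
  proof -
    have "\<exists>y. \<bar>y\<bar> \<le> \<bar>t\<bar> \<and> \<Psi> t = t * \<psi> y"
    proof (cases "t = 0")
      case False
      show ?thesis
      proof (cases "t > 0")
        case True
        obtain y where "0 < y" "y < t" "\<Psi> t - \<Psi> 0 = (t - 0) * \<psi> y" using MVT2[OF True, of \<Psi> \<psi>] \<Psi>(1) by auto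
        then show ?thesis using \<Psi>(2) by (intro exI[of _ y]) auto
      next
        case F: False
        then have "t < 0" using False by simp
        then obtain y where "t < y" "y < 0" "\<Psi> 0 - \<Psi> t = (0 - t) * \<psi> y" using MVT2[of t 0 \<Psi> \<psi>] \<Psi>(1) by auto
        then show ?thesis using \<Psi>(2) by (intro exI[of _ y]) auto
      qed
    qed (use \<Psi>(2) in auto)
    then obtain y where "\<bar>y\<bar> \<le> \<bar>t\<bar>" "\<Psi> t = t * \<psi> y" by blast
    then show ?thesis using \<psi>_mono \<psi>_nonneg by (auto simp: abs_mult intro!: mult_left_mono)
  qed
  let ?F = "\<lambda>x. ((\<eta> x ^ n * \<psi> (u x)) *\<^sub>R Du x + (real n * \<eta> x ^ m * \<Psi> (u x)) *\<^sub>R E x) \<bullet> A x + (\<eta> x ^ n * \<Psi> (u x)) * B x"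
  have bnd: "\<bar>\<Psi> t\<bar> \<le> K ^ n * \<bar>t\<bar>" "\<bar>\<psi> t\<bar> \<le> K ^ n" for t
  proof -
    show 1: "\<bar>\<psi> t\<bar> \<le> K ^ n" using \<psi>_nonneg[of t] hK by (simp add: \<psi>_def)
    have "\<bar>t\<bar> * \<psi> t \<le> \<bar>t\<bar> * K ^ n" using 1 by (intro mult_left_mono) auto
    then show "\<bar>\<Psi> t\<bar> \<le> K ^ n * \<bar>t\<bar>" using \<Psi>_le[of t] by (simp add: mult.commute)
  qed
  note F = weak_equation_Lipschitz[OF \<eta> \<rho> \<Psi>(1) \<psi>c bnd]
  \<comment> \<open>The inequality already holds pointwise. In terms of
    \<open>y = \<eta> x * w * g\<close> and \<open>q = v x * w\<close>, coercivity yields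
    \<open>y ^ n\<close>; the cut-off term and the term with \<open>B\<close> each take back at most
    \<open>y ^ n / 4\<close> plus contributions containing \<open>q ^ n\<close>.\<close>
  have key: "?X x / 2 - CC * ?Y x \<le> ?F x" for x
  proof -
    define w where "w = h (v x)"
    define g where "g = norm (Du x)"
    define e where "e = norm (E x)"
    define y where "y = \<eta> x * w * g"
    define q where "q = v x * w"
    have nn: "0 \<le> w" "0 \<le> g" "0 \<le> e" "0 \<le> \<eta> x" "0 \<le> v x" "0 \<le> \<beta> x" "0 \<le> c x" "0 \<le> d x"
      using h(2) \<eta>(2) v_ge(3)[of x] nonneg by (auto simp: w_def g_def e_def less_imp_le)
    then have nn2: "0 \<le> y" "0 \<le> q" by (auto simp: y_def q_def)
    have \<psi>u: "\<psi> (u x) = w ^ n" by (simp add: \<psi>_def s_u w_def)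
    have \<Psi>u: "\<bar>\<Psi> (u x)\<bar> \<le> q * w ^ m"
    proof -
      have "\<bar>\<Psi> (u x)\<bar> \<le> \<bar>u x\<bar> * w ^ n" using \<Psi>_le[of "u x"] by (simp add: \<psi>u)
      also have "\<dots> \<le> v x * w ^ n" using v_ge(2) nn by (intro mult_right_mono) auto
      finally show ?thesis by (simp add: q_def n(2) mult_ac)
    qed
    have T1: "(\<eta> x ^ n * \<psi> (u x)) * (Du x \<bullet> A x) \<ge> y ^ n - 2 ^ n * (d x * \<eta> x ^ n * q ^ n)"
    proof -
      have "(\<eta> x ^ n * \<psi> (u x)) * (g ^ n - 2 ^ n * (d x * v x ^ n)) \<le> (\<eta> x ^ n * \<psi> (u x)) * (Du x \<bullet> A x)"
        unfolding g_def using coercive \<eta>n[of x n] \<psi>_nonneg by (intro mult_left_mono) auto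
      moreover have "(\<eta> x ^ n * \<psi> (u x)) * (g ^ n - 2 ^ n * (d x * v x ^ n)) = y ^ n - 2 ^ n * (d x * \<eta> x ^ n * q ^ n)"
        by (simp add: \<psi>u y_def q_def power_mult_distrib algebra_simps)
      ultimately show ?thesis by simp
    qed
    have T2: "\<bar>(real n * \<eta> x ^ m * \<Psi> (u x)) * (E x \<bullet> A x)\<bar>
      \<le> y ^ n / 4 + 4 ^ m * (real n * a) ^ n * (e ^ n * q ^ n) + 2 ^ n * real n * (e ^ n * q ^ n + \<beta> x ^ n * \<eta> x ^ n * q ^ n)"
    proof -
      have "\<bar>(real n * \<eta> x ^ m * \<Psi> (u x)) * (E x \<bullet> A x)\<bar> = (real n * \<eta> x ^ m) * \<bar>\<Psi> (u x)\<bar> * \<bar>E x \<bullet> A x\<bar>"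
        using nn by (simp add: abs_mult)
      also have "\<dots> \<le> (real n * \<eta> x ^ m) * (q * w ^ m) * (e * (a * g ^ m + 2 ^ n * (\<beta> x * v x) ^ m))"
      proof (intro mult_mono \<Psi>u)
        have "\<bar>E x \<bullet> A x\<bar> \<le> e * norm (A x)" unfolding e_def by (rule Cauchy_Schwarz_ineq2)
        also have "\<dots> \<le> e * (a * g ^ m + 2 ^ n * (\<beta> x * v x) ^ m)" unfolding g_def using A_le nn by (intro mult_left_mono) auto
        finally show "\<bar>E x \<bullet> A x\<bar> \<le> e * (a * g ^ m + 2 ^ n * (\<beta> x * v x) ^ m)" .
      qed (use nn nn2 in auto)
      also have "\<dots> = (real n * a) * ((e * q) * y ^ m) + 2 ^ n * real n * ((e * q) * (\<beta> x * \<eta> x * q) ^ m)"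
        by (simp add: y_def q_def power_mult_distrib algebra_simps)
      also have "\<dots> \<le> (y ^ n / 4 + 4 ^ m * (real n * a) ^ n * (e * q) ^ n) + 2 ^ n * real n * ((e * q) ^ n + (\<beta> x * \<eta> x * q) ^ n)"
        unfolding n(2) using nn nn2 a by (intro add_mono mult_power_le_eps mult_left_mono mult_power_le) auto
      finally show ?thesis by (simp add: power_mult_distrib mult.assoc)
    qed
    have T3: "\<bar>(\<eta> x ^ n * \<Psi> (u x)) * B x\<bar> \<le> y ^ n / 4 + 4 ^ m * (c x ^ n * \<eta> x ^ n * q ^ n) + 2 ^ n * (d x * \<eta> x ^ n * q ^ n)"
    proof -
      have "\<bar>(\<eta> x ^ n * \<Psi> (u x)) * B x\<bar> = \<eta> x ^ n * \<bar>\<Psi> (u x)\<bar> * \<bar>B x\<bar>" using nn by (simp add: abs_mult)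
      also have "\<dots> \<le> \<eta> x ^ n * (q * w ^ m) * (c x * g ^ m + 2 ^ n * (d x * v x ^ m))"
        using \<Psi>u B_le[of x] nn nn2 unfolding g_def by (intro mult_mono mult_left_mono) auto
      also have "\<dots> = 1 * ((c x * \<eta> x * q) * y ^ m) + 2 ^ n * (d x * \<eta> x ^ n * q ^ n)"
        by (simp add: y_def q_def n(2) power_mult_distrib algebra_simps)
      also have "\<dots> \<le> (y ^ n / 4 + 4 ^ m * 1 ^ n * (c x * \<eta> x * q) ^ n) + 2 ^ n * (d x * \<eta> x ^ n * q ^ n)"
        unfolding n(2) using nn nn2 by (intro add_right_mono mult_power_le_eps) auto
      finally show ?thesis by (simp add: power_mult_distrib mult.assoc)
    qed
    have X_eq: "?X x = y ^ n" by (simp add: y_def w_def g_def power_mult_distrib)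
    have sum_le: "4 ^ m * (real n * a) ^ n * (e ^ n * q ^ n) + 2 ^ n * real n * (e ^ n * q ^ n + \<beta> x ^ n * \<eta> x ^ n * q ^ n)
       + 4 ^ m * (c x ^ n * \<eta> x ^ n * q ^ n) + 2 ^ n * (d x * \<eta> x ^ n * q ^ n) + 2 ^ n * (d x * \<eta> x ^ n * q ^ n) \<le> CC * ?Y x"
    proof -
      define r1 where "r1 = e ^ n * q ^ n"
      define r2 where "r2 = \<beta> x ^ n * \<eta> x ^ n * q ^ n"
      define r3 where "r3 = c x ^ n * \<eta> x ^ n * q ^ n"
      define r4 where "r4 = d x * \<eta> x ^ n * q ^ n"
      have r: "0 \<le> r1" "0 \<le> r2" "0 \<le> r3" "0 \<le> r4" using nn nn2 by (auto simp: r1_def r2_def r3_def r4_def)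
      have Y_eq: "?Y x = r1 + r2 + r3 + r4"
        unfolding r1_def r2_def r3_def r4_def e_def q_def w_def V_def by (simp add: algebra_simps)
      have k1: "4 ^ m * (real n * a) ^ n + 2 ^ n * real n \<le> CC" "2 ^ n * real n \<le> CC" "4 ^ m \<le> CC" "2 ^ n * 2 \<le> CC"
        using a by (auto simp: CC_def distrib_left add_increasing add_increasing2)
      have "(4 ^ m * (real n * a) ^ n + 2 ^ n * real n) * r1 + (2 ^ n * real n) * r2 + 4 ^ m * r3 + (2 ^ n * 2) * r4
        \<le> CC * r1 + CC * r2 + CC * r3 + CC * r4"
        using k1 r by (intro add_mono mult_right_mono)
      then show ?thesis unfolding Y_eq r1_def[symmetric] r2_def[symmetric] r3_def[symmetric] r4_def[symmetric]
        by (simp add: algebra_simps)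
    qed
    have "?F x = (\<eta> x ^ n * \<psi> (u x)) * (Du x \<bullet> A x) + (real n * \<eta> x ^ m * \<Psi> (u x)) * (E x \<bullet> A x) + (\<eta> x ^ n * \<Psi> (u x)) * B x"
      by (simp add: inner_add_left)
    then show ?thesis unfolding X_eq using T1 T2 T3 sum_le by linarith
  qed
  have "(\<integral>x. ?X x / 2 - CC * ?Y x \<partial>lborel) \<le> (\<integral>x. ?F x \<partial>lborel)"
    using X_int Y_int by (intro integral_mono F(1) key) simp
  also have "\<dots> = 0" by (rule F(2))
  finally show "(\<integral>x. ?X x \<partial>lborel) \<le> 2 * CC * (\<integral>x. ?Y x \<partial>lborel)"
    using X_int Y_int by simp
qed

end

section \<open>Orlicz duality\<close>

lemma N_fun_continuous:
  assumes "p > 0" shows "continuous_on {0..t} (\<lambda>\<tau>::real. ln (\<tau> + 1) powr p)"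
  using assms by (intro continuous_on_powr' continuous_intros) auto

text \<open>Only the upper half of the interval is used, where the increasing integrand is at least
  its value at \<open>t / 2\<close>.\<close>

lemma N_fun_lower:
  assumes n: "n \<ge> 2" and s: "s > 0" and t: "t \<ge> 0"
  shows "t / 2 * ln (t / 2 + 1) powr ((real n - 1) / s) \<le> N_fun n s t"
proof -
  let ?p = "(real n - 1) / s"
  let ?f = "\<lambda>\<tau>::real. ln (\<tau> + 1) powr ?p"
  have p: "?p > 0" using n s by simp
  have int: "?f integrable_on {0..t}"
    by (rule integrable_continuous_real[OF N_fun_continuous[OF p]])
  have int2: "?f integrable_on {t/2..t}"
    by (rule integrable_subinterval_real[OF int]) (use t in auto)
  have "t / 2 * ?f (t / 2) = integral {t/2..t} (\<lambda>_. ?f (t / 2))"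
    using t by simp
  also have "\<dots> \<le> integral {t/2..t} ?f"
    using p t by (intro integral_le int2) (auto intro!: powr_mono2)
  also have "\<dots> \<le> integral {0..t} ?f"
    using t by (intro integral_subset_le int int2) auto
  finally show ?thesis by (simp add: N_fun_def)
qed

lemma N_fun_upper:
  assumes n: "n \<ge> 2" and s: "s > 0" and t: "t \<ge> 0"
  shows "N_fun n s t \<le> t * ln (t + 1) powr ((real n - 1) / s)"
proof -
  let ?p = "(real n - 1) / s"
  let ?f = "\<lambda>\<tau>::real. ln (\<tau> + 1) powr ?p"
  have p: "?p > 0" using n s by simp
  have int: "?f integrable_on {0..t}"
    by (rule integrable_continuous_real[OF N_fun_continuous[OF p]])
  have "integral {0..t} ?f \<le> integral {0..t} (\<lambda>_. ?f t)"
    using p t by (intro integral_le int) (auto intro!: powr_mono2)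
  then show ?thesis using t by (simp add: N_fun_def)
qed

text \<open>Comparison with one term of the exponential series, of order
  \<open>j \<ge> 1 / \<rho>\<close>. The last conclusion makes a multiple of \<open>J\<close> large
  enough to halve an exponent in \<open>exp_powr_Young\<close>.\<close>

lemma linear_le_exp_powr:
  fixes \<rho> :: real
  assumes "\<rho> > 0"
  obtains J where "J \<ge> 1" "\<And>z. z \<ge> 0 \<Longrightarrow> z \<le> J * exp (z powr \<rho> / 2)" "2 powr (1 / \<rho>) \<le> J"
proof -
  define j where "j = nat \<lceil>1 / \<rho>\<rceil>"
  have j: "1 / \<rho> \<le> real j" unfolding j_def by linarith
  define J :: real where "J = 2 ^ j * fact j"
  have f1: "(1::real) \<le> fact j" by simp
  have J: "2 ^ j \<le> J" "J \<ge> 1"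
  proof -
    show "2 ^ j \<le> J" using f1 unfolding J_def by simp
    then show "J \<ge> 1" using one_le_power[of "2::real" j] by linarith
  qed
  have "z \<le> J * exp (z powr \<rho> / 2)" if z: "z \<ge> 0" for z
  proof (cases "z \<le> 1")
    case True
    have "1 * 1 \<le> J * exp (z powr \<rho> / 2)" using J by (intro mult_mono) auto
    then show ?thesis using True by simp
  next
    case False
    define y where "y = z powr \<rho> / 2"
    have y: "2 * y \<ge> 1" using False assms by (simp add: y_def ge_one_powr_ge_zero)
    have "z = (2 * y) powr (1 / \<rho>)" using assms z by (simp add: y_def powr_powr)
    also have "\<dots> \<le> (2 * y) powr (real j)" using y j by (intro powr_mono) auto
    also have "\<dots> = 2 ^ j * y ^ j" using y by (simp add: powr_realpow power_mult_distrib)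
    also have "y ^ j \<le> fact j * exp y"
    proof -
      have "y ^ j /\<^sub>R fact j \<le> (\<Sum>i. y ^ i /\<^sub>R fact i)"
        using sum_le_suminf[OF summable_exp_generic[of y], of "{j}"] y by simp
      then show ?thesis by (simp add: exp_def field_simps)
    qed
    finally show ?thesis by (simp add: J_def y_def mult.assoc)
  qed
  moreover have "2 powr (1 / \<rho>) \<le> J"
  proof -
    have "2 powr (1 / \<rho>) \<le> 2 powr real j" using j by (intro powr_mono) auto
    also have "\<dots> = 2 ^ j" by (simp add: powr_realpow)
    finally show ?thesis using J(1) by linarith
  qed
  ultimately show thesis using J(2) that by blast
qed

text \<open>The duality of the logarithmic and the exponential class, by hand and without conjugate
  functions. Let \<open>y = z / K\<close>. If \<open>y\<close> is at most the power of the logarithm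
  occurring in \<open>N_fun_lower\<close>, then \<open>N_fun\<close> bounds the product. Otherwise
  \<open>x\<close> is bounded by an exponential of \<open>y powr \<rho>\<close>, and the scaling by
  \<open>K\<close> leaves room to absorb the remaining factor \<open>y\<close>. The last conclusion
  is the counterpart for a constant coefficient.\<close>

lemma exp_powr_Young:
  assumes n: "n \<ge> 2" and r: "r > 0"
  obtains K where "K \<ge> 1"
    "\<And>x z. x \<ge> 0 \<Longrightarrow> z \<ge> 0 \<Longrightarrow> x * z \<le> K * (2 * N_fun n r x + (exp (z powr (r / (real n - 1))) - 1))"
    "\<And>z. z \<ge> 0 \<Longrightarrow> z \<le> K * exp (z powr (r / (real n - 1)))"
proof -
  define \<rho> where "\<rho> = r / (real n - 1)"
  have \<rho>: "\<rho> > 0" using n r by (simp add: \<rho>_def)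
  have p: "1 / \<rho> = (real n - 1) / r" by (simp add: \<rho>_def)
  obtain J where J: "J \<ge> 1" "\<And>z. z \<ge> 0 \<Longrightarrow> z \<le> J * exp (z powr \<rho> / 2)" "2 powr (1 / \<rho>) \<le> J"
    by (rule linear_le_exp_powr[OF \<rho>]) blast
  \<comment> \<open>\<open>J\<close> bounds \<open>2 * y\<close> by
    \<open>exp (z powr \<rho> / 2)\<close>, and \<open>K powr \<rho> \<ge> 2\<close> bounds
    \<open>y powr \<rho>\<close> by \<open>z powr \<rho> / 2\<close>; the two half exponents add up
    to \<open>z powr \<rho>\<close>.\<close>
  define K where "K = 2 * J"
  have K: "K \<ge> 1" "K > 0" using J(1) by (auto simp: K_def)
  have Y: "x * z \<le> K * (2 * N_fun n r x + (exp (z powr \<rho>) - 1))" if x: "x \<ge> 0" and z: "z \<ge> 0" for x z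
  proof -
    define y where "y = z / K"
    have y: "y \<ge> 0" using z K by (simp add: y_def)
    have N0: "0 \<le> N_fun n r x" using N_fun_lower[OF n r x] x by (meson mult_nonneg_nonneg powr_ge_zero divide_nonneg_nonneg zero_le_numeral order_trans)
    have E0: "0 \<le> exp (z powr \<rho>) - 1" by simp
    have "x * y \<le> 2 * N_fun n r x + (exp (z powr \<rho>) - 1)"
    proof (cases "y \<le> ln (x / 2 + 1) powr (1 / \<rho>)")
      case True
      then have "x / 2 * y \<le> x / 2 * ln (x / 2 + 1) powr ((real n - 1) / r)" unfolding p using x by (intro mult_left_mono) auto
      also have "\<dots> \<le> N_fun n r x" by (rule N_fun_lower[OF n r x])
      finally show ?thesis using E0 by linarith
    next
      case False
      then have "(ln (x / 2 + 1) powr (1 / \<rho>)) powr \<rho> < y powr \<rho>" using \<rho> by (intro powr_less_mono2) auto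
      moreover have "(ln (x / 2 + 1) powr (1 / \<rho>)) powr \<rho> = ln (x / 2 + 1)" using \<rho> x by (simp add: powr_powr)
      ultimately have "ln (x / 2 + 1) < y powr \<rho>" by simp
      then have "x / 2 + 1 < exp (y powr \<rho>)" using x by (metis add_nonneg_pos divide_nonneg_pos exp_less_cancel_iff exp_ln zero_less_numeral zero_less_one)
      then have "x * y \<le> (2 * (exp (y powr \<rho>) - 1)) * y" using y by (intro mult_right_mono) auto
      also have "\<dots> = (exp (y powr \<rho>) - 1) * (2 * y)" by simp
      also have "\<dots> \<le> (exp (z powr \<rho> / 2) - 1) * exp (z powr \<rho> / 2)"
      proof (intro mult_mono)
        have "K powr \<rho> \<ge> 2"
        proof -
          have "2 = (2 powr (1 / \<rho>)) powr \<rho>" using \<rho> by (simp add: powr_powr)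
          also have "\<dots> \<le> K powr \<rho>" using J \<rho> by (intro powr_mono2) (auto simp: K_def)
          finally show ?thesis .
        qed
        then have "z powr \<rho> / K powr \<rho> \<le> z powr \<rho> / 2" by (intro divide_left_mono) auto
        then show "exp (y powr \<rho>) - 1 \<le> exp (z powr \<rho> / 2) - 1"
          using z K by (simp add: y_def powr_divide)
        show "2 * y \<le> exp (z powr \<rho> / 2)"
          using J(2)[OF z] J(1) by (simp add: y_def K_def field_simps)
      qed (use y in auto)
      also have "\<dots> \<le> exp (z powr \<rho>) - 1"
      proof -
        have "exp (z powr \<rho> / 2) * exp (z powr \<rho> / 2) = exp (z powr \<rho>)" by (simp add: exp_add[symmetric])
        moreover have "exp (z powr \<rho> / 2) \<ge> 1" by simp
        ultimately show ?thesis by (simp add: left_diff_distrib)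
      qed
      finally show ?thesis using N0 by simp
    qed
    then have "K * (x * y) \<le> K * (2 * N_fun n r x + (exp (z powr \<rho>) - 1))" using K by (intro mult_left_mono) auto
    then show ?thesis using K by (simp add: y_def)
  qed
  have L: "z \<le> K * exp (z powr \<rho>)" if z: "z \<ge> 0" for z
  proof -
    have "z \<le> J * exp (z powr \<rho> / 2)" by (rule J(2)[OF z])
    also have "\<dots> \<le> K * exp (z powr \<rho>)" using J(1) by (intro mult_mono) (auto simp: K_def)
    finally show ?thesis .
  qed
  show thesis using that[OF K(1)] Y L unfolding \<rho>_def by blast
qed

text \<open>Admissibility of \<open>l\<close> for the exponential Luxemburg norm. The parameter is
  the actual exponent, so the norm \<open>E_norm\<close> of index \<open>n * r\<close> corresponds
  to \<open>n * r / (n - 1)\<close>. Working with admissible constants avoids the question whether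
  the infimum is attained.\<close>

definition exp_modular :: "real \<Rightarrow> 'a::euclidean_space set \<Rightarrow> ('a \<Rightarrow> real) \<Rightarrow> real \<Rightarrow> bool" where
  "exp_modular s \<Omega> f l \<longleftrightarrow> 0 < l \<and>
     (\<integral>\<^sup>+x. indicator \<Omega> x * ennreal (exp ((\<bar>f x\<bar> / l) powr s) - 1) \<partial>lborel) \<le> 1"

lemma exp_modular_mono:
  assumes "exp_modular s \<Omega> f l" "l \<le> l'" "\<Omega>' \<subseteq> \<Omega>" "s \<ge> 0" "\<And>x. x \<in> \<Omega>' \<Longrightarrow> \<bar>g x\<bar> \<le> \<bar>f x\<bar>"
  shows "exp_modular s \<Omega>' g l'"
proof -
  have l: "l > 0" "l' > 0" using assms(1,2) by (auto simp: exp_modular_def)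
  have "(\<integral>\<^sup>+x. indicator \<Omega>' x * ennreal (exp ((\<bar>g x\<bar> / l') powr s) - 1) \<partial>lborel)
    \<le> (\<integral>\<^sup>+x. indicator \<Omega> x * ennreal (exp ((\<bar>f x\<bar> / l) powr s) - 1) \<partial>lborel)"
  proof (rule nn_integral_mono)
    fix x
    show "indicator \<Omega>' x * ennreal (exp ((\<bar>g x\<bar> / l') powr s) - 1) \<le> indicator \<Omega> x * ennreal (exp ((\<bar>f x\<bar> / l) powr s) - 1)"
    proof (cases "x \<in> \<Omega>'")
      case True
      have "\<bar>g x\<bar> / l' \<le> \<bar>f x\<bar> / l" using assms(2) assms(5)[OF True] l by (intro frac_le) auto
      then have "(\<bar>g x\<bar> / l') powr s \<le> (\<bar>f x\<bar> / l) powr s" using l assms(4) by (intro powr_mono2) auto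
      then show ?thesis using True assms(3) by (auto intro!: ennreal_leI)
    qed simp
  qed
  then show ?thesis using assms(1) l by (auto simp: exp_modular_def intro: order_trans)
qed

text \<open>If \<open>f\<close> has exponent \<open>n * r / (n - 1)\<close>, then
  \<open>f ^ n\<close> has exponent \<open>r / (n - 1)\<close>, the one paired with
  \<open>N_fun n r\<close> in \<open>exp_powr_Young\<close>. Scaling makes the bound linear in the
  admissible constant \<open>l\<close> of \<open>V\<close>. The second estimate is the analogue for
  \<open>V = 1\<close> on a bounded set.\<close>

lemma Orlicz_Hoelder:
  fixes V f :: "'a::euclidean_space \<Rightarrow> real"
  assumes n: "n \<ge> 2" and r: "r > 0"
  obtains K where "K \<ge> 1"
    "\<And>(V :: 'a \<Rightarrow> real) f \<Omega> l \<mu>. V \<in> borel_measurable borel \<Longrightarrow> f \<in> borel_measurable borel \<Longrightarrow> \<Omega> \<in> sets borel \<Longrightarrow>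
      (\<And>x. 0 \<le> V x) \<Longrightarrow> (\<And>x. 0 \<le> f x) \<Longrightarrow> 0 < l \<Longrightarrow>
      (\<integral>\<^sup>+x. indicator \<Omega> x * ennreal (N_fun n r (V x / l)) \<partial>lborel) \<le> 1 \<Longrightarrow>
      exp_modular (real n * r / (real n - 1)) \<Omega> f \<mu> \<Longrightarrow>
      (\<integral>\<^sup>+x. indicator \<Omega> x * ennreal (V x * f x ^ n) \<partial>lborel) \<le> ennreal (K * l * \<mu> ^ n)"
    "\<And>(f :: 'a \<Rightarrow> real) \<Omega> \<mu>. f \<in> borel_measurable borel \<Longrightarrow> \<Omega> \<in> sets borel \<Longrightarrow> \<Omega> \<subseteq> cball 0 2 \<Longrightarrow> (\<And>x. 0 \<le> f x) \<Longrightarrow>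
      exp_modular (real n * r / (real n - 1)) \<Omega> f \<mu> \<Longrightarrow>
      (\<integral>\<^sup>+x. indicator \<Omega> x * ennreal (f x ^ n) \<partial>lborel) \<le> ennreal (K * \<mu> ^ n)"
proof -
  obtain J where J: "J \<ge> 1"
    "\<And>x z. x \<ge> 0 \<Longrightarrow> z \<ge> 0 \<Longrightarrow> x * z \<le> J * (2 * N_fun n r x + (exp (z powr (r / (real n - 1))) - 1))"
    "\<And>z. z \<ge> 0 \<Longrightarrow> z \<le> J * exp (z powr (r / (real n - 1)))"
    by (rule exp_powr_Young[OF n r]) blast
  define \<beta> where "\<beta> = measure lborel (cball 0 2 :: 'a set)"
  have \<beta>: "\<beta> \<ge> 0" "emeasure lborel (cball 0 2 :: 'a set) = ennreal \<beta>"
    using emeasure_lborel_cball_finite[of "0::'a" 2] by (auto simp: \<beta>_def intro!: emeasure_eq_ennreal_measure)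
  \<comment> \<open>The 3 is \<open>2 * 1 + 1\<close> from the two modulars in Young's inequality;
    \<open>1 + \<beta>\<close> is modular plus volume in the second estimate.\<close>
  define K where "K = J * (3 + \<beta>)"
  have K: "J \<le> K" "3 * J \<le> K" "J * (1 + \<beta>) \<le> K" using J(1) \<beta>(1) by (auto simp: K_def algebra_simps)
  have pw: "(f ^ n / \<mu> ^ n) powr (r / (real n - 1)) = (\<bar>f\<bar> / \<mu>) powr (real n * r / (real n - 1))"
    if "f \<ge> 0" "\<mu> > 0" for f \<mu> :: real
  proof -
    have "f ^ n / \<mu> ^ n = (f / \<mu>) powr real n"
      using that n by (cases "f = 0") (auto simp: powr_realpow power_divide)
    then show ?thesis using that by (simp add: powr_powr)
  qed
  show thesis
  proof (rule that)
    show "K \<ge> 1" using J(1) K(1) by linarith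
    fix V f :: "'a \<Rightarrow> real" and \<Omega> l \<mu>
    assume m[measurable]: "V \<in> borel_measurable borel" "f \<in> borel_measurable borel" "\<Omega> \<in> sets borel"
      and nn: "\<And>x. 0 \<le> V x" "\<And>x. 0 \<le> f x" and l: "0 < l"
      and N1: "(\<integral>\<^sup>+x. indicator \<Omega> x * ennreal (N_fun n r (V x / l)) \<partial>lborel) \<le> 1"
      and E: "exp_modular (real n * r / (real n - 1)) \<Omega> f \<mu>"
    have lam: "\<mu> > 0" using E by (simp add: exp_modular_def)
    let ?E = "\<lambda>x. exp ((\<bar>f x\<bar> / \<mu>) powr (real n * r / (real n - 1))) - 1"
    let ?c = "J * l * \<mu> ^ n"
    have c: "?c > 0" using J(1) l lam by simp
    have c2: "ennreal ?c * ennreal (y::real) = ennreal (?c * y)" for y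
      using c by (metis ennreal_mult' less_imp_le)
    \<comment> \<open>Monotonicity of \<open>N_fun\<close> is established on the nonnegative
      half-line; composition with \<open>max 0\<close> makes it a monotone, hence Borel, function on
      all reals.\<close>
    have Nm: "(\<lambda>x. N_fun n r (V x / l)) \<in> borel_measurable borel"
    proof -
      have "mono_on {0..} (N_fun n r)"
      proof (rule mono_onI)
        fix s t :: real assume st: "s \<in> {0..}" "t \<in> {0..}" "s \<le> t"
        have p: "(real n - 1) / r > 0" using n r by simp
        have i: "(\<lambda>\<tau>::real. ln (\<tau> + 1) powr ((real n - 1) / r)) integrable_on {0..t}" for t
          by (rule integrable_continuous_real[OF N_fun_continuous[OF p]])
        show "N_fun n r s \<le> N_fun n r t" unfolding N_fun_def
          using st by (intro integral_subset_le i) auto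
      qed
      then have "mono (\<lambda>t. N_fun n r (max 0 t))" by (auto simp: mono_on_def intro!: monoI)
      then have "(\<lambda>t. N_fun n r (max 0 t)) \<in> borel_measurable borel" by (rule borel_measurable_mono)
      then have "(\<lambda>x. N_fun n r (max 0 (V x / l))) \<in> borel_measurable borel"
        by (rule measurable_compose[rotated]) measurable
      moreover have "max 0 (V x / l) = V x / l" for x using nn(1)[of x] l by simp
      ultimately show ?thesis by simp
    qed
    note [measurable] = Nm
    have "(\<integral>\<^sup>+x. indicator \<Omega> x * ennreal (V x * f x ^ n) \<partial>lborel)
      \<le> (\<integral>\<^sup>+x. ennreal ?c * (2 * (indicator \<Omega> x * ennreal (N_fun n r (V x / l))) + indicator \<Omega> x * ennreal (?E x)) \<partial>lborel)"
    proof (rule nn_integral_mono)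
      fix x
      have "V x / l * (f x ^ n / \<mu> ^ n) \<le> J * (2 * N_fun n r (V x / l) + ?E x)"
        using J(2)[of "V x / l" "f x ^ n / \<mu> ^ n"] nn[of x] l lam by (simp add: pw)
      then have "l * \<mu> ^ n * (V x / l * (f x ^ n / \<mu> ^ n)) \<le> l * \<mu> ^ n * (J * (2 * N_fun n r (V x / l) + ?E x))"
        using l lam by (intro mult_left_mono) auto
      then have le: "V x * f x ^ n \<le> ?c * (2 * N_fun n r (V x / l) + ?E x)"
        using l lam by (simp add: mult_ac)
      have N0: "0 \<le> N_fun n r (V x / l)"
        using N_fun_lower[OF n r, of "V x / l"] nn(1)[of x] l
        by (meson mult_nonneg_nonneg powr_ge_zero divide_nonneg_nonneg zero_le_numeral order_trans less_imp_le)
      have "ennreal (V x * f x ^ n) \<le> ennreal (?c * (2 * N_fun n r (V x / l) + ?E x))" by (rule ennreal_leI[OF le])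
      also have "\<dots> = ennreal ?c * (2 * ennreal (N_fun n r (V x / l)) + ennreal (?E x))"
        unfolding c2[symmetric] using N0 by (subst ennreal_plus) (auto simp: ennreal_mult)
      finally show "indicator \<Omega> x * ennreal (V x * f x ^ n) \<le>
        ennreal ?c * (2 * (indicator \<Omega> x * ennreal (N_fun n r (V x / l))) + indicator \<Omega> x * ennreal (?E x))"
        by (auto simp: indicator_def)
    qed
    also have "\<dots> = ennreal ?c * (2 * (\<integral>\<^sup>+x. indicator \<Omega> x * ennreal (N_fun n r (V x / l)) \<partial>lborel) +
        (\<integral>\<^sup>+x. indicator \<Omega> x * ennreal (?E x) \<partial>lborel))"
      by (subst nn_integral_cmult, measurable, subst nn_integral_add, measurable, subst nn_integral_cmult) auto
    also have "\<dots> \<le> ennreal ?c * (2 * 1 + 1)"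
      using N1 E unfolding exp_modular_def by (intro mult_left_mono add_mono) auto
    also have "\<dots> = ennreal (?c * 3)" unfolding c2[symmetric] by simp
    also have "\<dots> \<le> ennreal (K * l * \<mu> ^ n)"
    proof (rule ennreal_leI)
      have "3 * J * (l * \<mu> ^ n) \<le> K * (l * \<mu> ^ n)" using K(2) l lam by (intro mult_right_mono) auto
      then show "?c * 3 \<le> K * l * \<mu> ^ n" by (simp add: mult_ac)
    qed
    finally show "(\<integral>\<^sup>+x. indicator \<Omega> x * ennreal (V x * f x ^ n) \<partial>lborel) \<le> ennreal (K * l * \<mu> ^ n)" .
  next
    fix f :: "'a \<Rightarrow> real" and \<Omega> \<mu>
    assume m[measurable]: "f \<in> borel_measurable borel" "\<Omega> \<in> sets borel" and sub: "\<Omega> \<subseteq> cball 0 2"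
      and nn: "\<And>x. 0 \<le> f x" and E: "exp_modular (real n * r / (real n - 1)) \<Omega> f \<mu>"
    have lam: "\<mu> > 0" using E by (simp add: exp_modular_def)
    let ?E = "\<lambda>x. exp ((\<bar>f x\<bar> / \<mu>) powr (real n * r / (real n - 1))) - 1"
    let ?c = "J * \<mu> ^ n"
    have c: "?c > 0" using J(1) lam by simp
    have "(\<integral>\<^sup>+x. indicator \<Omega> x * ennreal (f x ^ n) \<partial>lborel)
      \<le> (\<integral>\<^sup>+x. ennreal ?c * (indicator \<Omega> x * ennreal (?E x) + indicator \<Omega> x) \<partial>lborel)"
    proof (rule nn_integral_mono)
      fix x
      have "f x ^ n / \<mu> ^ n \<le> J * (?E x + 1)"
        using J(3)[of "f x ^ n / \<mu> ^ n"] nn[of x] lam by (simp add: pw)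
      then have "f x ^ n \<le> ?c * (?E x + 1)" using lam by (simp add: field_simps)
      then have "ennreal (f x ^ n) \<le> ennreal (?c * (?E x + 1))" by (rule ennreal_leI)
      also have "\<dots> = ennreal ?c * (ennreal (?E x) + 1)"
        using c by (subst ennreal_mult) (auto simp flip: ennreal_1 ennreal_plus)
      finally show "indicator \<Omega> x * ennreal (f x ^ n) \<le> ennreal ?c * (indicator \<Omega> x * ennreal (?E x) + indicator \<Omega> x)"
        by (auto simp: indicator_def)
    qed
    also have "\<dots> = ennreal ?c * ((\<integral>\<^sup>+x. indicator \<Omega> x * ennreal (?E x) \<partial>lborel) + emeasure lborel \<Omega>)"
      by (subst nn_integral_cmult, measurable, subst nn_integral_add) auto
    also have "\<dots> \<le> ennreal ?c * (1 + ennreal \<beta>)"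
    proof (intro mult_left_mono add_mono)
      show "(\<integral>\<^sup>+x. indicator \<Omega> x * ennreal (?E x) \<partial>lborel) \<le> 1" using E by (simp add: exp_modular_def)
      show "emeasure lborel \<Omega> \<le> ennreal \<beta>" unfolding \<beta>(2)[symmetric] using sub by (intro emeasure_mono) auto
    qed simp
    also have "\<dots> = ennreal (?c * (1 + \<beta>))"
      using c \<beta>(1) by (subst ennreal_mult) (auto simp: ennreal_plus)
    also have "\<dots> \<le> ennreal (K * \<mu> ^ n)"
    proof (rule ennreal_leI)
      have "J * (1 + \<beta>) * \<mu> ^ n \<le> K * \<mu> ^ n" using K(3) lam by (intro mult_right_mono) auto
      then show "?c * (1 + \<beta>) \<le> K * \<mu> ^ n" by (simp add: mult_ac)
    qed
    finally show "(\<integral>\<^sup>+x. indicator \<Omega> x * ennreal (f x ^ n) \<partial>lborel) \<le> ennreal (K * \<mu> ^ n)" .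
  qed
qed

section \<open>The iteration\<close>

lemma pos_part_power2_deriv:
  "((\<lambda>t. (max 0 t)\<^sup>2) has_real_derivative 2 * max 0 t) (at (t::real))"
proof (cases "t = 0")
  case True
  have "((\<lambda>h. ((max 0 (0 + h))\<^sup>2 - (max 0 0)\<^sup>2) / h) \<longlongrightarrow> (0::real)) (at 0)"
  proof (rule Lim_null_comparison)
    show "\<forall>\<^sub>F h in at 0. norm (((max 0 (0 + h))\<^sup>2 - (max 0 0)\<^sup>2) / h) \<le> \<bar>h\<bar>"
      by (rule always_eventually) (auto simp: power2_eq_square max_def)
    show "((\<lambda>h. \<bar>h\<bar>) \<longlongrightarrow> (0::real)) (at 0)" by (auto intro!: tendsto_eq_intros)
  qed
  then show ?thesis using True by (simp add: DERIV_def)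
next
  case False
  show ?thesis
  proof (cases "t > 0")
    case True
    have "((\<lambda>t. t\<^sup>2) has_real_derivative 2 * max 0 t) (at t)"
      using True by (auto intro!: derivative_eq_intros)
    then show ?thesis
      by (rule has_field_derivative_transform_within_open[where S="{0<..}"]) (use True in auto)
  next
    case F: False
    have "((\<lambda>t. 0) has_real_derivative 2 * max 0 t) (at t)" using F by simp
    then show ?thesis
      by (rule has_field_derivative_transform_within_open[where S="{..<0}"]) (use F False in auto)
  qed
qed

text \<open>\<open>z\<close> is affine in the squared norm, 0 at radius \<open>\<rho>\<close> and 1
  at radius \<open>\<rho>'\<close>. Applying \<open>p\<close> gives a C1 transition at
  \<open>\<rho>\<close>, reflecting and applying it once more gives one at \<open>\<rho>'\<close>.
  The 8 is a product of three factors 2; the quotient of \<open>\<rho>\<close> by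
  \<open>\<rho> + \<rho>'\<close> that remains is at most 1.\<close>

lemma C1_cutoff_exists:
  assumes \<rho>: "0 < \<rho>'" "\<rho>' < \<rho>"
  obtains \<eta> and E :: "'a::euclidean_space \<Rightarrow> 'a" where "C1_grad \<eta> E" "\<And>x. 0 \<le> \<eta> x" "\<And>x. \<eta> x \<le> 1"
    "\<And>x. norm x \<ge> \<rho> \<Longrightarrow> \<eta> x = 0" "\<And>x. norm x \<le> \<rho>' \<Longrightarrow> \<eta> x = 1" "\<And>x. norm (E x) \<le> 8 / (\<rho> - \<rho>')"
proof -
  define D where "D = \<rho>\<^sup>2 - \<rho>'\<^sup>2"
  have D: "D = (\<rho> - \<rho>') * (\<rho> + \<rho>')" by (simp add: D_def power2_eq_square algebra_simps)
  have Dpos: "D > 0" using \<rho> by (simp add: D)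
  define p where "p t = (max 0 t)\<^sup>2" for t :: real
  define z where "z x = (\<rho>\<^sup>2 - x \<bullet> x) / D" for x :: 'a
  define \<eta> where "\<eta> x = 1 - p (1 - p (z x))" for x :: 'a
  define k where "k x = (2 * max 0 (1 - p (z x))) * (2 * max 0 (z x)) * (- 2 / D)" for x :: 'a
  define E where "E x = k x *\<^sub>R x" for x :: 'a
  have p0: "0 \<le> p t" for t by (simp add: p_def)
  have zc: "continuous_on UNIV z" unfolding z_def[abs_def] using Dpos by (intro continuous_intros) auto
  have "C1_grad \<eta> E"
    unfolding C1_grad_def
  proof (intro conjI allI)
    show "continuous_on UNIV E"
      unfolding E_def[abs_def] k_def p_def using Dpos by (intro continuous_intros zc) auto
    fix x
    have 1: "(z has_derivative (\<lambda>h. (- 2 / D) * (x \<bullet> h))) (at x)"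
      unfolding z_def[abs_def] using Dpos by (auto intro!: derivative_eq_intros simp: inner_commute field_simps)
    have pd: "(p has_derivative (\<lambda>h. h * (2 * max 0 t))) (at t)" for t
      using pos_part_power2_deriv[of t] unfolding p_def[abs_def] has_field_derivative_def
      by (rule has_derivative_eq_rhs) (simp add: fun_eq_iff mult.commute)
    have 2: "((\<lambda>x. 1 - p (z x)) has_derivative (\<lambda>h. - ((- 2 / D) * (x \<bullet> h) * (2 * max 0 (z x))))) (at x)"
      using has_derivative_diff[OF has_derivative_const has_derivative_compose[OF 1 pd]] by simp
    have "(\<eta> has_derivative (\<lambda>h. - (- ((- 2 / D) * (x \<bullet> h) * (2 * max 0 (z x))) * (2 * max 0 (1 - p (z x)))))) (at x)"
      unfolding \<eta>_def[abs_def] using has_derivative_diff[OF has_derivative_const has_derivative_compose[OF 2 pd]] by simp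
    then show "(\<eta> has_derivative (\<lambda>h. E x \<bullet> h)) (at x)"
      by (rule has_derivative_eq_rhs) (auto simp: E_def k_def)
  qed
  moreover have "0 \<le> \<eta> x" for x
    using p0[of "z x"] by (auto simp: \<eta>_def p_def[of "1 - _"] max_def abs_square_le_1 power_le_one)
  moreover have "\<eta> x \<le> 1" for x using p0 by (simp add: \<eta>_def)
  moreover have "\<eta> x = 0" if "norm x \<ge> \<rho>" for x
  proof -
    have "\<rho>\<^sup>2 \<le> (norm x)\<^sup>2" using that \<rho> by (intro power_mono) auto
    then have "z x \<le> 0" using Dpos by (simp add: z_def power2_norm_eq_inner divide_nonpos_pos)
    then have "p (z x) = 0" by (simp add: p_def)
    then show ?thesis by (simp add: \<eta>_def p_def)
  qed
  moreover have "\<eta> x = 1" if "norm x \<le> \<rho>'" for x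
  proof -
    have "(norm x)\<^sup>2 \<le> \<rho>'\<^sup>2" using that by (intro power_mono) auto
    then have "z x \<ge> 1" using Dpos by (simp add: z_def D_def power2_norm_eq_inner)
    then have "p (z x) \<ge> 1" by (simp add: p_def)
    then show ?thesis by (simp add: \<eta>_def p_def[of "1 - _"])
  qed
  moreover have "norm (E x) \<le> 8 / (\<rho> - \<rho>')" for x
  proof (cases "norm x < \<rho>")
    case True
    have z: "max 0 (1 - p (z x)) * max 0 (z x) \<le> 1 * 1"
    proof (cases "z x \<le> 1")
      case True
      then show ?thesis using p0[of "z x"] by (intro mult_mono) auto
    next
      case False
      then have "p (z x) \<ge> 1" by (simp add: p_def)
      then show ?thesis by simp
    qed
    have "norm (E x) = max 0 (1 - p (z x)) * max 0 (z x) * (8 / D * norm x)"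
      using Dpos by (simp add: E_def k_def abs_mult)
    also have "\<dots> \<le> 1 * (8 / D * \<rho>)"
      using z True Dpos by (intro mult_mono) auto
    also have "\<dots> = 8 / (\<rho> - \<rho>') * (\<rho> / (\<rho> + \<rho>'))" by (simp add: D)
    also have "\<dots> \<le> 8 / (\<rho> - \<rho>') * 1" using \<rho> by (intro mult_left_mono) auto
    also have "\<dots> = 8 / (\<rho> - \<rho>')" by simp
    finally show ?thesis .
  next
    case False
    then have "\<rho>\<^sup>2 \<le> (norm x)\<^sup>2" using \<rho> by (intro power_mono) auto
    then have "z x \<le> 0" using Dpos by (simp add: z_def power2_norm_eq_inner divide_nonpos_pos)
    then show ?thesis using \<rho> by (simp add: E_def k_def)
  qed
  ultimately show thesis by (rule that)
qed

text \<open>The inequalities of Orlicz--Hoelder and Trudinger enter the iteration only through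
  their constants \<open>KO\<close> and \<open>KT\<close>.\<close>
locale elliptic_iteration = elliptic_ball u B \<beta> c d v Du A P a \<kappa> n m
  for u B \<beta> c d v :: "real^'n::finite \<Rightarrow> real" and Du A :: "real^'n \<Rightarrow> real^'n"
    and P a \<kappa> :: real and n m :: nat +
  fixes r S KO KT :: real
  assumes r: "0 < r" and S: "1 \<le> S" and KO: "1 \<le> KO" and KT: "0 < KT"
    and Orlicz: "\<And>f \<rho> \<mu>. f \<in> borel_measurable borel \<Longrightarrow> (\<And>x. 0 \<le> f x) \<Longrightarrow> \<rho> \<le> P \<Longrightarrow>
      exp_modular (real n * r / (real n - 1)) (ball 0 \<rho>) f \<mu> \<Longrightarrow>
      (\<integral>\<^sup>+x. indicator (ball 0 \<rho>) x * ennreal (V x * f x ^ n) \<partial>lborel) \<le> ennreal (KO * S * \<mu> ^ n)"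
    and Orlicz_1: "\<And>(f :: real^'n \<Rightarrow> real) \<rho> \<mu>. f \<in> borel_measurable borel \<Longrightarrow> (\<And>x. 0 \<le> f x) \<Longrightarrow> \<rho> \<le> P \<Longrightarrow>
      exp_modular (real n * r / (real n - 1)) (ball 0 \<rho>) f \<mu> \<Longrightarrow>
      (\<integral>\<^sup>+x. indicator (ball 0 \<rho>) x * ennreal (f x ^ n) \<partial>lborel) \<le> ennreal (KO * \<mu> ^ n)"
    and Trudinger: "\<And>(w :: real^'n \<Rightarrow> real) W L. C1_grad w W \<Longrightarrow> (\<And>y. norm y \<ge> 2 \<Longrightarrow> w y = 0) \<Longrightarrow> 0 < L \<Longrightarrow>
      (\<integral>\<^sup>+y. ennreal (norm (W y) ^ n) \<partial>lborel) \<le> ennreal (L ^ n) \<Longrightarrow>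
      (\<integral>\<^sup>+x. ennreal (exp ((\<bar>w x\<bar> / (KT * L)) powr (real n / (real n - 1))) - 1) \<partial>lborel) \<le> 1"
begin

text \<open>The 16 is the constant 8 of the cut-off taken over half of the gap between the radii;
  the 2 accounts for the two terms of the energy.\<close>

definition KE where "KE = 2 * KO * 16 ^ n"

lemma KE: "1 \<le> KE"
proof -
  have "1 * 1 \<le> KO * 16 ^ n" using KO by (intro mult_mono) auto
  then show ?thesis by (simp add: KE_def)
qed

text \<open>Both parts of the right side of \<open>Caccioppoli\<close> are paired with a function
  \<open>f\<close> that dominates \<open>v * h (v)\<close>; thus \<open>h\<close> enters only
  through the modular of \<open>f\<close>.\<close>

lemma energy_bound:
  assumes \<rho>: "0 < \<rho>'" "\<rho>' < \<rho>" "\<rho> \<le> P"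
    and mod: "exp_modular (real n * r / (real n - 1)) (ball 0 \<rho>) f \<mu>"
    and f: "f \<in> borel_measurable borel" "\<And>x. v x * h (v x) \<le> f x"
    and h: "\<And>s. 0 \<le> h s" "h \<in> borel_measurable borel"
    and \<eta>: "\<And>x. 0 \<le> \<eta> x" "\<And>x. \<eta> x \<le> 1" "\<And>x. norm x \<ge> \<rho> \<Longrightarrow> \<eta> x = 0" "\<And>x. norm x \<ge> \<rho> \<Longrightarrow> E x = 0"
      "\<And>x. norm (E x) \<le> 16 / (\<rho> - \<rho>')"
    and Y: "integrable lborel (\<lambda>x. (norm (E x) ^ n + \<eta> x ^ n * V x) * (v x * h (v x)) ^ n)"
  shows "(\<integral>x. (norm (E x) ^ n + \<eta> x ^ n * V x) * (v x * h (v x)) ^ n \<partial>lborel) \<le> KE * S * (\<mu> / (\<rho> - \<rho>')) ^ n"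
proof -
  note [measurable] = f(1)
  have [measurable]: "ball (0 :: real^'n) \<rho> \<in> sets borel" by simp
  have \<mu>: "\<mu> > 0" using mod by (simp add: exp_modular_def)
  have vh: "0 \<le> v x * h (v x)" for x using v_ge(3)[of x] h(1) by simp
  have f0: "0 \<le> f x" for x using vh f(2) by (rule order_trans)
  define k where "k = (16 / (\<rho> - \<rho>')) ^ n"
  have k: "k \<ge> 0" using \<rho> by (simp add: k_def)
  let ?Y = "\<lambda>x. (norm (E x) ^ n + \<eta> x ^ n * V x) * (v x * h (v x)) ^ n"
  have Y0: "0 \<le> ?Y x" for x using \<eta>(1) V_nonneg vh by (intro mult_nonneg_nonneg add_nonneg_nonneg) auto
  have "ennreal (\<integral>x. ?Y x \<partial>lborel) = (\<integral>\<^sup>+x. ennreal (?Y x) \<partial>lborel)"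
    by (rule nn_integral_eq_integral[symmetric, OF Y]) (use Y0 in simp)
  also have "\<dots> \<le> (\<integral>\<^sup>+x. ennreal k * (indicator (ball 0 \<rho>) x * ennreal (f x ^ n)) + indicator (ball 0 \<rho>) x * ennreal (V x * f x ^ n) \<partial>lborel)"
  proof (rule nn_integral_mono)
    fix x
    show "ennreal (?Y x) \<le> ennreal k * (indicator (ball 0 \<rho>) x * ennreal (f x ^ n)) + indicator (ball 0 \<rho>) x * ennreal (V x * f x ^ n)"
    proof (cases "norm x < \<rho>")
      case True
      have "\<eta> x ^ n * V x \<le> 1 * V x" using \<eta>(1,2) V_nonneg by (intro mult_right_mono power_le_one) auto
      moreover have "norm (E x) ^ n \<le> k" unfolding k_def by (intro power_mono \<eta>(5)) auto
      ultimately have "?Y x \<le> (k + 1 * V x) * f x ^ n"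
        using vh f(2) k V_nonneg[of x] by (intro mult_mono[OF add_mono] power_mono) auto
      then have "ennreal (?Y x) \<le> ennreal (k * f x ^ n + V x * f x ^ n)"
        by (intro ennreal_leI) (simp add: distrib_right)
      also have "\<dots> = ennreal k * ennreal (f x ^ n) + ennreal (V x * f x ^ n)"
        using k f0[of x] V_nonneg[of x] by (subst ennreal_plus) (auto simp: ennreal_mult)
      finally show ?thesis using True by simp
    next
      case False
      then show ?thesis using \<eta>(3,4)[of x] n(2) by simp
    qed
  qed
  also have "\<dots> = ennreal k * (\<integral>\<^sup>+x. indicator (ball 0 \<rho>) x * ennreal (f x ^ n) \<partial>lborel)
      + (\<integral>\<^sup>+x. indicator (ball 0 \<rho>) x * ennreal (V x * f x ^ n) \<partial>lborel)"
    by (subst nn_integral_add, measurable, subst nn_integral_cmult) auto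
  also have "\<dots> \<le> ennreal k * ennreal (KO * \<mu> ^ n) + ennreal (KO * S * \<mu> ^ n)"
    by (intro add_mono mult_left_mono Orlicz[OF f(1) f0 \<rho>(3) mod] Orlicz_1[OF f(1) f0 \<rho>(3) mod]) auto
  also have "\<dots> = ennreal (k * (KO * \<mu> ^ n) + KO * S * \<mu> ^ n)"
    using k KO S \<mu> by (subst ennreal_plus) (auto simp: ennreal_mult)
  finally have "ennreal (\<integral>x. ?Y x \<partial>lborel) \<le> ennreal (k * (KO * \<mu> ^ n) + KO * S * \<mu> ^ n)" .
  then have "(\<integral>x. ?Y x \<partial>lborel) \<le> k * (KO * \<mu> ^ n) + KO * S * \<mu> ^ n"
    using k KO S \<mu> by (subst (asm) ennreal_le_iff) auto
  also have "\<dots> \<le> k * (KO * \<mu> ^ n) * S + k * (KO * S * \<mu> ^ n)"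
  proof (rule add_mono)
    show "k * (KO * \<mu> ^ n) \<le> k * (KO * \<mu> ^ n) * S"
      using mult_left_mono[of 1 S "k * (KO * \<mu> ^ n)"] k KO S \<mu> by simp
    \<comment> \<open>The gap between the radii is at most \<open>P \<le> 2\<close>; hence the
      coefficient term can be put on the scale of the cut-off term.\<close>
    have "1 \<le> k" unfolding k_def using \<rho> P by (intro one_le_power) (simp add: field_simps)
    then show "KO * S * \<mu> ^ n \<le> k * (KO * S * \<mu> ^ n)"
      using mult_right_mono[of 1 k "KO * S * \<mu> ^ n"] KO S \<mu> by simp
  qed
  also have "\<dots> = KE * S * (\<mu> / (\<rho> - \<rho>')) ^ n"
    by (simp add: KE_def k_def power_divide)
  finally show ?thesis .
qed

lemma gradient_bound:
  assumes \<rho>: "0 < \<rho>'" "\<rho>' < \<rho>" "\<rho> \<le> P"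
    and mod: "exp_modular (real n * r / (real n - 1)) (ball 0 \<rho>) v \<mu>"
  shows "(\<integral>x. indicator (ball 0 \<rho>') x * norm (Du x) ^ n \<partial>lborel) \<le> 2 * CC * KE * S * (\<mu> / (\<rho> - \<rho>')) ^ n"
proof -
  \<comment> \<open>\<open>Caccioppoli\<close> asks for a cut-off that vanishes from a radius
    strictly below \<open>P\<close> on, while \<open>\<rho> = P\<close> is allowed; the midpoint
    provides it at the price of half the gap.\<close>
  define \<rho>'' where "\<rho>'' = (\<rho>' + \<rho>) / 2"
  have \<rho>'': "\<rho>' < \<rho>''" "\<rho>'' < P" "\<rho>'' < \<rho>" "\<rho>'' - \<rho>' = (\<rho> - \<rho>') / 2" using \<rho> by (auto simp: \<rho>''_def field_simps)
  obtain \<eta> and E :: "real^'n \<Rightarrow> real^'n" where \<eta>: "C1_grad \<eta> E" "\<And>x. 0 \<le> \<eta> x" "\<And>x. \<eta> x \<le> 1"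
    "\<And>x. norm x \<ge> \<rho>'' \<Longrightarrow> \<eta> x = 0" "\<And>x. norm x \<le> \<rho>' \<Longrightarrow> \<eta> x = 1" "\<And>x. norm (E x) \<le> 8 / (\<rho>'' - \<rho>')"
    by (rule C1_cutoff_exists[OF \<rho>(1) \<rho>''(1)]) blast
  have E0: "E x = 0" if "norm x \<ge> \<rho>" for x
    by (rule C1_grad_zero_outside[OF \<eta>(1), where S="- cball 0 \<rho>''"]) (use that \<eta>(4) \<rho>'' in auto)
  define h where "h s = (1::real)" for s :: real
  have h: "continuous_on UNIV h" "\<And>s. 0 \<le> h s" "mono h" "\<And>s. h s \<le> 1"
    by (auto simp: h_def[abs_def] mono_def)
  note C = Caccioppoli[OF \<eta>(1,2,3,4) \<rho>''(2) h]
  have "(\<integral>x. indicator (ball 0 \<rho>') x * norm (Du x) ^ n \<partial>lborel) \<le> (\<integral>x. \<eta> x ^ n * h (v x) ^ n * norm (Du x) ^ n \<partial>lborel)"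
  proof (rule integral_mono[OF _ C(1)])
    show "integrable lborel (\<lambda>x. indicator (ball 0 \<rho>') x * norm (Du x) ^ n)"
    proof (rule Bochner_Integration.integrable_bound[OF Du_int])
      show "(\<lambda>x. indicator (ball 0 \<rho>') x * norm (Du x) ^ n) \<in> borel_measurable lborel"
        by (intro borel_measurable_times borel_measurable_indicator borel_measurable_power) auto
    qed (auto simp: indicator_def)
    show "indicator (ball 0 \<rho>') x * norm (Du x) ^ n \<le> \<eta> x ^ n * h (v x) ^ n * norm (Du x) ^ n" for x
      using \<eta>(5)[of x] \<eta>(2)[of x] by (auto simp: indicator_def h_def)
  qed
  also have "\<dots> \<le> 2 * CC * (\<integral>x. (norm (E x) ^ n + \<eta> x ^ n * V x) * (v x * h (v x)) ^ n \<partial>lborel)" by (rule C(3))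
  also have "\<dots> \<le> 2 * CC * (KE * S * (\<mu> / (\<rho> - \<rho>')) ^ n)"
  proof (intro mult_left_mono energy_bound[OF \<rho> mod _ _ _ _ \<eta>(2,3) _ E0 _ C(2)])
    show "\<eta> x = 0" if "norm x \<ge> \<rho>" for x using \<eta>(4)[of x] that \<rho>'' by simp
    show "norm (E x) \<le> 16 / (\<rho> - \<rho>')" for x using \<eta>(6)[of x] \<rho>''(4) by simp
  qed (use CC_nonneg h in \<open>auto simp: h_def[abs_def]\<close>)
  finally show ?thesis by (simp add: mult.assoc)
qed

end

lemma antiderivative_mono_bounds:
  fixes h :: "real \<Rightarrow> real"
  assumes H: "\<And>t. (H has_real_derivative h t) (at t)" "H 0 = 0" and h: "\<And>s. 0 \<le> h s" "mono h" and s: "0 \<le> s"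
  shows "0 \<le> H s" "H s \<le> s * h s"
proof -
  have "\<exists>y. 0 \<le> y \<and> y \<le> s \<and> H s = s * h y"
  proof (cases "s = 0")
    case False
    then obtain y where "0 < y" "y < s" "H s - H 0 = (s - 0) * h y"
      using MVT2[of 0 s H h] H(1) s by auto
    then show ?thesis using H(2) by (intro exI[of _ y]) auto
  qed (use H(2) in auto)
  then obtain y where y: "0 \<le> y" "y \<le> s" "H s = s * h y" by blast
  show "0 \<le> H s" using y h s by simp
  show "H s \<le> s * h s" unfolding y(3) using h(2) y s by (intro mult_left_mono) (auto dest: monoD)
qed

context elliptic_iteration
begin

text \<open>\<open>2 ^ n\<close> arises from splitting the gradient of
  \<open>\<eta> * H (v)\<close>, and \<open>2 * CC + 1\<close> from its two parts after
  \<open>Caccioppoli\<close>. The final 1 buys a strict inequality, which persists for the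
  approximants.\<close>

definition K2 where "K2 = 2 ^ n * (2 * CC + 1) * KE + 1"

lemma K2: "1 \<le> K2"
  using CC_nonneg KE by (simp add: K2_def)

text \<open>Trudinger's inequality is available for C1 functions, so it is applied to
  \<open>\<eta> * G (w j)\<close>, where \<open>G\<close> is \<open>H\<close> composed with
  \<open>s\<close>. The gradient norms converge and hence lie below the bound for all large
  \<open>j\<close>; Fatou then carries the modular inequality over to \<open>H (v)\<close>.\<close>

lemma Trudinger_composed:
  assumes \<rho>: "0 < \<rho>'" "\<rho>' < \<rho>" "\<rho> \<le> P"
    and mod: "exp_modular (real n * r / (real n - 1)) (ball 0 \<rho>) f \<mu>"
    and f: "f \<in> borel_measurable borel" "\<And>x. v x * h (v x) \<le> f x"
    and h: "continuous_on UNIV h" "\<And>s. 0 \<le> h s" "mono h" "\<And>s. h s \<le> K"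
    and H: "\<And>t. (H has_real_derivative h t) (at t)" "H 0 = 0"
  shows "exp_modular (real n / (real n - 1)) (ball 0 \<rho>') (\<lambda>x. H (v x)) (KT * (K2 * S * \<mu> / (\<rho> - \<rho>')))"
proof -
  define \<rho>'' where "\<rho>'' = (\<rho>' + \<rho>) / 2"
  have \<rho>'': "\<rho>' < \<rho>''" "\<rho>'' < P" "\<rho>'' < \<rho>" "\<rho>'' - \<rho>' = (\<rho> - \<rho>') / 2" using \<rho> by (auto simp: \<rho>''_def field_simps)
  have \<mu>: "\<mu> > 0" using mod by (simp add: exp_modular_def)
  obtain \<eta> and E :: "real^'n \<Rightarrow> real^'n" where \<eta>: "C1_grad \<eta> E" "\<And>x. 0 \<le> \<eta> x" "\<And>x. \<eta> x \<le> 1"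
    "\<And>x. norm x \<ge> \<rho>'' \<Longrightarrow> \<eta> x = 0" "\<And>x. norm x \<le> \<rho>' \<Longrightarrow> \<eta> x = 1" "\<And>x. norm (E x) \<le> 8 / (\<rho>'' - \<rho>')"
    by (rule C1_cutoff_exists[OF \<rho>(1) \<rho>''(1)]) blast
  have E00: "E x = 0" if "norm x > \<rho>''" for x
    by (rule C1_grad_zero_outside[OF \<eta>(1), where S="- cball 0 \<rho>''"]) (use that \<eta>(4) \<rho>'' in auto)
  then have E0: "E x = 0" if "norm x \<ge> \<rho>" for x using that \<rho>'' by simp
  define KE' where "KE' = 8 / (\<rho>'' - \<rho>')"
  have KE': "KE' > 0" "norm (E x) \<le> KE'" for x
  proof -
    show "KE' > 0" using \<rho>'' by (simp add: KE'_def)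
    show "norm (E x) \<le> KE'" unfolding KE'_def by (rule \<eta>(6))
  qed
  have K: "K \<ge> 0" using h(2)[of 0] h(4)[of 0] by linarith
  note C = Caccioppoli[OF \<eta>(1,2,3,4) \<rho>''(2) h]
  let ?X = "\<lambda>x. \<eta> x ^ n * h (v x) ^ n * norm (Du x) ^ n"
  let ?Y = "\<lambda>x. (norm (E x) ^ n + \<eta> x ^ n * V x) * (v x * h (v x)) ^ n"
  have hm[measurable]: "h \<in> borel_measurable borel" using h(1) by (rule borel_measurable_continuous_onI)
  have EB: "(\<integral>x. ?Y x \<partial>lborel) \<le> KE * S * (\<mu> / (\<rho> - \<rho>')) ^ n"
  proof (rule energy_bound[OF \<rho> mod f h(2) hm \<eta>(2,3) _ E0 _ C(2)])
    show "\<eta> x = 0" if "norm x \<ge> \<rho>" for x using \<eta>(4)[of x] that \<rho>'' by simp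
    show "norm (E x) \<le> 16 / (\<rho> - \<rho>')" for x using \<eta>(6)[of x] \<rho>''(4) by simp
  qed
  define s where "s t = sqrt (t\<^sup>2 + \<kappa>\<^sup>2)" for t
  have s_u: "s (u x) = v x" for x by (simp add: s_def v)
  have s_pos: "s t > 0" for t using \<kappa> by (simp add: s_def add_nonneg_pos)
  have s_ge: "\<bar>t\<bar> \<le> s t" for t unfolding s_def by (intro real_le_rsqrt) auto
  have s_le: "s t \<le> \<bar>t\<bar> + \<kappa>" for t unfolding s_def using \<kappa> by (intro real_le_lsqrt) (auto simp: power2_sum)
  have s_deriv: "(s has_real_derivative t / s t) (at t)" for t
  proof -
    have "0 < t\<^sup>2 + \<kappa>\<^sup>2" using \<kappa> by (simp add: add_nonneg_pos)
    then show ?thesis unfolding s_def[abs_def] by (auto intro!: derivative_eq_intros simp: field_simps)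
  qed
  have s_cont: "continuous_on UNIV s" unfolding s_def[abs_def] by (intro continuous_intros)
  define G where "G t = H (s t)" for t
  define g where "g t = h (s t) * (t / s t)" for t
  have Gd: "(G has_real_derivative g t) (at t)" for t
    unfolding G_def[abs_def] g_def using DERIV_chain2[OF H(1) s_deriv] by simp
  have g_cont: "continuous_on UNIV g"
    unfolding g_def[abs_def]
    by (intro continuous_on_mult continuous_on_divide continuous_on_compose2[OF h(1) s_cont] s_cont continuous_on_id)
      (use s_pos in \<open>auto simp: less_imp_neq[THEN not_sym]\<close>)
  have g_le: "\<bar>g t\<bar> \<le> h (s t)" for t
  proof -
    have "\<bar>t / s t\<bar> \<le> 1" using s_ge[of t] s_pos[of t] by (simp add: abs_divide)
    then have "h (s t) * \<bar>t / s t\<bar> \<le> h (s t) * 1" using h(2) by (intro mult_left_mono)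
    then show ?thesis using h(2)[of "s t"] by (simp add: g_def abs_mult)
  qed
  have G0: "0 \<le> G t" and G_le: "G t \<le> s t * h (s t)" for t
    using antiderivative_mono_bounds[OF H h(2,3), of "s t"] s_pos[of t] by (auto simp: G_def less_imp_le)
  have G_cont: "continuous_on UNIV G" using DERIV_isCont[OF Gd] by (simp add: continuous_on_eq_continuous_at)
  have [measurable]: "g \<in> borel_measurable borel" "G \<in> borel_measurable borel"
    using g_cont G_cont by (auto intro: borel_measurable_continuous_onI)
  have [measurable]: "\<eta> \<in> borel_measurable borel" "E \<in> borel_measurable borel"
    using C1_grad_measurable[OF \<eta>(1)] by auto
  obtain w W Z where wC: "\<And>j::nat. C1_grad (w j) (W j)" and Z: "integrable lborel Z" "\<And>x. Z x \<ge> 0"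
    and conv: "AE x in lborel. norm x < (\<rho>'' + P) / 2 \<longrightarrow> (\<forall>j. \<bar>w j x\<bar> ^ n \<le> Z x \<and> norm (W j x) ^ n \<le> Z x) \<and>
       (\<lambda>j. w j x) \<longlonglongrightarrow> u x \<and> (\<lambda>j. W j x) \<longlonglongrightarrow> Du x"
    by (rule smooth_approximation[of "(\<rho>'' + P) / 2"]) (use \<rho>'' in auto)
  have [measurable]: "w j \<in> borel_measurable borel" "W j \<in> borel_measurable borel" for j
    using C1_grad_measurable[OF wC] by auto
  define F where "F w W x = (\<eta> x * g (w x)) *\<^sub>R W x + G (w x) *\<^sub>R E x" for w :: "real^'n \<Rightarrow> real" and W x
  have FC: "C1_grad (\<lambda>x. \<eta> x * G (w j x)) (F (w j) (W j))" for j
    using C1_grad_cutoff[OF wC[of j] \<eta>(1) Gd g_cont, of 0] by (simp add: F_def[abs_def])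
  define KT' where "KT' = K * KE'"
  have KT': "KT' \<ge> 0" using K KE' by (simp add: KT'_def)
  have F_norm: "norm (F w W x) ^ n \<le> 2 ^ n * ((\<eta> x * h (s (w x)) * norm (W x)) ^ n + (norm (E x) * (s (w x) * h (s (w x)))) ^ n)" for w W x
  proof -
    have "norm (F w W x) \<le> \<bar>\<eta> x * g (w x)\<bar> * norm (W x) + \<bar>G (w x)\<bar> * norm (E x)"
      unfolding F_def by (rule order_trans[OF norm_triangle_ineq]) simp
    also have "\<dots> \<le> \<eta> x * h (s (w x)) * norm (W x) + norm (E x) * (s (w x) * h (s (w x)))"
    proof (rule add_mono)
      show "\<bar>\<eta> x * g (w x)\<bar> * norm (W x) \<le> \<eta> x * h (s (w x)) * norm (W x)"
        unfolding abs_mult using \<eta>(2)[of x] g_le by (intro mult_right_mono) (auto intro: mult_left_mono)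
      have "\<bar>G (w x)\<bar> * norm (E x) \<le> (s (w x) * h (s (w x))) * norm (E x)"
        using G0 G_le by (intro mult_right_mono) auto
      then show "\<bar>G (w x)\<bar> * norm (E x) \<le> norm (E x) * (s (w x) * h (s (w x)))" by (simp add: mult.commute)
    qed
    finally have "norm (F w W x) ^ n \<le> \<bar>\<eta> x * h (s (w x)) * norm (W x) + norm (E x) * (s (w x) * h (s (w x)))\<bar> ^ n"
      by (intro power_mono) auto
    also have "\<dots> \<le> 2 ^ n * (\<bar>\<eta> x * h (s (w x)) * norm (W x)\<bar> ^ n + \<bar>norm (E x) * (s (w x) * h (s (w x)))\<bar> ^ n)"
      by (rule power_abs_add_le)
    finally show ?thesis using \<eta>(2)[of x] h(2) s_pos[of "w x"] by (simp add: less_imp_le)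
  qed
  \<comment> \<open>Here \<open>K\<close> bounds \<open>h\<close>, \<open>KT'\<close> bounds
    \<open>h\<close> times the gradient of the cut-off, and
    \<open>s t \<le> \<bar>t\<bar> + \<kappa>\<close> accounts for the term with
    \<open>\<kappa>\<close>.\<close>
  define D where "D x = 2 ^ n * (K ^ n * Z x + KT' ^ n * (2 ^ n * (Z x + \<kappa> ^ n * indicator (ball 0 P) x)))" for x
  have D_int: "integrable lborel D" unfolding D_def[abs_def]
    using Z(1) indicator_ball_integrable by (intro integrable_mult_right Bochner_Integration.integrable_add)
  have D0: "D x \<ge> 0" for x unfolding D_def using Z(2)[of x] K KT' \<kappa> by simp
  have F_zero: "F w W x = 0" if "\<not> norm x < (\<rho>'' + P) / 2" for w W x
    using that \<rho>'' \<eta>(4)[of x] E00[of x] by (simp add: F_def)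
  have F_lim: "(\<lambda>j. F (w j) (W j) x) \<longlonglongrightarrow> F u Du x"
    if "norm x < (\<rho>'' + P) / 2 \<longrightarrow> (\<forall>j. \<bar>w j x\<bar> ^ n \<le> Z x \<and> norm (W j x) ^ n \<le> Z x) \<and>
       (\<lambda>j. w j x) \<longlonglongrightarrow> u x \<and> (\<lambda>j. W j x) \<longlonglongrightarrow> Du x" for x
  proof (cases "norm x < (\<rho>'' + P) / 2")
    case True
    with that have l: "(\<lambda>j. w j x) \<longlonglongrightarrow> u x" "(\<lambda>j. W j x) \<longlonglongrightarrow> Du x" by auto
    show ?thesis unfolding F_def
      using continuous_on_tendsto_compose[OF g_cont l(1)] continuous_on_tendsto_compose[OF G_cont l(1)] l(2)
      by (intro tendsto_intros) auto
  qed (simp add: F_zero)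
  have F_meas[measurable]: "F (w j) (W j) \<in> borel_measurable borel" "F u Du \<in> borel_measurable borel" for j
    unfolding F_def[abs_def] by measurable
  have F_int_lim: "(\<lambda>j. \<integral>x. norm (F (w j) (W j) x) ^ n \<partial>lborel) \<longlonglongrightarrow> (\<integral>x. norm (F u Du x) ^ n \<partial>lborel)"
    and F_int: "\<And>j. integrable lborel (\<lambda>x. norm (F (w j) (W j) x) ^ n)"
  proof -
    have lim: "AE x in lborel. (\<lambda>j. norm (F (w j) (W j) x) ^ n) \<longlonglongrightarrow> norm (F u Du x) ^ n"
      using conv by eventually_elim (intro tendsto_intros F_lim)
    have dom: "AE x in lborel. norm (norm (F (w j) (W j) x) ^ n) \<le> D x" for j
      using conv
    proof eventually_elim
      case (elim x)
      show ?case
      proof (cases "norm x < (\<rho>'' + P) / 2")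
        case True
        then have xP: "norm x < P" using \<rho>'' by simp
        have b: "\<bar>w j x\<bar> ^ n \<le> Z x" "norm (W j x) ^ n \<le> Z x" using elim True by auto
        have "norm (F (w j) (W j) x) ^ n \<le> 2 ^ n * ((\<eta> x * h (s (w j x)) * norm (W j x)) ^ n + (norm (E x) * (s (w j x) * h (s (w j x)))) ^ n)"
          by (rule F_norm)
        also have "\<dots> \<le> D x"
        proof -
          have "(\<eta> x * h (s (w j x)) * norm (W j x)) ^ n \<le> (1 * K * norm (W j x)) ^ n"
            using \<eta>(2,3) h(2,4) K by (intro power_mono mult_mono) auto
          also have "\<dots> \<le> K ^ n * Z x"
            using b(2) K by (simp add: power_mult_distrib mult_left_mono)
          finally have 1: "(\<eta> x * h (s (w j x)) * norm (W j x)) ^ n \<le> K ^ n * Z x" .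
          have "norm (E x) * (s (w j x) * h (s (w j x))) \<le> KE' * ((\<bar>w j x\<bar> + \<kappa>) * K)"
            using KE' s_le h(2,4) K s_pos[of "w j x"] \<kappa> by (intro mult_mono) (auto simp: less_imp_le)
          then have "(norm (E x) * (s (w j x) * h (s (w j x)))) ^ n \<le> (KT' * \<bar>\<bar>w j x\<bar> + \<kappa>\<bar>) ^ n"
            using h(2) s_pos[of "w j x"] \<kappa> by (intro power_mono) (auto simp: KT'_def mult_ac less_imp_le)
          also have "\<dots> \<le> KT' ^ n * (2 ^ n * (\<bar>\<bar>w j x\<bar>\<bar> ^ n + \<bar>\<kappa>\<bar> ^ n))"
            unfolding power_mult_distrib using KT' by (intro mult_left_mono power_abs_add_le) auto
          also have "\<dots> \<le> KT' ^ n * (2 ^ n * (Z x + \<kappa> ^ n * indicator (ball 0 P) x))"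
            using b(1) \<kappa> xP KT' by (intro mult_left_mono add_mono) auto
          finally have 2: "(norm (E x) * (s (w j x) * h (s (w j x)))) ^ n \<le> KT' ^ n * (2 ^ n * (Z x + \<kappa> ^ n * indicator (ball 0 P) x))" .
          show ?thesis unfolding D_def using 1 2 by (intro mult_left_mono add_mono) auto
        qed
        finally show ?thesis by simp
      next
        case False
        then show ?thesis using D0[of x] n(2) by (simp add: F_zero)
      qed
    qed
    show "(\<lambda>j. \<integral>x. norm (F (w j) (W j) x) ^ n \<partial>lborel) \<longlonglongrightarrow> (\<integral>x. norm (F u Du x) ^ n \<partial>lborel)"
      by (rule integral_dominated_convergence[OF _ _ D_int lim dom]) measurable
    show "integrable lborel (\<lambda>x. norm (F (w j) (W j) x) ^ n)" for j
    proof (rule Bochner_Integration.integrable_bound[OF D_int])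
      show "AE x in lborel. norm (norm (F (w j) (W j) x) ^ n) \<le> norm (D x)"
        using dom[of j] by eventually_elim (use D0 in auto)
    qed measurable
  qed
  \<comment> \<open>The energy bound contains \<open>K2 * S\<close> only once, but
    \<open>L ^ n\<close> contains its \<open>n\<close>-th power; this is allowed because
    \<open>K2 * S \<ge> 1\<close>.\<close>
  define L where "L = K2 * S * \<mu> / (\<rho> - \<rho>')"
  have L: "L > 0" using K2 S \<mu> \<rho> by (simp add: L_def)
  have F_bound: "(\<integral>x. norm (F u Du x) ^ n \<partial>lborel) < L ^ n"
  proof -
    have le: "norm (F u Du x) ^ n \<le> 2 ^ n * (?X x + ?Y x)" for x
    proof -
      have "norm (F u Du x) ^ n \<le> 2 ^ n * ((\<eta> x * h (v x) * norm (Du x)) ^ n + (norm (E x) * (v x * h (v x))) ^ n)"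
        using F_norm[of u Du x] by (simp add: s_u)
      also have "\<dots> \<le> 2 ^ n * (?X x + ?Y x)"
      proof (intro mult_left_mono add_mono)
        show "(\<eta> x * h (v x) * norm (Du x)) ^ n \<le> ?X x" by (simp add: power_mult_distrib)
        have "0 \<le> \<eta> x ^ n * V x * (v x * h (v x)) ^ n"
          using \<eta>(2)[of x] V_nonneg[of x] v_ge(3)[of x] h(2) by (intro mult_nonneg_nonneg zero_le_power) (auto simp: less_imp_le)
        then show "(norm (E x) * (v x * h (v x))) ^ n \<le> ?Y x"
          unfolding power_mult_distrib[of "norm (E x)"] by (simp add: distrib_right)
      qed auto
      finally show ?thesis .
    qed
    have XY_int: "integrable lborel (\<lambda>x. 2 ^ n * (?X x + ?Y x))"
      using C(1,2) by (intro integrable_mult_right Bochner_Integration.integrable_add)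
    have "(\<integral>x. norm (F u Du x) ^ n \<partial>lborel) \<le> (\<integral>x. 2 ^ n * (?X x + ?Y x) \<partial>lborel)"
    proof (rule integral_mono[OF _ XY_int le])
      show "integrable lborel (\<lambda>x. norm (F u Du x) ^ n)"
      proof (rule Bochner_Integration.integrable_bound[OF XY_int])
        show "AE x in lborel. norm (norm (F u Du x) ^ n) \<le> norm (2 ^ n * (?X x + ?Y x))"
        proof (rule AE_I2)
          fix x
          show "norm (norm (F u Du x) ^ n) \<le> norm (2 ^ n * (?X x + ?Y x))"
            using le[of x] unfolding real_norm_def by (smt (verit) norm_ge_zero zero_le_power)
        qed
      qed measurable
    qed
    also have "\<dots> = 2 ^ n * ((\<integral>x. ?X x \<partial>lborel) + (\<integral>x. ?Y x \<partial>lborel))"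
      using C(1,2) by simp
    also have "\<dots> \<le> 2 ^ n * (2 * CC * (KE * S * (\<mu> / (\<rho> - \<rho>')) ^ n) + KE * S * (\<mu> / (\<rho> - \<rho>')) ^ n)"
    proof (intro mult_left_mono add_mono EB)
      have "(\<integral>x. ?X x \<partial>lborel) \<le> 2 * CC * (\<integral>x. ?Y x \<partial>lborel)" by (rule C(3))
      also have "\<dots> \<le> 2 * CC * (KE * S * (\<mu> / (\<rho> - \<rho>')) ^ n)"
        by (intro mult_left_mono EB) (use CC_nonneg in simp)
      finally show "(\<integral>x. ?X x \<partial>lborel) \<le> 2 * CC * (KE * S * (\<mu> / (\<rho> - \<rho>')) ^ n)" .
    qed simp
    also have "\<dots> = (K2 - 1) * S * (\<mu> / (\<rho> - \<rho>')) ^ n" by (simp add: K2_def algebra_simps)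
    also have "\<dots> < K2 * S * (\<mu> / (\<rho> - \<rho>')) ^ n"
      using S \<mu> \<rho> by (intro mult_strict_right_mono) auto
    also have "\<dots> \<le> (K2 * S) ^ n * (\<mu> / (\<rho> - \<rho>')) ^ n"
    proof (rule mult_right_mono)
      have "1 * 1 \<le> K2 * S" using K2 S by (intro mult_mono) auto
      then show "K2 * S \<le> (K2 * S) ^ n" using power_increasing[of 1 n "K2 * S"] n by simp
    qed (use \<mu> \<rho> in simp)
    also have "\<dots> = L ^ n" by (simp add: L_def power_mult_distrib[symmetric])
    finally show ?thesis .
  qed
  have "eventually (\<lambda>j. (\<integral>x. norm (F (w j) (W j) x) ^ n \<partial>lborel) < L ^ n) sequentially"
    using F_int_lim F_bound by (rule order_tendstoD(2))
  then obtain j0 where j0: "\<And>j. j \<ge> j0 \<Longrightarrow> (\<integral>x. norm (F (w j) (W j) x) ^ n \<partial>lborel) < L ^ n"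
    by (auto simp: eventually_sequentially)
  let ?e = "\<lambda>t. exp ((\<bar>t\<bar> / (KT * L)) powr (real n / (real n - 1))) - 1"
  have KTL: "KT * L > 0" using KT L by simp
  \<comment> \<open>Guaranteed from \<open>j0\<close> on only, which explains the shift of the
    sequence in the Fatou argument below.\<close>
  have T: "(\<integral>\<^sup>+x. ennreal (?e (\<eta> x * G (w j x))) \<partial>lborel) \<le> 1" if "j \<ge> j0" for j
  proof (rule Trudinger[OF FC _ L])
    show "\<eta> y * G (w j y) = 0" if "2 \<le> norm y" for y using that \<rho>'' P \<eta>(4)[of y] by simp
    have "(\<integral>\<^sup>+y. ennreal (norm (F (w j) (W j) y) ^ n) \<partial>lborel) = ennreal (\<integral>y. norm (F (w j) (W j) y) ^ n \<partial>lborel)"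
      by (rule nn_integral_eq_integral[OF F_int]) simp
    also have "\<dots> \<le> ennreal (L ^ n)" using j0[OF that] by (intro ennreal_leI) simp
    finally show "(\<integral>\<^sup>+y. ennreal (norm (F (w j) (W j) y) ^ n) \<partial>lborel) \<le> ennreal (L ^ n)" .
  qed
  have n1: "real n / (real n - 1) > 0" using n by simp
  have "(\<integral>\<^sup>+x. indicator (ball 0 \<rho>') x * ennreal (?e (H (v x))) \<partial>lborel)
    \<le> (\<integral>\<^sup>+x. liminf (\<lambda>j. ennreal (?e (\<eta> x * G (w (j + j0) x)))) \<partial>lborel)"
  proof (rule nn_integral_mono_AE)
    show "AE x in lborel. indicator (ball 0 \<rho>') x * ennreal (?e (H (v x))) \<le> liminf (\<lambda>j. ennreal (?e (\<eta> x * G (w (j + j0) x))))"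
      using conv
    proof eventually_elim
      case (elim x)
      show ?case
      proof (cases "norm x < \<rho>'")
        case True
        then have "norm x < (\<rho>'' + P) / 2" using \<rho>'' by simp
        with elim have "(\<lambda>j. w j x) \<longlonglongrightarrow> u x" by auto
        then have "(\<lambda>j. w (j + j0) x) \<longlonglongrightarrow> u x" by (rule LIMSEQ_ignore_initial_segment)
        then have "(\<lambda>j. G (w (j + j0) x)) \<longlonglongrightarrow> G (u x)"
          by (rule continuous_on_tendsto_compose[OF G_cont]) auto
        then have "(\<lambda>j. ?e (\<eta> x * G (w (j + j0) x))) \<longlonglongrightarrow> ?e (\<eta> x * G (u x))"
          using KTL n1 by (intro tendsto_intros tendsto_powr') auto
        then have "(\<lambda>j. ennreal (?e (\<eta> x * G (w (j + j0) x)))) \<longlonglongrightarrow> ennreal (?e (\<eta> x * G (u x)))"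
          by (rule tendsto_ennrealI)
        then have "liminf (\<lambda>j. ennreal (?e (\<eta> x * G (w (j + j0) x)))) = ennreal (?e (\<eta> x * G (u x)))"
          by (rule lim_imp_Liminf[OF trivial_limit_sequentially])
        moreover have "\<eta> x * G (u x) = H (v x)" using \<eta>(5)[of x] True by (simp add: G_def s_u)
        ultimately show ?thesis using True by simp
      qed simp
    qed
  qed
  also have "\<dots> \<le> liminf (\<lambda>j. \<integral>\<^sup>+x. ennreal (?e (\<eta> x * G (w (j + j0) x))) \<partial>lborel)"
    by (rule nn_integral_liminf) measurable
  also have "\<dots> \<le> liminf (\<lambda>j::nat. 1 :: ennreal)"
    by (intro Liminf_mono always_eventually allI T) simp
  also have "\<dots> = 1" by (rule Liminf_const) simp
  finally show ?thesis using KTL by (simp add: exp_modular_def L_def)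
qed

end

text \<open>Fatou's lemma in the form that removes a truncation: at each point the truncated
  functions eventually dominate \<open>f\<close>.\<close>

lemma exp_modular_limit:
  fixes f :: "'a::euclidean_space \<Rightarrow> real" and g :: "nat \<Rightarrow> 'a \<Rightarrow> real"
  assumes [measurable]: "\<And>j. g j \<in> borel_measurable borel" "\<Omega> \<in> sets borel"
    and s: "s \<ge> 0" and l: "l > 0" and mod: "\<And>j. exp_modular s \<Omega> (g j) l"
    and ev: "\<And>x. x \<in> \<Omega> \<Longrightarrow> eventually (\<lambda>j. \<bar>f x\<bar> \<le> \<bar>g j x\<bar>) sequentially"
  shows "exp_modular s \<Omega> f l"
proof -
  let ?e = "\<lambda>t. ennreal (exp ((\<bar>t\<bar> / l) powr s) - 1)"
  have "(\<integral>\<^sup>+x. indicator \<Omega> x * ?e (f x) \<partial>lborel) \<le> (\<integral>\<^sup>+x. liminf (\<lambda>j. indicator \<Omega> x * ?e (g j x)) \<partial>lborel)"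
  proof (rule nn_integral_mono)
    fix x
    show "indicator \<Omega> x * ?e (f x) \<le> liminf (\<lambda>j. indicator \<Omega> x * ?e (g j x))"
    proof (cases "x \<in> \<Omega>")
      case True
      from ev[OF True] have "eventually (\<lambda>j. indicator \<Omega> x * ?e (f x) \<le> indicator \<Omega> x * ?e (g j x)) sequentially"
      proof eventually_elim
        case (elim j)
        then have "\<bar>f x\<bar> / l \<le> \<bar>g j x\<bar> / l" using l by (intro divide_right_mono) auto
        then have "(\<bar>f x\<bar> / l) powr s \<le> (\<bar>g j x\<bar> / l) powr s" using l s by (intro powr_mono2) auto
        then show ?case by (intro mult_left_mono ennreal_leI) auto
      qed
      then show ?thesis by (rule Liminf_bounded)
    qed simp
  qed
  also have "\<dots> \<le> liminf (\<lambda>j. \<integral>\<^sup>+x. indicator \<Omega> x * ?e (g j x) \<partial>lborel)"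
    by (rule nn_integral_liminf) measurable
  also have "\<dots> \<le> liminf (\<lambda>j::nat. 1 :: ennreal)"
    using mod by (intro Liminf_mono always_eventually allI) (simp add: exp_modular_def)
  also have "\<dots> = 1" by (rule Liminf_const) simp
  finally show ?thesis using l by (simp add: exp_modular_def)
qed

text \<open>The homogeneity behind the gain of exponent: a modular bound for a power is one for the
  function itself with the exponent multiplied.\<close>

lemma exp_modular_powr:
  assumes "q > 0" "l > 0" "\<And>x. f x > 0"
  shows "exp_modular s \<Omega> (\<lambda>x. f x powr q) (l powr q) \<longleftrightarrow> exp_modular (s * q) \<Omega> f l"
proof -
  have "(\<bar>f x powr q\<bar> / l powr q) powr s = (\<bar>f x\<bar> / l) powr (s * q)" for x
  proof -
    have "\<bar>f x powr q\<bar> / l powr q = (f x / l) powr q" using assms(2) assms(3)[of x] by (simp add: powr_divide)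
    then show ?thesis using assms(3)[of x] by (simp add: powr_powr mult.commute)
  qed
  then show ?thesis using assms by (simp add: exp_modular_def)
qed

section \<open>One step of the iteration\<close>

context elliptic_iteration
begin

text \<open>The truncated power \<open>h M\<close> is bounded and monotone, and its antiderivative
  is at least \<open>t powr q / q\<close> between \<open>\<kappa>\<close> and \<open>M\<close>.
  Letting \<open>M\<close> tend to infinity leaves the factor \<open>q\<close> in the
  constant.\<close>

lemma step_powr:
  assumes \<rho>: "0 < \<rho>'" "\<rho>' < \<rho>" "\<rho> \<le> P" and q: "1 \<le> q"
    and mod: "exp_modular (real n * r / (real n - 1)) (ball 0 \<rho>) (\<lambda>x. v x powr q) \<mu>"
  shows "exp_modular (real n / (real n - 1)) (ball 0 \<rho>') (\<lambda>x. v x powr q) (KT * K2 * S * q * \<mu> / (\<rho> - \<rho>'))"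
proof -
  have \<mu>: "\<mu> > 0" using mod by (simp add: exp_modular_def)
  have n1: "real n / (real n - 1) > 0" using n by simp
  define L where "L = KT * (K2 * S * \<mu> / (\<rho> - \<rho>'))"
  have L: "L > 0" using KT K2 S \<mu> \<rho> by (simp add: L_def)
  \<comment> \<open>Clamping from below keeps the base of the power positive, clamping from above
    keeps it bounded; on the range of \<open>v\<close> only the upper clamp can be active.\<close>
  define h where "h M s = min (max s \<kappa>) (max M \<kappa>) powr (q - 1)" for M s :: real
  have hpos: "min (max s \<kappa>) (max M \<kappa>) \<ge> \<kappa>" for M s using \<kappa> by simp
  have h1: "continuous_on UNIV (h M)" for M
    unfolding h_def[abs_def] using hpos \<kappa>
    by (intro continuous_on_powr continuous_intros) (auto simp: min_def max_def)
  have h2: "0 \<le> h M s" for M s by (simp add: h_def)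
  have h3: "mono (h M)" for M
    unfolding h_def using q \<kappa> by (intro monoI powr_mono2) (auto simp: min_def max_def)
  have h4: "h M s \<le> max M \<kappa> powr (q - 1)" for M s
    unfolding h_def using q \<kappa> by (intro powr_mono2) (auto simp: min_def max_def)
  have hv: "v x * h M (v x) \<le> v x powr q" for M x
  proof -
    have "h M (v x) \<le> v x powr (q - 1)"
      unfolding h_def using q \<kappa> v_ge(1)[of x] by (intro powr_mono2) (auto simp: min_def max_def)
    then have "v x * h M (v x) \<le> v x * v x powr (q - 1)" using v_ge(3)[of x] by (intro mult_left_mono) auto
    also have "\<dots> = v x powr q" using v_ge(3)[of x] by (simp add: powr_diff)
    finally show ?thesis .
  qed
  have "\<exists>H. (\<forall>t. (H has_real_derivative h M t) (at t)) \<and> H 0 = 0" for M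
    by (rule antiderivative_exists[OF h1[of M]]) blast
  then have "\<forall>M. \<exists>H. (\<forall>t. (H has_real_derivative h M t) (at t)) \<and> H 0 = 0" by blast
  from choice[OF this] obtain H where H: "\<forall>M. (\<forall>t. (H M has_real_derivative h M t) (at t)) \<and> H M 0 = 0" ..
  have Hd: "(H M has_real_derivative h M t) (at t)" and H0: "H M 0 = 0" for M t using H by blast+
  have modH: "exp_modular (real n / (real n - 1)) (ball 0 \<rho>') (\<lambda>x. H M (v x)) L" for M
    unfolding L_def
    by (rule Trudinger_composed[OF \<rho> mod _ hv h1 h2 h3 h4 Hd H0]) measurable
  \<comment> \<open>Up to \<open>\<kappa>\<close> the function \<open>h M\<close> is constant,
    whence \<open>H M \<kappa> = \<kappa> powr q\<close>, and this is at least
    \<open>\<kappa> powr q / q\<close>; between \<open>\<kappa>\<close> and \<open>M\<close> the two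
    sides have the same derivative.\<close>
  have H_lower: "t powr q / q \<le> H M t" if t: "\<kappa> \<le> t" "t \<le> M" for t M
  proof -
    have "\<exists>y. 0 \<le> y \<and> y \<le> \<kappa> \<and> H M \<kappa> = \<kappa> * h M y"
    proof -
      obtain y where "0 < y" "y < \<kappa>" "H M \<kappa> - H M 0 = (\<kappa> - 0) * h M y"
        using MVT2[of 0 \<kappa> "H M" "h M"] Hd \<kappa> by auto
      then show ?thesis using H0[of M] by (intro exI[of _ y]) auto
    qed
    then obtain y where y: "0 \<le> y" "y \<le> \<kappa>" "H M \<kappa> = \<kappa> * h M y" by blast
    have "h M y = \<kappa> powr (q - 1)" using y by (simp add: h_def max_def min_def)
    then have Hk: "H M \<kappa> = \<kappa> powr q" using y \<kappa> by (simp add: powr_diff)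
    have "\<kappa> powr q / q - H M \<kappa> \<ge> t powr q / q - H M t"
    proof (rule DERIV_nonpos_imp_nonincreasing[where f="\<lambda>t. t powr q / q - H M t", OF t(1)])
      fix z assume z: "\<kappa> \<le> z" "z \<le> t"
      have "((\<lambda>t. t powr q / q - H M t) has_real_derivative (q * z powr (q - 1)) / q - h M z) (at z)"
        using z \<kappa> by (intro DERIV_diff Hd DERIV_cdivide has_real_derivative_powr) auto
      moreover have "(q * z powr (q - 1)) / q - h M z = 0"
        using z t q \<kappa> by (simp add: h_def max_def min_def)
      ultimately show "\<exists>y. ((\<lambda>t. t powr q / q - H M t) has_real_derivative y) (at z) \<and> y \<le> 0" by auto
    qed
    moreover have "\<kappa> powr q / q \<le> \<kappa> powr q" using q by (simp add: divide_le_eq mult_le_cancel_left1)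
    ultimately show ?thesis using Hk by linarith
  qed
  have Hm: "(\<lambda>x. H M (v x)) \<in> borel_measurable borel" for M
  proof -
    have "continuous_on UNIV (H M)" using DERIV_isCont[OF Hd] by (simp add: continuous_on_eq_continuous_at)
    then have [measurable]: "H M \<in> borel_measurable borel" by (rule borel_measurable_continuous_onI)
    show ?thesis by measurable
  qed
  have "exp_modular (real n / (real n - 1)) (ball 0 \<rho>') (\<lambda>x. v x powr q / q) L"
  proof (rule exp_modular_limit[where g="\<lambda>j x. H (real j) (v x)"])
    show "eventually (\<lambda>j. \<bar>v x powr q / q\<bar> \<le> \<bar>H (real j) (v x)\<bar>) sequentially" for x
      using eventually_ge_at_top[of "nat \<lceil>v x\<rceil>"]
    proof eventually_elim
      case (elim j)
      then have "v x \<le> real j" by linarith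
      from H_lower[OF v_ge(1) this] show ?case using q by simp
    qed
  qed (use Hm modH L n1 in auto)
  moreover have "(\<bar>v x powr q / q\<bar> / L) = \<bar>v x powr q\<bar> / (KT * K2 * S * q * \<mu> / (\<rho> - \<rho>'))" for x
    using q by (simp add: L_def abs_divide mult_ac)
  moreover have "0 < KT * K2 * S * q * \<mu> / (\<rho> - \<rho>')" using KT K2 S q \<mu> \<rho> by simp
  ultimately show ?thesis unfolding exp_modular_def by (simp only: simp_thms)
qed

text \<open>Returning from the power to \<open>v\<close> itself takes the \<open>q\<close>-th root
  of the constant. These roots make the infinite product of the constants converge.\<close>

lemma step:
  assumes \<rho>: "0 < \<rho>'" "\<rho>' < \<rho>" "\<rho> \<le> P" and q: "1 \<le> q"
    and mod: "exp_modular (real n * r / (real n - 1) * q) (ball 0 \<rho>) v \<mu>"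
  shows "exp_modular (real n / (real n - 1) * q) (ball 0 \<rho>') v (\<mu> * (KT * K2 * S * q / (\<rho> - \<rho>')) powr (1 / q))"
proof -
  have \<mu>: "\<mu> > 0" using mod by (simp add: exp_modular_def)
  let ?c = "KT * K2 * S * q / (\<rho> - \<rho>')"
  have c: "?c > 0" using KT K2 S q \<rho> by simp
  have "exp_modular (real n * r / (real n - 1)) (ball 0 \<rho>) (\<lambda>x. v x powr q) (\<mu> powr q)"
    using mod q \<mu> v_ge(3) by (simp add: exp_modular_powr)
  from step_powr[OF \<rho> q this]
  have "exp_modular (real n / (real n - 1)) (ball 0 \<rho>') (\<lambda>x. v x powr q) (?c * \<mu> powr q)"
    by (simp add: mult_ac)
  also have "?c * \<mu> powr q = (\<mu> * ?c powr (1 / q)) powr q"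
  proof -
    have "C * \<mu> powr q = (\<mu> * C powr (1 / q)) powr q" if "C > 0" for C
      using \<mu> q that by (simp add: powr_mult powr_powr)
    from this[OF c] show ?thesis .
  qed
  finally have *: "exp_modular (real n / (real n - 1)) (ball 0 \<rho>') (\<lambda>x. v x powr q) ((\<mu> * ?c powr (1 / q)) powr q)" .
  have "?c powr (1 / q) > 0" using c unfolding powr_gt_zero by linarith
  then have "\<mu> * ?c powr (1 / q) > 0" using \<mu> by (rule mult_pos_pos[rotated])
  moreover have "q > 0" using q by simp
  ultimately show ?thesis using * exp_modular_powr[where f=v and l="\<mu> * ?c powr (1 / q)", OF _ _ v_ge(3)] by blast
qed

end

text \<open>Where \<open>\<bar>f\<bar>\<close> exceeds \<open>l * (1 + e)\<close> the integrand is
  at least \<open>(1 + e) powr (\<sigma> * b ^ j)\<close>, which is unbounded in \<open>j\<close>,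
  while the integrals stay at most 1; so this set is null for every \<open>e > 0\<close>.\<close>

lemma exp_modular_AE_le:
  fixes f :: "'a::euclidean_space \<Rightarrow> real"
  assumes [measurable]: "f \<in> borel_measurable borel" "\<Omega> \<in> sets borel"
    and \<sigma>: "\<sigma> > 0" and b: "b > 1" and mod: "\<And>j::nat. exp_modular (\<sigma> * b ^ j) \<Omega> f l"
  shows "AE x in lborel. x \<in> \<Omega> \<longrightarrow> \<bar>f x\<bar> \<le> l"
proof -
  have l: "l > 0" using mod[of 0] by (simp add: exp_modular_def)
  have "AE x in lborel. \<not> (x \<in> \<Omega> \<and> \<bar>f x\<bar> > l * (1 + e))" if e: "e > 0" for e
  proof -
    define E where "E = {x \<in> \<Omega>. \<bar>f x\<bar> > l * (1 + e)}"
    have [measurable]: "E \<in> sets borel"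
    proof -
      have "E = \<Omega> \<inter> {x. \<bar>f x\<bar> > l * (1 + e)}" by (auto simp: E_def)
      also have "\<dots> \<in> sets borel" by (intro sets.Int) (use assms(2) in measurable)
      finally show ?thesis .
    qed
    have k: "ennreal (real k) * emeasure lborel E \<le> 1" for k :: nat
    proof -
      have ln: "ln (1 + e) > 0" using e by simp
      obtain j where j: "real k / (\<sigma> * ln (1 + e)) < b ^ j" using real_arch_pow[OF b] by blast
      then have "real k \<le> \<sigma> * b ^ j * ln (1 + e)"
        using \<sigma> ln by (simp add: divide_less_eq mult_ac)
      also have "\<dots> \<le> exp (\<sigma> * b ^ j * ln (1 + e))"
        using exp_ge_add_one_self[of "\<sigma> * b ^ j * ln (1 + e)"] by linarith
      also have "\<dots> = (1 + e) powr (\<sigma> * b ^ j)" using e by (simp add: powr_def)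
      finally have kle: "real k \<le> (1 + e) powr (\<sigma> * b ^ j)" .
      have "ennreal (real k) * emeasure lborel E = (\<integral>\<^sup>+x. ennreal (real k) * indicator E x \<partial>lborel)"
        by (simp add: nn_integral_cmult)
      also have "\<dots> \<le> (\<integral>\<^sup>+x. indicator \<Omega> x * ennreal (exp ((\<bar>f x\<bar> / l) powr (\<sigma> * b ^ j)) - 1) \<partial>lborel)"
      proof (rule nn_integral_mono)
        fix x
        show "ennreal (real k) * indicator E x \<le> indicator \<Omega> x * ennreal (exp ((\<bar>f x\<bar> / l) powr (\<sigma> * b ^ j)) - 1)"
        proof (cases "x \<in> E")
          case True
          then have x: "x \<in> \<Omega>" "1 + e \<le> \<bar>f x\<bar> / l" using l by (auto simp: E_def field_simps)
          have "(1 + e) powr (\<sigma> * b ^ j) \<le> (\<bar>f x\<bar> / l) powr (\<sigma> * b ^ j)"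
            using x(2) e \<sigma> b by (intro powr_mono2) auto
          then have "real k \<le> (\<bar>f x\<bar> / l) powr (\<sigma> * b ^ j)" using kle by linarith
          also have "\<dots> \<le> exp ((\<bar>f x\<bar> / l) powr (\<sigma> * b ^ j)) - 1"
            using exp_ge_add_one_self[of "(\<bar>f x\<bar> / l) powr (\<sigma> * b ^ j)"] by linarith
          finally show ?thesis using True x(1) by (simp add: ennreal_leI)
        qed simp
      qed
      also have "\<dots> \<le> 1" using mod[of j] by (simp add: exp_modular_def)
      finally show ?thesis .
    qed
    have "emeasure lborel E = 0"
    proof (rule ccontr)
      assume ne: "emeasure lborel E \<noteq> 0"
      have fin: "emeasure lborel E \<le> 1" using k[of 1] by simp
      then obtain y where y: "emeasure lborel E = ennreal y" "y \<ge> 0"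
        by (metis ennreal_cases ennreal_one_neq_top top.extremum_unique)
      then have "y > 0" using ne by (cases "y = 0") auto
      obtain k0 :: nat where "2 / y < real k0" using reals_Archimedean2 by blast
      then have "2 < real k0 * y" using \<open>y > 0\<close> by (simp add: divide_less_eq)
      moreover have "ennreal (real k0 * y) \<le> ennreal 1" using k[of k0] y by (simp add: ennreal_mult)
      then have "real k0 * y \<le> 1" by (subst (asm) ennreal_le_iff) auto
      ultimately show False by simp
    qed
    then have "E \<in> null_sets lborel" by (intro null_setsI) auto
    then have "AE x in lborel. x \<notin> E" by (rule AE_not_in)
    then show ?thesis by (simp add: E_def)
  qed
  then have "AE x in lborel. \<forall>k::nat. \<not> (x \<in> \<Omega> \<and> \<bar>f x\<bar> > l * (1 + 1 / real (Suc k)))"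
    by (subst AE_all_countable) simp
  then show ?thesis
  proof eventually_elim
    case (elim x)
    show ?case
    proof
      assume x: "x \<in> \<Omega>"
      have "(\<lambda>k. 1 / real (Suc k)) \<longlonglongrightarrow> 0" using LIMSEQ_Suc[OF lim_const_over_n[of "1::real"]] by simp
      then have "(\<lambda>k. l * (1 + 1 / real (Suc k))) \<longlonglongrightarrow> l * (1 + 0)" by (intro tendsto_intros)
      then have "(\<lambda>k. l * (1 + 1 / real (Suc k))) \<longlonglongrightarrow> l" by simp
      then show "\<bar>f x\<bar> \<le> l"
        by (rule LIMSEQ_le_const) (use elim x in \<open>auto simp: not_less\<close>)
    qed
  qed
qed

section \<open>The full iteration and the two bounds\<close>

context elliptic_iteration
begin

text \<open>At stage \<open>j\<close> the power is \<open>q = (1 / r) ^ j\<close> and the radius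
  shrinks by \<open>R / 2 * (1 / 2) ^ j\<close>. The fixed part of the constant is collected in
  \<open>X\<close>, the growing part \<open>q * 2 ^ j\<close> equals \<open>Y ^ j\<close>; the
  \<open>q\<close>-th root turns these into the exponents \<open>r ^ j\<close> and
  \<open>j * r ^ j\<close>.\<close>

lemma iterate_step:
  fixes \<mu>0 :: real
  defines "R \<equiv> P / 2" and "X \<equiv> 4 * max 1 (KT * K2) * S / P" and "Y \<equiv> 2 / r"
  assumes r1: "r < 1" and mod: "exp_modular (real n * r / (real n - 1)) (ball 0 P) v \<mu>0"
  shows "exp_modular (real n * r / (real n - 1) * (1 / r) ^ j) (ball 0 (R * (1 + (1/2) ^ j))) v
    (\<mu>0 * (X powr (\<Sum>i<j. r ^ i) * Y powr (\<Sum>i<j. real i * r ^ i)))"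
proof (induction j)
  case 0
  have "X > 0" "Y > 0" using S P r by (auto simp: X_def Y_def max_def)
  then show ?case using mod by (simp add: R_def)
next
  case (Suc j)
  have R: "R > 0" using P by (simp add: R_def)
  \<comment> \<open>The maximum with 1 is what gives \<open>X \<ge> 1\<close> in
    \<open>sup_bound\<close>.\<close>
  define c0 where "c0 = max 1 (KT * K2)"
  have c0: "c0 \<ge> 1" "KT * K2 \<le> c0" by (auto simp: c0_def)
  have X: "X = 2 * c0 * S / R" by (simp add: X_def R_def c0_def)
  have Xpos: "X > 0" using c0 S R by (simp add: X)
  have Ypos: "Y > 0" using r by (simp add: Y_def)
  define q where "q = (1 / r) ^ j"
  have q: "1 \<le> q" "q > 0" using r r1 by (auto simp: q_def intro!: one_le_power)
  have q1: "1 / q = r ^ j" using r by (simp add: q_def power_one_over)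
  let ?s = "\<lambda>j. \<Sum>i<j. r ^ i" and ?t = "\<lambda>j. \<Sum>i<j. real i * r ^ i"
  let ?\<mu> = "\<lambda>j. \<mu>0 * (X powr ?s j * Y powr ?t j)"
  let ?c = "KT * K2 * S * q / (R * (1 + (1/2) ^ j) - R * (1 + (1/2) ^ Suc j))"
  have diff: "R * (1 + (1/2) ^ j) - R * (1 + (1/2) ^ Suc j) = R / 2 * (1/2) ^ j" by (simp add: algebra_simps)
  have st: "exp_modular (real n / (real n - 1) * q) (ball 0 (R * (1 + (1/2) ^ Suc j))) v (?\<mu> j * ?c powr (1 / q))"
  proof (rule step[OF _ _ _ q(1)])
    show "0 < R * (1 + (1/2) ^ Suc j)" using R by (simp add: add_pos_pos)
    show "R * (1 + (1/2) ^ Suc j) < R * (1 + (1/2) ^ j)" using diff R by (smt (verit) mult_pos_pos zero_less_power half_gt_zero zero_less_divide_1_iff)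
    have "(1/2::real) ^ j \<le> 1" by (intro power_le_one) auto
    then have "R * (1 + (1/2) ^ j) \<le> R * 2" using R by (intro mult_left_mono) auto
    then show "R * (1 + (1/2) ^ j) \<le> P" by (simp add: R_def)
    show "exp_modular (real n * r / (real n - 1) * q) (ball 0 (R * (1 + (1/2) ^ j))) v (?\<mu> j)"
      using Suc.IH by (simp only: q_def)
  qed
  have "?c powr (1 / q) \<le> (X * Y ^ j) powr (1 / q)"
  proof (rule powr_mono2)
    show "0 \<le> ?c" unfolding diff using KT K2 S q R by (intro divide_nonneg_nonneg mult_nonneg_nonneg) auto
    have "?c = KT * K2 * S * q * (2 * 2 ^ j) / R"
      unfolding diff by (simp add: power_divide)
    also have "\<dots> \<le> c0 * S * q * (2 * 2 ^ j) / R"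
      using c0 S q R by (intro divide_right_mono mult_right_mono) auto
    also have "\<dots> = X * Y ^ j" by (simp add: X Y_def q_def power_divide mult_ac)
    finally show "?c \<le> X * Y ^ j" .
  qed (use q in simp)
  also have "\<dots> = X powr (r ^ j) * Y powr (real j * r ^ j)"
    using Xpos Ypos by (simp add: q1 powr_mult powr_powr powr_realpow[symmetric])
  finally have "?c powr (1 / q) \<le> X powr (r ^ j) * Y powr (real j * r ^ j)" .
  moreover have \<mu>0: "\<mu>0 > 0" using mod by (simp add: exp_modular_def)
  moreover have "?\<mu> j > 0" using \<mu>0 Xpos Ypos by simp
  ultimately have "?\<mu> j * ?c powr (1 / q) \<le> ?\<mu> j * (X powr (r ^ j) * Y powr (real j * r ^ j))"
    by (intro mult_left_mono) auto
  also have "\<dots> = ?\<mu> (Suc j)" by (simp add: powr_add mult_ac)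
  finally have le: "?\<mu> j * ?c powr (1 / q) \<le> ?\<mu> (Suc j)" .
  have "real n * r / (real n - 1) * (1 / r) ^ Suc j = real n / (real n - 1) * q"
    using r by (simp add: q_def)
  then show ?case
    using exp_modular_mono[OF st le subset_refl] n q by simp
qed

text \<open>As \<open>X\<close> and \<open>Y\<close> are at least 1, the partial sums in the
  exponents may be replaced by the full series. This yields a single constant that is admissible for
  all exponents on the ball of half the radius, and the exponents tend to infinity.\<close>

theorem sup_bound:
  fixes \<mu>0 :: real
  defines "T \<equiv> \<Sum>i. real i * r ^ i"
  assumes r1: "r < 1" and mod: "exp_modular (real n * r / (real n - 1)) (ball 0 P) v \<mu>0"
  shows "AE x in lborel. norm x < P / 2 \<longrightarrow>
    v x \<le> \<mu>0 * ((4 * max 1 (KT * K2) * S / P) powr (1 / (1 - r)) * (2 / r) powr T)"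
proof -
  define X where "X = 4 * max 1 (KT * K2) * S / P"
  define Y where "Y = 2 / r"
  have \<mu>0: "\<mu>0 > 0" using mod by (simp add: exp_modular_def)
  have X: "X \<ge> 1"
  proof -
    have "2 * 1 \<le> 4 * max 1 (KT * K2) * S" using S by (intro mult_mono) auto
    then have "P \<le> 4 * max 1 (KT * K2) * S" using P by linarith
    then show ?thesis using P(1) by (simp add: X_def)
  qed
  have Y: "Y \<ge> 1" using r r1 by (simp add: Y_def)
  have sm: "summable (\<lambda>i. real i * r ^ i)"
  proof -
    have "summable (\<lambda>i. real (Suc i) * r ^ i)"
      using sums_summable[OF geometric_deriv_sums[of r]] r r1 by simp
    then show ?thesis by (rule summable_comparison_test'[where N=0]) (use r in \<open>auto intro!: mult_right_mono\<close>)
  qed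
  have tb: "(\<Sum>i<j. real i * r ^ i) \<le> T" for j
    unfolding T_def using r by (intro sum_le_suminf sm) auto
  have sb: "(\<Sum>i<j. r ^ i) \<le> 1 / (1 - r)" for j
    using sum_le_suminf[OF summable_geometric[of r], of "{..<j}"] suminf_geometric[of r] r r1 by simp
  have "AE x in lborel. x \<in> ball 0 (P / 2) \<longrightarrow> \<bar>v x\<bar> \<le> \<mu>0 * (X powr (1 / (1 - r)) * Y powr T)"
  proof (rule exp_modular_AE_le[where b="1 / r"])
    show "real n * r / (real n - 1) > 0" using n r by simp
    show "1 / r > 1" using r r1 by simp
    show "exp_modular (real n * r / (real n - 1) * (1 / r) ^ j) (ball 0 (P / 2)) v (\<mu>0 * (X powr (1 / (1 - r)) * Y powr T))" for j
    proof (rule exp_modular_mono[OF iterate_step[OF r1 mod, of j]])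
      show "\<mu>0 * ((4 * max 1 (KT * K2) * S / P) powr (\<Sum>i<j. r ^ i) * (2 / r) powr (\<Sum>i<j. real i * r ^ i)) \<le> \<mu>0 * (X powr (1 / (1 - r)) * Y powr T)"
        unfolding X_def[symmetric] Y_def[symmetric]
        using \<mu>0 X Y by (intro mult_left_mono mult_mono powr_mono sb tb) auto
      show "ball 0 (P / 2) \<subseteq> (ball 0 (P / 2 * (1 + (1/2) ^ j)) :: (real^'n) set)"
      proof (rule subset_ball)
        show "P / 2 \<le> P / 2 * (1 + (1/2) ^ j)" using P by (simp add: mult_le_cancel_left1)
      qed
      show "0 \<le> real n * r / (real n - 1) * (1 / r) ^ j" using n r by simp
    qed simp
  qed auto
  then show ?thesis
    unfolding X_def Y_def by eventually_elim (use v_ge(3) in \<open>auto simp: less_imp_le\<close>)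
qed

text \<open>The constant \<open>K2 * S\<close> is at least 1, so it may be put under the
  \<open>n\<close>-th power before the root is taken.\<close>

theorem gradient_norm_bound:
  assumes mod: "exp_modular (real n * r / (real n - 1)) (ball 0 P) v \<mu>0"
  shows "(\<integral>x. indicator (ball 0 (P / 2)) x * norm (Du x) ^ n \<partial>lborel) powr (1 / real n) \<le> K2 * S * (\<mu>0 / (P / 2))"
proof -
  have \<mu>0: "\<mu>0 > 0" using mod by (simp add: exp_modular_def)
  have "(\<integral>x. indicator (ball 0 (P / 2)) x * norm (Du x) ^ n \<partial>lborel) \<le> 2 * CC * KE * S * (\<mu>0 / (P - P / 2)) ^ n"
    using P by (intro gradient_bound mod) auto
  also have "\<dots> \<le> K2 * S * (\<mu>0 / (P / 2)) ^ n"
  proof -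
    have "2 * CC * KE \<le> 2 ^ n * (2 * CC + 1) * KE"
    proof (intro mult_right_mono)
      have "1 * (2 * CC) \<le> 2 ^ n * (2 * CC + 1)" using CC_nonneg by (intro mult_mono) auto
      then show "2 * CC \<le> 2 ^ n * (2 * CC + 1)" by simp
    qed (use KE in simp)
    then have "2 * CC * KE * S * (\<mu>0 / (P / 2)) ^ n \<le> K2 * S * (\<mu>0 / (P / 2)) ^ n"
      using S \<mu>0 P by (intro mult_right_mono) (auto simp: K2_def)
    then show ?thesis by simp
  qed
  also have "\<dots> \<le> (K2 * S) ^ n * (\<mu>0 / (P / 2)) ^ n"
  proof (rule mult_right_mono)
    have "1 * 1 \<le> K2 * S" using K2 S by (intro mult_mono) auto
    then show "K2 * S \<le> (K2 * S) ^ n" using power_increasing[of 1 n "K2 * S"] n by simp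
  qed (use \<mu>0 P in simp)
  also have "\<dots> = (K2 * S * (\<mu>0 / (P / 2))) ^ n" by (simp only: power_mult_distrib)
  finally have le: "(\<integral>x. indicator (ball 0 (P / 2)) x * norm (Du x) ^ n \<partial>lborel) \<le> (K2 * S * (\<mu>0 / (P / 2))) ^ n" .
  have pos: "K2 * S * (\<mu>0 / (P / 2)) > 0" using K2 S \<mu>0 P by simp
  have "(\<integral>x. indicator (ball 0 (P / 2)) x * norm (Du x) ^ n \<partial>lborel) powr (1 / real n) \<le> ((K2 * S * (\<mu>0 / (P / 2))) ^ n) powr (1 / real n)"
    by (intro powr_mono2 le integral_nonneg_AE) auto
  also have "\<dots> = K2 * S * (\<mu>0 / (P / 2))"
  proof -
    have n0: "real n > 0" using n(2) by simp
    have "(y ^ n) powr (1 / real n) = y" if "y > 0" for y :: real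
      using that n0 by (simp add: powr_realpow[symmetric] powr_powr)
    from this[OF pos] show ?thesis .
  qed
  finally show ?thesis .
qed

end

section \<open>Passing from Lebesgue to Borel measurable functions\<close>

text \<open>Tonelli over \<open>lborel\<close> and composition of measurable maps call for Borel
  functions, whereas the hypotheses speak of Lebesgue measurability on \<open>D\<close>.\<close>

lemma borel_representative_real:
  fixes f :: "'a::euclidean_space \<Rightarrow> real"
  assumes f: "f \<in> borel_measurable (lebesgue_on D)" and D: "D \<in> sets lebesgue"
  shows "\<exists>f'\<in>borel_measurable borel. AE x in lborel. x \<in> D \<longrightarrow> f x = f' x"
proof -
  have "(\<lambda>x. if x \<in> D then f x else 0) \<in> borel_measurable lebesgue"
    using f D by (rule borel_measurable_if_I)
  from completion_ex_borel_measurable_real[OF this]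
  obtain f' where f': "f' \<in> borel_measurable lborel" "AE x in lborel. (if x \<in> D then f x else 0) = f' x" by blast
  from f'(2) have "AE x in lborel. x \<in> D \<longrightarrow> f x = f' x" by eventually_elim auto
  then show ?thesis using f'(1) by auto
qed

lemma borel_representative_vec:
  fixes f :: "'a::euclidean_space \<Rightarrow> real^'n::finite"
  assumes f: "f \<in> borel_measurable (lebesgue_on D)" and D: "D \<in> sets lebesgue"
  shows "\<exists>f'\<in>borel_measurable borel. AE x in lborel. x \<in> D \<longrightarrow> f x = f' x"
proof -
  have "(\<lambda>x. f x $ i) \<in> borel_measurable (lebesgue_on D)" for i
    by (rule measurable_compose[OF f borel_measurable_continuous_onI[OF linear_continuous_on[OF bounded_linear_vec_nth]]])
  from borel_representative_real[OF this D]
  have "\<forall>i. \<exists>g. g \<in> borel_measurable borel \<and> (AE x in lborel. x \<in> D \<longrightarrow> f x $ i = g x)" by blast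
  from choice[OF this] obtain g where g: "\<forall>i. g i \<in> borel_measurable borel \<and> (AE x in lborel. x \<in> D \<longrightarrow> f x $ i = g i x)" ..
  have "(\<lambda>x. \<chi> i. g i x) \<in> borel_measurable borel"
  proof (subst borel_measurable_euclidean_space, intro ballI)
    fix b :: "real^'n" assume "b \<in> Basis"
    then obtain i where "b = axis i 1" by (auto simp: Basis_vec_def)
    then show "(\<lambda>x. (\<chi> i. g i x) \<bullet> b) \<in> borel_measurable borel" using g by (simp add: inner_axis)
  qed
  moreover have "AE x in lborel. x \<in> D \<longrightarrow> f x = (\<chi> i. g i x)"
  proof -
    have "AE x in lborel. \<forall>i. x \<in> D \<longrightarrow> f x $ i = g i x" using g by (intro eventually_all_finite) blast
    then show ?thesis by eventually_elim (auto simp: vec_eq_iff)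
  qed
  ultimately show ?thesis by (intro bexI[where x="\<lambda>x. \<chi> i. g i x"])
qed

text \<open>\<open>G\<close> is a Borel set of full measure in \<open>\<Omega> \<subseteq> D\<close> on which the Borel representatives agree
  with the given functions; outside of \<open>G\<close> the representatives are set to 0.\<close>
lemma lebesgue_on_transfer:
  fixes F F1 :: "'a::euclidean_space \<Rightarrow> real"
  assumes D: "D \<in> sets lebesgue" and \<Omega>: "\<Omega> \<subseteq> D" and G: "G \<subseteq> \<Omega>" and null: "\<Omega> - G \<in> null_sets lborel"
    and F1: "F1 \<in> borel_measurable borel" "\<And>x. x \<in> G \<Longrightarrow> F1 x = F x" "\<And>x. x \<notin> G \<Longrightarrow> F1 x = 0"
  shows "integrable (lebesgue_on D) F \<Longrightarrow> integrable lborel F1"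
    and "(\<And>x. x \<in> D - \<Omega> \<Longrightarrow> F x = 0) \<Longrightarrow> (LINT x|lebesgue_on D. F x) = (\<integral>x. F1 x \<partial>lborel)"
proof -
  have ae: "AE x in lebesgue. x \<notin> \<Omega> - G"
    using null by (intro AE_not_in) (rule null_sets_completionI)
  have F1m: "F1 \<in> borel_measurable lebesgue" using F1(1) by (intro measurable_completion) simp
  show "integrable lborel F1" if "integrable (lebesgue_on D) F"
  proof -
    have "integrable lebesgue (\<lambda>x. indicator D x *\<^sub>R F x)"
      using that D by (subst (asm) integrable_restrict_space) (auto simp: set_integrable_def)
    then have "integrable lebesgue F1"
    proof (rule Bochner_Integration.integrable_bound)
      show "AE x in lebesgue. norm (F1 x) \<le> norm (indicator D x *\<^sub>R F x)"
      proof (rule AE_I2)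
        fix x
        show "norm (F1 x) \<le> norm (indicator D x *\<^sub>R F x)"
        proof (cases "x \<in> G")
          case True
          then have "x \<in> D" using G \<Omega> by blast
          then show ?thesis using F1(2)[OF True] by simp
        next
          case False
          then show ?thesis using F1(3) by simp
        qed
      qed
    qed (rule F1m)
    then show ?thesis using F1(1) by (subst (asm) integrable_completion) auto
  qed
  show "(LINT x|lebesgue_on D. F x) = (\<integral>x. F1 x \<partial>lborel)" if z: "\<And>x. x \<in> D - \<Omega> \<Longrightarrow> F x = 0"
  proof -
    have eq: "AE x in lebesgue. F1 x = indicator D x *\<^sub>R F x"
      using ae
    proof eventually_elim
      case (elim x)
      then show ?case using z[of x] F1(2,3)[of x] \<Omega> G by (cases "x \<in> G") (auto simp: indicator_def)
    qed
    \<comment> \<open>Nothing is assumed on the measurability of \<open>F\<close>; that of its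
      extension comes from \<open>F1\<close>, since \<open>lebesgue\<close> is complete.\<close>
    have m: "(\<lambda>x. indicator D x *\<^sub>R F x) \<in> borel_measurable lebesgue"
      by (rule borel_measurable_AE[OF F1m eq])
    have "(LINT x|lebesgue_on D. F x) = (LINT x|lebesgue. indicator D x *\<^sub>R F x)"
      using D by (subst integral_restrict_space) (auto simp: set_lebesgue_integral_def)
    also have "\<dots> = (LINT x|lebesgue. F1 x)"
      by (rule integral_cong_AE[OF m F1m]) (use eq in \<open>eventually_elim, simp\<close>)
    also have "\<dots> = (\<integral>x. F1 x \<partial>lborel)" using F1(1) by (intro integral_completion) simp
    finally show ?thesis .
  qed
qed

text \<open>An inequality is enough here: it transfers the admissibility of a constant from
  \<open>D\<close> to a smaller set.\<close>

lemma nn_integral_lebesgue_on_transfer: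
  fixes F F1 :: "'a::euclidean_space \<Rightarrow> ennreal"
  assumes D: "D \<in> sets lebesgue" and \<Omega>: "\<Omega> \<subseteq> D" and null: "\<Omega> - G \<in> null_sets lborel"
    and F1: "\<And>x. x \<in> G \<Longrightarrow> x \<in> \<Omega> \<Longrightarrow> F1 x = F x"
  shows "(\<integral>\<^sup>+x. indicator \<Omega> x * F1 x \<partial>lborel) \<le> (\<integral>\<^sup>+x. F x \<partial>lebesgue_on D)"
proof -
  have ae: "AE x in lebesgue. x \<notin> \<Omega> - G"
    using null by (intro AE_not_in) (rule null_sets_completionI)
  have "(\<integral>\<^sup>+x. indicator \<Omega> x * F1 x \<partial>lborel) = (\<integral>\<^sup>+x. indicator \<Omega> x * F1 x \<partial>lebesgue)"
    by (rule nn_integral_completion[symmetric])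
  also have "\<dots> \<le> (\<integral>\<^sup>+x. F x * indicator D x \<partial>lebesgue)"
  proof (rule nn_integral_mono_AE)
    show "AE x in lebesgue. indicator \<Omega> x * F1 x \<le> F x * indicator D x"
      using ae by eventually_elim (use F1 \<Omega> in \<open>auto simp: indicator_def\<close>)
  qed
  also have "\<dots> = (\<integral>\<^sup>+x. F x \<partial>lebesgue_on D)" using D by (subst nn_integral_restrict_space) auto
  finally show ?thesis .
qed

text \<open>Where \<open>\<bar>f\<bar> \<ge> k\<close> the sum is at most
  \<open>2 * \<bar>f\<bar>\<close>, elsewhere it is below \<open>2 * k\<close>. A large
  \<open>C\<close> makes both exponents small by the factor \<open>t\<close>, and convexity of exp
  turns this into small integrals.\<close>

lemma exp_modular_shift:
  fixes f g :: "'a::euclidean_space \<Rightarrow> real"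
  assumes \<sigma>: "\<sigma> > 0"
  obtains C where "C \<ge> 1"
    "\<And>(f :: 'a \<Rightarrow> real) g \<Omega> l k. f \<in> borel_measurable borel \<Longrightarrow> \<Omega> \<in> sets borel \<Longrightarrow> \<Omega> \<subseteq> cball 0 2 \<Longrightarrow> 0 < k \<Longrightarrow>
      (\<And>x. \<bar>g x\<bar> \<le> \<bar>f x\<bar> + k) \<Longrightarrow> exp_modular \<sigma> \<Omega> f l \<Longrightarrow> exp_modular \<sigma> \<Omega> g (C * (l + k))"
proof -
  define \<beta> where "\<beta> = measure lborel (cball 0 2 :: 'a set)"
  have \<beta>: "\<beta> \<ge> 0" "emeasure lborel (cball 0 2 :: 'a set) = ennreal \<beta>"
    using emeasure_lborel_cball_finite[of "0::'a" 2] by (auto simp: \<beta>_def intro!: emeasure_eq_ennreal_measure)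
  \<comment> \<open>Chosen such that \<open>t + 2 * t * \<beta> \<le> 1\<close>, the two parts being
    the modular of \<open>f\<close> and the volume; \<open>C\<close> is then determined by
    \<open>(2 / C) powr \<sigma> = t\<close>.\<close>
  define t where "t = 1 / (4 * (\<beta> + 1))"
  have t: "0 < t" "t \<le> 1/4" "\<beta> * (2 * t) \<le> 1/2"
    using \<beta>(1) by (auto simp: t_def field_simps)
  define C where "C = 2 * (1 / t) powr (1 / \<sigma>)"
  have C1: "C \<ge> 1"
  proof -
    have "1 \<le> (1 / t) powr (1 / \<sigma>)" using t \<sigma> by (intro ge_one_powr_ge_zero) auto
    then show ?thesis by (simp add: C_def)
  qed
  have Ct: "(2 / C) powr \<sigma> = t"
  proof -
    have "2 / C = t powr (1 / \<sigma>)" using t by (simp add: C_def powr_divide)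
    then show ?thesis using t \<sigma> by (simp add: powr_powr)
  qed
  show thesis
  proof (rule that[OF C1])
    fix f g :: "'a \<Rightarrow> real" and \<Omega> l k
    assume [measurable]: "f \<in> borel_measurable borel" "\<Omega> \<in> sets borel" and sub: "\<Omega> \<subseteq> cball 0 2" and k: "0 < k"
      and gf: "\<And>x. \<bar>g x\<bar> \<le> \<bar>f x\<bar> + k" and mod: "exp_modular \<sigma> \<Omega> f l"
    have l: "l > 0" using mod by (simp add: exp_modular_def)
    define \<mu> where "\<mu> = C * (l + k)"
    have \<mu>: "\<mu> > 0" "C * l \<le> \<mu>" "C * k \<le> \<mu>" using l k C1 by (auto simp: \<mu>_def)
    let ?e = "\<lambda>x. exp ((\<bar>f x\<bar> / l) powr \<sigma>) - 1"
    have pt: "exp ((\<bar>g x\<bar> / \<mu>) powr \<sigma>) - 1 \<le> t * ?e x + 2 * t" for x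
    proof (cases "k \<le> \<bar>f x\<bar>")
      case True
      have "\<bar>g x\<bar> / \<mu> \<le> (2 * \<bar>f x\<bar>) / (C * l)" using gf[of x] True \<mu> l C1 by (intro frac_le) auto
      then have "(\<bar>g x\<bar> / \<mu>) powr \<sigma> \<le> ((2 / C) * (\<bar>f x\<bar> / l)) powr \<sigma>" using \<sigma> \<mu> by (intro powr_mono2) auto
      also have "\<dots> = t * (\<bar>f x\<bar> / l) powr \<sigma>" using C1 l by (subst powr_mult) (auto simp: Ct)
      finally have "exp ((\<bar>g x\<bar> / \<mu>) powr \<sigma>) - 1 \<le> exp (t * (\<bar>f x\<bar> / l) powr \<sigma>) - 1" by simp
      also have "\<dots> \<le> t * ?e x" using t by (intro exp_minus_one_scale) auto
      finally show ?thesis using t by simp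
    next
      case False
      have "\<bar>g x\<bar> / \<mu> \<le> (2 * k) / (C * k)" using gf[of x] False \<mu> k C1 by (intro frac_le) auto
      then have "\<bar>g x\<bar> / \<mu> \<le> 2 / C" using k by simp
      then have "(\<bar>g x\<bar> / \<mu>) powr \<sigma> \<le> (2 / C) powr \<sigma>" using \<sigma> \<mu> by (intro powr_mono2) auto
      then have "exp ((\<bar>g x\<bar> / \<mu>) powr \<sigma>) - 1 \<le> exp (t * 1) - 1" by (simp add: Ct)
      also have "\<dots> \<le> t * (exp 1 - 1)" using t by (intro exp_minus_one_scale) auto
      also have "\<dots> \<le> t * 2" using t exp_le by (intro mult_left_mono) auto
      finally show ?thesis using t by (simp add: add_increasing)
    qed
    have "(\<integral>\<^sup>+x. indicator \<Omega> x * ennreal (exp ((\<bar>g x\<bar> / \<mu>) powr \<sigma>) - 1) \<partial>lborel)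
      \<le> (\<integral>\<^sup>+x. ennreal t * (indicator \<Omega> x * ennreal (?e x)) + ennreal (2 * t) * indicator \<Omega> x \<partial>lborel)"
    proof (rule nn_integral_mono)
      fix x
      have "ennreal (exp ((\<bar>g x\<bar> / \<mu>) powr \<sigma>) - 1) \<le> ennreal (t * ?e x + 2 * t)" by (intro ennreal_leI pt)
      also have "\<dots> = ennreal t * ennreal (?e x) + ennreal (2 * t)"
        using t by (subst ennreal_plus) (auto simp: ennreal_mult)
      finally show "indicator \<Omega> x * ennreal (exp ((\<bar>g x\<bar> / \<mu>) powr \<sigma>) - 1) \<le> ennreal t * (indicator \<Omega> x * ennreal (?e x)) + ennreal (2 * t) * indicator \<Omega> x"
        by (auto simp: indicator_def)
    qed
    also have "\<dots> = ennreal t * (\<integral>\<^sup>+x. indicator \<Omega> x * ennreal (?e x) \<partial>lborel) + ennreal (2 * t) * emeasure lborel \<Omega>"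
      by (subst nn_integral_add, measurable, subst nn_integral_cmult, measurable, subst nn_integral_cmult_indicator) auto
    also have "\<dots> \<le> ennreal t * 1 + ennreal (2 * t) * ennreal \<beta>"
    proof (intro add_mono mult_left_mono)
      show "(\<integral>\<^sup>+x. indicator \<Omega> x * ennreal (?e x) \<partial>lborel) \<le> 1" using mod by (simp add: exp_modular_def)
      show "emeasure lborel \<Omega> \<le> ennreal \<beta>" unfolding \<beta>(2)[symmetric] using sub by (intro emeasure_mono) auto
    qed auto
    also have "\<dots> = ennreal (t + 2 * t * \<beta>)" using t \<beta>(1) by (subst ennreal_plus) (auto simp: ennreal_mult)
    also have "\<dots> \<le> 1" using t by (intro ennreal_le_1[THEN iffD2]) (simp add: mult_ac)
    finally show "exp_modular \<sigma> \<Omega> g (C * (l + k))" using \<mu>(1) by (simp add: exp_modular_def \<mu>_def)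
  qed
qed

section \<open>Luxemburg norms and admissible constants\<close>

lemma luxemburg_norm_lessD:
  assumes "luxemburg_norm \<Phi> \<Omega> f < ennreal y"
  obtains l where "0 < l" "l < y" "(\<integral>\<^sup>+x. ennreal (\<Phi> (\<bar>f x\<bar> / l)) \<partial>lebesgue_on \<Omega>) \<le> 1"
proof -
  from assms obtain z where "z \<in> {ennreal l | l. 0 < l \<and> (\<integral>\<^sup>+x. ennreal (\<Phi> (\<bar>f x\<bar> / l)) \<partial>lebesgue_on \<Omega>) \<le> 1}" "z < ennreal y"
    unfolding luxemburg_norm_def Inf_less_iff by blast
  then show thesis using that by (auto simp: ennreal_less_iff less_imp_le)
qed

text \<open>One plus the integral in the definition of \<open>LlogL\<close> is an admissible
  constant, by \<open>N_fun_upper\<close>. Finiteness matters because \<open>enn2real\<close> would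
  turn an infinite norm into 0.\<close>

lemma N_norm_finite:
  fixes f :: "real^'n::finite \<Rightarrow> real"
  assumes n: "CARD('n) \<ge> 2" and r: "r > 0" and f: "f \<in> LlogL r D"
  shows "N_norm r D f < \<infinity>"
proof -
  let ?p = "(real CARD('n) - 1) / r"
  have p: "?p > 0" using n r by simp
  let ?g = "\<lambda>x. \<bar>f x\<bar> * ln (\<bar>f x\<bar> + 1) powr ?p"
  have g: "integrable (lebesgue_on D) ?g" "?g \<in> borel_measurable (lebesgue_on D)"
    using f by (auto simp: LlogL_def)
  define I where "I = (LINT x|lebesgue_on D. ?g x)"
  define l where "l = I + 1"
  have I: "I \<ge> 0" unfolding I_def by (intro integral_nonneg_AE) auto
  have l: "l \<ge> 1" using I by (simp add: l_def)
  have "(\<integral>\<^sup>+x. ennreal (N_fun CARD('n) r (\<bar>f x\<bar> / l)) \<partial>lebesgue_on D) \<le> (\<integral>\<^sup>+x. ennreal (1 / l) * ennreal (?g x) \<partial>lebesgue_on D)"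
  proof (rule nn_integral_mono)
    fix x
    have "N_fun CARD('n) r (\<bar>f x\<bar> / l) \<le> \<bar>f x\<bar> / l * ln (\<bar>f x\<bar> / l + 1) powr ?p"
      using l by (intro N_fun_upper n r) auto
    also have "\<dots> \<le> \<bar>f x\<bar> / l * ln (\<bar>f x\<bar> + 1) powr ?p"
    proof (intro mult_left_mono powr_mono2)
      have "\<bar>f x\<bar> / l \<le> \<bar>f x\<bar> / 1" using l by (intro divide_left_mono) auto
      then show "ln (\<bar>f x\<bar> / l + 1) \<le> ln (\<bar>f x\<bar> + 1)" using l by (subst ln_le_cancel_iff) (auto simp: add_nonneg_pos)
    qed (use p l in auto)
    finally have "ennreal (N_fun CARD('n) r (\<bar>f x\<bar> / l)) \<le> ennreal (1 / l * ?g x)" by (intro ennreal_leI) simp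
    also have "\<dots> = ennreal (1 / l) * ennreal (?g x)" using l by (intro ennreal_mult) auto
    finally show "ennreal (N_fun CARD('n) r (\<bar>f x\<bar> / l)) \<le> ennreal (1 / l) * ennreal (?g x)" .
  qed
  also have "\<dots> = ennreal (1 / l) * (\<integral>\<^sup>+x. ennreal (?g x) \<partial>lebesgue_on D)"
    using g(2) by (intro nn_integral_cmult) auto
  also have "(\<integral>\<^sup>+x. ennreal (?g x) \<partial>lebesgue_on D) = ennreal I"
    unfolding I_def by (rule nn_integral_eq_integral[OF g(1)]) simp
  also have "ennreal (1 / l) * ennreal I = ennreal (I / l)" using l I by (subst ennreal_mult[symmetric]) auto
  also have "\<dots> \<le> 1" using I l by (intro ennreal_le_1[THEN iffD2]) (simp add: l_def)
  finally have "N_norm r D f \<le> ennreal l"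
    unfolding N_norm_def luxemburg_norm_def using l by (intro Inf_lower) auto
  then show ?thesis by (rule le_less_trans) simp
qed

text \<open>The summand 1 is room for an infimum that is not attained or equals 0.\<close>

lemma N_norm_realE:
  fixes f :: "real^'n::finite \<Rightarrow> real"
  assumes n: "CARD('n) \<ge> 2" and r: "r > 0" and f: "f \<in> LlogL r D"
  obtains l where "0 < l" "l \<le> enn2real (N_norm r D f) + 1"
    "(\<integral>\<^sup>+x. ennreal (N_fun CARD('n) r (\<bar>f x\<bar> / l)) \<partial>lebesgue_on D) \<le> 1"
proof -
  have "N_norm r D f = ennreal (enn2real (N_norm r D f))"
    using N_norm_finite[OF assms] by (intro ennreal_enn2real[symmetric]) (simp add: infinity_ennreal_def)
  also have "\<dots> < ennreal (enn2real (N_norm r D f) + 1)" by (simp add: ennreal_less_iff)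
  finally have "luxemburg_norm (N_fun CARD('n) r) D f < ennreal (enn2real (N_norm r D f) + 1)" by (simp add: N_norm_def)
  from luxemburg_norm_lessD[OF this] show thesis using that by (metis less_imp_le)
qed

section \<open>The estimates on one ball, with all constants as parameters\<close>

lemma test_functions_mono: "\<Omega> \<subseteq> D \<Longrightarrow> \<phi> \<in> test_functions \<Omega> \<Longrightarrow> \<phi> \<in> test_functions D"
  by (auto simp: test_functions_def)

lemma test_function_outside:
  fixes \<phi> :: "real^'n::finite \<Rightarrow> real"
  assumes "\<phi> \<in> test_functions \<Omega>" "x \<notin> \<Omega>"
  shows "\<phi> x = 0" "grad \<phi> x = 0" "partial_deriv i \<phi> x = 0"
proof -
  let ?K = "closure {x. \<phi> x \<noteq> 0}"
  have K: "?K \<subseteq> \<Omega>" and sm: "smooth \<phi>" using assms(1) by (auto simp: test_functions_def)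
  have x: "x \<in> - ?K" using K assms(2) by blast
  have z: "\<phi> y = 0" if "y \<in> - ?K" for y using that closure_subset[of "{x. \<phi> x \<noteq> 0}"] by blast
  show "\<phi> x = 0" by (rule z[OF x])
  show g: "grad \<phi> x = 0"
    by (rule C1_grad_zero_outside[OF smooth_C1_grad[OF sm] _ x z]) auto
  then show "partial_deriv i \<phi> x = 0" by (simp add: grad_def vec_eq_iff)
qed

lemma test_function_measurable:
  fixes \<phi> :: "real^'n::finite \<Rightarrow> real"
  assumes "\<phi> \<in> test_functions \<Omega>"
  shows "\<phi> \<in> borel_measurable borel" "grad \<phi> \<in> borel_measurable borel" "partial_deriv i \<phi> \<in> borel_measurable borel"
proof -
  have sm: "smooth \<phi>" using assms by (auto simp: test_functions_def)
  show "\<phi> \<in> borel_measurable borel" "grad \<phi> \<in> borel_measurable borel"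
    using C1_grad_measurable[OF smooth_C1_grad[OF sm]] by auto
  show "partial_deriv i \<phi> \<in> borel_measurable borel"
    using C1_grad_measurable(1)[OF smooth_C1_grad[OF smooth_partial_deriv[OF sm]]] .
qed

lemma measurable_restrict_to_set:
  fixes f :: "'a::euclidean_space \<Rightarrow> 'b::euclidean_space"
  assumes "f \<in> borel_measurable borel" "G \<in> sets borel"
  shows "(\<lambda>x. if x \<in> G then f x else 0) \<in> borel_measurable borel"
  using assms by (intro measurable_If) auto

lemma powr_real_card: "0 < n \<Longrightarrow> 0 \<le> x \<Longrightarrow> x powr real n = x ^ n" for x :: real
  by (cases "x = 0") (auto simp: powr_realpow)

text \<open>The smooth substitute loses a factor 2 at degree 1; \<open>2 ^ n\<close> covers the
  degrees \<open>n - 1\<close> and \<open>n\<close> alike.\<close>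

lemma add_power_le_sqrt:
  fixes z k \<kappa> :: real
  assumes "0 \<le> k" "k \<le> \<kappa>" "j \<le> n"
  shows "(\<bar>z\<bar> + k) ^ j \<le> 2 ^ n * sqrt (z\<^sup>2 + \<kappa>\<^sup>2) ^ j"
proof -
  have "\<bar>z\<bar> \<le> sqrt (z\<^sup>2 + \<kappa>\<^sup>2)" "\<kappa> \<le> sqrt (z\<^sup>2 + \<kappa>\<^sup>2)"
    using assms by (auto intro!: real_le_rsqrt)
  then have "\<bar>z\<bar> + k \<le> 2 * sqrt (z\<^sup>2 + \<kappa>\<^sup>2)" using assms by linarith
  then have "(\<bar>z\<bar> + k) ^ j \<le> (2 * sqrt (z\<^sup>2 + \<kappa>\<^sup>2)) ^ j" using assms by (intro power_mono) auto
  also have "\<dots> = 2 ^ j * sqrt (z\<^sup>2 + \<kappa>\<^sup>2) ^ j" by (rule power_mult_distrib)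
  also have "\<dots> \<le> 2 ^ n * sqrt (z\<^sup>2 + \<kappa>\<^sup>2) ^ j" using assms by (intro mult_right_mono power_increasing) auto
  finally show ?thesis .
qed

text \<open>The constants \<open>KT\<close>, \<open>KO\<close> and \<open>CS\<close> are parameters,
  to be fixed before the domain, the solution and the radius, and \<open>K\<close> is formed from
  \<open>a\<close>, \<open>n\<close> and \<open>KO\<close> alone; this is what makes the final
  constant independent of \<open>u\<close>, \<open>D\<close> and \<open>R\<close>. The factor in
  \<open>3 * KO\<close> is due to \<open>V\<close> being a sum of three coefficients, each with an
  admissible constant of its own.\<close>

lemma local_estimates:
  fixes u b c d :: "real^'n::finite \<Rightarrow> real" and Du :: "real^'n \<Rightarrow> real^'n"
    and A :: "real^'n \<Rightarrow> real \<Rightarrow> real^'n \<Rightarrow> real^'n" and B :: "real^'n \<Rightarrow> real \<Rightarrow> real^'n \<Rightarrow> real"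
  defines "n \<equiv> CARD('n)"
  assumes n2: "n \<ge> 2" and r: "0 < r" "r < 1" and a: "0 \<le> a"
    and KT: "0 < KT" "\<And>(w :: real^'n \<Rightarrow> real) W L. C1_grad w W \<Longrightarrow> (\<And>y. norm y \<ge> 2 \<Longrightarrow> w y = 0) \<Longrightarrow> 0 < L \<Longrightarrow>
      (\<integral>\<^sup>+y. ennreal (norm (W y) ^ n) \<partial>lborel) \<le> ennreal (L ^ n) \<Longrightarrow>
      (\<integral>\<^sup>+x. ennreal (exp ((\<bar>w x\<bar> / (KT * L)) powr (real n / (real n - 1))) - 1) \<partial>lborel) \<le> 1"
    and KO: "1 \<le> KO"
      "\<And>(V :: real^'n \<Rightarrow> real) f \<Omega> l \<mu>. V \<in> borel_measurable borel \<Longrightarrow> f \<in> borel_measurable borel \<Longrightarrow> \<Omega> \<in> sets borel \<Longrightarrow>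
      (\<And>x. 0 \<le> V x) \<Longrightarrow> (\<And>x. 0 \<le> f x) \<Longrightarrow> 0 < l \<Longrightarrow>
      (\<integral>\<^sup>+x. indicator \<Omega> x * ennreal (N_fun n r (V x / l)) \<partial>lborel) \<le> 1 \<Longrightarrow>
      exp_modular (real n * r / (real n - 1)) \<Omega> f \<mu> \<Longrightarrow>
      (\<integral>\<^sup>+x. indicator \<Omega> x * ennreal (V x * f x ^ n) \<partial>lborel) \<le> ennreal (KO * l * \<mu> ^ n)"
      "\<And>(f :: real^'n \<Rightarrow> real) \<Omega> \<mu>. f \<in> borel_measurable borel \<Longrightarrow> \<Omega> \<in> sets borel \<Longrightarrow> \<Omega> \<subseteq> cball 0 2 \<Longrightarrow> (\<And>x. 0 \<le> f x) \<Longrightarrow>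
      exp_modular (real n * r / (real n - 1)) \<Omega> f \<mu> \<Longrightarrow>
      (\<integral>\<^sup>+x. indicator \<Omega> x * ennreal (f x ^ n) \<partial>lborel) \<le> ennreal (KO * \<mu> ^ n)"
    and CS: "1 \<le> CS"
      "\<And>(f :: real^'n \<Rightarrow> real) g \<Omega> l k. f \<in> borel_measurable borel \<Longrightarrow> \<Omega> \<in> sets borel \<Longrightarrow> \<Omega> \<subseteq> cball 0 2 \<Longrightarrow> 0 < k \<Longrightarrow>
      (\<And>x. \<bar>g x\<bar> \<le> \<bar>f x\<bar> + k) \<Longrightarrow> exp_modular (real n * r / (real n - 1)) \<Omega> f l \<Longrightarrow>
      exp_modular (real n * r / (real n - 1)) \<Omega> g (CS * (l + k))"
    and D: "open D" and R: "0 < R" "R \<le> 1" "ball 0 (2 * R) \<subseteq> D"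
    and nonneg: "\<And>x. x \<in> D \<Longrightarrow> 0 \<le> b x \<and> 0 \<le> c x \<and> 0 \<le> d x" and k: "0 \<le> k" "k < \<kappa>"
    and meas: "(\<lambda>x. b x powr (real n / (real n - 1))) \<in> borel_measurable (lebesgue_on D)"
      "(\<lambda>x. c x ^ n) \<in> borel_measurable (lebesgue_on D)" "d \<in> borel_measurable (lebesgue_on D)"
    and S: "1 \<le> S"
      "0 < lb" "lb \<le> S" "(\<integral>\<^sup>+x. ennreal (N_fun n r (\<bar>b x powr (real n / (real n - 1))\<bar> / lb)) \<partial>lebesgue_on D) \<le> 1"
      "0 < lc" "lc \<le> S" "(\<integral>\<^sup>+x. ennreal (N_fun n r (\<bar>c x ^ n\<bar> / lc)) \<partial>lebesgue_on D) \<le> 1"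
      "0 < ld" "ld \<le> S" "(\<integral>\<^sup>+x. ennreal (N_fun n r (\<bar>d x\<bar> / ld)) \<partial>lebesgue_on D) \<le> 1"
    and struc: "structure_conditions a k b c d A B D" and sol: "weak_solution A B D u Du"
    and la: "0 < la" "(\<integral>\<^sup>+x. ennreal (exp ((\<bar>u x\<bar> / la) powr (real n * r / (real n - 1))) - 1) \<partial>lebesgue_on (ball 0 (2 * R))) \<le> 1"
  defines "K \<equiv> elliptic_iteration.K2 a n (n - 1) (3 * KO)"
  shows "1 \<le> K"
    and "AE x in lebesgue_on (ball 0 R). \<bar>u x\<bar> \<le> CS * (la + \<kappa>) *
      ((2 * max 1 (KT * K) * S / R) powr (1 / (1 - r)) * (2 / r) powr (\<Sum>i. real i * r ^ i))"
    and "Lp_norm (real n) (ball 0 R) Du \<le> K * S * (CS * (la + \<kappa>) / R)"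
proof -
  define m where "m = n - 1"
  have nm: "n = Suc m" "m \<ge> 1" using n2 by (auto simp: m_def)
  have n0: "0 < n" using n2 by simp
  have n1: "real n - 1 = real m" by (simp add: nm)
  define P where "P = 2 * R"
  define \<Omega> where "\<Omega> = (ball 0 P :: (real^'n) set)"
  have P: "0 < P" "P \<le> 2" using R by (auto simp: P_def)
  have \<Omega>D: "\<Omega> \<subseteq> D" using R(3) by (simp add: \<Omega>_def P_def)
  have \<Omega>m: "\<Omega> \<in> sets borel" by (simp add: \<Omega>_def)
  have Dm: "D \<in> sets lebesgue" using D by (simp add: borel_open sets_completionI_sets)
  have \<Omega>l: "\<Omega> \<in> sets lebesgue" using \<Omega>m by (simp add: sets_completionI_sets)
  let ?p = "real n / (real n - 1)"
  have W: "W1_with_gradient (real n) D u Du" and Am: "(\<lambda>x. A x (u x) (Du x)) \<in> borel_measurable (lebesgue_on D)"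
    and Bm: "(\<lambda>x. B x (u x) (Du x)) \<in> borel_measurable (lebesgue_on D)"
    and weq: "\<And>\<phi>. \<phi> \<in> test_functions D \<Longrightarrow> (LINT x|lebesgue_on D.
          grad \<phi> x \<bullet> A x (u x) (Du x) + \<phi> x * B x (u x) (Du x)) = 0"
    using sol unfolding weak_solution_def n_def by blast+
  have uL: "u \<in> Lp (real n) D" and DuL: "Du \<in> Lp (real n) D"
    and wgr: "\<And>\<phi> i. \<phi> \<in> test_functions D \<Longrightarrow>
        (LINT x|lebesgue_on D. u x * partial_deriv i \<phi> x) = - (LINT x|lebesgue_on D. Du x $ i * \<phi> x)"
    using W unfolding W1_with_gradient_def by blast+
  \<comment> \<open>With this root \<open>\<beta> ^ (n - 1)\<close> is the coefficient in the
    structure condition, and \<open>\<beta> ^ n\<close> is the function whose norm is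
    controlled.\<close>
  define \<beta> where "\<beta> x = b x powr (1 / real m)" for x
  have \<beta>m: "\<beta> \<in> borel_measurable (lebesgue_on D)"
  proof -
    have "\<beta> = (\<lambda>x. (b x powr ?p) powr (1 / real n))"
      using nm by (simp add: \<beta>_def powr_powr n1 fun_eq_iff)
    then show ?thesis using meas(1) by simp
  qed
  have \<beta>m_pow: "\<beta> x ^ m = b x" if "x \<in> D" for x
    using nonneg[OF that] nm(2) by (cases "b x = 0") (auto simp: \<beta>_def powr_realpow[symmetric] powr_powr)
  have \<beta>n_pow: "\<beta> x ^ n = b x powr ?p" for x
    unfolding \<beta>_def powr_real_card[OF n0 powr_ge_zero, symmetric] by (simp add: powr_powr n1)
  \<comment> \<open>What is assumed measurable is \<open>c ^ n\<close>; as \<open>c\<close> is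
    nonnegative on \<open>D\<close>, it is the root of it.\<close>
  have cm: "c \<in> borel_measurable (lebesgue_on D)"
  proof -
    have "(\<lambda>x. (c x ^ n) powr (1 / real n)) \<in> borel_measurable (lebesgue_on D)" using meas(2) by measurable
    moreover have "(c x ^ n) powr (1 / real n) = c x" if "x \<in> space (lebesgue_on D)" for x
    proof -
      have c0: "0 \<le> c x" using nonneg[of x] that by simp
      show ?thesis unfolding powr_real_card[OF n0 c0, symmetric] using n0 c0 by (simp add: powr_powr)
    qed
    ultimately show ?thesis by (subst (asm) measurable_cong) auto
  qed
  obtain u' where u': "u' \<in> borel_measurable borel" "AE x in lborel. x \<in> D \<longrightarrow> u x = u' x"
    using borel_representative_real[OF _ Dm, of u] uL by (auto simp: Lp_def)
  obtain Du' where Du': "Du' \<in> borel_measurable borel" "AE x in lborel. x \<in> D \<longrightarrow> Du x = Du' x"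
    using borel_representative_vec[OF _ Dm, of Du] DuL by (auto simp: Lp_def)
  obtain A' where A': "A' \<in> borel_measurable borel" "AE x in lborel. x \<in> D \<longrightarrow> A x (u x) (Du x) = A' x"
    using borel_representative_vec[OF Am Dm] by blast
  obtain B' where B': "B' \<in> borel_measurable borel" "AE x in lborel. x \<in> D \<longrightarrow> B x (u x) (Du x) = B' x"
    using borel_representative_real[OF Bm Dm] by blast
  obtain \<beta>' where \<beta>': "\<beta>' \<in> borel_measurable borel" "AE x in lborel. x \<in> D \<longrightarrow> \<beta> x = \<beta>' x"
    using borel_representative_real[OF \<beta>m Dm] by blast
  obtain c' where c': "c' \<in> borel_measurable borel" "AE x in lborel. x \<in> D \<longrightarrow> c x = c' x"
    using borel_representative_real[OF cm Dm] by blast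
  obtain d' where d': "d' \<in> borel_measurable borel" "AE x in lborel. x \<in> D \<longrightarrow> d x = d' x"
    using borel_representative_real[OF meas(3) Dm] by blast
  let ?good = "\<lambda>x. x \<in> D \<longrightarrow> u x = u' x \<and> Du x = Du' x \<and> A x (u x) (Du x) = A' x \<and> B x (u x) (Du x) = B' x \<and>
      \<beta> x = \<beta>' x \<and> c x = c' x \<and> d x = d' x"
  have "AE x in lborel. ?good x"
    using u'(2) Du'(2) A'(2) B'(2) \<beta>'(2) c'(2) d'(2) by eventually_elim simp
  \<comment> \<open>One Borel null set collects the exceptional sets of all seven representatives,
    so that on \<open>G\<close> pointwise information such as the structure conditions applies to
    them.\<close>
  then obtain N where N: "{x \<in> space lborel. \<not> ?good x} \<subseteq> N" "emeasure lborel N = 0" "N \<in> sets lborel" by (rule AE_E)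
  define G where "G = \<Omega> - N"
  have Gm: "G \<in> sets borel" using \<Omega>m N(3) by (simp add: G_def)
  have G\<Omega>: "G \<subseteq> \<Omega>" by (auto simp: G_def)
  have GD: "x \<in> D" if "x \<in> G" for x using that G\<Omega> \<Omega>D by blast
  have null: "\<Omega> - G \<in> null_sets lborel"
  proof (rule null_sets_subset)
    show "N \<in> null_sets lborel" using N by (intro null_setsI) auto
    show "\<Omega> - G \<in> sets lborel" using \<Omega>m Gm by simp
    show "\<Omega> - G \<subseteq> N" by (auto simp: G_def)
  qed
  have good: "u x = u' x" "Du x = Du' x" "A x (u x) (Du x) = A' x" "B x (u x) (Du x) = B' x"
      "\<beta> x = \<beta>' x" "c x = c' x" "d x = d' x" if "x \<in> G" for x
    using N(1) that GD[OF that] by (auto simp: G_def)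
  \<comment> \<open>Setting all data to 0 off \<open>G\<close> makes the structure inequalities
    trivial there and confines the data to the ball.\<close>
  define u1 where "u1 x = (if x \<in> G then u' x else 0)" for x
  define Du1 where "Du1 x = (if x \<in> G then Du' x else 0)" for x
  define A1 where "A1 x = (if x \<in> G then A' x else 0)" for x
  define B1 where "B1 x = (if x \<in> G then B' x else 0)" for x
  define \<beta>1 where "\<beta>1 x = (if x \<in> G then \<beta>' x else 0)" for x
  define c1 where "c1 x = (if x \<in> G then c' x else 0)" for x
  define d1 where "d1 x = (if x \<in> G then d' x else 0)" for x
  define v1 where "v1 x = sqrt ((u1 x)\<^sup>2 + \<kappa>\<^sup>2)" for x
  note defs = u1_def Du1_def A1_def B1_def \<beta>1_def c1_def d1_def
  have m1[measurable]: "u1 \<in> borel_measurable borel" "Du1 \<in> borel_measurable borel" "A1 \<in> borel_measurable borel"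
    "B1 \<in> borel_measurable borel" "\<beta>1 \<in> borel_measurable borel" "c1 \<in> borel_measurable borel" "d1 \<in> borel_measurable borel"
    unfolding defs[abs_def]
    by (rule measurable_restrict_to_set[OF u'(1) Gm], rule measurable_restrict_to_set[OF Du'(1) Gm],
        rule measurable_restrict_to_set[OF A'(1) Gm], rule measurable_restrict_to_set[OF B'(1) Gm],
        rule measurable_restrict_to_set[OF \<beta>'(1) Gm], rule measurable_restrict_to_set[OF c'(1) Gm],
        rule measurable_restrict_to_set[OF d'(1) Gm])
  have on: "u1 x = u x" "Du1 x = Du x" "A1 x = A x (u x) (Du x)" "B1 x = B x (u x) (Du x)"
      "\<beta>1 x = \<beta> x" "c1 x = c x" "d1 x = d x" if "x \<in> G" for x
    using good[OF that] that by (auto simp: defs)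
  have off: "u1 x = 0" "Du1 x = 0" "A1 x = 0" "B1 x = 0" "\<beta>1 x = 0" "c1 x = 0" "d1 x = 0" if "x \<notin> G" for x
    using that by (auto simp: defs)
  have v1m[measurable]: "v1 \<in> borel_measurable borel" unfolding v1_def[abs_def] by measurable
  have v1pos: "v1 x > 0" for x using k by (simp add: v1_def add_nonneg_pos)
  have nn1: "0 \<le> \<beta>1 x" "0 \<le> c1 x" "0 \<le> d1 x" for x
    using on(5-7)[of x] off(5-7)[of x] nonneg[of x] GD[of x] by (cases "x \<in> G"; simp add: \<beta>_def)+
  have st: "norm (A1 x) \<le> a * norm (Du1 x) ^ m + 2 ^ n * (\<beta>1 x * v1 x) ^ m"
    "\<bar>B1 x\<bar> \<le> c1 x * norm (Du1 x) ^ m + 2 ^ n * (d1 x * v1 x ^ m)"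
    "Du1 x \<bullet> A1 x \<ge> norm (Du1 x) ^ n - 2 ^ n * (d1 x * v1 x ^ n)" for x
  proof -
    have le: "(\<bar>u x\<bar> + k) ^ m \<le> 2 ^ n * v1 x ^ m" "(\<bar>u x\<bar> + k) ^ n \<le> 2 ^ n * v1 x ^ n" if "x \<in> G"
      unfolding v1_def on(1)[OF that]
    proof -
      have "k \<le> \<kappa>" "m \<le> n" using k nm by auto
      then show "(\<bar>u x\<bar> + k) ^ m \<le> 2 ^ n * sqrt ((u x)\<^sup>2 + \<kappa>\<^sup>2) ^ m"
        "(\<bar>u x\<bar> + k) ^ n \<le> 2 ^ n * sqrt ((u x)\<^sup>2 + \<kappa>\<^sup>2) ^ n"
        using k(1) add_power_le_sqrt by blast+
    qed
    have sc: "norm (A x (u x) (Du x)) \<le> a * norm (Du x) ^ m + b x * (\<bar>u x\<bar> + k) ^ m"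
      "\<bar>B x (u x) (Du x)\<bar> \<le> c x * norm (Du x) ^ m + d x * (\<bar>u x\<bar> + k) ^ m"
      "Du x \<bullet> A x (u x) (Du x) \<ge> norm (Du x) ^ n - d x * (\<bar>u x\<bar> + k) ^ n" if "x \<in> G"
      using struc GD[OF that] unfolding structure_conditions_def n_def[symmetric] m_def[symmetric] by blast+
    show "norm (A1 x) \<le> a * norm (Du1 x) ^ m + 2 ^ n * (\<beta>1 x * v1 x) ^ m"
    proof (cases "x \<in> G")
      case True
      have "b x * (\<bar>u x\<bar> + k) ^ m \<le> b x * (2 ^ n * v1 x ^ m)"
        using nonneg[OF GD[OF True]] le(1)[OF True] by (intro mult_left_mono) auto
      also have "\<dots> = 2 ^ n * (\<beta>1 x * v1 x) ^ m"
        using \<beta>m_pow[OF GD[OF True]] by (simp add: on[OF True] power_mult_distrib)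
      finally show ?thesis using sc(1)[OF True] by (simp add: on[OF True])
    next
      case False then show ?thesis using a nm(2) by (simp add: off)
    qed
    show "\<bar>B1 x\<bar> \<le> c1 x * norm (Du1 x) ^ m + 2 ^ n * (d1 x * v1 x ^ m)"
    proof (cases "x \<in> G")
      case True
      have "d x * (\<bar>u x\<bar> + k) ^ m \<le> d x * (2 ^ n * v1 x ^ m)"
        using nonneg[OF GD[OF True]] le(1)[OF True] by (intro mult_left_mono) auto
      then show ?thesis using sc(2)[OF True] by (simp add: on[OF True] mult.left_commute)
    qed (simp add: off)
    show "Du1 x \<bullet> A1 x \<ge> norm (Du1 x) ^ n - 2 ^ n * (d1 x * v1 x ^ n)"
    proof (cases "x \<in> G")
      case True
      have "d x * (\<bar>u x\<bar> + k) ^ n \<le> d x * (2 ^ n * v1 x ^ n)"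
        using nonneg[OF GD[OF True]] le(2)[OF True] by (intro mult_left_mono) auto
      then show ?thesis using sc(3)[OF True] by (simp add: on[OF True] mult.left_commute)
    qed (simp add: off nm(1))
  qed
  have ui: "integrable lborel (\<lambda>x. \<bar>u1 x\<bar> ^ n)"
  proof (rule lebesgue_on_transfer(1)[OF Dm \<Omega>D G\<Omega> null])
    show "integrable (lebesgue_on D) (\<lambda>x. norm (u x) powr real n)" using uL by (simp add: Lp_def)
  qed (use n0 in \<open>auto simp: on off powr_real_card\<close>)
  have Dui: "integrable lborel (\<lambda>x. norm (Du1 x) ^ n)"
  proof (rule lebesgue_on_transfer(1)[OF Dm \<Omega>D G\<Omega> null])
    show "integrable (lebesgue_on D) (\<lambda>x. norm (Du x) powr real n)" using DuL by (simp add: Lp_def)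
  qed (use n0 in \<open>auto simp: on off powr_real_card\<close>)
  have mod_u: "exp_modular (real n * r / (real n - 1)) \<Omega> u1 la"
    unfolding exp_modular_def
  proof (intro conjI la(1))
    have "(\<integral>\<^sup>+x. indicator \<Omega> x * ennreal (exp ((\<bar>u1 x\<bar> / la) powr (real n * r / (real n - 1))) - 1) \<partial>lborel)
      \<le> (\<integral>\<^sup>+x. ennreal (exp ((\<bar>u x\<bar> / la) powr (real n * r / (real n - 1))) - 1) \<partial>lebesgue_on \<Omega>)"
      by (rule nn_integral_lebesgue_on_transfer[OF \<Omega>l order_refl null]) (simp add: on)
    also have "\<dots> \<le> 1" using la(2) by (simp add: \<Omega>_def P_def)
    finally show "(\<integral>\<^sup>+x. indicator \<Omega> x * ennreal (exp ((\<bar>u1 x\<bar> / la) powr (real n * r / (real n - 1))) - 1) \<partial>lborel) \<le> 1" .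
  qed
  have \<Omega>2: "\<Omega> \<subseteq> cball 0 2" using P by (auto simp: \<Omega>_def)
  have mod_v: "exp_modular (real n * r / (real n - 1)) \<Omega> v1 (CS * (la + \<kappa>))"
  proof (rule CS(2)[OF m1(1) \<Omega>m \<Omega>2 _ _ mod_u])
    show "0 < \<kappa>" using k by simp
    have "v1 x \<le> \<bar>u1 x\<bar> + \<kappa>" for x
      unfolding v1_def using k by (intro real_le_lsqrt) (auto simp: power2_sum)
    then show "\<bar>v1 x\<bar> \<le> \<bar>u1 x\<bar> + \<kappa>" for x using v1pos[of x] by simp
  qed
  \<comment> \<open>The case of a single coefficient: a constant admissible over \<open>D\<close>
    stays admissible on a subball.\<close>
  have Or1: "(\<integral>\<^sup>+x. indicator (ball 0 \<rho>) x * ennreal (W x * f x ^ n) \<partial>lborel) \<le> ennreal (KO * S * \<mu> ^ n)"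
    if W[measurable]: "W \<in> borel_measurable borel" and W0: "\<And>x. 0 \<le> W x" and WG: "\<And>x. x \<in> G \<Longrightarrow> W x = \<bar>W' x\<bar>"
      and l: "0 < l" "l \<le> S" "(\<integral>\<^sup>+x. ennreal (N_fun n r (\<bar>W' x\<bar> / l)) \<partial>lebesgue_on D) \<le> 1"
      and f: "f \<in> borel_measurable borel" "\<And>x. 0 \<le> f x" and \<rho>: "\<rho> \<le> P"
      and mod: "exp_modular (real n * r / (real n - 1)) (ball 0 \<rho>) f \<mu>" for W W' f l \<rho> \<mu>
  proof -
    have sub: "ball 0 \<rho> \<subseteq> \<Omega>" unfolding \<Omega>_def using \<rho> by (rule subset_ball)
    have "(\<integral>\<^sup>+x. indicator (ball 0 \<rho>) x * ennreal (N_fun n r (W x / l)) \<partial>lborel)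
      \<le> (\<integral>\<^sup>+x. indicator \<Omega> x * ennreal (N_fun n r (W x / l)) \<partial>lborel)"
      using sub by (intro nn_integral_mono) (auto simp: indicator_def)
    also have "\<dots> \<le> (\<integral>\<^sup>+x. ennreal (N_fun n r (\<bar>W' x\<bar> / l)) \<partial>lebesgue_on D)"
      by (rule nn_integral_lebesgue_on_transfer[OF Dm \<Omega>D null]) (simp add: WG)
    also have "\<dots> \<le> 1" by (rule l(3))
    finally have "(\<integral>\<^sup>+x. indicator (ball 0 \<rho>) x * ennreal (N_fun n r (W x / l)) \<partial>lborel) \<le> 1" .
    from KO(2)[OF W f(1) _ W0 f(2) l(1) this mod]
    have "(\<integral>\<^sup>+x. indicator (ball 0 \<rho>) x * ennreal (W x * f x ^ n) \<partial>lborel) \<le> ennreal (KO * l * \<mu> ^ n)" by simp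
    also have "\<dots> \<le> ennreal (KO * S * \<mu> ^ n)"
      using l KO(1) mod by (intro ennreal_leI mult_right_mono mult_left_mono) (auto simp: exp_modular_def)
    finally show ?thesis .
  qed
  have Or: "(\<integral>\<^sup>+x. indicator (ball 0 \<rho>) x * ennreal ((\<beta>1 x ^ n + c1 x ^ n + d1 x) * f x ^ n) \<partial>lborel) \<le> ennreal (3 * KO * S * \<mu> ^ n)"
    if f[measurable]: "f \<in> borel_measurable borel" and f0: "\<And>x. 0 \<le> f x" and \<rho>: "\<rho> \<le> P"
      and mod: "exp_modular (real n * r / (real n - 1)) (ball 0 \<rho>) f \<mu>" for f \<rho> \<mu>
  proof -
    have [measurable]: "ball (0::real^'n) \<rho> \<in> sets borel" by simp
    have \<mu>: "\<mu> > 0" using mod by (simp add: exp_modular_def)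
    have "(\<integral>\<^sup>+x. indicator (ball 0 \<rho>) x * ennreal ((\<beta>1 x ^ n + c1 x ^ n + d1 x) * f x ^ n) \<partial>lborel)
      = (\<integral>\<^sup>+x. (indicator (ball 0 \<rho>) x * ennreal (\<beta>1 x ^ n * f x ^ n) + indicator (ball 0 \<rho>) x * ennreal (c1 x ^ n * f x ^ n))
          + indicator (ball 0 \<rho>) x * ennreal (d1 x * f x ^ n) \<partial>lborel)"
    proof (rule nn_integral_cong)
      fix x
      have "ennreal ((\<beta>1 x ^ n + c1 x ^ n + d1 x) * f x ^ n) = ennreal (\<beta>1 x ^ n * f x ^ n) + ennreal (c1 x ^ n * f x ^ n) + ennreal (d1 x * f x ^ n)"
        using nn1[of x] f0[of x] by (simp add: distrib_right ennreal_plus)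
      then show "indicator (ball 0 \<rho>) x * ennreal ((\<beta>1 x ^ n + c1 x ^ n + d1 x) * f x ^ n) =
        (indicator (ball 0 \<rho>) x * ennreal (\<beta>1 x ^ n * f x ^ n) + indicator (ball 0 \<rho>) x * ennreal (c1 x ^ n * f x ^ n))
          + indicator (ball 0 \<rho>) x * ennreal (d1 x * f x ^ n)"
        by (simp add: indicator_def)
    qed
    also have "\<dots> = ((\<integral>\<^sup>+x. indicator (ball 0 \<rho>) x * ennreal (\<beta>1 x ^ n * f x ^ n) \<partial>lborel) + (\<integral>\<^sup>+x. indicator (ball 0 \<rho>) x * ennreal (c1 x ^ n * f x ^ n) \<partial>lborel))
        + (\<integral>\<^sup>+x. indicator (ball 0 \<rho>) x * ennreal (d1 x * f x ^ n) \<partial>lborel)"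
      by (subst nn_integral_add, measurable, subst nn_integral_add, measurable)
    also have "\<dots> \<le> (ennreal (KO * S * \<mu> ^ n) + ennreal (KO * S * \<mu> ^ n)) + ennreal (KO * S * \<mu> ^ n)"
    proof (intro add_mono)
      show "(\<integral>\<^sup>+x. indicator (ball 0 \<rho>) x * ennreal (\<beta>1 x ^ n * f x ^ n) \<partial>lborel) \<le> ennreal (KO * S * \<mu> ^ n)"
        by (rule Or1[OF _ _ _ S(2-4) f f0 \<rho> mod]) (use nn1 \<beta>n_pow on in auto)
      show "(\<integral>\<^sup>+x. indicator (ball 0 \<rho>) x * ennreal (c1 x ^ n * f x ^ n) \<partial>lborel) \<le> ennreal (KO * S * \<mu> ^ n)"
        by (rule Or1[OF _ _ _ S(5-7) f f0 \<rho> mod]) (use nn1 on nonneg GD in auto)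
      show "(\<integral>\<^sup>+x. indicator (ball 0 \<rho>) x * ennreal (d1 x * f x ^ n) \<partial>lborel) \<le> ennreal (KO * S * \<mu> ^ n)"
        by (rule Or1[OF _ _ _ S(8-10) f f0 \<rho> mod]) (use nn1 on nonneg GD in auto)
    qed
    also have "\<dots> = ennreal (3 * KO * S * \<mu> ^ n)"
      using KO(1) S(1) \<mu> by (simp add: ennreal_plus[symmetric] del: ennreal_plus)
    finally show ?thesis .
  qed
  \<comment> \<open>The integrability that the locale demands is itself an instance of the duality
    estimate, with \<open>f = v1\<close>.\<close>
  have Vi: "integrable lborel (\<lambda>x. (\<beta>1 x ^ n + c1 x ^ n + d1 x) * v1 x ^ n)"
  proof (rule integrableI_bounded)
    have "(\<integral>\<^sup>+x. ennreal (norm ((\<beta>1 x ^ n + c1 x ^ n + d1 x) * v1 x ^ n)) \<partial>lborel)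
      \<le> (\<integral>\<^sup>+x. indicator (ball 0 P) x * ennreal ((\<beta>1 x ^ n + c1 x ^ n + d1 x) * v1 x ^ n) \<partial>lborel)"
    proof (rule nn_integral_mono)
      fix x
      show "ennreal (norm ((\<beta>1 x ^ n + c1 x ^ n + d1 x) * v1 x ^ n)) \<le> indicator (ball 0 P) x * ennreal ((\<beta>1 x ^ n + c1 x ^ n + d1 x) * v1 x ^ n)"
      proof (cases "x \<in> G")
        case True
        then show ?thesis using G\<Omega> nn1[of x] v1pos[of x] by (auto simp: \<Omega>_def)
      next
        case False then show ?thesis using nm by (simp add: off)
      qed
    qed
    also have "\<dots> \<le> ennreal (3 * KO * S * (CS * (la + \<kappa>)) ^ n)"
      by (rule Or) (use mod_v v1pos in \<open>auto simp: \<Omega>_def less_imp_le\<close>)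
    finally show "(\<integral>\<^sup>+x. ennreal (norm ((\<beta>1 x ^ n + c1 x ^ n + d1 x) * v1 x ^ n)) \<partial>lborel) < \<infinity>"
      by (rule le_less_trans) simp
  qed measurable
  have wg1: "(\<integral>x. u1 x * partial_deriv i \<phi> x \<partial>lborel) = - (\<integral>x. Du1 x $ i * \<phi> x \<partial>lborel)"
    if \<phi>: "\<phi> \<in> test_functions (ball 0 P)" for \<phi> i
  proof -
    have \<phi>\<Omega>: "\<phi> \<in> test_functions \<Omega>" using \<phi> by (simp add: \<Omega>_def)
    note [measurable] = test_function_measurable[OF \<phi>\<Omega>]
    have "(\<lambda>x. Du1 x $ i) \<in> borel_measurable borel"
      by (rule measurable_compose[OF m1(2) borel_measurable_continuous_onI[OF linear_continuous_on[OF bounded_linear_vec_nth]]])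
    note [measurable] = this
    have "(LINT x|lebesgue_on D. u x * partial_deriv i \<phi> x) = (\<integral>x. u1 x * partial_deriv i \<phi> x \<partial>lborel)"
      by (rule lebesgue_on_transfer(2)[OF Dm \<Omega>D G\<Omega> null]) (use test_function_outside[OF \<phi>\<Omega>] in \<open>auto simp: on off\<close>)
    moreover have "(LINT x|lebesgue_on D. Du x $ i * \<phi> x) = (\<integral>x. Du1 x $ i * \<phi> x \<partial>lborel)"
      by (rule lebesgue_on_transfer(2)[OF Dm \<Omega>D G\<Omega> null]) (use test_function_outside[OF \<phi>\<Omega>] in \<open>auto simp: on off\<close>)
    ultimately show ?thesis using wgr[OF test_functions_mono[OF \<Omega>D \<phi>\<Omega>], of i] by simp
  qed
  have weq1: "(\<integral>x. grad \<phi> x \<bullet> A1 x + \<phi> x * B1 x \<partial>lborel) = 0" if \<phi>: "\<phi> \<in> test_functions (ball 0 P)" for \<phi>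
  proof -
    have \<phi>\<Omega>: "\<phi> \<in> test_functions \<Omega>" using \<phi> by (simp add: \<Omega>_def)
    note [measurable] = test_function_measurable[OF \<phi>\<Omega>]
    have "(LINT x|lebesgue_on D. grad \<phi> x \<bullet> A x (u x) (Du x) + \<phi> x * B x (u x) (Du x)) = (\<integral>x. grad \<phi> x \<bullet> A1 x + \<phi> x * B1 x \<partial>lborel)"
      by (rule lebesgue_on_transfer(2)[OF Dm \<Omega>D G\<Omega> null]) (use test_function_outside[OF \<phi>\<Omega>] in \<open>auto simp: on off\<close>)
    then show ?thesis using weq[OF test_functions_mono[OF \<Omega>D \<phi>\<Omega>]] by simp
  qed
  have outside1: "u1 x = 0 \<and> Du1 x = 0 \<and> A1 x = 0 \<and> B1 x = 0 \<and> \<beta>1 x = 0 \<and> c1 x = 0 \<and> d1 x = 0" if "P \<le> norm x" for x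
  proof -
    have "x \<notin> G" using that G\<Omega> by (auto simp: \<Omega>_def)
    then show ?thesis using off by blast
  qed
  interpret E: elliptic_ball u1 B1 \<beta>1 c1 d1 v1 Du1 A1 P a \<kappa> n m
  proof
    show "n = CARD('n)" by (simp add: n_def)
    show "0 < \<kappa>" using k by simp
    show "v1 x = sqrt ((u1 x)\<^sup>2 + \<kappa>\<^sup>2)" for x by (simp add: v1_def)
  qed (fact nm P a m1 outside1 nn1 st ui Dui Vi wg1 weq1)+
  interpret I: elliptic_iteration u1 B1 \<beta>1 c1 d1 v1 Du1 A1 P a \<kappa> n m r S "3 * KO" KT
  proof
    show "0 < r" "1 \<le> S" "1 \<le> 3 * KO" "0 < KT" using r S(1) KO(1) KT(1) by auto
    show "(\<integral>\<^sup>+x. indicator (ball 0 \<rho>) x * ennreal (E.V x * f x ^ n) \<partial>lborel) \<le> ennreal (3 * KO * S * \<mu> ^ n)"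
      if "f \<in> borel_measurable borel" "\<And>x. 0 \<le> f x" "\<rho> \<le> P" "exp_modular (real n * r / (real n - 1)) (ball 0 \<rho>) f \<mu>" for f \<rho> \<mu>
      unfolding E.V_def by (rule Or[OF that])
    show "(\<integral>\<^sup>+x. indicator (ball 0 \<rho>) x * ennreal (f x ^ n) \<partial>lborel) \<le> ennreal (3 * KO * \<mu> ^ n)"
      if "f \<in> borel_measurable borel" "\<And>x. 0 \<le> f x" "\<rho> \<le> P" "exp_modular (real n * r / (real n - 1)) (ball 0 \<rho>) f \<mu>"
      for f :: "real^'n \<Rightarrow> real" and \<rho> \<mu>
    proof -
      have "(\<integral>\<^sup>+x. indicator (ball 0 \<rho>) x * ennreal (f x ^ n) \<partial>lborel) \<le> ennreal (KO * \<mu> ^ n)"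
        using that P by (intro KO(3)) auto
      also have "\<dots> \<le> ennreal (3 * KO * \<mu> ^ n)"
        using KO(1) that(4) by (intro ennreal_leI mult_right_mono) (auto simp: exp_modular_def)
      finally show ?thesis .
    qed
  qed (fact KT(2))
  have K_eq: "K = I.K2" by (simp add: K_def m_def)
  show "1 \<le> K" unfolding K_eq by (rule I.K2)
  have mod_v': "exp_modular (real n * r / (real n - 1)) (ball 0 P) v1 (CS * (la + \<kappa>))" using mod_v by (simp add: \<Omega>_def)
  have Rm: "ball 0 R \<in> sets lebesgue" by (simp add: sets_completionI_sets)
  have R\<Omega>: "ball 0 R \<subseteq> \<Omega>" unfolding \<Omega>_def P_def using R(1) by (intro subset_ball) simp
  show "AE x in lebesgue_on (ball 0 R). \<bar>u x\<bar> \<le> CS * (la + \<kappa>) *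
      ((2 * max 1 (KT * K) * S / R) powr (1 / (1 - r)) * (2 / r) powr (\<Sum>i. real i * r ^ i))"
  proof -
    have "AE x in lborel. norm x < R \<longrightarrow> v1 x \<le> CS * (la + \<kappa>) *
      ((2 * max 1 (KT * K) * S / R) powr (1 / (1 - r)) * (2 / r) powr (\<Sum>i. real i * r ^ i))"
    proof -
      have e: "4 * max 1 (KT * I.K2) * S / P = 2 * max 1 (KT * I.K2) * S / R" "P / 2 = R" by (simp_all add: P_def)
      show ?thesis using I.sup_bound[OF r(2) mod_v'] unfolding e K_eq .
    qed
    then have "AE x in lebesgue. norm x < R \<longrightarrow> v1 x \<le> CS * (la + \<kappa>) *
      ((2 * max 1 (KT * K) * S / R) powr (1 / (1 - r)) * (2 / r) powr (\<Sum>i. real i * r ^ i))"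
      by (rule AE_completion)
    moreover have "AE x in lebesgue. x \<notin> \<Omega> - G"
      using null by (intro AE_not_in) (rule null_sets_completionI)
    ultimately have "AE x in lebesgue. x \<in> ball 0 R \<longrightarrow> \<bar>u x\<bar> \<le> CS * (la + \<kappa>) *
      ((2 * max 1 (KT * K) * S / R) powr (1 / (1 - r)) * (2 / r) powr (\<Sum>i. real i * r ^ i))"
    proof eventually_elim
      case (elim x)
      show ?case
      proof
        assume x: "x \<in> ball 0 R"
        then have "x \<in> G" using elim(2) R\<Omega> by blast
        then have "\<bar>u x\<bar> \<le> v1 x" using E.v_ge(2)[of x] by (simp add: on)
        then show "\<bar>u x\<bar> \<le> CS * (la + \<kappa>) *
          ((2 * max 1 (KT * K) * S / R) powr (1 / (1 - r)) * (2 / r) powr (\<Sum>i. real i * r ^ i))"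
          using elim(1) x by (auto intro: order_trans)
      qed
    qed
    then show ?thesis using Rm by (subst AE_restrict_space_iff) auto
  qed
  show "Lp_norm (real n) (ball 0 R) Du \<le> K * S * (CS * (la + \<kappa>) / R)"
  proof -
    have null2: "ball 0 R - (G \<inter> ball 0 R) \<in> null_sets lborel"
      by (rule null_sets_subset[OF null]) (use Gm R\<Omega> in auto)
    have "(LINT x|lebesgue_on (ball 0 R). norm (Du x) powr real n) = (\<integral>x. indicator (ball 0 R) x * norm (Du1 x) ^ n \<partial>lborel)"
    proof (rule lebesgue_on_transfer(2)[OF Rm order_refl _ null2])
      show "(\<lambda>x. indicator (ball 0 R) x * norm (Du1 x) ^ n) \<in> borel_measurable borel"
        by (intro borel_measurable_times borel_measurable_indicator borel_measurable_power borel_measurable_norm m1) auto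
    qed (use n0 in \<open>auto simp: on off powr_real_card indicator_def\<close>)
    then have "Lp_norm (real n) (ball 0 R) Du = (\<integral>x. indicator (ball 0 R) x * norm (Du1 x) ^ n \<partial>lborel) powr (1 / real n)"
      by (simp add: Lp_norm_def)
    also have "\<dots> \<le> K * S * (CS * (la + \<kappa>) / R)"
      using I.gradient_norm_bound[OF mod_v'] by (simp add: P_def K_eq)
    finally show ?thesis .
  qed
qed

text \<open>Performs two limits at once: the admissible constant tends to the norm, and
  \<open>\<kappa>\<close> tends to \<open>k\<close>. The denominator \<open>M + 1\<close> takes care
  of \<open>M = 0\<close>.\<close>

lemma ennreal_le_of_shifts:
  fixes L :: ennreal and e M k :: real
  assumes M: "0 \<le> M" and e: "0 \<le> e" and k: "0 \<le> k"
    and le: "\<And>t. 0 < t \<Longrightarrow> L \<le> ennreal (M * (e + k + t))"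
  shows "L \<le> ennreal M * (ennreal e + ennreal k)"
proof -
  have "L \<le> ennreal (M * (e + k))"
  proof (rule ennreal_le_epsilon)
    fix s :: real assume s: "0 < s"
    have "L \<le> ennreal (M * (e + k + s / (M + 1)))" using s M by (intro le) auto
    also have "\<dots> \<le> ennreal (M * (e + k) + s)"
    proof (rule ennreal_leI)
      have "s * (M / (M + 1)) \<le> s * 1" using s M by (intro mult_left_mono) auto
      then show "M * (e + k + s / (M + 1)) \<le> M * (e + k) + s" by (simp add: distrib_left mult.commute)
    qed
    also have "\<dots> = ennreal (M * (e + k)) + ennreal s" using M e k s by (intro ennreal_plus) auto
    finally show "L \<le> ennreal (M * (e + k)) + ennreal s" .
  qed
  then show ?thesis using M e k by (simp add: ennreal_mult ennreal_plus[symmetric] del: ennreal_plus)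
qed

theorem theorem3p1:
  fixes r a :: real
  assumes "CARD('n::finite) \<ge> 2"
    and "(real CARD('n) - 1) / real CARD('n) < r" and "r < 1"
    and "0 < a"
  shows "\<exists>C :: real \<Rightarrow> real \<Rightarrow> real \<Rightarrow> real.
    (\<forall>\<beta> \<gamma> \<delta>. 0 < C \<beta> \<gamma> \<delta>) \<and>
    (\<forall>\<beta> \<beta>' \<gamma> \<gamma>' \<delta> \<delta>'. \<beta> \<le> \<beta>' \<longrightarrow> \<gamma> \<le> \<gamma>' \<longrightarrow> \<delta> \<le> \<delta>' \<longrightarrow> C \<beta> \<gamma> \<delta> \<le> C \<beta>' \<gamma>' \<delta>') \<and>
    (\<forall>(D :: (real^'n) set) b c d e f g A B u Du k bb dd C0 R.
       bounded D \<longrightarrow> connected D \<longrightarrow> open D \<longrightarrow>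
       (\<forall>x\<in>D. 0 \<le> b x \<and> 0 \<le> c x \<and> 0 \<le> d x \<and> 0 \<le> e x \<and> 0 \<le> f x \<and> 0 \<le> g x) \<longrightarrow>
       e \<in> borel_measurable (lebesgue_on D) \<longrightarrow>
       f \<in> borel_measurable (lebesgue_on D) \<longrightarrow>
       g \<in> borel_measurable (lebesgue_on D) \<longrightarrow>
       N_norm r D (\<lambda>x. e x powr (real CARD('n) / (real CARD('n) - 1))) < \<infinity> \<longrightarrow>
       N_norm r D f < \<infinity> \<longrightarrow>
       N_norm r D g < \<infinity> \<longrightarrow>
       k = k_const r D e f g \<longrightarrow>
       bb = b_bar k b e \<longrightarrow>
       dd = d_bar k d f g \<longrightarrow>
       (\<lambda>x. bb x powr (real CARD('n) / (real CARD('n) - 1))) \<in> LlogL r D \<longrightarrow>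
       (\<lambda>x. c x ^ CARD('n)) \<in> LlogL r D \<longrightarrow>
       dd \<in> LlogL r D \<longrightarrow>
       structure_conditions a k bb c dd A B D \<longrightarrow>
       weak_solution A B D u Du \<longrightarrow>
       0 < R \<longrightarrow> R \<le> 1 \<longrightarrow> closure (ball 0 (2 * R)) \<subseteq> D \<longrightarrow>
       C0 = C (enn2real (N_norm r D (\<lambda>x. bb x powr (real CARD('n) / (real CARD('n) - 1)))))
              (enn2real (N_norm r D (\<lambda>x. c x ^ CARD('n))))
              (enn2real (N_norm r D dd)) \<longrightarrow>
       Linf_norm (ball 0 R) u
         \<le> ennreal (C0 * R powr (- 1 / (1 - r)))
             * (E_norm (real CARD('n) * r) (ball 0 (2 * R)) u + ennreal k) \<and>
       ennreal (Lp_norm (real CARD('n)) (ball 0 R) Du)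
         \<le> ennreal (C0 * R powr (- 1))
             * (E_norm (real CARD('n) * r) (ball 0 (2 * R)) u + ennreal k))"
proof -
  define n where "n = CARD('n)"
  have n2: "n \<ge> 2" using assms(1) by (simp add: n_def)
  have r0: "0 < r" using assms(2) n2 by (smt (verit) divide_nonneg_nonneg n_def of_nat_0_le_iff of_nat_1 of_nat_mono one_le_numeral order_trans)
  note r1 = assms(3)
  have \<sigma>: "real n * r / (real n - 1) > 0" using n2 r0 by simp
  \<comment> \<open>This constant and the two obtained next depend on the dimension and on
    \<open>r\<close> only; they are fixed before any data of the equation.\<close>
  obtain KT where KT: "KT > 0"
    "\<And>(w :: real^'n \<Rightarrow> real) W L. C1_grad w W \<Longrightarrow> (\<And>y. norm y \<ge> 2 \<Longrightarrow> w y = 0) \<Longrightarrow> 0 < L \<Longrightarrow>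
      (\<integral>\<^sup>+y. ennreal (norm (W y) ^ n) \<partial>lborel) \<le> ennreal (L ^ n) \<Longrightarrow>
      (\<integral>\<^sup>+x. ennreal (exp ((\<bar>w x\<bar> / (KT * L)) powr (real n / (real n - 1))) - 1) \<partial>lborel) \<le> 1"
    by (rule Trudinger_inequality[where 'a="real^'n"]) (use assms(1) in \<open>auto simp: n_def\<close>)
  obtain KO where KO: "1 \<le> KO"
      "\<And>(V :: real^'n \<Rightarrow> real) f \<Omega> l \<mu>. V \<in> borel_measurable borel \<Longrightarrow> f \<in> borel_measurable borel \<Longrightarrow> \<Omega> \<in> sets borel \<Longrightarrow>
      (\<And>x. 0 \<le> V x) \<Longrightarrow> (\<And>x. 0 \<le> f x) \<Longrightarrow> 0 < l \<Longrightarrow>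
      (\<integral>\<^sup>+x. indicator \<Omega> x * ennreal (N_fun n r (V x / l)) \<partial>lborel) \<le> 1 \<Longrightarrow>
      exp_modular (real n * r / (real n - 1)) \<Omega> f \<mu> \<Longrightarrow>
      (\<integral>\<^sup>+x. indicator \<Omega> x * ennreal (V x * f x ^ n) \<partial>lborel) \<le> ennreal (KO * l * \<mu> ^ n)"
      "\<And>(f :: real^'n \<Rightarrow> real) \<Omega> \<mu>. f \<in> borel_measurable borel \<Longrightarrow> \<Omega> \<in> sets borel \<Longrightarrow> \<Omega> \<subseteq> cball 0 2 \<Longrightarrow> (\<And>x. 0 \<le> f x) \<Longrightarrow>
      exp_modular (real n * r / (real n - 1)) \<Omega> f \<mu> \<Longrightarrow>
      (\<integral>\<^sup>+x. indicator \<Omega> x * ennreal (f x ^ n) \<partial>lborel) \<le> ennreal (KO * \<mu> ^ n)"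
    by (rule Orlicz_Hoelder[OF n2 r0, where 'a="real^'n"]) blast
  obtain CS where CS: "1 \<le> CS"
      "\<And>(f :: real^'n \<Rightarrow> real) g \<Omega> l k. f \<in> borel_measurable borel \<Longrightarrow> \<Omega> \<in> sets borel \<Longrightarrow> \<Omega> \<subseteq> cball 0 2 \<Longrightarrow> 0 < k \<Longrightarrow>
      (\<And>x. \<bar>g x\<bar> \<le> \<bar>f x\<bar> + k) \<Longrightarrow> exp_modular (real n * r / (real n - 1)) \<Omega> f l \<Longrightarrow>
      exp_modular (real n * r / (real n - 1)) \<Omega> g (CS * (l + k))"
    by (rule exp_modular_shift[OF \<sigma>, where 'a="real^'n"]) blast
  define K where "K = elliptic_iteration.K2 a n (n - 1) (3 * KO)"
  define c0 where "c0 = 2 * max 1 (KT * K)"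
  define ex where "ex = 1 / (1 - r)"
  define Y where "Y = (2 / r) powr (\<Sum>i. real i * r ^ i)"
  \<comment> \<open>One constant for both estimates: the first summand serves the supremum bound,
    the second the gradient bound.\<close>
  define M where "M = CS * (c0 powr ex * Y + max 1 K)"
  \<comment> \<open>At least one plus each of the norms, as \<open>N_norm_realE\<close> asks for.
    The maxima with 0 keep \<open>S \<ge> 1\<close>, and so \<open>C\<close> positive and monotone,
    for arbitrary real arguments.\<close>
  define S where "S \<beta> \<gamma> \<delta> = 1 + max 0 \<beta> + max 0 \<gamma> + max 0 \<delta>" for \<beta> \<gamma> \<delta> :: real
  define C where "C \<beta> \<gamma> \<delta> = M * S \<beta> \<gamma> \<delta> powr ex" for \<beta> \<gamma> \<delta>
  have S1: "1 \<le> S \<beta> \<gamma> \<delta>" for \<beta> \<gamma> \<delta> by (simp add: S_def)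
  have c0: "c0 > 0" by (simp add: c0_def max_def)
  have ex1: "ex \<ge> 1" using r0 r1 by (simp add: ex_def)
  have Y0: "Y \<ge> 0" by (simp add: Y_def)
  have M0: "M > 0" unfolding M_def using CS(1) Y0 by (intro mult_pos_pos add_nonneg_pos) auto
  have Cpos: "0 < C \<beta> \<gamma> \<delta>" for \<beta> \<gamma> \<delta> using M0 S1[of \<beta> \<gamma> \<delta>] by (simp add: C_def)
  have Cmono: "C \<beta> \<gamma> \<delta> \<le> C \<beta>' \<gamma>' \<delta>'" if "\<beta> \<le> \<beta>'" "\<gamma> \<le> \<gamma>'" "\<delta> \<le> \<delta>'" for \<beta> \<gamma> \<delta> \<beta>' \<gamma>' \<delta>'
  proof -
    have "S \<beta> \<gamma> \<delta> \<le> S \<beta>' \<gamma>' \<delta>'" unfolding S_def using that by (intro add_mono max.mono) auto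
    then have "S \<beta> \<gamma> \<delta> powr ex \<le> S \<beta>' \<gamma>' \<delta>' powr ex" using ex1 S1[of \<beta> \<gamma> \<delta>] by (intro powr_mono2) auto
    then show ?thesis unfolding C_def using M0 by (intro mult_left_mono) auto
  qed
  have main: "Linf_norm (ball 0 R) u \<le> ennreal (C0 * R powr (- 1 / (1 - r))) * (E_norm (real n * r) (ball 0 (2 * R)) u + ennreal k) \<and>
       ennreal (Lp_norm (real n) (ball 0 R) Du) \<le> ennreal (C0 * R powr (- 1)) * (E_norm (real n * r) (ball 0 (2 * R)) u + ennreal k)"
    if D: "open D" and nn: "\<forall>x\<in>D. 0 \<le> b x \<and> 0 \<le> c x \<and> 0 \<le> d x \<and> 0 \<le> e x \<and> 0 \<le> f x \<and> 0 \<le> g x"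
      and k: "k = k_const r D e f g" and bb: "bb = b_bar k b e" and dd: "dd = d_bar k d f g"
      and L1: "(\<lambda>x. bb x powr (real n / (real n - 1))) \<in> LlogL r D" and L2: "(\<lambda>x. c x ^ n) \<in> LlogL r D" and L3: "dd \<in> LlogL r D"
      and struc: "structure_conditions a k bb c dd A B D" and sol: "weak_solution A B D u Du"
      and R: "0 < R" "R \<le> 1" "closure (ball 0 (2 * R)) \<subseteq> D"
      and C0: "C0 = C (enn2real (N_norm r D (\<lambda>x. bb x powr (real n / (real n - 1))))) (enn2real (N_norm r D (\<lambda>x. c x ^ n))) (enn2real (N_norm r D dd))"
    for D :: "(real^'n) set" and b c d e f g A B u Du k bb dd C0 R
  proof -
    define S0 where "S0 = S (enn2real (N_norm r D (\<lambda>x. bb x powr (real n / (real n - 1))))) (enn2real (N_norm r D (\<lambda>x. c x ^ n))) (enn2real (N_norm r D dd))"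
    have C0S: "C0 = M * S0 powr ex" by (simp add: C0 C_def S0_def)
    have S0: "1 \<le> S0" by (simp add: S0_def S1)
    have Sle: "enn2real (N_norm r D (\<lambda>x. bb x powr (real n / (real n - 1)))) + 1 \<le> S0"
      "enn2real (N_norm r D (\<lambda>x. c x ^ n)) + 1 \<le> S0" "enn2real (N_norm r D dd) + 1 \<le> S0"
      by (simp_all add: S0_def S_def)
    have k0: "0 \<le> k" unfolding k k_const_def Let_def by simp
    have ab: "0 \<le> bb x \<and> 0 \<le> c x \<and> 0 \<le> dd x" if "x \<in> D" for x
      using nn that k0 by (auto simp: bb dd b_bar_def d_bar_def)
    obtain l1 where l1: "0 < l1" "l1 \<le> enn2real (N_norm r D (\<lambda>x. bb x powr (real n / (real n - 1)))) + 1"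
      "(\<integral>\<^sup>+x. ennreal (N_fun n r (\<bar>bb x powr (real n / (real n - 1))\<bar> / l1)) \<partial>lebesgue_on D) \<le> 1"
      using N_norm_realE[OF assms(1) r0 L1] unfolding n_def[symmetric] by blast
    obtain l2 where l2: "0 < l2" "l2 \<le> enn2real (N_norm r D (\<lambda>x. c x ^ n)) + 1"
      "(\<integral>\<^sup>+x. ennreal (N_fun n r (\<bar>c x ^ n\<bar> / l2)) \<partial>lebesgue_on D) \<le> 1"
      using N_norm_realE[OF assms(1) r0 L2] unfolding n_def[symmetric] by blast
    obtain l3 where l3: "0 < l3" "l3 \<le> enn2real (N_norm r D dd) + 1"
      "(\<integral>\<^sup>+x. ennreal (N_fun n r (\<bar>dd x\<bar> / l3)) \<partial>lebesgue_on D) \<le> 1"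
      using N_norm_realE[OF assms(1) r0 L3] unfolding n_def[symmetric] by blast
    have RD: "ball 0 (2 * R) \<subseteq> D" using R(3) closure_subset by blast
    have um: "(\<lambda>x. ennreal \<bar>u x\<bar>) \<in> borel_measurable (lebesgue_on (ball 0 R))"
    proof -
      have "u \<in> borel_measurable (lebesgue_on D)"
        using sol by (auto simp: weak_solution_def W1_with_gradient_def Lp_def)
      moreover have "ball 0 R \<subseteq> D" using RD R(1) subset_ball[of R "2 * R" "0::real^'n"] by auto
      ultimately have "u \<in> borel_measurable (lebesgue_on (ball 0 R))"
        by (rule measurable_restrict_mono)
      then show ?thesis by measurable
    qed
    have est: "Linf_norm (ball 0 R) u \<le> ennreal (C0 * R powr (- 1 / (1 - r)) * (l0 + \<kappa>))"
      "Lp_norm (real n) (ball 0 R) Du \<le> C0 * R powr (- 1) * (l0 + \<kappa>)"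
      if \<kappa>: "k < \<kappa>" and l0: "0 < l0"
        "(\<integral>\<^sup>+x. ennreal (exp ((\<bar>u x\<bar> / l0) powr (real n * r / (real n - 1))) - 1) \<partial>lebesgue_on (ball 0 (2 * R))) \<le> 1"
      for \<kappa> l0
    proof -
      have pos: "l0 + \<kappa> > 0" using l0 k0 \<kappa> by simp
      have mm: "(\<lambda>x. bb x powr (real n / (real n - 1))) \<in> borel_measurable (lebesgue_on D)"
        "(\<lambda>x. c x ^ n) \<in> borel_measurable (lebesgue_on D)" "dd \<in> borel_measurable (lebesgue_on D)"
        using L1 L2 L3 by (auto simp: LlogL_def)
      have a0: "0 \<le> a" using assms(4) by simp
      have lS: "l1 \<le> S0" "l2 \<le> S0" "l3 \<le> S0" using l1(2) l2(2) l3(2) Sle by linarith+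
      note le = local_estimates[where 'n='n and a=a and b=bb and c=c and d=dd and KT=KT and KO=KO and CS=CS
          and la=l0 and lb=l1 and lc=l2 and ld=l3 and \<kappa>=\<kappa> and k=k and S=S0 and r=r and D=D and R=R
          and A=A and B=B and u=u and Du=Du, folded n_def, folded K_def]
      have K1: "1 \<le> K"
        by (rule le(1)) (fact | rule ab, assumption)+
      have loc2: "AE x in lebesgue_on (ball 0 R). \<bar>u x\<bar> \<le> CS * (l0 + \<kappa>) *
          ((2 * max 1 (KT * K) * S0 / R) powr (1 / (1 - r)) * (2 / r) powr (\<Sum>i. real i * r ^ i))"
        by (rule le(2)) (fact | rule ab, assumption)+
      have loc3: "Lp_norm (real n) (ball 0 R) Du \<le> K * S0 * (CS * (l0 + \<kappa>) / R)"
        by (rule le(3)) (fact | rule ab, assumption)+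
      \<comment> \<open>Separates the power of \<open>R\<close> in the theorem from the
        constant.\<close>
      have powr_eq: "(2 * max 1 (KT * K) * S0 / R) powr ex = c0 powr ex * S0 powr ex * R powr (- 1 / (1 - r))"
        using c0 S0 R(1) by (simp add: c0_def[symmetric] ex_def powr_divide powr_mult powr_minus_divide)
      have "AE x in lebesgue_on (ball 0 R). ennreal \<bar>u x\<bar> \<le> ennreal (C0 * R powr (- 1 / (1 - r)) * (l0 + \<kappa>))"
        using loc2
      proof eventually_elim
        case (elim x)
        also have "CS * (l0 + \<kappa>) * ((2 * max 1 (KT * K) * S0 / R) powr (1 / (1 - r)) * (2 / r) powr (\<Sum>i. real i * r ^ i))
          = (CS * (c0 powr ex * Y)) * (S0 powr ex * R powr (- 1 / (1 - r)) * (l0 + \<kappa>))"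
          unfolding ex_def[symmetric] powr_eq Y_def by (simp add: mult_ac)
        also have "\<dots> \<le> M * (S0 powr ex * R powr (- 1 / (1 - r)) * (l0 + \<kappa>))"
          unfolding M_def using CS(1) pos by (intro mult_right_mono mult_left_mono) auto
        finally show ?case by (intro ennreal_leI) (simp add: C0S mult_ac)
      qed
      then show "Linf_norm (ball 0 R) u \<le> ennreal (C0 * R powr (- 1 / (1 - r)) * (l0 + \<kappa>))"
        unfolding Linf_norm_def by (rule esssup_I[OF um])
      have "Lp_norm (real n) (ball 0 R) Du \<le> K * S0 * (CS * (l0 + \<kappa>) / R)" by (rule loc3)
      also have "\<dots> = (CS * K) * S0 * (R powr (- 1) * (l0 + \<kappa>))" using R(1) by (simp add: powr_minus_divide)
      \<comment> \<open>The gradient estimate is linear in \<open>S0\<close>; since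
        \<open>ex\<close> and \<open>S0\<close> are at least 1, the power from the supremum bound
        covers it.\<close>
      also have "\<dots> \<le> M * S0 powr ex * (R powr (- 1) * (l0 + \<kappa>))"
      proof (intro mult_right_mono mult_mono)
        show "CS * K \<le> M" unfolding M_def using CS(1) Y0 by (intro mult_left_mono) (auto simp: add_increasing)
        show "S0 \<le> S0 powr ex" using powr_mono[OF ex1 S0] S0 by simp
      qed (use M0 S0 pos in auto)
      finally show "Lp_norm (real n) (ball 0 R) Du \<le> C0 * R powr (- 1) * (l0 + \<kappa>)" by (simp add: C0S mult_ac)
    qed
    have C0pos: "C0 > 0" unfolding C0 by (rule Cpos)
    define M1 where "M1 = C0 * R powr (- 1 / (1 - r))"
    define M2 where "M2 = C0 * R powr (- 1)"
    have pos1: "M1 > 0" "M2 > 0" using C0pos R(1) by (simp_all add: M1_def M2_def)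
    note est' = est[folded M1_def M2_def]
    have "Linf_norm (ball 0 R) u \<le> ennreal M1 * (E_norm (real n * r) (ball 0 (2 * R)) u + ennreal k) \<and>
       ennreal (Lp_norm (real n) (ball 0 R) Du) \<le> ennreal M2 * (E_norm (real n * r) (ball 0 (2 * R)) u + ennreal k)"
    proof (cases "E_norm (real n * r) (ball 0 (2 * R)) u = \<infinity>")
      \<comment> \<open>Both factors \<open>M1\<close> and \<open>M2\<close> are positive, so the
        right sides are infinite.\<close>
      case True
      then show ?thesis using pos1 by (simp add: ennreal_mult_top)
    next
      case False
      define e where "e = enn2real (E_norm (real n * r) (ball 0 (2 * R)) u)"
      have e: "E_norm (real n * r) (ball 0 (2 * R)) u = ennreal e" "0 \<le> e"
        using False by (auto simp: e_def infinity_ennreal_def less_top)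
      have l0: "\<exists>l0. 0 < l0 \<and> l0 < e + t \<and>
        (\<integral>\<^sup>+x. ennreal (exp ((\<bar>u x\<bar> / l0) powr (real n * r / (real n - 1))) - 1) \<partial>lebesgue_on (ball 0 (2 * R))) \<le> 1" if "t > 0" for t
      proof -
        have "E_norm (real n * r) (ball 0 (2 * R)) u < ennreal (e + t)"
          unfolding e(1) using e(2) that by (simp add: ennreal_less_iff)
        then show ?thesis unfolding E_norm_def n_def[symmetric] by (rule luxemburg_norm_lessD) blast
      qed
      have "Linf_norm (ball 0 R) u \<le> ennreal (M1 * (e + k + t)) \<and>
        ennreal (Lp_norm (real n) (ball 0 R) Du) \<le> ennreal (M2 * (e + k + t))" if t: "0 < t" for t
      proof -
        \<comment> \<open>Half of the slack goes to the admissible constant above the norm, half to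
          \<open>\<kappa> = k + t / 2\<close>.\<close>
        from l0[of "t / 2"] t obtain l where l: "0 < l" "l < e + t / 2"
          "(\<integral>\<^sup>+x. ennreal (exp ((\<bar>u x\<bar> / l) powr (real n * r / (real n - 1))) - 1) \<partial>lebesgue_on (ball 0 (2 * R))) \<le> 1" by auto
        have kt: "k < k + t / 2" using t by simp
        have le: "l + (k + t / 2) \<le> e + k + t" using l(2) by simp
        have "Linf_norm (ball 0 R) u \<le> ennreal (M1 * (l + (k + t / 2)))"
          by (rule est'(1)[OF kt l(1,3)])
        also have "\<dots> \<le> ennreal (M1 * (e + k + t))"
          using le pos1 by (intro ennreal_leI mult_left_mono) auto
        finally have 1: "Linf_norm (ball 0 R) u \<le> ennreal (M1 * (e + k + t))" .
        have "Lp_norm (real n) (ball 0 R) Du \<le> M2 * (l + (k + t / 2))"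
          by (rule est'(2)[OF kt l(1,3)])
        also have "\<dots> \<le> M2 * (e + k + t)" using le pos1 by (intro mult_left_mono) auto
        finally show ?thesis using 1 by (simp add: ennreal_leI)
      qed
      then show ?thesis unfolding e(1)
        using pos1 e(2) k0 by (intro conjI ennreal_le_of_shifts) auto
    qed
    then show ?thesis unfolding M1_def M2_def .
  qed
  show ?thesis
    unfolding n_def[symmetric]
  proof (rule exI[of _ C], rule conjI[OF _ conjI], goal_cases)
    case 1
    then show ?case using Cpos by blast
  next
    case 2
    then show ?case using Cmono by blast
  next
    case 3
    show ?case by (intro allI impI, rule main; assumption)
  qed
qed

end
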